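(* Let $C$ be a projective algebraic curve over an algebraically closed field $L$ of characteristic zero, and let $A$ be an effective weighted set on $C$ such that $\dim(|A|)\geq 1$. Then the series $$|A_{j}|-|2A|$$ depends only on $C$ and not on the choice of the effective weighted set $A$ with $\dim(|A|)\geq 1$.
   Context: A projective algebraic curve is an irreducible closed subvariety $C$ of dimension $1$ of some $P^{w}(L)$. A branch $\gamma$ of $C$ centred at $p\in C$ is a point, lying over $p$, of a nonsingular projective model $C^{ns}\to C$. For a form $\phi$ not vanishing identically on $C$, $I_{\gamma}(C,\phi)$ is the order in $t$ of the power series obtained by substituting a power series parametrisation of $\gamma$ into $\phi$ (in affine coordinates at $p$). A (effective) weighted set on $C$ is a finite formal sum of branches with non-negative integer multiplicities; a generalised weighted set allows arbitrary integer multiplicities; the total multiplicity is the sum of the multiplicities. Put $C\sqcap\phi=\sum_{\gamma}I_{\gamma}(C,\phi)\gamma$. For a linear system $\Sigma$ of forms of fixed degree on $P^w$, $Series(\Sigma)$ is the collection of weighted sets $C\sqcap\phi$, for $\phi\in\Sigma$ having finite intersection with $C$; its dimension is the least $r$ such that all these weighted sets are cut out by the forms of some linear subsystem of $\Sigma$ of dimension $r$. A $g_{n}^{r}$ on $C$ is a collection of effective weighted sets of total multiplicity $n$ obtained from some $Series(\Sigma)$ of dimension $r$ by subtracting from all its members a common fixed effective weighted set (possibly empty) contained in each member. $g_{n}^{r}\subseteq g_{n}^{t}$ means containment of collections of weighted sets. For an effective weighted set $A$ of total multiplicity $n$, $|A|$ denotes the unique complete (not strictly contained in a $g_n^s$ of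 greater dimension) $g_{n}^{t}$ containing $A$, and $\dim(|A|)=t$. Linear equivalence: effective weighted sets of the same total multiplicity satisfy $A\equiv B$ if some $g_{n}^{r}$ contains both; generalised weighted sets $A=A_{1}-A_{2}$, $B=B_{1}-B_{2}$ (with $A_1,A_2$ disjoint effective, and $B_1,B_2$ disjoint effective) satisfy $A\equiv B$ if $A_{1}+B_{2}\equiv B_{1}+A_{2}$. For a generalised weighted set $G$, the complete series in the generalised sense is the class of all generalised weighted sets $G'\equiv G$, again denoted $|G|$, and $|A|-|B|$ is the complete series, in the generalised sense, containing all $A'-B'$ with $A'\in|A|$, $B'\in|B|$. Jacobians: for a $g_{n}^{1}$ with no branch common to all its members, $Jac(g_{n}^{1})$ is the weighted set in which a branch which appears with multiplicity $a+1\geq 2$ in the (unique) member containing it is counted $a$ times (finitely many such branches); in general, if $K$ is the fixed branch contribution (the largest weighted set contained in every member), $Jac(g_{n}^{1})=2K+Jac(g_{n}^{1}-K)$, where $g_{n}^{1}-K$ is obtained by subtracting $K$ from every member. For an effective weighted set $A$ with $\dim(|A|)\geq 1$, $|A_{j}|$ denotes the complete series containing $Jac(g_{n}^{1})$ for any $g_{n}^{1}\subseteq|A|$. *)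

theory Defs
  imports
    "HOL-Library.Poly_Mapping"
    "HOL-Library.Multiset"
    "HOL-Library.Function_Algebras"
    "HOL-Computational_Algebra.Polynomial"
    "HOL-Computational_Algebra.Formal_Power_Series"
begin

section \<open>Forms\<close>

text \<open>Polynomials in the homogeneous coordinates \<open>x\<^sub>0, x\<^sub>1, \<dots>\<close>; only
  \<open>x\<^sub>0, \<dots>, x\<^sub>w\<close> occur in a form on projective \<open>w\<close>-space.\<close>

type_synonym 'a mpol = "(nat \<Rightarrow>\<^sub>0 nat) \<Rightarrow>\<^sub>0 'a"

definition form :: "nat \<Rightarrow> nat \<Rightarrow> 'a::zero mpol \<Rightarrow> bool" where
  "form w d F \<longleftrightarrow> (\<forall>m \<in> Poly_Mapping.keys F. Poly_Mapping.keys m \<subseteq> {..w} \<and>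
     (\<Sum>i \<in> Poly_Mapping.keys m. Poly_Mapping.lookup m i) = d)"

text \<open>Substitution into a polynomial, with coefficients mapped by \<open>h\<close>: this is used with
  \<open>h = id\<close> for points and with \<open>h = fps_const\<close> for power series.\<close>

definition subst_mpol :: "('a::zero \<Rightarrow> 'b::comm_semiring_1) \<Rightarrow> 'a mpol \<Rightarrow> (nat \<Rightarrow> 'b) \<Rightarrow> 'b" where
  "subst_mpol h F x = (\<Sum>m \<in> Poly_Mapping.keys F. h (Poly_Mapping.lookup F m) *
     (\<Prod>i \<in> Poly_Mapping.keys m. x i ^ Poly_Mapping.lookup m i))"

definition partial_deriv :: "nat \<Rightarrow> 'a::comm_semiring_1 mpol \<Rightarrow> 'a mpol" where
  "partial_deriv i F = (\<Sum>m \<in> Poly_Mapping.keys F.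
     Poly_Mapping.single (m - Poly_Mapping.single i 1)
       (of_nat (Poly_Mapping.lookup m i) * Poly_Mapping.lookup F m))"

definition scale_mpol :: "'a::field \<Rightarrow> 'a mpol \<Rightarrow> 'a mpol" where
  "scale_mpol c F = Poly_Mapping.map ((*) c) F"

lemma lookup_scale_mpol: "Poly_Mapping.lookup (scale_mpol c F) m = c * Poly_Mapping.lookup F m"
  by (simp add: scale_mpol_def Poly_Mapping.map.rep_eq when_def)

interpretation mpol_space: vector_space scale_mpol
  by unfold_locales
    (auto intro!: poly_mapping_eqI simp: lookup_scale_mpol lookup_add algebra_simps)

definition scale_vec :: "'a::field \<Rightarrow> (nat \<Rightarrow> 'a) \<Rightarrow> nat \<Rightarrow> 'a" where
  "scale_vec c v = (\<lambda>i. c * v i)"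

interpretation coord_space: vector_space scale_vec
  by unfold_locales (auto simp: scale_vec_def fun_eq_iff algebra_simps)

section \<open>Projective varieties\<close>

text \<open>A point is the set of all its homogeneous coordinate vectors. The coordinates of a point of
  projective \<open>w\<close>-space are indexed by \<open>0, \<dots>, w\<close>, all later entries being \<open>0\<close>.\<close>

type_synonym 'a point = "(nat \<Rightarrow> 'a) set"

definition proj_point :: "(nat \<Rightarrow> 'a::field) \<Rightarrow> 'a point" where
  "proj_point v = {scale_vec c v | c. c \<noteq> 0}"

definition proj_space :: "nat \<Rightarrow> 'a::field point set" where
  "proj_space w = {proj_point v | v. v \<noteq> 0 \<and> (\<forall>i>w. v i = 0)}"

definition vanishes_at :: "'a::field mpol \<Rightarrow> 'a point \<Rightarrow> bool" where
  "vanishes_at F p \<longleftrightarrow> (\<forall>v\<in>p. subst_mpol id F v = 0)"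

definition proj_closed :: "nat \<Rightarrow> 'a::field point set \<Rightarrow> bool" where
  "proj_closed w Z \<longleftrightarrow> (\<exists>S. (\<forall>F\<in>S. \<exists>d. form w d F) \<and>
     Z = {p \<in> proj_space w. \<forall>F\<in>S. vanishes_at F p})"

definition irreducible_closed :: "nat \<Rightarrow> 'a::field point set \<Rightarrow> bool" where
  "irreducible_closed w Z \<longleftrightarrow> proj_closed w Z \<and> Z \<noteq> {} \<and>
     (\<forall>Z1 Z2. proj_closed w Z1 \<and> proj_closed w Z2 \<and> Z = Z1 \<union> Z2 \<longrightarrow> Z = Z1 \<or> Z = Z2)"

definition irreducible_chain :: "nat \<Rightarrow> 'a::field point set \<Rightarrow> nat \<Rightarrow> (nat \<Rightarrow> 'a point set) \<Rightarrow> bool" where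
  "irreducible_chain w Z n T \<longleftrightarrow>
     (\<forall>i\<le>n. irreducible_closed w (T i) \<and> T i \<subseteq> Z) \<and> (\<forall>i<n. T i \<subset> T (Suc i))"

definition has_dimension :: "nat \<Rightarrow> 'a::field point set \<Rightarrow> nat \<Rightarrow> bool" where
  "has_dimension w Z n \<longleftrightarrow>
     (\<exists>T. irreducible_chain w Z n T) \<and> \<not> (\<exists>T. irreducible_chain w Z (Suc n) T)"

definition proj_curve :: "nat \<Rightarrow> 'a::field point set \<Rightarrow> bool" where
  "proj_curve w C \<longleftrightarrow> irreducible_closed w C \<and> has_dimension w C 1"

definition vanishing_forms :: "nat \<Rightarrow> 'a::field point set \<Rightarrow> 'a mpol set" where
  "vanishing_forms w Z = {F. (\<exists>d. form w d F) \<and> (\<forall>p\<in>Z. vanishes_at F p)}"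

text \<open>Jacobian criterion for a curve in projective \<open>m\<close>-space: at every point, the rank of the
  matrix of partial derivatives of the forms vanishing on the curve (that is, the dimension of its
  row space) is \<open>m - 1\<close>.\<close>

definition nonsingular_curve :: "nat \<Rightarrow> 'a::field point set \<Rightarrow> bool" where
  "nonsingular_curve m X \<longleftrightarrow> proj_curve m X \<and> (\<forall>q\<in>X. \<forall>v\<in>q.
     coord_space.dim {(\<lambda>j. subst_mpol id (partial_deriv j F) v) | F. F \<in> vanishing_forms m X}
       = m - 1)"

section \<open>Morphisms and nonsingular models\<close>

definition form_map :: "nat \<Rightarrow> (nat \<Rightarrow> 'a::field mpol) \<Rightarrow> (nat \<Rightarrow> 'a) \<Rightarrow> nat \<Rightarrow> 'a" where
  "form_map w G v = (\<lambda>i. if i \<le> w then subst_mpol id (G i) v else 0)"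

text \<open>The forms \<open>G\<^sub>0, \<dots>, G\<^sub>w\<close>, all of the same degree, represent \<open>f\<close> on an open neighbourhood
  of \<open>q\<close> in \<open>U\<close>.\<close>

definition represents_near ::
  "nat \<Rightarrow> nat \<Rightarrow> 'a::field point set \<Rightarrow> ('a point \<Rightarrow> 'a point) \<Rightarrow> 'a point \<Rightarrow> (nat \<Rightarrow> 'a mpol) \<Rightarrow> bool" where
  "represents_near m w U f q G \<longleftrightarrow> (\<exists>d. \<forall>i\<le>w. form m d (G i)) \<and>
     (\<exists>Z. proj_closed m Z \<and> q \<notin> Z \<and>
        (\<forall>u\<in>U - Z. \<forall>v\<in>u. form_map w G v \<noteq> 0 \<and> f u = proj_point (form_map w G v)))"

definition morphism_on ::
  "nat \<Rightarrow> nat \<Rightarrow> 'a::field point set \<Rightarrow> ('a point \<Rightarrow> 'a point) \<Rightarrow> bool" where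
  "morphism_on m w U f \<longleftrightarrow> (\<forall>q\<in>U. \<exists>G. represents_near m w U f q G)"

text \<open>\<open>\<phi> : X \<rightarrow> C\<close> is a nonsingular projective model of \<open>C\<close>: a birational morphism from a
  nonsingular projective curve, i.e. one restricting to an isomorphism between nonempty open
  subsets.\<close>

definition nonsingular_model ::
  "nat \<Rightarrow> 'a::field point set \<Rightarrow> nat \<Rightarrow> 'a point set \<Rightarrow> ('a point \<Rightarrow> 'a point) \<Rightarrow> bool" where
  "nonsingular_model w C m X \<phi> \<longleftrightarrow> nonsingular_curve m X \<and> morphism_on m w X \<phi> \<and> \<phi> ` X \<subseteq> C \<and>
     (\<exists>Z Z'. proj_closed m Z \<and> proj_closed w Z' \<and> X - Z \<noteq> {} \<and> C - Z' \<noteq> {} \<and>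
        bij_betw \<phi> (X - Z) (C - Z') \<and> morphism_on w m (C - Z') (inv_into (X - Z) \<phi>))"

section \<open>Power series parametrisations\<close>

text \<open>Parametrisation of a nonsingular curve at its point \<open>q\<close>, in affine coordinates at \<open>q\<close>
  (one coordinate is \<open>1\<close>). The last clause says that \<open>t\<close> is a local uniformiser, so that the
  parametrisation is not a reparametrisation by a series of higher order.\<close>

definition point_param :: "nat \<Rightarrow> 'a::field point set \<Rightarrow> 'a point \<Rightarrow> (nat \<Rightarrow> 'a fps) \<Rightarrow> bool" where
  "point_param m X q x \<longleftrightarrow>
     (\<exists>i\<le>m. x i = 1) \<and> (\<forall>i>m. x i = 0) \<and>
     (\<lambda>i. fps_nth (x i) 0) \<in> q \<and>
     (\<forall>F \<in> vanishing_forms m X. subst_mpol fps_const F x = 0) \<and>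
     (\<exists>i\<le>m. fps_nth (x i) 1 \<noteq> 0)"

section \<open>Weighted sets\<close>

text \<open>Effective weighted sets are finite multisets of branches, total multiplicity being \<open>size\<close>;
  generalised weighted sets are elements of the free abelian group on the branches.\<close>

definition gen_of :: "'b multiset \<Rightarrow> ('b \<Rightarrow>\<^sub>0 int)" where
  "gen_of A = (\<Sum>\<gamma>\<in>#A. frag_of \<gamma>)"

section \<open>Series on a curve\<close>

definition linear_system :: "nat \<Rightarrow> nat \<Rightarrow> 'a::field mpol set \<Rightarrow> bool" where
  "linear_system w d V \<longleftrightarrow> mpol_space.subspace V \<and> V \<noteq> {0} \<and> (\<forall>F\<in>V. form w d F)"

locale curve_with_model =
  fixes w :: nat and C :: "'a::field point set"
    and m :: nat and X :: "'a point set" and \<phi> :: "'a point \<Rightarrow> 'a point"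
  assumes curve: "proj_curve w C"
    and model: "nonsingular_model w C m X \<phi>"
begin

text \<open>The branches of \<open>C\<close> are the points of \<open>X\<close>; the branch \<open>\<gamma>\<close> is centred at \<open>\<phi> \<gamma>\<close>.
  A parametrisation of \<open>\<gamma>\<close> is the image under \<open>\<phi>\<close> of one of \<open>X\<close> at \<open>\<gamma>\<close>, normalised to affine
  coordinates at \<open>\<phi> \<gamma>\<close> by making a coordinate \<open>k\<close> equal to \<open>1\<close>.\<close>

definition branch_param :: "'a point \<Rightarrow> (nat \<Rightarrow> 'a fps) \<Rightarrow> bool" where
  "branch_param \<gamma> y \<longleftrightarrow> (\<exists>x G k. point_param m X \<gamma> x \<and> represents_near m w X \<phi> \<gamma> G \<and> k \<le> w \<and>
     fps_nth (subst_mpol fps_const (G k) x) 0 \<noteq> 0 \<and>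
     y = (\<lambda>j. if j \<le> w then subst_mpol fps_const (G j) x * inverse (subst_mpol fps_const (G k) x)
              else 0))"

definition int_mult :: "'a point \<Rightarrow> 'a mpol \<Rightarrow> nat" where
  "int_mult \<gamma> F = (THE n. \<exists>y. branch_param \<gamma> y \<and> n = subdegree (subst_mpol fps_const F y))"

definition finite_intersection :: "'a mpol \<Rightarrow> bool" where
  "finite_intersection F \<longleftrightarrow> finite {p \<in> C. vanishes_at F p}"

definition cut_out :: "'a mpol \<Rightarrow> 'a point multiset" where
  "cut_out F = (\<Sum>\<gamma> | \<gamma> \<in> X \<and> int_mult \<gamma> F \<noteq> 0. replicate_mset (int_mult \<gamma> F) \<gamma>)"

definition Series :: "'a mpol set \<Rightarrow> 'a point multiset set" where
  "Series V = {cut_out F | F. F \<in> V \<and> finite_intersection F}"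

text \<open>A linear system of projective dimension \<open>r\<close> is a vector space of forms of dimension
  \<open>r + 1\<close>.\<close>

definition Series_dim :: "'a mpol set \<Rightarrow> nat" where
  "Series_dim V = (LEAST r. \<exists>W d. W \<subseteq> V \<and> linear_system w d W \<and> mpol_space.dim W = r + 1 \<and>
     Series V \<subseteq> Series W)"

text \<open>\<open>G\<close> is a \<open>g\<^sub>n\<^sup>r\<close>. Systems all of whose forms vanish on \<open>C\<close> cut out the empty collection,
  to which no \<open>n\<close> can be attached, and are excluded.\<close>

definition is_g :: "nat \<Rightarrow> nat \<Rightarrow> 'a point multiset set \<Rightarrow> bool" where
  "is_g n r G \<longleftrightarrow> (\<exists>V d K. linear_system w d V \<and> Series V \<noteq> {} \<and> Series_dim V = r \<and>
     (\<forall>A \<in> Series V. K \<subseteq># A) \<and> G = (\<lambda>A. A - K) ` Series V \<and> (\<forall>A\<in>G. size A = n))"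

definition complete_g :: "nat \<Rightarrow> nat \<Rightarrow> 'a point multiset set \<Rightarrow> bool" where
  "complete_g n t G \<longleftrightarrow> is_g n t G \<and> \<not> (\<exists>s G'. s > t \<and> is_g n s G' \<and> G \<subset> G')"

text \<open>\<open>|A|\<close> and \<open>dim(|A|)\<close>\<close>

definition complete_series :: "'a point multiset \<Rightarrow> 'a point multiset set" where
  "complete_series A = (THE G. A \<in> G \<and> (\<exists>t. complete_g (size A) t G))"

definition complete_dim :: "'a point multiset \<Rightarrow> nat" where
  "complete_dim A = (THE t. complete_g (size A) t (complete_series A))"

definition lin_equiv :: "'a point multiset \<Rightarrow> 'a point multiset \<Rightarrow> bool" where
  "lin_equiv A B \<longleftrightarrow> (\<exists>n r G. is_g n r G \<and> A \<in> G \<and> B \<in> G)"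

definition gen_equiv :: "('a point \<Rightarrow>\<^sub>0 int) \<Rightarrow> ('a point \<Rightarrow>\<^sub>0 int) \<Rightarrow> bool" where
  "gen_equiv A B \<longleftrightarrow> (\<exists>A1 A2 B1 B2.
     A = gen_of A1 - gen_of A2 \<and> A1 \<inter># A2 = {#} \<and>
     B = gen_of B1 - gen_of B2 \<and> B1 \<inter># B2 = {#} \<and>
     lin_equiv (A1 + B2) (B1 + A2))"

definition gen_series :: "('a point \<Rightarrow>\<^sub>0 int) \<Rightarrow> ('a point \<Rightarrow>\<^sub>0 int) set" where
  "gen_series D = {D'. gen_equiv D' D}"

text \<open>\<open>|A| - |B|\<close> for complete series \<open>S = |A|\<close>, \<open>T = |B|\<close>\<close>

definition series_diff ::
  "'a point multiset set \<Rightarrow> 'a point multiset set \<Rightarrow> ('a point \<Rightarrow>\<^sub>0 int) set" where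
  "series_diff S T = (THE R. (\<exists>D. R = gen_series D) \<and>
     (\<forall>A\<in>S. \<forall>B\<in>T. gen_of A - gen_of B \<in> R))"

text \<open>Multiplicity with which \<open>\<gamma>\<close> appears in the unique member of \<open>G\<close> containing it, for \<open>G\<close> a
  \<open>g\<^sub>n\<^sup>1\<close> without fixed branches\<close>

definition member_mult :: "'a point multiset set \<Rightarrow> 'a point \<Rightarrow> nat" where
  "member_mult G \<gamma> = count (THE A. A \<in> G \<and> \<gamma> \<in># A) \<gamma>"

definition Jac_free :: "'a point multiset set \<Rightarrow> 'a point multiset" where
  "Jac_free G =
     (\<Sum>\<gamma> | \<gamma> \<in> X \<and> member_mult G \<gamma> \<ge> 2. replicate_mset (member_mult G \<gamma> - 1) \<gamma>)"

text \<open>\<open>Inf G\<close> is the largest multiset contained in every member of \<open>G\<close>.\<close>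

definition Jac :: "'a point multiset set \<Rightarrow> 'a point multiset" where
  "Jac G = Inf G + Inf G + Jac_free ((\<lambda>A. A - Inf G) ` G)"

text \<open>\<open>|A\<^sub>j|\<close>\<close>

definition Jac_series :: "'a point multiset \<Rightarrow> 'a point multiset set" where
  "Jac_series A = (THE S. (\<exists>n t. complete_g n t S) \<and>
     (\<forall>G n. is_g n 1 G \<and> G \<subseteq> complete_series A \<longrightarrow> Jac G \<in> S))"

end

end

theory Submission
  imports Defs "HOL-Computational_Algebra.Formal_Laurent_Series"
begin

text \<open>The field \<open>K\<close> of rational functions on the nonsingular model \<open>X\<close> is realised inside the Laurent
  series at one point of \<open>X\<close>, and every point of \<open>X\<close> gives an expansion, hence a valuation, of \<open>K\<close>.
  Since \<open>X\<close> and \<open>C\<close> have the same functions, being a \<open>g\<^sub>n\<^sup>r\<close> means being a linear series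
  \<open>{A + div f | f \<in> U - {0}}\<close> for a subspace \<open>U\<close> of dimension \<open>r + 1\<close> of the space of functions with
  poles bounded by \<open>A\<close>; linear equivalence is equality up to a principal divisor, and complete series
  are the linear equivalence classes. If a pencil in \<open>|A|\<close> contains \<open>A\<close> and is given by the functions
  \<open>1\<close> and \<open>z\<close>, then its Jacobian is \<open>2A + div dz\<close>. As any two functions on a curve are algebraically
  dependent, the quotient of two differentials \<open>dz\<close>, \<open>dz'\<close> is again a function, so that the class of
  \<open>div dz = Jac - 2A\<close> does not depend on \<open>A\<close>.\<close>

section \<open>Evaluating polynomials\<close>

text \<open>Dimension is defined by chains of closed sets, so what it yields directly is that proper
  closed subsets of a curve are finite. The two global facts about functions, constancy in the
  absence of poles and algebraic dependence, need points of the curve with prescribed properties.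
  These arise by specialising the coordinates of a power series point to the field:
  \<open>specialisation_extend_list\<close> keeps a chosen element nonzero, and
  \<open>exists_place\<close> sends a chosen nonconstant function to zero. Nonsingularity is given
  as a rank of gradients; Nakayama's lemma turns it into a uniformiser, and expansion along it
  yields a parametrisation. The locale \<open>places\<close> then separates divisors and
  differentials from forms. That principal divisors have degree zero is proved there by counting
  independent functions; it keeps the total multiplicity constant on a linear series. Characteristic
  zero gives the order of a derivative and the nonvanishing of \<open>dz\<close> for nonconstant
  \<open>z\<close>.\<close>

lemma mpol_as_sum:
  "(F :: 'a::comm_monoid_add mpol) =
     (\<Sum>m\<in>Poly_Mapping.keys F. Poly_Mapping.single m (Poly_Mapping.lookup F m))"
  by (rule poly_mapping_eqI) (auto simp: lookup_sum lookup_single when_def in_keys_iff)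

text \<open>The \<open>single\<close> case is restricted to monomials of \<open>F\<close>, so a
  bound on variables or degree, such as \<open>form m d F\<close>, stays available during the
  induction.\<close>

lemma mpol_induct [case_names zero single add]:
  fixes F :: "'a::comm_monoid_add mpol"
  assumes "P 0" "\<And>m c. m \<in> Poly_Mapping.keys F \<Longrightarrow> P (Poly_Mapping.single m c)"
    and "\<And>A B. P A \<Longrightarrow> P B \<Longrightarrow> P (A + B)"
  shows "P F"
proof -
  have "P (\<Sum>m\<in>M. Poly_Mapping.single m (Poly_Mapping.lookup F m))"
    if "finite M" "M \<subseteq> Poly_Mapping.keys F" for M
    using that by (induction M rule: finite_induct) (auto intro: assms)
  from this[of "Poly_Mapping.keys F"] show ?thesis
    using mpol_as_sum[of F] by simp
qed

definition mono_eval :: "(nat \<Rightarrow> 'b::comm_semiring_1) \<Rightarrow> (nat \<Rightarrow>\<^sub>0 nat) \<Rightarrow> 'b" where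
  "mono_eval x m = (\<Prod>i\<in>Poly_Mapping.keys m. x i ^ Poly_Mapping.lookup m i)"

lemma mono_eval_superset:
  assumes "finite I" "Poly_Mapping.keys m \<subseteq> I"
  shows "mono_eval x m = (\<Prod>i\<in>I. x i ^ Poly_Mapping.lookup m i)"
  unfolding mono_eval_def
  by (rule prod.mono_neutral_left) (use assms in \<open>auto simp: in_keys_iff\<close>)

lemma mono_eval_zero [simp]: "mono_eval x 0 = 1"
  by (simp add: mono_eval_def)

lemma mono_eval_add: "mono_eval x (m + n) = mono_eval x m * mono_eval x n"
proof -
  let ?I = "Poly_Mapping.keys m \<union> Poly_Mapping.keys n"
  have "mono_eval x (m + n) = (\<Prod>i\<in>?I. x i ^ Poly_Mapping.lookup (m + n) i)"
    by (rule mono_eval_superset) (auto simp: keys_add)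
  also have "\<dots> = mono_eval x m * mono_eval x n"
    by (subst (1 2) mono_eval_superset[of ?I]) (auto simp: lookup_add power_add prod.distrib)
  finally show ?thesis .
qed

lemma mono_eval_single [simp]: "mono_eval x (Poly_Mapping.single i n) = x i ^ n"
  by (simp add: mono_eval_def)

text \<open>One interface for substitution at points, in power series, in Laurent series and in
  polynomials. Other ring homomorphisms, such as evaluations, are instances as well, so
  \<open>hom_subst\<close> also commutes two substitutions.\<close>

locale const_hom =
  fixes h :: "'a::comm_ring_1 \<Rightarrow> 'b::comm_ring_1"
  assumes hom_add: "h (a + b) = h a + h b"
    and hom_mult: "h (a * b) = h a * h b"
    and hom_one: "h 1 = 1"
begin

lemma hom_zero: "h 0 = 0"
  using hom_add[of 0 0] by simp

lemma hom_uminus: "h (- a) = - h a"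
  using hom_add[of a "- a"] by (simp add: hom_zero eq_neg_iff_add_eq_0 add.commute)

lemma hom_diff: "h (a - b) = h a - h b"
  using hom_add[of a "- b"] by (simp add: hom_uminus)

lemma hom_power: "h (a ^ n) = h a ^ n"
  by (induction n) (auto simp: hom_one hom_mult)

lemma hom_sum: "h (\<Sum>i\<in>I. f i) = (\<Sum>i\<in>I. h (f i))"
  by (induction I rule: infinite_finite_induct) (auto simp: hom_zero hom_add)

lemma hom_prod: "h (\<Prod>i\<in>I. f i) = (\<Prod>i\<in>I. h (f i))"
  by (induction I rule: infinite_finite_induct) (auto simp: hom_one hom_mult)

lemma subst_alt: "subst_mpol h F x = (\<Sum>m\<in>Poly_Mapping.keys F. h (Poly_Mapping.lookup F m) * mono_eval x m)"
  by (simp add: subst_mpol_def mono_eval_def)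

lemma subst_zero [simp]: "subst_mpol h 0 x = 0"
  by (simp add: subst_alt)

lemma subst_single: "subst_mpol h (Poly_Mapping.single m c) x = h c * mono_eval x m"
  by (simp add: subst_alt hom_zero)

lemma subst_one [simp]: "subst_mpol h 1 x = 1"
  using subst_single[of 0 1 x] by (simp add: hom_one)

lemma subst_add: "subst_mpol h (F + G) x = subst_mpol h F x + subst_mpol h G x"
  unfolding subst_alt
  by (rule setsum_keys_plus_distrib[where f = "\<lambda>m c. h c * mono_eval x m"])
     (auto simp: hom_zero hom_add algebra_simps)

lemma subst_uminus: "subst_mpol h (- F) x = - subst_mpol h F x"
  using subst_add[of F "- F" x] by (simp add: eq_neg_iff_add_eq_0 add.commute)

lemma subst_diff: "subst_mpol h (F - G) x = subst_mpol h F x - subst_mpol h G x"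
  using subst_add[of F "- G" x] by (simp add: subst_uminus)

lemma subst_sum: "subst_mpol h (\<Sum>i\<in>I. F i) x = (\<Sum>i\<in>I. subst_mpol h (F i) x)"
  by (induction I rule: infinite_finite_induct) (auto simp: subst_add)

lemma subst_mult: "subst_mpol h (F * G) x = subst_mpol h F x * subst_mpol h G x"
proof (induction F rule: mpol_induct)
  case (single m c)
  show ?case
  proof (induction G rule: mpol_induct)
    case (single n d)
    then show ?case by (simp add: mult_single subst_single mono_eval_add hom_mult algebra_simps)
  qed (auto simp: subst_add algebra_simps)
qed (auto simp: subst_add algebra_simps)

lemma subst_power: "subst_mpol h (F ^ n) x = subst_mpol h F x ^ n"
  by (induction n) (auto simp: subst_mult)

lemma subst_prod: "subst_mpol h (\<Prod>i\<in>I. F i) x = (\<Prod>i\<in>I. subst_mpol h (F i) x)"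
  by (induction I rule: infinite_finite_induct) (auto simp: subst_mult)

lemma subst_cong:
  assumes "\<And>m. m \<in> Poly_Mapping.keys F \<Longrightarrow> Poly_Mapping.keys m \<subseteq> I" "\<And>i. i \<in> I \<Longrightarrow> x i = y i"
  shows "subst_mpol h F x = subst_mpol h F y"
  unfolding subst_mpol_def
proof (rule sum.cong[OF refl])
  fix m assume "m \<in> Poly_Mapping.keys F"
  then have "Poly_Mapping.keys m \<subseteq> I"
    by (rule assms(1))
  then have "(\<Prod>i\<in>Poly_Mapping.keys m. x i ^ Poly_Mapping.lookup m i) =
      (\<Prod>i\<in>Poly_Mapping.keys m. y i ^ Poly_Mapping.lookup m i)"
    by (intro prod.cong refl) (simp add: assms(2) subset_iff)
  then show "h (Poly_Mapping.lookup F m) * (\<Prod>i\<in>Poly_Mapping.keys m. x i ^ Poly_Mapping.lookup m i) =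
      h (Poly_Mapping.lookup F m) * (\<Prod>i\<in>Poly_Mapping.keys m. y i ^ Poly_Mapping.lookup m i)"
    by simp
qed

lemma hom_subst:
  assumes "const_hom \<psi>"
  shows "\<psi> (subst_mpol h F x) = subst_mpol (\<lambda>c. \<psi> (h c)) F (\<lambda>i. \<psi> (x i))"
proof -
  interpret \<psi>: const_hom \<psi> by fact
  show ?thesis
    unfolding subst_mpol_def by (simp add: \<psi>.hom_sum \<psi>.hom_mult \<psi>.hom_prod \<psi>.hom_power)
qed

end

interpretation id_hom: const_hom "id :: 'a::comm_ring_1 \<Rightarrow> 'a"
  by unfold_locales auto

interpretation fps_hom: const_hom "fps_const :: 'a::comm_ring_1 \<Rightarrow> 'a fps"
  by unfold_locales auto

interpretation fls_hom: const_hom "fls_const :: 'a::comm_ring_1 \<Rightarrow> 'a fls"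
  by unfold_locales (auto simp: fls_plus_const)

interpretation mpol_hom: const_hom "Poly_Mapping.single 0 :: 'a::comm_ring_1 \<Rightarrow> 'a mpol"
  by unfold_locales (auto simp: single_add mult_single)

lemma const_hom_fps_nth_0: "const_hom (\<lambda>f :: 'a::comm_ring_1 fps. fps_nth f 0)"
  by unfold_locales auto

lemma const_hom_fps_to_fls: "const_hom (fps_to_fls :: 'a::comm_ring_1 fps \<Rightarrow> 'a fls)"
  by unfold_locales (auto simp: fls_times_fps_to_fls)

lemma subst_fps_nth_0:
  fixes F :: "'a::comm_ring_1 mpol"
  shows "fps_nth (subst_mpol fps_const F x) 0 = subst_mpol id F (\<lambda>i. fps_nth (x i) 0)"
  using fps_hom.hom_subst[OF const_hom_fps_nth_0, of F x] by (simp add: id_def)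

lemma fps_to_fls_subst:
  fixes F :: "'a::comm_ring_1 mpol"
  shows "fps_to_fls (subst_mpol fps_const F x) = subst_mpol fls_const F (\<lambda>i. fps_to_fls (x i))"
  using fps_hom.hom_subst[OF const_hom_fps_to_fls, of F x] by simp

text \<open>Pullback of \<open>F\<close> along the map with components \<open>G\<close>; if the
  components are forms of one degree, forms pull back to forms.\<close>

definition mcomp :: "'a::comm_ring_1 mpol \<Rightarrow> (nat \<Rightarrow> 'a mpol) \<Rightarrow> 'a mpol" where
  "mcomp F G = subst_mpol (Poly_Mapping.single 0) F G"

lemma (in const_hom) const_hom_subst: "const_hom (\<lambda>F. subst_mpol h F x)"
  by unfold_locales (auto simp: subst_add subst_mult)

lemma (in const_hom) subst_mcomp: "subst_mpol h (mcomp F G) x = subst_mpol h F (\<lambda>i. subst_mpol h (G i) x)"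
  unfolding mcomp_def using mpol_hom.hom_subst[OF const_hom_subst, of F G x]
  by (simp add: subst_single)

definition mvar :: "nat \<Rightarrow> 'a::comm_ring_1 mpol" where
  "mvar i = Poly_Mapping.single (Poly_Mapping.single i 1) 1"

lemma (in const_hom) subst_mvar [simp]: "subst_mpol h (mvar i) x = x i"
  by (simp add: mvar_def subst_single hom_one)

lemma (in const_hom) subst_const [simp]: "subst_mpol h (Poly_Mapping.single 0 c) x = h c"
  by (simp add: subst_single)

section \<open>Forms\<close>

lemma scale_mpol_eq: "scale_mpol c F = Poly_Mapping.single 0 c * F"
  by (simp add: scale_mpol_def mult_map_scale_conv_mult)

definition mdeg :: "(nat \<Rightarrow>\<^sub>0 nat) \<Rightarrow> nat" where
  "mdeg m = (\<Sum>i\<in>Poly_Mapping.keys m. Poly_Mapping.lookup m i)"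

lemma mdeg_superset:
  assumes "finite I" "Poly_Mapping.keys m \<subseteq> I"
  shows "mdeg m = (\<Sum>i\<in>I. Poly_Mapping.lookup m i)"
  unfolding mdeg_def by (rule sum.mono_neutral_left) (use assms in \<open>auto simp: in_keys_iff\<close>)

lemma mdeg_add: "mdeg (m + n) = mdeg m + mdeg n"
proof -
  let ?I = "Poly_Mapping.keys m \<union> Poly_Mapping.keys n"
  have "mdeg (m + n) = (\<Sum>i\<in>?I. Poly_Mapping.lookup (m + n) i)"
    by (rule mdeg_superset) (auto simp: keys_add)
  also have "\<dots> = mdeg m + mdeg n"
    by (subst (1 2) mdeg_superset[of ?I]) (auto simp: lookup_add sum.distrib)
  finally show ?thesis .
qed

lemma mdeg_zero [simp]: "mdeg 0 = 0"
  by (simp add: mdeg_def)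

lemma mdeg_single [simp]: "mdeg (Poly_Mapping.single i n) = n"
  by (simp add: mdeg_def)

lemma form_alt: "form w d F \<longleftrightarrow> (\<forall>m\<in>Poly_Mapping.keys F. Poly_Mapping.keys m \<subseteq> {..w} \<and> mdeg m = d)"
  by (simp add: form_def mdeg_def)

lemma form_zero [simp]: "form w d 0"
  by (simp add: form_alt)

lemma form_single: "Poly_Mapping.keys m \<subseteq> {..w} \<Longrightarrow> mdeg m = d \<Longrightarrow> form w d (Poly_Mapping.single m c)"
  by (simp add: form_alt)

lemma form_const [simp]: "form w 0 (Poly_Mapping.single 0 c)"
  by (simp add: form_alt)

lemma form_one [simp]: "form w 0 1"
  by (simp add: form_alt)

lemma form_mvar: "i \<le> w \<Longrightarrow> form w 1 (mvar i)"
  by (simp add: form_alt mvar_def)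

lemma form_add: "form w d F \<Longrightarrow> form w d G \<Longrightarrow> form w d (F + G :: 'a::comm_monoid_add mpol)"
  unfolding form_alt using keys_add[of F G] by blast

lemma form_uminus: "form w d F \<Longrightarrow> form w d (- F :: 'a::ab_group_add mpol)"
  unfolding form_alt by (metis in_keys_iff lookup_uminus neg_equal_0_iff_equal)

lemma form_diff: "form w d F \<Longrightarrow> form w d G \<Longrightarrow> form w d (F - G :: 'a::ab_group_add mpol)"
  using form_add[of w d F "- G"] form_uminus[of w d G] by simp

lemma form_mult: "form w d F \<Longrightarrow> form w e G \<Longrightarrow> form w (d + e) (F * G :: 'a::comm_ring_1 mpol)"
  unfolding form_alt
proof
  fix m assume F: "\<forall>m\<in>Poly_Mapping.keys F. Poly_Mapping.keys m \<subseteq> {..w} \<and> mdeg m = d"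
    and G: "\<forall>m\<in>Poly_Mapping.keys G. Poly_Mapping.keys m \<subseteq> {..w} \<and> mdeg m = e"
    and m: "m \<in> Poly_Mapping.keys (F * G)"
  from m keys_mult[of F G] obtain a b where "m = a + b" "a \<in> Poly_Mapping.keys F" "b \<in> Poly_Mapping.keys G"
    by auto
  with F G have "Poly_Mapping.keys a \<subseteq> {..w}" "Poly_Mapping.keys b \<subseteq> {..w}" "mdeg m = d + e"
    by (auto simp: mdeg_add)
  with keys_add[of a b] show "Poly_Mapping.keys m \<subseteq> {..w} \<and> mdeg m = d + e"
    unfolding \<open>m = a + b\<close> by blast
qed

lemma form_scale: "form w d F \<Longrightarrow> form w d (scale_mpol c F)"
  using form_mult[OF form_const[of w c], of d F] by (simp add: scale_mpol_eq)

lemma form_sum: "(\<And>i. i \<in> I \<Longrightarrow> form w d (F i)) \<Longrightarrow> form w d (\<Sum>i\<in>I. F i :: 'a::comm_monoid_add mpol)"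
  by (induction I rule: infinite_finite_induct) (auto intro: form_add)

lemma form_prod:
  "(\<And>i. i \<in> I \<Longrightarrow> form w (d i) (F i)) \<Longrightarrow> form w (\<Sum>i\<in>I. d i) (\<Prod>i\<in>I. F i :: 'a::comm_ring_1 mpol)"
  by (induction I rule: infinite_finite_induct) (auto intro: form_mult)

lemma form_power: "form w d F \<Longrightarrow> form w (n * d) (F ^ n :: 'a::comm_ring_1 mpol)"
  by (induction n) (auto intro: form_mult)

lemma (in const_hom) subst_form_cong:
  "form w d F \<Longrightarrow> (\<And>i. i \<le> w \<Longrightarrow> x i = y i) \<Longrightarrow> subst_mpol h F x = subst_mpol h F y"
  by (rule subst_cong[of _ "{..w}"]) (auto simp: form_alt)

lemma mono_eval_scale: "mono_eval (\<lambda>i. c * x i) m = c ^ mdeg m * mono_eval x m"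
  by (simp add: mono_eval_def mdeg_def power_mult_distrib prod.distrib power_sum)

lemma (in const_hom) subst_form_scale:
  "form w d F \<Longrightarrow> subst_mpol h F (\<lambda>i. c * x i) = c ^ d * subst_mpol h F x"
  unfolding subst_alt sum_distrib_left
  by (rule sum.cong) (auto simp: form_alt mono_eval_scale algebra_simps)

lemma form_mcomp:
  assumes "form w d F" "\<And>i. i \<le> w \<Longrightarrow> form m e (G i)"
  shows "form m (d * e) (mcomp F G :: 'a::comm_ring_1 mpol)"
proof -
  have "form m (d * e) (Poly_Mapping.single 0 (Poly_Mapping.lookup F n) * mono_eval G n)"
    if "n \<in> Poly_Mapping.keys F" for n
  proof -
    from that assms(1) have n: "Poly_Mapping.keys n \<subseteq> {..w}" "mdeg n = d"
      by (auto simp: form_alt)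
    have "form m (\<Sum>i\<in>Poly_Mapping.keys n. Poly_Mapping.lookup n i * e) (mono_eval G n)"
      unfolding mono_eval_def using n by (intro form_prod form_power assms) auto
    also have "(\<Sum>i\<in>Poly_Mapping.keys n. Poly_Mapping.lookup n i * e) = d * e"
      using n by (simp add: mdeg_def flip: sum_distrib_right)
    finally show ?thesis
      using form_mult[OF form_const, of m "d * e" "mono_eval G n"] by simp
  qed
  then show ?thesis
    unfolding mcomp_def mpol_hom.subst_alt by (intro form_sum)
qed

text \<open>Lets a least leading monomial be chosen by \<open>Min\<close> among forms of one degree,
  without well-foundedness of the monomial order.\<close>

lemma finite_monomials: "finite {m. Poly_Mapping.keys m \<subseteq> {..w} \<and> mdeg m = d}"
proof (rule finite_subset)
  let ?S = "{f. \<forall>i. (i \<in> {..w} \<longrightarrow> f i \<in> {..d}) \<and> (i \<notin> {..w} \<longrightarrow> f i = 0)}"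
  show "finite (Poly_Mapping.lookup -` ?S)"
    by (intro finite_vimageI finite_set_of_finite_funs injI poly_mapping_eqI) simp_all
  show "{m. Poly_Mapping.keys m \<subseteq> {..w} \<and> mdeg m = d} \<subseteq> Poly_Mapping.lookup -` ?S"
  proof
    fix m assume "m \<in> {m. Poly_Mapping.keys m \<subseteq> {..w} \<and> mdeg m = d}"
    then have m: "Poly_Mapping.keys m \<subseteq> {..w}" "mdeg m = d" by auto
    have "Poly_Mapping.lookup m i \<le> d" for i
    proof (cases "i \<in> Poly_Mapping.keys m")
      case True
      then have "Poly_Mapping.lookup m i \<le> mdeg m"
        unfolding mdeg_def by (intro member_le_sum) auto
      with m show ?thesis by simp
    qed (auto simp: in_keys_iff)
    moreover have "Poly_Mapping.lookup m i = 0" if "i \<notin> {..w}" for i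
      using m that by (auto simp: in_keys_iff)
    ultimately show "m \<in> Poly_Mapping.lookup -` ?S" by auto
  qed
qed

lemma subst_scale_id: "subst_mpol id (scale_mpol c F) x = c * subst_mpol id F x"
  by (simp add: scale_mpol_eq id_hom.subst_mult)

section \<open>Closed subsets of projective space\<close>

lemma proj_point_scale:
  fixes v :: "nat \<Rightarrow> 'a::field"
  assumes c: "c \<noteq> 0"
  shows "proj_point (scale_vec c v) = proj_point v"
proof (intro set_eqI iffI)
  fix u assume "u \<in> proj_point (scale_vec c v)"
  then obtain d where "u = scale_vec (d * c) v" "d \<noteq> 0"
    by (auto simp: proj_point_def)
  with c show "u \<in> proj_point v" unfolding proj_point_def
    by (intro CollectI exI[of _ "d * c"]) simp
next
  fix u assume "u \<in> proj_point v"
  then obtain d where "u = scale_vec d v" "d \<noteq> 0" by (auto simp: proj_point_def)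
  with c have "u = scale_vec (d / c) (scale_vec c v)" "d / c \<noteq> 0"
    by auto
  then show "u \<in> proj_point (scale_vec c v)" unfolding proj_point_def by blast
qed

lemma proj_spaceD:
  assumes "p \<in> proj_space m" "v \<in> p"
  shows "p = proj_point v" "v \<noteq> 0" "\<And>i. i > m \<Longrightarrow> v i = 0"
proof -
  from assms(1) obtain u where u: "p = proj_point u" "u \<noteq> 0" "\<forall>i>m. u i = 0"
    by (auto simp: proj_space_def)
  with assms(2) obtain c where c: "v = scale_vec c u" "c \<noteq> 0"
    by (auto simp: proj_point_def)
  show "p = proj_point v" using proj_point_scale[OF c(2), of u] u(1) c(1) by simp
  show "v \<noteq> 0" using c u by (auto simp: scale_vec_def fun_eq_iff)
  show "v i = 0" if "i > m" for i using c u that by (auto simp: scale_vec_def)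
qed

lemma proj_point_self: "v \<in> proj_point v"
  unfolding proj_point_def by (rule CollectI, rule exI[of _ 1]) (simp add: scale_vec_def)

lemma proj_space_nonempty: "p \<in> proj_space m \<Longrightarrow> \<exists>v. v \<in> p"
  by (auto simp: proj_space_def intro: proj_point_self)

lemma proj_point_in_space: "v \<noteq> 0 \<Longrightarrow> (\<And>i. i > m \<Longrightarrow> v i = 0) \<Longrightarrow> proj_point v \<in> proj_space m"
  by (auto simp: proj_space_def)

text \<open>Scaling the vector multiplies the value of a form by \<open>c ^ d\<close>, so one
  representative decides for the whole point.\<close>

lemma vanishes_at_iff:
  assumes "p \<in> proj_space m" "v \<in> p" "form w d F"
  shows "vanishes_at F p \<longleftrightarrow> subst_mpol id F v = 0"
proof -
  have "subst_mpol id F (scale_vec c v) = c ^ d * subst_mpol id F v" for c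
    using id_hom.subst_form_scale[OF assms(3), of c v] by (simp add: scale_vec_def)
  then show ?thesis
    using assms proj_spaceD(1)[OF assms(1,2)]
    by (auto simp: vanishes_at_def proj_point_def)
qed

lemma vanishes_at_mult:
  assumes "p \<in> proj_space m" "form w d F" "form w' e G"
  shows "vanishes_at (F * G) p \<longleftrightarrow> vanishes_at F p \<or> vanishes_at G p"
proof -
  obtain v where v: "v \<in> p" using proj_space_nonempty[OF assms(1)] by auto
  \<comment> \<open>The two forms may have different bounds on their variables; the larger bound
    accommodates both.\<close>
  have F: "form (max w w') d F" and G: "form (max w w') e G"
    using assms(2,3) by (fastforce simp: form_alt)+
  show ?thesis
    unfolding vanishes_at_iff[OF assms(1) v F] vanishes_at_iff[OF assms(1) v G]
      vanishes_at_iff[OF assms(1) v form_mult[OF F G]] by (simp add: id_hom.subst_mult)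
qed

lemma proj_closedD: "proj_closed m Z \<Longrightarrow> Z \<subseteq> proj_space m"
  by (auto simp: proj_closed_def)

lemma proj_closed_form: "form m d F \<Longrightarrow> proj_closed m {p \<in> proj_space m. vanishes_at F p}"
  unfolding proj_closed_def by (rule exI[of _ "{F}"]) auto

lemma proj_closed_Int: "proj_closed m Z \<Longrightarrow> proj_closed m Y \<Longrightarrow> proj_closed m (Z \<inter> Y)"
  unfolding proj_closed_def by (elim exE conjE, rule_tac x = "S \<union> Sa" in exI) auto

lemma proj_closed_form_Int:
  assumes "proj_closed m Z" "form m d F"
  shows "proj_closed m {p \<in> Z. vanishes_at F p}"
proof -
  have "{p \<in> Z. vanishes_at F p} = Z \<inter> {p \<in> proj_space m. vanishes_at F p}"
    using proj_closedD[OF assms(1)] by auto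
  then show ?thesis using proj_closed_Int[OF assms(1) proj_closed_form[OF assms(2)]] by simp
qed

lemma proj_closed_Un:
  assumes "proj_closed m Z" "proj_closed m Y"
  shows "proj_closed m (Z \<union> Y)"
proof -
  from assms obtain S T where S: "\<forall>F\<in>S. \<exists>d. form m d F" "Z = {p \<in> proj_space m. \<forall>F\<in>S. vanishes_at F p}"
    and T: "\<forall>F\<in>T. \<exists>d. form m d F" "Y = {p \<in> proj_space m. \<forall>F\<in>T. vanishes_at F p}"
    by (auto simp: proj_closed_def)
  let ?U = "{F * G | F G. F \<in> S \<and> G \<in> T}"
  have mult: "vanishes_at (F * G) p \<longleftrightarrow> vanishes_at F p \<or> vanishes_at G p"
    if "F \<in> S" "G \<in> T" "p \<in> proj_space m" for F G p
    using S(1) T(1) that vanishes_at_mult by metis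
  have "\<forall>F\<in>?U. \<exists>d. form m d F"
    using S(1) T(1) form_mult by blast
  moreover have "Z \<union> Y = {p \<in> proj_space m. \<forall>F\<in>?U. vanishes_at F p}"
  proof (intro set_eqI iffI)
    fix p assume "p \<in> Z \<union> Y"
    then show "p \<in> {p \<in> proj_space m. \<forall>F\<in>?U. vanishes_at F p}"
      using S(2) T(2) mult by auto
  next
    fix p assume p: "p \<in> {p \<in> proj_space m. \<forall>F\<in>?U. vanishes_at F p}"
    show "p \<in> Z \<union> Y"
    proof (rule ccontr)
      assume "p \<notin> Z \<union> Y"
      with p S(2) T(2) obtain F G where "F \<in> S" "G \<in> T" "\<not> vanishes_at F p" "\<not> vanishes_at G p"
        by auto
      with p mult[of F G p] show False by auto
    qed
  qed
  ultimately show ?thesis unfolding proj_closed_def by blast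
qed

lemma proj_closed_empty: "proj_closed m {}"
  unfolding proj_closed_def
proof (intro exI conjI)
  show "\<forall>F\<in>{1}. \<exists>d. form m d F" by (auto intro: exI[of _ 0])
  have "\<not> vanishes_at 1 p" if "p \<in> proj_space m" for p :: "'a point"
    using proj_space_nonempty[OF that] by (auto simp: vanishes_at_def)
  then show "{} = {p \<in> proj_space m. \<forall>F\<in>{1 :: 'a mpol}. vanishes_at F p}" by auto
qed

text \<open>The linear forms \<open>L\<close> with value \<open>v j * w i - v i * w j\<close> at
  \<open>w\<close> cut out exactly the point of \<open>v\<close>: if all of them vanish at
  \<open>u\<close>, then \<open>u\<close> is proportional to \<open>v\<close>.\<close>

lemma separating_form:
  fixes p q :: "'a::field point"
  assumes "p \<in> proj_space m" "q \<in> proj_space m" "p \<noteq> q"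
  shows "\<exists>L. form m 1 L \<and> vanishes_at L p \<and> \<not> vanishes_at L q"
proof (rule ccontr)
  assume contra: "\<not> ?thesis"
  obtain v where v: "v \<in> p" using proj_space_nonempty[OF assms(1)] by auto
  obtain u where u: "u \<in> q" using proj_space_nonempty[OF assms(2)] by auto
  have *: "v j * u i = v i * u j" if "i \<le> m" "j \<le> m" for i j
  proof -
    define L where "L = scale_mpol (v j) (mvar i) - scale_mpol (v i) (mvar j)"
    have L: "form m 1 L" using that by (simp add: L_def form_diff form_scale form_mvar[simplified])
    have eval: "subst_mpol id L w = v j * w i - v i * w j" for w
      by (simp add: L_def id_hom.subst_diff subst_scale_id)
    have "vanishes_at L p" using vanishes_at_iff[OF assms(1) v L] eval by simp
    then have "vanishes_at L q" using contra L by blast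
    then show ?thesis using vanishes_at_iff[OF assms(2) u L] eval by simp
  qed
  obtain k where k: "v k \<noteq> 0" "k \<le> m"
    using proj_spaceD(2,3)[OF assms(1) v] by (metis ext leI zero_fun_apply)
  have uk: "u k \<noteq> 0"
  proof
    assume "u k = 0"
    then have "u i = 0" for i
      using *[of i k] k proj_spaceD(3)[OF assms(2) u, of i] by (cases "i \<le> m") auto
    with proj_spaceD(2)[OF assms(2) u] show False by auto
  qed
  have "u = scale_vec (u k / v k) v"
  proof
    fix i show "u i = scale_vec (u k / v k) v i"
      using *[of i k] k proj_spaceD(3)[OF assms(2) u, of i] proj_spaceD(3)[OF assms(1) v, of i]
      by (cases "i \<le> m") (auto simp: scale_vec_def field_simps)
  qed
  then have "proj_point u = proj_point v"
    using proj_point_scale[of "u k / v k" v] uk k by simp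
  then show False
    using assms(3) proj_spaceD(1)[OF assms(1) v] proj_spaceD(1)[OF assms(2) u] by simp
qed

lemma proj_closed_point:
  fixes p :: "'a::field point"
  assumes "p \<in> proj_space m"
  shows "proj_closed m {p}"
proof -
  let ?S = "{L. form m 1 L \<and> vanishes_at L p}"
  have "{p} = {q \<in> proj_space m. \<forall>L\<in>?S. vanishes_at L q}"
    using assms separating_form[OF assms] by auto
  then show ?thesis unfolding proj_closed_def by (intro exI[of _ ?S]) auto
qed

lemma proj_closed_finite: "finite Z \<Longrightarrow> Z \<subseteq> proj_space m \<Longrightarrow> proj_closed m Z"
proof (induction Z rule: finite_induct)
  case empty
  show ?case by (rule proj_closed_empty)
next
  case (insert p Z)
  then show ?case using proj_closed_Un[OF proj_closed_point[of p m], of Z] by simp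
qed

section \<open>Descending chains of closed sets\<close>

text \<open>A monotone subsequence exists, and a decreasing sequence of naturals is constant from
  the place where its minimum is attained.\<close>

lemma nat_seq_incseq_subseq: "\<exists>r :: nat \<Rightarrow> nat. strict_mono r \<and> incseq (\<lambda>n. a (r n) :: nat)"
proof -
  obtain r where r: "strict_mono r" "monoseq (\<lambda>n. a (r n))" using seq_monosub[of a] by auto
  show ?thesis
  proof (cases "incseq (\<lambda>n. a (r n))")
    case False
    with r have dec: "decseq (\<lambda>n. a (r n))" by (auto simp: monoseq_iff)
    define N where "N = (ARG_MIN (\<lambda>n. a (r n)) n. True)"
    have N: "a (r N) \<le> a (r n)" for n
      unfolding N_def by (rule arg_min_nat_le) simp
    have "a (r (N + n)) = a (r N)" for n
      using N[of "N + n"] decseqD[OF dec, of N "N + n"] by simp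
    then have "incseq (\<lambda>n. a (r (N + n)))" by (simp add: incseq_def)
    moreover have "strict_mono (\<lambda>n. r (N + n))"
      using r(1) by (simp add: strict_mono_def)
    ultimately show ?thesis by blast
  qed (use r in blast)
qed

lemma dickson_subseq: "\<exists>r. strict_mono r \<and> (\<forall>l<k. incseq (\<lambda>n. a (r n) l))"
  for a :: "nat \<Rightarrow> nat \<Rightarrow> nat"
proof (induction k)
  case 0
  show ?case by (auto intro: exI[of _ id] simp: strict_mono_def)
next
  case (Suc k)
  then obtain r where r: "strict_mono r" "\<forall>l<k. incseq (\<lambda>n. a (r n) l)" by auto
  obtain s where s: "strict_mono s" "incseq (\<lambda>n. a (r (s n)) k)"
    using nat_seq_incseq_subseq[of "\<lambda>n. a (r n) k"] by auto
  have "incseq (\<lambda>n. a (r (s n)) l)" if "l < Suc k" for l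
  proof (cases "l = k")
    case False
    with that r(2) have "incseq (\<lambda>n. a (r n) l)" by auto
    with s(1) show ?thesis by (auto simp: incseq_def strict_mono_less_eq)
  qed (use s in simp)
  moreover have "strict_mono (\<lambda>n. r (s n))" using r(1) s(1) by (simp add: strict_mono_def)
  ultimately show ?case by (intro exI[of _ "\<lambda>n. r (s n)"]) blast
qed

text \<open>Dickson's lemma for exponent vectors: a subsequence increasing in every coordinate is
  obtained one coordinate at a time, and its first two terms are compared.\<close>

lemma dickson: "\<exists>i j. i < j \<and> (\<forall>l<k. a i l \<le> a j l)" for a :: "nat \<Rightarrow> nat \<Rightarrow> nat"
proof -
  obtain r where r: "strict_mono r" "\<forall>l<k. incseq (\<lambda>n. a (r n) l)" using dickson_subseq by blast
  have "r 0 < r 1" using r(1) by (simp add: strict_mono_def)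
  moreover have "\<forall>l<k. a (r 0) l \<le> a (r 1) l" using r(2) by (auto simp: incseq_def)
  ultimately show ?thesis by blast
qed

lemma lookup_single_mult: "Poly_Mapping.lookup (Poly_Mapping.single a c * G) (a + b) = c * Poly_Mapping.lookup G b"
  for G :: "'a::comm_ring_1 mpol"
proof (induction G rule: mpol_induct)
  case (single m d)
  then show ?case by (auto simp: mult_single lookup_single when_def)
qed (auto simp: lookup_add algebra_simps)

text \<open>Leading monomial for the linear order on exponent vectors, which is translation
  invariant; the value at \<open>F = 0\<close> is arbitrary.\<close>

definition lead_mono :: "'a::zero mpol \<Rightarrow> (nat \<Rightarrow>\<^sub>0 nat)" where
  "lead_mono F = Max (Poly_Mapping.keys F)"

lemma lead_mono_in: "F \<noteq> 0 \<Longrightarrow> lead_mono F \<in> Poly_Mapping.keys F"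
  unfolding lead_mono_def by (rule Max_in) auto

lemma lead_mono_ge: "a \<in> Poly_Mapping.keys F \<Longrightarrow> a \<le> lead_mono F"
  unfolding lead_mono_def by (rule Max_ge) auto

text \<open>The constant \<open>c\<close> cancels the leading terms, and translation invariance
  keeps every monomial of the subtracted multiple at or below the leading one.\<close>

lemma lead_mono_reduce:
  fixes F G :: "'a::field mpol"
  assumes "F \<noteq> 0" "G \<noteq> 0" "lead_mono F = a + lead_mono G"
  defines "c \<equiv> Poly_Mapping.lookup F (lead_mono F) / Poly_Mapping.lookup G (lead_mono G)"
  defines "F' \<equiv> F - Poly_Mapping.single a c * G"
  assumes "F' \<noteq> 0"
  shows "lead_mono F' < lead_mono F"
proof -
  have "lead_mono F' \<in> Poly_Mapping.keys F'" using assms lead_mono_in by blast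
  moreover have "Poly_Mapping.lookup F' (lead_mono F) = 0"
    using lead_mono_in[OF assms(2)]
    by (simp add: F'_def assms(3) lookup_minus lookup_single_mult c_def in_keys_iff)
  ultimately have ne: "lead_mono F' \<noteq> lead_mono F" by (auto simp: in_keys_iff)
  have "Poly_Mapping.keys (Poly_Mapping.single a c * G) \<subseteq> {a + b | b. b \<in> Poly_Mapping.keys G}"
    using keys_mult[of "Poly_Mapping.single a c" G] by (auto split: if_splits)
  moreover have "a + b \<le> lead_mono F" if "b \<in> Poly_Mapping.keys G" for b
    using lead_mono_ge[OF that] by (simp add: assms(3) add_left_mono)
  ultimately have "k \<le> lead_mono F" if "k \<in> Poly_Mapping.keys F'" for k
    using that keys_diff[of F "Poly_Mapping.single a c * G"] lead_mono_ge[of k F]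
    unfolding F'_def by blast
  then have "lead_mono F' \<le> lead_mono F" using \<open>lead_mono F' \<in> Poly_Mapping.keys F'\<close> by blast
  with ne show ?thesis by (rule le_neq_trans[rotated])
qed

text \<open>A Groebner basis argument. For each \<open>n\<close> take, among the forms of a suitable
  degree that vanish on \<open>Z (Suc n)\<close> but not on \<open>Z n\<close>, one with least
  leading monomial. Dickson's lemma gives \<open>i < j\<close> such that the leading monomial of
  \<open>F i\<close> divides that of \<open>F j\<close>; subtracting a multiple of
  \<open>F i\<close> contradicts the minimality of \<open>F j\<close>.\<close>

lemma proj_closed_chain:
  fixes Z :: "nat \<Rightarrow> 'a::field point set"
  assumes "\<And>n. proj_closed m (Z n)" "\<And>n. Z (Suc n) \<subset> Z n"
  shows False
proof -
  define J where "J = (\<lambda>n d. {F. form m d F \<and> (\<forall>p\<in>Z n. vanishes_at F p)})"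
  have Zsp: "Z n \<subseteq> proj_space m" for n using proj_closedD[OF assms(1)] .
  have mono: "Z j \<subseteq> Z i" if "i \<le> j" for i j
    using that by (induction j rule: dec_induct) (use assms(2) in blast)+
  have Jmono: "J i d \<subseteq> J j d" if "i \<le> j" for i j d
    using mono[OF that] by (auto simp: J_def)
  have Jeval: "F \<in> J n d \<longleftrightarrow> form m d F \<and> (\<forall>p\<in>Z n. \<forall>v\<in>p. subst_mpol id F v = 0)" for F n d
    by (auto simp: J_def vanishes_at_def)
  have Jdiff: "F - G \<in> J n d" if "F \<in> J n d" "G \<in> J n d" for F G n d
    using that by (auto simp: Jeval form_diff id_hom.subst_diff)
  have Jmult: "H * G \<in> J n (d + e)" if "form m d H" "G \<in> J n e" for H G n d e
    using that by (auto simp: Jeval form_mult id_hom.subst_mult)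
  have J0: "0 \<in> J n d" for n d by (auto simp: Jeval)
  have "\<exists>d F. F \<in> J (Suc n) d \<and> F \<notin> J n d \<and>
      (\<forall>F'. F' \<in> J (Suc n) d \<and> F' \<notin> J n d \<longrightarrow> lead_mono F \<le> lead_mono F')" for n
  proof -
    from assms(2)[of n] obtain p where p: "p \<in> Z n" "p \<notin> Z (Suc n)" by blast
    from assms(1)[of "Suc n"] obtain S where S: "\<forall>F\<in>S. \<exists>d. form m d F"
      "Z (Suc n) = {p \<in> proj_space m. \<forall>F\<in>S. vanishes_at F p}" by (auto simp: proj_closed_def)
    with p Zsp obtain F where F: "F \<in> S" "\<not> vanishes_at F p" by blast
    with S obtain d where d: "form m d F" by auto
    let ?A = "J (Suc n) d - J n d"
    have FA: "F \<in> ?A" using F S p d by (auto simp: J_def)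
    have "lead_mono ` ?A \<subseteq> {a. Poly_Mapping.keys a \<subseteq> {..m} \<and> mdeg a = d}"
    proof
      fix a assume "a \<in> lead_mono ` ?A"
      then obtain F where F: "F \<in> ?A" "a = lead_mono F" by auto
      then have "F \<noteq> 0" using J0 by auto
      with F lead_mono_in[of F] show "a \<in> {a. Poly_Mapping.keys a \<subseteq> {..m} \<and> mdeg a = d}"
        by (auto simp: J_def form_alt)
    qed
    then have fin: "finite (lead_mono ` ?A)" using finite_monomials finite_subset by blast
    then have "Min (lead_mono ` ?A) \<in> lead_mono ` ?A" using FA by (intro Min_in) auto
    then obtain F0 where F0: "F0 \<in> ?A" "lead_mono F0 = Min (lead_mono ` ?A)" by auto
    have "lead_mono F0 \<le> lead_mono F'" if "F' \<in> ?A" for F'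
      unfolding F0(2) using fin that by (intro Min_le) auto
    with F0(1) show ?thesis by blast
  qed
  then obtain d F where F: "\<And>n. F n \<in> J (Suc n) (d n)" "\<And>n. F n \<notin> J n (d n)"
    "\<And>n F'. F' \<in> J (Suc n) (d n) \<Longrightarrow> F' \<notin> J n (d n) \<Longrightarrow> lead_mono (F n) \<le> lead_mono F'"
    by metis
  have F0: "F n \<noteq> 0" for n using F(2)[of n] J0 by metis
  have LM: "Poly_Mapping.keys (lead_mono (F n)) \<subseteq> {..m}" "mdeg (lead_mono (F n)) = d n" for n
    using F(1)[of n] lead_mono_in[OF F0[of n]] by (auto simp: J_def form_alt)
  obtain i j where ij: "i < j" "\<forall>l<Suc m. Poly_Mapping.lookup (lead_mono (F i)) l \<le> Poly_Mapping.lookup (lead_mono (F j)) l"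
    using dickson[of "Suc m" "\<lambda>n. Poly_Mapping.lookup (lead_mono (F n))"] by blast
  define a where "a = lead_mono (F j) - lead_mono (F i)"
  have a: "lead_mono (F j) = a + lead_mono (F i)"
  proof (rule poly_mapping_eqI)
    fix l
    show "Poly_Mapping.lookup (lead_mono (F j)) l = Poly_Mapping.lookup (a + lead_mono (F i)) l"
    proof (cases "l \<le> m")
      case True
      then show ?thesis using ij(2) by (simp add: a_def lookup_add lookup_minus less_Suc_eq_le)
    next
      case False
      then have "l \<notin> Poly_Mapping.keys (lead_mono (F n))" for n using LM(1)[of n] by auto
      then show ?thesis by (simp add: a_def lookup_add lookup_minus in_keys_iff)
    qed
  qed
  define c where "c = Poly_Mapping.lookup (F j) (lead_mono (F j)) / Poly_Mapping.lookup (F i) (lead_mono (F i))"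
  define F' where "F' = F j - Poly_Mapping.single a c * F i"
  have "Poly_Mapping.keys a \<subseteq> {..m}"
    using LM(1)[of j] a by (auto simp: in_keys_iff lookup_add subset_iff)
  moreover have "mdeg a + d i = d j" using LM(2)[of i] LM(2)[of j] a by (simp add: mdeg_add)
  moreover have "F i \<in> J j (d i)" using F(1)[of i] Jmono[of "Suc i" j "d i"] ij(1) by auto
  ultimately have G: "Poly_Mapping.single a c * F i \<in> J j (d j)"
    using Jmult[OF form_single, of a "mdeg a" "F i" j "d i" c] by simp
  then have "F' \<in> J (Suc j) (d j)"
    unfolding F'_def using Jmono[of j "Suc j" "d j"] F(1)[of j] by (intro Jdiff) auto
  \<comment> \<open>As \<open>i < j\<close>, the form \<open>F i\<close> vanishes on
    \<open>Z j\<close>, so subtracting a multiple of it does not change the values on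
    \<open>Z j\<close>.\<close>
  moreover have "F' \<notin> J j (d j)"
  proof
    assume "F' \<in> J j (d j)"
    moreover have "0 - Poly_Mapping.single a c * F i \<in> J j (d j)" using G J0 Jdiff by blast
    ultimately have "F' - (0 - Poly_Mapping.single a c * F i) \<in> J j (d j)" by (rule Jdiff)
    then show False using F(2)[of j] by (simp add: F'_def)
  qed
  ultimately have "lead_mono (F j) \<le> lead_mono F'" "F' \<noteq> 0" using F(3) J0 by metis+
  with lead_mono_reduce[OF F0[of j] F0[of i] a] show False
    unfolding F'_def c_def by auto
qed

lemma wf_proj_closed: "wf {(A, B). proj_closed m A \<and> proj_closed m B \<and> A \<subset> B}"
  unfolding wf_iff_no_infinite_down_chain using proj_closed_chain by blast

section \<open>Topology of projective curves\<close>

text \<open>The zero sets of the two factors are closed and cover \<open>X\<close>, so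
  irreducibility makes one of them all of \<open>X\<close>.\<close>

lemma irreducible_form_prime:
  assumes "irreducible_closed m X" "form m d F" "form m e G" "\<forall>p\<in>X. vanishes_at (F * G) p"
  shows "(\<forall>p\<in>X. vanishes_at F p) \<or> (\<forall>p\<in>X. vanishes_at G p)"
proof -
  have cl: "proj_closed m X" using assms(1) by (simp add: irreducible_closed_def)
  then have X: "X \<subseteq> proj_space m" by (rule proj_closedD)
  have "X = {p\<in>X. vanishes_at F p} \<union> {p\<in>X. vanishes_at G p}"
    using assms(4) vanishes_at_mult[OF _ assms(2,3)] X by blast
  with assms(1) proj_closed_form_Int[OF cl assms(2)] proj_closed_form_Int[OF cl assms(3)]
  have "X = {p\<in>X. vanishes_at F p} \<or> X = {p\<in>X. vanishes_at G p}"
    unfolding irreducible_closed_def by blast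
  then show ?thesis by blast
qed

lemma proj_curve_closed: "proj_curve m X \<Longrightarrow> proj_closed m X"
  by (simp add: proj_curve_def irreducible_closed_def)

lemma proj_curve_space: "proj_curve m X \<Longrightarrow> X \<subseteq> proj_space m"
  using proj_curve_closed proj_closedD by blast

lemma irreducible_closed_point: "p \<in> proj_space m \<Longrightarrow> irreducible_closed m {p}"
  unfolding irreducible_closed_def
  by (intro conjI allI impI proj_closed_point insert_not_empty) (assumption, blast)

text \<open>All subsets of a finite set of points are closed, so a finite irreducible set is a
  single point, and no nonempty set fits strictly below it in a chain.\<close>

lemma infinite_proj_curve:
  assumes "proj_curve m X"
  shows "infinite X"
proof
  assume fin: "finite X"
  from assms obtain T where T: "irreducible_chain m X 1 T"
    by (auto simp: proj_curve_def has_dimension_def)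
  then have T01: "irreducible_closed m (T 1)" "T 1 \<subseteq> X" "T 0 \<subset> T 1" "irreducible_closed m (T 0)"
    by (auto simp: irreducible_chain_def)
  then obtain p where p: "p \<in> T 0" by (auto simp: irreducible_closed_def)
  have sp: "T 1 \<subseteq> proj_space m" using T01 by (auto simp: irreducible_closed_def dest: proj_closedD)
  have "proj_closed m {p}" "proj_closed m (T 1 - {p})" "T 1 = {p} \<union> (T 1 - {p})"
    using p sp T01 fin by (auto intro!: proj_closed_finite dest: finite_subset)
  with T01(1) have "T 1 = {p} \<or> T 1 = T 1 - {p}" unfolding irreducible_closed_def by blast
  with p T01 show False by auto
qed

text \<open>Here dimension at most one enters. A minimal infinite closed subset is irreducible,
  because one of two closed sets covering it is infinite again; placed between one of its points and
  \<open>X\<close> it gives a chain that is too long.\<close>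

lemma finite_proper_closed:
  assumes X: "proj_curve m X" and Z: "proj_closed m Z" "Z \<subset> X"
  shows "finite Z"
proof (rule ccontr)
  assume inf: "infinite Z"
  let ?Q = "{Y. proj_closed m Y \<and> infinite Y \<and> Y \<subseteq> Z}"
  obtain Y where Y: "Y \<in> ?Q" "\<And>W. (W, Y) \<in> {(A, B). proj_closed m A \<and> proj_closed m B \<and> A \<subset> B} \<Longrightarrow> W \<notin> ?Q"
    using wfE_min[OF wf_proj_closed[of m], of Z ?Q] Z inf by blast
  have irr: "irreducible_closed m Y"
    unfolding irreducible_closed_def
  proof (intro conjI allI impI)
    fix Z1 Z2 assume Z12: "proj_closed m Z1 \<and> proj_closed m Z2 \<and> Y = Z1 \<union> Z2"
    with Y(1) have "infinite Z1 \<or> infinite Z2" by auto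
    with Z12 Y show "Y = Z1 \<or> Y = Z2" by blast
  qed (use Y in auto)
  from Y obtain p where p: "p \<in> Y" by fastforce
  have psp: "p \<in> proj_space m" using p Y Z X proj_curve_space by blast
  have "{p} \<subset> Y" using p Y(1) by (metis (no_types, lifting) finite.emptyI finite_insert insert_subset
        mem_Collect_eq psubsetI empty_subsetI)
  define T where "T = (\<lambda>n::nat. if n = 0 then {p} else if n = 1 then Y else X)"
  have "irreducible_chain m X (Suc 1) T"
    unfolding irreducible_chain_def T_def
    using \<open>{p} \<subset> Y\<close> irr irreducible_closed_point[OF psp] X Y(1) Z p
    by (auto simp: proj_curve_def less_Suc_eq)
  with X show False by (auto simp: proj_curve_def has_dimension_def)
qed

lemma form_vanishes_on_curve:
  assumes "proj_curve m X" "form m d F" "infinite {p \<in> X. vanishes_at F p}"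
  shows "\<forall>p\<in>X. vanishes_at F p"
proof (rule ccontr)
  assume "\<not> ?thesis"
  then have "{p \<in> X. vanishes_at F p} \<subset> X" by auto
  with finite_proper_closed[OF assms(1) proj_closed_form_Int[OF proj_curve_closed[OF assms(1)] assms(2)]] assms(3)
  show False by simp
qed

section \<open>Extending specialisations\<close>

text \<open>A specialisation is a ring homomorphism from a subring of \<open>'b\<close> to \<open>'a\<close>, given by its graph.\<close>

definition spec_graph :: "('b::comm_ring_1 \<times> 'a::comm_ring_1) set \<Rightarrow> bool" where
  "spec_graph \<Gamma> \<longleftrightarrow> (1, 1) \<in> \<Gamma> \<and>
     (\<forall>b c b' c'. (b, c) \<in> \<Gamma> \<longrightarrow> (b', c') \<in> \<Gamma> \<longrightarrow>
        (b + b', c + c') \<in> \<Gamma> \<and> (b - b', c - c') \<in> \<Gamma> \<and> (b * b', c * c') \<in> \<Gamma>) \<and>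
     (\<forall>c. (0, c) \<in> \<Gamma> \<longrightarrow> c = 0)"

lemma spec_graphD:
  assumes "spec_graph \<Gamma>"
  shows "(1, 1) \<in> \<Gamma>" "(0, 0) \<in> \<Gamma>"
    "(b, c) \<in> \<Gamma> \<Longrightarrow> (b', c') \<in> \<Gamma> \<Longrightarrow> (b + b', c + c') \<in> \<Gamma>"
    "(b, c) \<in> \<Gamma> \<Longrightarrow> (b', c') \<in> \<Gamma> \<Longrightarrow> (b - b', c - c') \<in> \<Gamma>"
    "(b, c) \<in> \<Gamma> \<Longrightarrow> (b', c') \<in> \<Gamma> \<Longrightarrow> (b * b', c * c') \<in> \<Gamma>"
    "(0, c) \<in> \<Gamma> \<Longrightarrow> c = 0"
proof -
  show "(0, 0) \<in> \<Gamma>" using assms unfolding spec_graph_def by (metis diff_self)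
qed (use assms in \<open>auto simp: spec_graph_def\<close>)

lemma spec_graph_unique: "spec_graph \<Gamma> \<Longrightarrow> (b, c) \<in> \<Gamma> \<Longrightarrow> (b, c') \<in> \<Gamma> \<Longrightarrow> c = c'"
  using spec_graphD(4)[of \<Gamma> b c b c'] spec_graphD(6)[of \<Gamma> "c - c'"] by simp

lemma spec_graph_sum:
  "spec_graph \<Gamma> \<Longrightarrow> (\<And>i. i \<in> I \<Longrightarrow> (f i, g i) \<in> \<Gamma>) \<Longrightarrow> ((\<Sum>i\<in>I. f i), (\<Sum>i\<in>I. g i)) \<in> \<Gamma>"
  by (induction I rule: infinite_finite_induct) (auto intro: spec_graphD)

lemma spec_graph_prod:
  "spec_graph \<Gamma> \<Longrightarrow> (\<And>i. i \<in> I \<Longrightarrow> (f i, g i) \<in> \<Gamma>) \<Longrightarrow> ((\<Prod>i\<in>I. f i), (\<Prod>i\<in>I. g i)) \<in> \<Gamma>"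
  by (induction I rule: infinite_finite_induct) (auto intro: spec_graphD)

lemma spec_graph_power: "spec_graph \<Gamma> \<Longrightarrow> (b, c) \<in> \<Gamma> \<Longrightarrow> (b ^ n, c ^ n) \<in> \<Gamma>"
  by (induction n) (auto intro: spec_graphD)

lemma spec_graph_subst:
  assumes "spec_graph \<Gamma>" "\<And>c. (h c, c) \<in> \<Gamma>" "\<And>i. i \<le> m \<Longrightarrow> (x i, v i) \<in> \<Gamma>" "form m d F"
  shows "(subst_mpol h F x, subst_mpol id F v) \<in> \<Gamma>"
  unfolding subst_mpol_def
  by (intro spec_graph_sum spec_graphD(5) spec_graph_prod spec_graph_power assms(1))
     (use assms(2,3,4) in \<open>auto simp: form_alt\<close>)

lemma spec_graph_subst_all:
  assumes "spec_graph \<Gamma>" "\<And>c. (h c, c) \<in> \<Gamma>" "\<And>i. (x i, v i) \<in> \<Gamma>"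
  shows "(subst_mpol h F x, subst_mpol id F v) \<in> \<Gamma>"
  unfolding subst_mpol_def
  by (intro spec_graph_sum spec_graphD(5) spec_graph_prod spec_graph_power assms(1))
     (use assms(2,3) in auto)

text \<open>The specialisation applied to coefficients, kept as a relation like the graph
  itself.\<close>

definition coeff_rel :: "('b::comm_ring_1 \<times> 'a::comm_ring_1) set \<Rightarrow> 'b poly \<Rightarrow> 'a poly \<Rightarrow> bool" where
  "coeff_rel \<Gamma> p q \<longleftrightarrow> (\<forall>i. (coeff p i, coeff q i) \<in> \<Gamma>)"

lemma coeff_rel_diff: "spec_graph \<Gamma> \<Longrightarrow> coeff_rel \<Gamma> p q \<Longrightarrow> coeff_rel \<Gamma> p' q' \<Longrightarrow> coeff_rel \<Gamma> (p - p') (q - q')"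
  by (auto simp: coeff_rel_def intro: spec_graphD)

lemma coeff_rel_add: "spec_graph \<Gamma> \<Longrightarrow> coeff_rel \<Gamma> p q \<Longrightarrow> coeff_rel \<Gamma> p' q' \<Longrightarrow> coeff_rel \<Gamma> (p + p') (q + q')"
  by (auto simp: coeff_rel_def intro: spec_graphD)

lemma coeff_rel_mult: "spec_graph \<Gamma> \<Longrightarrow> coeff_rel \<Gamma> p q \<Longrightarrow> coeff_rel \<Gamma> p' q' \<Longrightarrow> coeff_rel \<Gamma> (p * p') (q * q')"
  by (auto simp: coeff_rel_def coeff_mult intro!: spec_graph_sum intro: spec_graphD)

lemma coeff_rel_monom: "spec_graph \<Gamma> \<Longrightarrow> (b, c) \<in> \<Gamma> \<Longrightarrow> coeff_rel \<Gamma> (monom b n) (monom c n)"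
  by (auto simp: coeff_rel_def intro: spec_graphD)

lemma coeff_rel_smult: "spec_graph \<Gamma> \<Longrightarrow> (b, c) \<in> \<Gamma> \<Longrightarrow> coeff_rel \<Gamma> p q \<Longrightarrow> coeff_rel \<Gamma> (smult b p) (smult c q)"
  by (auto simp: coeff_rel_def intro: spec_graphD)

lemma coeff_rel_sum:
  "spec_graph \<Gamma> \<Longrightarrow> (\<And>i. i \<in> I \<Longrightarrow> coeff_rel \<Gamma> (f i) (g i)) \<Longrightarrow> coeff_rel \<Gamma> (\<Sum>i\<in>I. f i) (\<Sum>i\<in>I. g i)"
  by (auto simp: coeff_rel_def coeff_sum intro!: spec_graph_sum)

lemma coeff_rel_unique: "spec_graph \<Gamma> \<Longrightarrow> coeff_rel \<Gamma> p q \<Longrightarrow> coeff_rel \<Gamma> p q' \<Longrightarrow> q = q'"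
  by (rule poly_eqI) (auto simp: coeff_rel_def intro: spec_graph_unique)

lemma coeff_rel_exists:
  assumes "spec_graph \<Gamma>" "\<And>i. coeff p i \<in> Domain \<Gamma>"
  shows "\<exists>q. coeff_rel \<Gamma> p q"
proof -
  have "\<exists>c. (coeff p i, c) \<in> \<Gamma>" for i using assms(2)[of i] by auto
  then obtain c where c: "(coeff p i, c i) \<in> \<Gamma>" for i by metis
  have "coeff_rel \<Gamma> (\<Sum>i\<le>Polynomial.degree p. monom (coeff p i) i) (\<Sum>i\<le>Polynomial.degree p. monom (c i) i)"
    using assms(1) c by (intro coeff_rel_sum coeff_rel_monom)
  then show ?thesis by (auto simp: poly_as_sum_of_monoms)
qed

text \<open>The relation forced by sending \<open>x\<close> to \<open>c\<close>. It is single valued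
  only if every relation satisfied by \<open>x\<close> specialises to one satisfied by
  \<open>c\<close>; this is the hypothesis of \<open>spec_graph_extend\<close>.\<close>

definition spec_extend :: "('b::comm_ring_1 \<times> 'a::comm_ring_1) set \<Rightarrow> 'b \<Rightarrow> 'a \<Rightarrow> ('b \<times> 'a) set" where
  "spec_extend \<Gamma> x c = {(poly p x, poly q c) | p q. coeff_rel \<Gamma> p q}"

lemma spec_extend_superset: "spec_graph \<Gamma> \<Longrightarrow> \<Gamma> \<subseteq> spec_extend \<Gamma> x c"
proof
  fix y assume \<Gamma>: "spec_graph \<Gamma>" and "y \<in> \<Gamma>"
  then have "coeff_rel \<Gamma> (monom (fst y) 0) (monom (snd y) 0)" by (intro coeff_rel_monom) auto
  moreover have "y = (poly (monom (fst y) 0) x, poly (monom (snd y) 0) c)" by (simp add: poly_monom)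
  ultimately show "y \<in> spec_extend \<Gamma> x c" unfolding spec_extend_def by blast
qed

lemma spec_extend_new: "spec_graph \<Gamma> \<Longrightarrow> (x, c) \<in> spec_extend \<Gamma> x c"
  using coeff_rel_monom[OF _ spec_graphD(1), of \<Gamma> 1] unfolding spec_extend_def
  by (auto intro!: exI[of _ "monom 1 1"] simp: poly_monom)

lemma spec_graph_extend:
  assumes \<Gamma>: "spec_graph \<Gamma>"
    and zero: "\<And>p q. coeff_rel \<Gamma> p q \<Longrightarrow> poly p x = 0 \<Longrightarrow> poly q c = 0"
  shows "spec_graph (spec_extend \<Gamma> x c)"
  unfolding spec_graph_def
proof (intro conjI allI impI)
  show "(1, 1) \<in> spec_extend \<Gamma> x c" using spec_extend_superset[OF \<Gamma>] spec_graphD(1)[OF \<Gamma>] by blast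
  show "e = 0" if "(0, e) \<in> spec_extend \<Gamma> x c" for e
    using that zero by (auto simp: spec_extend_def)
next
  fix b e b' e' assume "(b, e) \<in> spec_extend \<Gamma> x c" "(b', e') \<in> spec_extend \<Gamma> x c"
  then obtain p q p' q' where pq: "coeff_rel \<Gamma> p q" "coeff_rel \<Gamma> p' q'"
    "b = poly p x" "e = poly q c" "b' = poly p' x" "e' = poly q' c"
    by (auto simp: spec_extend_def)
  show "(b + b', e + e') \<in> spec_extend \<Gamma> x c"
    using coeff_rel_add[OF \<Gamma> pq(1,2)] pq unfolding spec_extend_def
    by (intro CollectI exI[of _ "p + p'"] exI[of _ "q + q'"]) simp
  show "(b - b', e - e') \<in> spec_extend \<Gamma> x c"
    using coeff_rel_diff[OF \<Gamma> pq(1,2)] pq unfolding spec_extend_def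
    by (intro CollectI exI[of _ "p - p'"] exI[of _ "q - q'"]) simp
  show "(b * b', e * e') \<in> spec_extend \<Gamma> x c"
    using coeff_rel_mult[OF \<Gamma> pq(1,2)] pq unfolding spec_extend_def
    by (intro CollectI exI[of _ "p * p'"] exI[of _ "q * q'"]) simp
qed

section \<open>Subrings, adjunction of elements and extension of specialisations\<close>

definition sub_ring :: "'b::comm_ring_1 set \<Rightarrow> bool" where
  "sub_ring R \<longleftrightarrow> 1 \<in> R \<and> (\<forall>a\<in>R. \<forall>b\<in>R. a + b \<in> R \<and> a - b \<in> R \<and> a * b \<in> R)"

lemma sub_ringD:
  assumes "sub_ring R"
  shows "1 \<in> R" "0 \<in> R" "a \<in> R \<Longrightarrow> b \<in> R \<Longrightarrow> a + b \<in> R" "a \<in> R \<Longrightarrow> b \<in> R \<Longrightarrow> a - b \<in> R"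
    "a \<in> R \<Longrightarrow> b \<in> R \<Longrightarrow> a * b \<in> R"
proof -
  show "0 \<in> R" using assms unfolding sub_ring_def by (metis diff_self)
qed (use assms in \<open>auto simp: sub_ring_def\<close>)

lemma sub_ring_sum: "sub_ring R \<Longrightarrow> (\<And>i. i \<in> I \<Longrightarrow> f i \<in> R) \<Longrightarrow> (\<Sum>i\<in>I. f i) \<in> R"
  by (induction I rule: infinite_finite_induct) (auto intro: sub_ringD)

lemma sub_ring_power: "sub_ring R \<Longrightarrow> a \<in> R \<Longrightarrow> a ^ n \<in> R"
  by (induction n) (auto intro: sub_ringD)

lemma sub_ring_Domain: "spec_graph \<Gamma> \<Longrightarrow> sub_ring (Domain \<Gamma>)"
  unfolding sub_ring_def by (auto intro: spec_graphD)

definition poly_over :: "'b::comm_ring_1 set \<Rightarrow> 'b poly set" where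
  "poly_over R = {p. \<forall>i. coeff p i \<in> R}"

lemma poly_over_ops:
  assumes "sub_ring R"
  shows "p \<in> poly_over R \<Longrightarrow> q \<in> poly_over R \<Longrightarrow> p + q \<in> poly_over R"
    "p \<in> poly_over R \<Longrightarrow> q \<in> poly_over R \<Longrightarrow> p - q \<in> poly_over R"
    "p \<in> poly_over R \<Longrightarrow> q \<in> poly_over R \<Longrightarrow> p * q \<in> poly_over R"
    "a \<in> R \<Longrightarrow> monom a n \<in> poly_over R"
    "a \<in> R \<Longrightarrow> p \<in> poly_over R \<Longrightarrow> smult a p \<in> poly_over R"
    "0 \<in> poly_over R"
  using assms by (auto simp: poly_over_def coeff_mult intro!: sub_ring_sum intro: sub_ringD)

definition adjoin :: "'b::comm_ring_1 set \<Rightarrow> 'b \<Rightarrow> 'b set" where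
  "adjoin R x = {poly p x | p. p \<in> poly_over R}"

lemma sub_ring_adjoin:
  assumes "sub_ring R"
  shows "sub_ring (adjoin R x)"
  unfolding sub_ring_def
proof (intro conjI ballI)
  show "1 \<in> adjoin R x"
    unfolding adjoin_def using poly_over_ops(4)[OF assms sub_ringD(1)[OF assms], of 0]
    by (intro CollectI exI[of _ "monom 1 0"]) (simp add: poly_monom)
next
  fix a b assume "a \<in> adjoin R x" "b \<in> adjoin R x"
  then obtain p q where pq: "p \<in> poly_over R" "q \<in> poly_over R" "a = poly p x" "b = poly q x"
    by (auto simp: adjoin_def)
  show "a + b \<in> adjoin R x" "a - b \<in> adjoin R x" "a * b \<in> adjoin R x"
    using poly_over_ops(1-3)[OF assms pq(1,2)] pq(3,4) unfolding adjoin_def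
    by (intro CollectI exI[of _ "p + q"] exI[of _ "p - q"] exI[of _ "p * q"]; simp)+
qed

lemma adjoin_superset: "sub_ring R \<Longrightarrow> R \<subseteq> adjoin R x"
  unfolding adjoin_def using poly_over_ops(4)[of R _ 0]
  by (intro subsetI CollectI, rule_tac x = "monom xa 0" in exI) (simp add: poly_monom)

lemma adjoin_new: "sub_ring R \<Longrightarrow> x \<in> adjoin R x"
  unfolding adjoin_def using poly_over_ops(4)[OF _ sub_ringD(1), of R 1]
  by (intro CollectI, rule_tac x = "monom 1 1" in exI) (simp add: poly_monom)

lemma Domain_spec_extend: "spec_graph \<Gamma> \<Longrightarrow> Domain (spec_extend \<Gamma> x c) = adjoin (Domain \<Gamma>) x"
proof (intro set_eqI iffI)
  fix b assume "b \<in> Domain (spec_extend \<Gamma> x c)"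
  then show "b \<in> adjoin (Domain \<Gamma>) x"
    by (auto simp: spec_extend_def adjoin_def poly_over_def coeff_rel_def Domain_iff)
next
  fix b assume \<Gamma>: "spec_graph \<Gamma>" and "b \<in> adjoin (Domain \<Gamma>) x"
  then obtain p where p: "b = poly p x" "\<forall>i. coeff p i \<in> Domain \<Gamma>" by (auto simp: adjoin_def poly_over_def)
  obtain q where "coeff_rel \<Gamma> p q" using coeff_rel_exists[OF \<Gamma>] p(2) by blast
  with p(1) show "b \<in> Domain (spec_extend \<Gamma> x c)" by (auto simp: spec_extend_def)
qed

text \<open>The leading coefficient of \<open>p0\<close> need not be invertible in \<open>R\<close>,
  so every division step multiplies by it instead; this is the origin of the power
  \<open>N\<close>.\<close>

lemma pseudo_division:
  fixes p0 :: "'b::idom poly"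
  assumes R: "sub_ring R" and p0: "p0 \<in> poly_over R" "p0 \<noteq> 0" and p: "p \<in> poly_over R"
  shows "\<exists>N s r. s \<in> poly_over R \<and> r \<in> poly_over R \<and> smult (lead_coeff p0 ^ N) p = s * p0 + r \<and>
    (r = 0 \<or> Polynomial.degree r < Polynomial.degree p0)"
  using p
proof (induction "Polynomial.degree p" arbitrary: p rule: less_induct)
  case less
  let ?l = "lead_coeff p0" and ?n = "Polynomial.degree p" and ?k = "Polynomial.degree p0"
  have lR: "?l \<in> R" using p0 by (auto simp: poly_over_def)
  show ?case
  proof (cases "p = 0 \<or> ?n < ?k")
    case True
    with less.prems show ?thesis
      by (intro exI[of _ 0] exI[of _ 0] exI[of _ p]) (auto simp: poly_over_ops(6)[OF R])
  next
    case False
    define t where "t = monom (lead_coeff p) (?n - ?k)"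
    define p' where "p' = smult ?l p - t * p0"
    have t: "t \<in> poly_over R" unfolding t_def using less.prems by (intro poly_over_ops[OF R]) (auto simp: poly_over_def)
    have p': "p' \<in> poly_over R" unfolding p'_def by (intro poly_over_ops[OF R] lR less.prems t p0)
    have deg1: "Polynomial.degree p' \<le> ?n"
      unfolding p'_def
    proof (rule degree_diff_le)
      show "Polynomial.degree (t * p0) \<le> ?n"
        using degree_mult_le[of t p0] degree_monom_le[of "lead_coeff p" "?n - ?k"] False
        unfolding t_def by linarith
    qed simp
    have "coeff (t * p0) ?n = lead_coeff p * ?l"
      using False by (simp add: t_def coeff_monom_mult)
    then have c0: "coeff p' ?n = 0" by (simp add: p'_def)
    show ?thesis
    proof (cases "p' = 0")
      case True
      then have "smult (?l ^ 1) p = t * p0 + 0" by (simp add: p'_def)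
      then show ?thesis using t poly_over_ops(6)[OF R] by blast
    next
      case nz: False
      with c0 have "Polynomial.degree p' \<noteq> ?n" by (metis leading_coeff_0_iff)
      with deg1 have "Polynomial.degree p' < ?n" by simp
      from less.hyps[OF this p'] obtain N s r where sr: "s \<in> poly_over R" "r \<in> poly_over R"
        "smult (?l ^ N) p' = s * p0 + r" "r = 0 \<or> Polynomial.degree r < ?k" by blast
      have "smult (?l ^ Suc N) p = smult (?l ^ N) (p' + t * p0)"
        by (simp add: p'_def smult_add_right mult.commute)
      also have "\<dots> = (s + smult (?l ^ N) t) * p0 + r"
        using sr(3) by (simp add: smult_add_right algebra_simps)
      finally have "smult (?l ^ Suc N) p = (s + smult (?l ^ N) t) * p0 + r" .
      moreover have "s + smult (?l ^ N) t \<in> poly_over R"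
        by (intro poly_over_ops[OF R] sr t sub_ring_power[OF R] lR)
      ultimately show ?thesis using sr(2,4) by blast
    qed
  qed
qed

text \<open>The condition that \<open>b\<close> stays nonzero is pulled back to a condition on one
  element \<open>a\<close> of \<open>R\<close>. If \<open>x\<close> is transcendental over
  \<open>R\<close>, then \<open>a\<close> is the leading coefficient of a polynomial expressing
  \<open>b\<close>, and any \<open>c\<close> off the roots of the specialised polynomial works. If
  \<open>x\<close> is algebraic, then \<open>a\<close> is the leading coefficient of a relation
  \<open>p0\<close> of least degree times a nonzero multiple of \<open>b\<close> in
  \<open>R\<close>, and \<open>c\<close> is a root of the specialised \<open>p0\<close>.\<close>

lemma specialisation_extend:
  fixes R :: "'b::idom set"
  assumes R: "sub_ring R" and b: "b \<in> adjoin R x" "b \<noteq> 0"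
  shows "\<exists>a\<in>R. a \<noteq> 0 \<and> (\<forall>\<Gamma> :: ('b \<times> 'a::{alg_closed_field,field_char_0}) set.
    spec_graph \<Gamma> \<longrightarrow> Domain \<Gamma> = R \<longrightarrow> (\<forall>c. (a, c) \<in> \<Gamma> \<longrightarrow> c \<noteq> 0) \<longrightarrow>
    (\<exists>c. spec_graph (spec_extend \<Gamma> x c) \<and> (\<forall>e. (b, e) \<in> spec_extend \<Gamma> x c \<longrightarrow> e \<noteq> 0)))"
proof (cases "\<forall>p\<in>poly_over R. poly p x = 0 \<longrightarrow> p = 0")
  case True
  from b(1) obtain p where p: "p \<in> poly_over R" "b = poly p x" by (auto simp: adjoin_def)
  with b(2) have "p \<noteq> 0" by auto
  note p = p this
  have "\<exists>c. spec_graph (spec_extend \<Gamma> x c) \<and> (\<forall>e. (b, e) \<in> spec_extend \<Gamma> x c \<longrightarrow> e \<noteq> 0)"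
    if \<Gamma>: "spec_graph \<Gamma>" "Domain \<Gamma> = R" and nz: "\<And>c. (lead_coeff p, c) \<in> \<Gamma> \<Longrightarrow> c \<noteq> 0"
    for \<Gamma> :: "('b \<times> 'a) set"
  proof -
    obtain q where q: "coeff_rel \<Gamma> p q"
      using coeff_rel_exists[OF \<Gamma>(1), of p] p(1) \<Gamma>(2) by (auto simp: poly_over_def)
    with nz have "q \<noteq> 0" unfolding coeff_rel_def by (metis coeff_0)
    then have "finite {c. poly q c = 0}" by (rule poly_roots_finite)
    then have "\<exists>c. poly q c \<noteq> 0"
      using infinite_UNIV_char_0[where ?'a = 'a] by (metis (mono_tags) UNIV_I finite_subset mem_Collect_eq subsetI)
    then obtain c where c: "poly q c \<noteq> 0" by auto
    have sp: "spec_graph (spec_extend \<Gamma> x c)"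
    proof (rule spec_graph_extend[OF \<Gamma>(1)])
      fix p' q' assume pq: "coeff_rel \<Gamma> p' q'" "poly p' x = 0"
      then have "p' \<in> poly_over R" using \<Gamma>(2) by (auto simp: poly_over_def coeff_rel_def)
      with True pq have "p' = 0" by auto
      with pq(1) have "q' = 0" by (intro poly_eqI) (auto simp: coeff_rel_def intro: spec_graphD(6)[OF \<Gamma>(1)])
      then show "poly q' c = 0" by simp
    qed
    moreover have "(b, poly q c) \<in> spec_extend \<Gamma> x c" using q p(2) by (auto simp: spec_extend_def)
    ultimately have "\<forall>e. (b, e) \<in> spec_extend \<Gamma> x c \<longrightarrow> e \<noteq> 0" using c spec_graph_unique by metis
    with sp show ?thesis by blast
  qed
  moreover have "lead_coeff p \<in> R" "lead_coeff p \<noteq> 0" using p by (auto simp: poly_over_def)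
  ultimately show ?thesis by blast
next
  case False
  define P where "P = (\<lambda>p. p \<in> poly_over R \<and> poly p x = 0 \<and> p \<noteq> 0)"
  from False have "\<exists>p. P p" by (auto simp: P_def)
  define p0 where "p0 = (ARG_MIN Polynomial.degree p. P p)"
  have p0: "P p0" and p0_min: "\<And>p. P p \<Longrightarrow> Polynomial.degree p0 \<le> Polynomial.degree p"
    using \<open>\<exists>p. P p\<close> unfolding p0_def by (auto intro: arg_min_natI arg_min_nat_le)
  let ?l = "lead_coeff p0" and ?k = "Polynomial.degree p0"
  have lR: "?l \<in> R" "?l \<noteq> 0" using p0 by (auto simp: P_def poly_over_def)
  have small: "p = 0" if "p \<in> poly_over R" "poly p x = 0" "p = 0 \<or> Polynomial.degree p < ?k" for p
    using p0_min[of p] that by (cases "p = 0") (auto simp: P_def)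
  have k: "?k > 0"
  proof (rule ccontr)
    assume "\<not> ?k > 0"
    then obtain a where "p0 = [:a:]" by (metis degree_eq_zeroE gr0I)
    with p0 show False by (auto simp: P_def)
  qed
  \<comment> \<open>\<open>Q q\<close> says that \<open>q\<close> expresses a nonzero multiple of
    \<open>b\<close> in \<open>R[x]\<close>. A representative of degree zero is wanted, that is, a
    multiple lying in \<open>R\<close>.\<close>
  define Q where "Q = (\<lambda>q. q \<in> poly_over R \<and> poly q x \<noteq> 0 \<and> (\<exists>t\<in>adjoin R x. poly q x = b * t))"
  from b obtain p where p: "p \<in> poly_over R" "b = poly p x" by (auto simp: adjoin_def)
  obtain N s r where sr: "s \<in> poly_over R" "r \<in> poly_over R" "smult (?l ^ N) p = s * p0 + r"
    "r = 0 \<or> Polynomial.degree r < ?k"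
    using pseudo_division[OF R, of p0 p] p0 p(1) by (auto simp: P_def)
  have rx: "poly r x = b * ?l ^ N"
    using arg_cong[OF sr(3), of "\<lambda>p. poly p x"] p0 p(2) by (simp add: P_def mult.commute)
  have Qr: "Q r"
    unfolding Q_def using sr(2) rx b(2) lR adjoin_superset[OF R, of x] sub_ring_power[OF R lR(1), of N] by auto
  define q0 where "q0 = (ARG_MIN Polynomial.degree q. Q q)"
  have q0: "Q q0" and q0_min: "\<And>q. Q q \<Longrightarrow> Polynomial.degree q0 \<le> Polynomial.degree q"
    using Qr unfolding q0_def by (auto intro: arg_min_natI arg_min_nat_le)
  have q0nz: "q0 \<noteq> 0" using q0 by (auto simp: Q_def)
  have "r \<noteq> 0" using Qr by (auto simp: Q_def)
  then have degq0: "Polynomial.degree q0 < ?k" using q0_min[OF Qr] sr(4) by auto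
  \<comment> \<open>Divide \<open>p0\<close> by \<open>q0\<close>. A remainder with nonzero value at
    \<open>x\<close> would satisfy \<open>Q\<close> in smaller degree; a remainder with value zero
    vanishes by minimality of \<open>p0\<close>, and then the quotient is a relation of degree below
    that of \<open>p0\<close>.\<close>
  have "Polynomial.degree q0 = 0"
  proof (rule ccontr)
    assume pos: "Polynomial.degree q0 \<noteq> 0"
    obtain N' s' r' where sr': "s' \<in> poly_over R" "r' \<in> poly_over R"
      "smult (lead_coeff q0 ^ N') p0 = s' * q0 + r'" "r' = 0 \<or> Polynomial.degree r' < Polynomial.degree q0"
      using pseudo_division[OF R, of q0 p0] q0 p0 q0nz by (auto simp: P_def Q_def)
    have x0: "poly s' x * poly q0 x + poly r' x = 0"
      using arg_cong[OF sr'(3), of "\<lambda>p. poly p x"] p0 by (simp add: P_def)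
    have r'x: "poly r' x = 0"
    proof (rule ccontr)
      assume nz: "poly r' x \<noteq> 0"
      obtain t where t: "t \<in> adjoin R x" "poly q0 x = b * t" using q0 by (auto simp: Q_def)
      have "poly s' x \<in> adjoin R x" using sr'(1) by (auto simp: adjoin_def)
      then have "0 - poly s' x * t \<in> adjoin R x"
        by (intro sub_ringD(4,5)[OF sub_ring_adjoin[OF R]] sub_ringD(2)[OF sub_ring_adjoin[OF R]] t(1))
      moreover have "poly r' x = b * (0 - poly s' x * t)" using x0 t(2) by (simp add: algebra_simps add_eq_0_iff)
      ultimately have "Q r'" using sr'(2) nz unfolding Q_def by blast
      moreover have "r' \<noteq> 0" using nz by auto
      ultimately show False using q0_min[of r'] sr'(4) by auto
    qed
    then have "r' = 0" using small[OF sr'(2)] sr'(4) degq0 by auto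
    then have eq: "smult (lead_coeff q0 ^ N') p0 = s' * q0" using sr'(3) by simp
    have s'x: "poly s' x = 0" using x0 r'x q0 by (auto simp: Q_def)
    have lhs: "smult (lead_coeff q0 ^ N') p0 \<noteq> 0" using q0nz p0 by (auto simp: P_def)
    then have "s' \<noteq> 0" using eq by auto
    then have "Polynomial.degree s' + Polynomial.degree q0 = ?k"
      using arg_cong[OF eq, of Polynomial.degree] q0nz by (simp add: degree_mult_eq)
    then have "s' = 0" using small[OF sr'(1) s'x] pos by auto
    with \<open>s' \<noteq> 0\<close> show False by simp
  qed
  then obtain r0 where r0': "q0 = [:r0:]" by (metis degree_eq_zeroE)
  obtain t where t: "t \<in> adjoin R x" "r0 = b * t" using q0 r0' by (auto simp: Q_def)
  have r0: "r0 \<in> R" "r0 \<noteq> 0" using q0 r0' by (auto simp: Q_def poly_over_def dest: spec[of _ 0])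
  have "\<exists>c. spec_graph (spec_extend \<Gamma> x c) \<and> (\<forall>e. (b, e) \<in> spec_extend \<Gamma> x c \<longrightarrow> e \<noteq> 0)"
    if \<Gamma>: "spec_graph \<Gamma>" "Domain \<Gamma> = R" and nz: "\<And>c. (?l * r0, c) \<in> \<Gamma> \<Longrightarrow> c \<noteq> 0"
    for \<Gamma> :: "('b \<times> 'a) set"
  proof -
    obtain q where q: "coeff_rel \<Gamma> p0 q"
      using coeff_rel_exists[OF \<Gamma>(1), of p0] p0 \<Gamma>(2) by (auto simp: P_def poly_over_def)
    obtain \<rho> where \<rho>: "(r0, \<rho>) \<in> \<Gamma>" using r0(1) \<Gamma>(2) by auto
    have \<lambda>: "(?l, coeff q ?k) \<in> \<Gamma>" using q by (simp add: coeff_rel_def)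
    have "coeff q ?k * \<rho> \<noteq> 0" using nz spec_graphD(5)[OF \<Gamma>(1) \<lambda> \<rho>] by blast
    then have nz': "coeff q ?k \<noteq> 0" "\<rho> \<noteq> 0" by auto
    \<comment> \<open>The leading coefficient specialises to a nonzero value, so the degree does not
      drop and a root exists in the algebraically closed field.\<close>
    have "?k \<le> Polynomial.degree q" using nz'(1) by (rule le_degree)
    then obtain c where c: "poly q c = 0" using alg_closed_imp_poly_has_root[of q] k by auto
    have sp: "spec_graph (spec_extend \<Gamma> x c)"
    proof (rule spec_graph_extend[OF \<Gamma>(1)])
      fix p' q' assume pq: "coeff_rel \<Gamma> p' q'" "poly p' x = 0"
      then have p'R: "p' \<in> poly_over R" using \<Gamma>(2) by (auto simp: poly_over_def coeff_rel_def)
      obtain N s r where sr: "s \<in> poly_over R" "r \<in> poly_over R" "smult (?l ^ N) p' = s * p0 + r"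
        "r = 0 \<or> Polynomial.degree r < ?k"
        using pseudo_division[OF R, of p0 p'] p0 p'R by (auto simp: P_def)
      have "poly r x = 0" using arg_cong[OF sr(3), of "\<lambda>p. poly p x"] p0 pq(2) by (simp add: P_def)
      then have "r = 0" using small sr by auto
      with sr have eq: "smult (?l ^ N) p' = s * p0" by simp
      obtain \<sigma> where \<sigma>: "coeff_rel \<Gamma> s \<sigma>"
        using coeff_rel_exists[OF \<Gamma>(1), of s] sr(1) \<Gamma>(2) by (auto simp: poly_over_def)
      have "coeff_rel \<Gamma> (s * p0) (\<sigma> * q)" by (rule coeff_rel_mult[OF \<Gamma>(1) \<sigma> q])
      moreover have "coeff_rel \<Gamma> (smult (?l ^ N) p') (smult (coeff q ?k ^ N) q')"
        by (rule coeff_rel_smult[OF \<Gamma>(1) spec_graph_power[OF \<Gamma>(1) \<lambda>] pq(1)])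
      ultimately have "smult (coeff q ?k ^ N) q' = \<sigma> * q" using eq coeff_rel_unique[OF \<Gamma>(1)] by metis
      then have "coeff q ?k ^ N * poly q' c = 0" using c by (metis poly_mult poly_smult mult_zero_right)
      then show "poly q' c = 0" using nz' by simp
    qed
    \<comment> \<open>\<open>b\<close> divides \<open>r0\<close> in \<open>R[x]\<close>, and the
      value of \<open>r0\<close> is nonzero by the choice of \<open>a\<close>.\<close>
    have "e \<noteq> 0" if e: "(b, e) \<in> spec_extend \<Gamma> x c" for e
    proof
      assume "e = 0"
      obtain \<tau> where "(t, \<tau>) \<in> spec_extend \<Gamma> x c"
        using t(1) Domain_spec_extend[OF \<Gamma>(1), of x c] \<Gamma>(2) by auto
      from spec_graphD(5)[OF sp e this] have "(r0, 0) \<in> spec_extend \<Gamma> x c" using t(2) \<open>e = 0\<close> by simp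
      moreover have "(r0, \<rho>) \<in> spec_extend \<Gamma> x c" using \<rho> spec_extend_superset[OF \<Gamma>(1)] by blast
      ultimately show False using spec_graph_unique[OF sp] nz'(2) by blast
    qed
    with sp show ?thesis by blast
  qed
  moreover have "?l * r0 \<in> R" "?l * r0 \<noteq> 0" using lR r0 sub_ringD(5)[OF R] by auto
  ultimately show ?thesis by blast
qed

primrec adjoin_list :: "'b::comm_ring_1 set \<Rightarrow> (nat \<Rightarrow> 'b) \<Rightarrow> nat \<Rightarrow> 'b set" where
  "adjoin_list R x 0 = R"
| "adjoin_list R x (Suc n) = adjoin (adjoin_list R x n) (x n)"

lemma sub_ring_adjoin_list: "sub_ring R \<Longrightarrow> sub_ring (adjoin_list R x n)"
  by (induction n) (auto intro: sub_ring_adjoin)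

lemma adjoin_list_mono:
  assumes "sub_ring R" "n \<le> k"
  shows "adjoin_list R x n \<subseteq> adjoin_list R x k"
  using assms(2)
proof (induction k rule: dec_induct)
  case (step k)
  then show ?case using adjoin_superset[OF sub_ring_adjoin_list[OF assms(1), of x k], of "x k"] by auto
qed simp

lemma adjoin_list_gen: "sub_ring R \<Longrightarrow> i < n \<Longrightarrow> x i \<in> adjoin_list R x n"
  using adjoin_list_mono[of R "Suc i" n x] adjoin_new[OF sub_ring_adjoin_list[of R x i], of "x i"] by auto

text \<open>The last generator is handled first: nonvanishing of \<open>b\<close> becomes a
  condition on an element of the ring generated by the others, and so on down to \<open>R\<close>.
  The element \<open>a\<close> is chosen before the specialisation, so one \<open>a\<close> serves
  infinitely many specialisations of \<open>R\<close>.\<close>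

theorem specialisation_extend_list:
  fixes R :: "'b::idom set"
  assumes R: "sub_ring R" and b: "b \<in> adjoin_list R x n" "b \<noteq> 0"
  shows "\<exists>a\<in>R. a \<noteq> 0 \<and> (\<forall>\<Gamma> :: ('b \<times> 'a::{alg_closed_field,field_char_0}) set.
    spec_graph \<Gamma> \<longrightarrow> Domain \<Gamma> = R \<longrightarrow> (\<forall>c. (a, c) \<in> \<Gamma> \<longrightarrow> c \<noteq> 0) \<longrightarrow>
    (\<exists>\<Gamma>'. spec_graph \<Gamma>' \<and> \<Gamma> \<subseteq> \<Gamma>' \<and> Domain \<Gamma>' = adjoin_list R x n \<and> (\<forall>e. (b, e) \<in> \<Gamma>' \<longrightarrow> e \<noteq> 0)))"
  using b
proof (induction n arbitrary: b)
  case 0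
  then show ?case by auto
next
  case (Suc n)
  have "b \<in> adjoin (adjoin_list R x n) (x n)" using Suc.prems by simp
  from specialisation_extend[OF sub_ring_adjoin_list[OF R] this Suc.prems(2), where ?'a = 'a]
  obtain a where a: "a \<in> adjoin_list R x n" "a \<noteq> 0"
    and a': "\<forall>\<Gamma> :: ('b \<times> 'a) set. spec_graph \<Gamma> \<longrightarrow> Domain \<Gamma> = adjoin_list R x n \<longrightarrow>
      (\<forall>c. (a, c) \<in> \<Gamma> \<longrightarrow> c \<noteq> 0) \<longrightarrow> (\<exists>c. spec_graph (spec_extend \<Gamma> (x n) c) \<and>
        (\<forall>e. (b, e) \<in> spec_extend \<Gamma> (x n) c \<longrightarrow> e \<noteq> 0))"
    by (elim bexE conjE) (rule that)
  from Suc.IH[OF a] obtain a0 where a0: "a0 \<in> R" "a0 \<noteq> 0"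
    and a0': "\<forall>\<Gamma> :: ('b \<times> 'a) set. spec_graph \<Gamma> \<longrightarrow> Domain \<Gamma> = R \<longrightarrow> (\<forall>c. (a0, c) \<in> \<Gamma> \<longrightarrow> c \<noteq> 0) \<longrightarrow>
      (\<exists>\<Gamma>'. spec_graph \<Gamma>' \<and> \<Gamma> \<subseteq> \<Gamma>' \<and> Domain \<Gamma>' = adjoin_list R x n \<and> (\<forall>e. (a, e) \<in> \<Gamma>' \<longrightarrow> e \<noteq> 0))"
    by (elim bexE conjE) (rule that)
  show ?case
  proof (intro bexI[of _ a0] conjI a0 allI impI)
    fix \<Gamma> :: "('b \<times> 'a) set"
    assume "spec_graph \<Gamma>" "Domain \<Gamma> = R" "\<forall>c. (a0, c) \<in> \<Gamma> \<longrightarrow> c \<noteq> 0"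
    with a0'[rule_format, of \<Gamma>] obtain \<Gamma>1 where \<Gamma>1: "spec_graph \<Gamma>1" "\<Gamma> \<subseteq> \<Gamma>1" "Domain \<Gamma>1 = adjoin_list R x n"
      "\<forall>e. (a, e) \<in> \<Gamma>1 \<longrightarrow> e \<noteq> 0" by blast
    with a'[rule_format, of \<Gamma>1] obtain c where c: "spec_graph (spec_extend \<Gamma>1 (x n) c)"
      "\<forall>e. (b, e) \<in> spec_extend \<Gamma>1 (x n) c \<longrightarrow> e \<noteq> 0" by blast
    moreover have "Domain (spec_extend \<Gamma>1 (x n) c) = adjoin_list R x (Suc n)"
      using Domain_spec_extend[OF \<Gamma>1(1)] \<Gamma>1(3) by simp
    moreover have "\<Gamma> \<subseteq> spec_extend \<Gamma>1 (x n) c" using \<Gamma>1(2) spec_extend_superset[OF \<Gamma>1(1)] by blast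
    ultimately show "\<exists>\<Gamma>'. spec_graph \<Gamma>' \<and> \<Gamma> \<subseteq> \<Gamma>' \<and> Domain \<Gamma>' = adjoin_list R x (Suc n) \<and>
      (\<forall>e. (b, e) \<in> \<Gamma>' \<longrightarrow> e \<noteq> 0)" by blast
  qed
qed

section \<open>Maximal specialisations of a field\<close>

lemma spec_graph_Union_chain:
  assumes "chain\<^sub>\<subseteq> \<C>" "\<C> \<noteq> {}" "\<And>\<Gamma>. \<Gamma> \<in> \<C> \<Longrightarrow> spec_graph \<Gamma>"
  shows "spec_graph (\<Union>\<C>)"
  unfolding spec_graph_def
proof (intro conjI allI impI)
  show "(1, 1) \<in> \<Union>\<C>" using assms(2,3) by (auto dest: spec_graphD(1))
  show "c = 0" if "(0, c) \<in> \<Union>\<C>" for c using that assms(3) by (auto dest: spec_graphD(6))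
next
  fix b c b' c' assume "(b, c) \<in> \<Union>\<C>" "(b', c') \<in> \<Union>\<C>"
  then obtain \<Gamma>1 \<Gamma>2 where "\<Gamma>1 \<in> \<C>" "\<Gamma>2 \<in> \<C>" "(b, c) \<in> \<Gamma>1" "(b', c') \<in> \<Gamma>2" by auto
  moreover from this(1,2) assms(1) have "\<Gamma>1 \<subseteq> \<Gamma>2 \<or> \<Gamma>2 \<subseteq> \<Gamma>1" by (auto simp: chain_subset_def)
  ultimately obtain \<Gamma> where \<Gamma>: "\<Gamma> \<in> \<C>" "(b, c) \<in> \<Gamma>" "(b', c') \<in> \<Gamma>" by blast
  note sp = spec_graphD[OF assms(3)[OF \<Gamma>(1)]]
  show "(b + b', c + c') \<in> \<Union>\<C>" using sp(3)[OF \<Gamma>(2,3)] \<Gamma>(1) by blast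
  show "(b - b', c - c') \<in> \<Union>\<C>" using sp(4)[OF \<Gamma>(2,3)] \<Gamma>(1) by blast
  show "(b * b', c * c') \<in> \<Union>\<C>" using sp(5)[OF \<Gamma>(2,3)] \<Gamma>(1) by blast
qed

lemma maximal_spec_graph:
  assumes "spec_graph \<Gamma>0"
  shows "\<exists>\<Gamma>. spec_graph \<Gamma> \<and> \<Gamma>0 \<subseteq> \<Gamma> \<and> (\<forall>\<Gamma>'. spec_graph \<Gamma>' \<longrightarrow> \<Gamma> \<subseteq> \<Gamma>' \<longrightarrow> \<Gamma>' = \<Gamma>)"
proof -
  let ?A = "{\<Gamma>. spec_graph \<Gamma> \<and> \<Gamma>0 \<subseteq> \<Gamma>}"
  have "\<exists>M\<in>?A. \<forall>X\<in>?A. M \<subseteq> X \<longrightarrow> X = M"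
  proof (rule subset_Zorn_nonempty)
    show "?A \<noteq> {}" using assms by auto
    fix \<C> assume "\<C> \<noteq> {}" "subset.chain ?A \<C>"
    then have "chain\<^sub>\<subseteq> \<C>" "\<C> \<subseteq> ?A" by (auto simp: subset_chain_def chain_subset_def)
    with \<open>\<C> \<noteq> {}\<close> show "\<Union>\<C> \<in> ?A" using spec_graph_Union_chain[of \<C>] by blast
  qed
  then obtain M where M: "M \<in> ?A" and max: "\<forall>X\<in>?A. M \<subseteq> X \<longrightarrow> X = M" ..
  from M have M': "spec_graph M" "\<Gamma>0 \<subseteq> M" by simp_all
  have "\<Gamma>' = M" if "spec_graph \<Gamma>'" "M \<subseteq> \<Gamma>'" for \<Gamma>'
    by (rule max[rule_format, OF _ that(2)]) (simp add: that(1) order_trans[OF M'(2) that(2)])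
  with M' show ?thesis by (intro exI[of _ M] conjI allI impI)
qed

section \<open>Reversed polynomials and the valuation property\<close>

definition poly_rev :: "nat \<Rightarrow> 'b::comm_ring_1 poly \<Rightarrow> 'b poly" where
  "poly_rev n p = (\<Sum>i\<le>n. monom (coeff p i) (n - i))"

lemma coeff_rel_poly_rev: "spec_graph \<Gamma> \<Longrightarrow> coeff_rel \<Gamma> p q \<Longrightarrow> coeff_rel \<Gamma> (poly_rev n p) (poly_rev n q)"
  unfolding poly_rev_def by (intro coeff_rel_sum coeff_rel_monom) (auto simp: coeff_rel_def)

lemma coeff_poly_rev: "coeff (poly_rev n p) n = coeff p 0"
proof -
  have "coeff (poly_rev n p) n = (\<Sum>i\<le>n. if i = 0 then coeff p i else 0)"
    unfolding poly_rev_def coeff_sum by (intro sum.cong) auto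
  then show ?thesis by simp
qed

lemma degree_poly_rev: "Polynomial.degree (poly_rev n p) \<le> n"
  unfolding poly_rev_def by (intro degree_sum_le) (auto intro: order_trans[OF degree_monom_le])

lemma poly_poly_rev:
  fixes z :: "'b::field"
  assumes "Polynomial.degree p \<le> n" "z \<noteq> 0"
  shows "poly (poly_rev n p) z = z ^ n * poly p (inverse z)"
proof -
  have "poly (poly_rev n p) z = (\<Sum>i\<le>n. coeff p i * z ^ (n - i))"
    by (simp add: poly_rev_def poly_sum poly_monom)
  also have "\<dots> = (\<Sum>i\<le>n. z ^ n * (coeff p i * inverse z ^ i))"
    using assms(2) by (intro sum.cong) (auto simp: power_diff field_simps)
  also have "\<dots> = z ^ n * poly p (inverse z)"
    unfolding poly_altdef sum_distrib_left
    by (rule sum.mono_neutral_right) (use assms(1) in \<open>auto intro: coeff_eq_0\<close>)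
  finally show ?thesis .
qed

text \<open>Chevalley's argument. If neither alternative holds, maximality forbids every extension
  to \<open>z\<close>, and the extension sending \<open>inverse z\<close> to \<open>0\<close>. Both
  obstructions are polynomial relations; taken of least degree, the longer one can be shortened by
  the reversal of the other.\<close>

theorem maximal_spec_graph_valuation:
  fixes \<Gamma> :: "('b::field \<times> 'a::alg_closed_field) set"
  assumes \<Gamma>: "spec_graph \<Gamma>" and h: "\<And>c. (h c, c) \<in> \<Gamma>"
    and max: "\<And>\<Gamma>'. spec_graph \<Gamma>' \<Longrightarrow> \<Gamma> \<subseteq> \<Gamma>' \<Longrightarrow> \<Gamma>' = \<Gamma>"
    and z: "z \<noteq> 0"
  shows "(\<exists>c. (z, c) \<in> \<Gamma>) \<or> (inverse z, 0) \<in> \<Gamma>"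
proof (rule ccontr)
  assume contra: "\<not> ?thesis"
  have ext: "\<exists>p q. coeff_rel \<Gamma> p q \<and> poly p y = 0 \<and> poly q c \<noteq> 0" if "(y, c) \<notin> \<Gamma>" for y c
  proof (rule ccontr)
    assume "\<not> ?thesis"
    then have "spec_graph (spec_extend \<Gamma> y c)" by (intro spec_graph_extend[OF \<Gamma>]) blast
    then have "spec_extend \<Gamma> y c = \<Gamma>" using max spec_extend_superset[OF \<Gamma>] by blast
    with that spec_extend_new[OF \<Gamma>] show False by blast
  qed
  \<comment> \<open>The specialised relations of \<open>z\<close> form an ideal in polynomials over
    the field. No \<open>c\<close> is a common root, since otherwise \<open>z\<close> could be sent
    to \<open>c\<close>.\<close>
  define I where "I = {q. \<exists>p. coeff_rel \<Gamma> p q \<and> poly p z = 0}"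
  have Idiff: "q - q' \<in> I" if "q \<in> I" "q' \<in> I" for q q'
  proof -
    from that obtain p p' where "coeff_rel \<Gamma> p q" "poly p z = 0" "coeff_rel \<Gamma> p' q'" "poly p' z = 0"
      by (auto simp: I_def)
    then show ?thesis unfolding I_def
      by (intro CollectI exI[of _ "p - p'"]) (auto intro: coeff_rel_diff[OF \<Gamma>])
  qed
  have Imult: "u * q \<in> I" if "q \<in> I" for u q
  proof -
    from that obtain p where p: "coeff_rel \<Gamma> p q" "poly p z = 0" by (auto simp: I_def)
    have "coeff_rel \<Gamma> (\<Sum>i\<le>Polynomial.degree u. monom (h (coeff u i)) i) (\<Sum>i\<le>Polynomial.degree u. monom (coeff u i) i)"
      by (intro coeff_rel_sum[OF \<Gamma>] coeff_rel_monom[OF \<Gamma>] h)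
    then have "coeff_rel \<Gamma> ((\<Sum>i\<le>Polynomial.degree u. monom (h (coeff u i)) i) * p) (u * q)"
      using p(1) by (auto simp: poly_as_sum_of_monoms intro: coeff_rel_mult[OF \<Gamma>])
    with p(2) show ?thesis unfolding I_def by (intro CollectI exI) (auto simp: poly_mult)
  qed
  have Iroot: "\<exists>q\<in>I. poly q c \<noteq> 0" for c
    using ext[of z c] contra unfolding I_def by blast
  define q0 where "q0 = (ARG_MIN Polynomial.degree q. q \<in> I \<and> q \<noteq> 0)"
  have "\<exists>q. q \<in> I \<and> q \<noteq> 0" using Iroot[of 0] by auto
  then have q0: "q0 \<in> I" "q0 \<noteq> 0" and q0_min: "\<And>q. q \<in> I \<Longrightarrow> q \<noteq> 0 \<Longrightarrow> Polynomial.degree q0 \<le> Polynomial.degree q"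
    unfolding q0_def using arg_min_natI[of "\<lambda>q. q \<in> I \<and> q \<noteq> 0"] arg_min_nat_le[of "\<lambda>q. q \<in> I \<and> q \<noteq> 0"] by blast+
  \<comment> \<open>\<open>q0\<close> generates the ideal, so a root of \<open>q0\<close> would be a
    common root.\<close>
  have "Polynomial.degree q0 = 0"
  proof (rule ccontr)
    assume "Polynomial.degree q0 \<noteq> 0"
    then obtain c where c: "poly q0 c = 0" using alg_closed_imp_poly_has_root by blast
    obtain q where q: "q \<in> I" "poly q c \<noteq> 0" using Iroot by auto
    have "q mod q0 = q - (q div q0) * q0" by (simp add: minus_div_mult_eq_mod)
    then have "q mod q0 \<in> I" using q(1) q0(1) Idiff Imult by simp
    with q0_min[of "q mod q0"] degree_mod_less'[of q0 q] q0(2) have "q mod q0 = 0" by fastforce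
    then have "q = (q div q0) * q0" by (metis add.right_neutral div_mult_mod_eq)
    with c have "poly q c = 0" by (metis mult_zero_right poly_mult)
    with q(2) show False by simp
  qed
  then obtain \<kappa> where \<kappa>: "q0 = [:\<kappa>:]" by (metis degree_eq_zeroE)
  with q0(2) have "\<kappa> \<noteq> 0" by simp
  \<comment> \<open>A relation for \<open>z\<close> whose specialisation is a nonzero constant
    exists because the ideal is the unit ideal. For \<open>inverse z\<close> only the value
    \<open>0\<close> is excluded, so there the constant coefficient alone is asked to be
    nonzero.\<close>
  define P1 where "P1 = (\<lambda>p. poly p z = 0 \<and> (\<exists>q. coeff_rel \<Gamma> p q \<and> coeff q 0 \<noteq> 0 \<and> (\<forall>i>0. coeff q i = 0)))"
  define P2 where "P2 = (\<lambda>p. poly p (inverse z) = 0 \<and> (\<exists>q. coeff_rel \<Gamma> p q \<and> coeff q 0 \<noteq> 0))"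
  have "\<exists>p. P1 p"
  proof -
    from q0(1) obtain p where p: "coeff_rel \<Gamma> p q0" "poly p z = 0" by (auto simp: I_def)
    then have "P1 p" unfolding P1_def using \<kappa> \<open>\<kappa> \<noteq> 0\<close> by (auto intro!: exI[of _ q0] simp: coeff_pCons split: nat.splits)
    then show ?thesis ..
  qed
  then obtain p where p: "P1 p" and p_min: "\<And>p'. P1 p' \<Longrightarrow> Polynomial.degree p \<le> Polynomial.degree p'"
    using arg_min_natI[of P1] arg_min_nat_le[of P1] by metis
  have "\<exists>p. P2 p" using ext[of "inverse z" 0] contra by (auto simp: P2_def poly_0_coeff_0)
  then obtain p' where p': "P2 p'" and p'_min: "\<And>p. P2 p \<Longrightarrow> Polynomial.degree p' \<le> Polynomial.degree p"
    using arg_min_natI[of P2] arg_min_nat_le[of P2] by metis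
  let ?n = "Polynomial.degree p" and ?l = "Polynomial.degree p'"
  from p obtain q where q: "poly p z = 0" "coeff_rel \<Gamma> p q" "coeff q 0 \<noteq> 0" "\<And>i. i > 0 \<Longrightarrow> coeff q i = 0"
    by (auto simp: P1_def)
  from p' obtain q' where q': "poly p' (inverse z) = 0" "coeff_rel \<Gamma> p' q'" "coeff q' 0 \<noteq> 0"
    by (auto simp: P2_def)
  have rel: "(coeff p i, coeff q i) \<in> \<Gamma>" "(coeff p' i, coeff q' i) \<in> \<Gamma>" for i
    using q(2) q'(2) by (auto simp: coeff_rel_def)
  have n: "?n > 0"
  proof (rule ccontr)
    assume "\<not> ?n > 0"
    then obtain a where "p = [:a:]" by (metis degree_eq_zeroE gr0I)
    with q(1) rel(1)[of 0] have "(0, coeff q 0) \<in> \<Gamma>" by simp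
    with q(3) spec_graphD(6)[OF \<Gamma>] show False by blast
  qed
  have l: "?l > 0"
  proof (rule ccontr)
    assume "\<not> ?l > 0"
    then obtain a where "p' = [:a:]" by (metis degree_eq_zeroE gr0I)
    with q'(1) rel(2)[of 0] have "(0, coeff q' 0) \<in> \<Gamma>" by simp
    with q'(3) spec_graphD(6)[OF \<Gamma>] show False by blast
  qed
  have deg_less: "Polynomial.degree r < k" if "k > 0" "Polynomial.degree r \<le> k" "coeff r k = 0" for r :: "'b poly" and k
    using that by (metis degree_0 le_neq_implies_less leading_coeff_0_iff)
  show False
  proof (cases "?l \<le> ?n")
    case True
    \<comment> \<open>The top coefficient of the reversal of \<open>p'\<close> is
      \<open>coeff p' 0\<close>, so the terms of degree \<open>?n\<close> cancel. The specialised
      subtrahend is zero because \<open>coeff q ?n = 0\<close>, so a nonzero constant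
      remains.\<close>
    define r where "r = smult (coeff p' 0) p - monom (coeff p ?n) (?n - ?l) * poly_rev ?l p'"
    define s where "s = smult (coeff q' 0) q - monom (coeff q ?n) (?n - ?l) * poly_rev ?l q'"
    have "coeff_rel \<Gamma> r s"
      unfolding r_def s_def using rel q(2) q'(2)
      by (intro coeff_rel_diff coeff_rel_smult coeff_rel_mult coeff_rel_monom coeff_rel_poly_rev \<Gamma>) auto
    moreover have "s = smult (coeff q' 0) q" using q(4)[OF n] by (simp add: s_def)
    moreover have "poly r z = 0"
      using q(1) q'(1) poly_poly_rev[of p' ?l z] z by (simp add: r_def)
    ultimately have "P1 r" unfolding P1_def using q(3,4) q'(3) by (auto intro!: exI[of _ s])
    moreover have "Polynomial.degree r < ?n"
    proof (rule deg_less[OF n])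
      show "Polynomial.degree r \<le> ?n"
        unfolding r_def
      proof (rule degree_diff_le)
        show "Polynomial.degree (monom (coeff p ?n) (?n - ?l) * poly_rev ?l p') \<le> ?n"
          using degree_mult_le[of "monom (coeff p ?n) (?n - ?l)" "poly_rev ?l p'"]
            degree_monom_le[of "coeff p ?n" "?n - ?l"] degree_poly_rev[of ?l p'] True by linarith
      qed simp
      show "coeff r ?n = 0" using True by (simp add: r_def coeff_monom_mult coeff_poly_rev)
    qed
    ultimately show False using p_min by fastforce
  next
    case False
    \<comment> \<open>The same cancellation in degree \<open>?l\<close>. As \<open>?l > ?n\<close>,
      the monomial factor has positive degree and leaves the constant coefficient intact.\<close>
    define r where "r = smult (coeff p 0) p' - monom (coeff p' ?l) (?l - ?n) * poly_rev ?n p"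
    define s where "s = smult (coeff q 0) q' - monom (coeff q' ?l) (?l - ?n) * poly_rev ?n q"
    have "coeff_rel \<Gamma> r s"
      unfolding r_def s_def using rel q(2) q'(2)
      by (intro coeff_rel_diff coeff_rel_smult coeff_rel_mult coeff_rel_monom coeff_rel_poly_rev \<Gamma>) auto
    moreover have "coeff s 0 = coeff q 0 * coeff q' 0" using False by (simp add: s_def coeff_monom_mult)
    moreover have "poly r (inverse z) = 0"
      using q(1) q'(1) poly_poly_rev[of p ?n "inverse z"] z by (simp add: r_def)
    ultimately have "P2 r" unfolding P2_def using q(3) q'(3) by (auto intro!: exI[of _ s])
    moreover have "Polynomial.degree r < ?l"
    proof (rule deg_less[OF l])
      show "Polynomial.degree r \<le> ?l"
        unfolding r_def
      proof (rule degree_diff_le)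
        show "Polynomial.degree (monom (coeff p' ?l) (?l - ?n) * poly_rev ?n p) \<le> ?l"
          using degree_mult_le[of "monom (coeff p' ?l) (?l - ?n)" "poly_rev ?n p"]
            degree_monom_le[of "coeff p' ?l" "?l - ?n"] degree_poly_rev[of ?n p] False by linarith
      qed simp
      show "coeff r ?l = 0" using False by (simp add: r_def coeff_monom_mult coeff_poly_rev)
    qed
    ultimately show False using p'_min by fastforce
  qed
qed

text \<open>A nonzero polynomial over the algebraically closed field splits, so all its roots lie in
  the range of \<open>h\<close>; linear factors are split off one at a time.\<close>

lemma algebraic_over_alg_closed:
  fixes h :: "'a::alg_closed_field \<Rightarrow> 'b::field"
  assumes "const_hom h" "g \<notin> range h" "poly (map_poly h p) g = 0"
  shows "p = 0"
  using assms(3)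
proof (induction "Polynomial.degree p" arbitrary: p)
  interpret const_hom h by fact
  case 0
  then obtain a where a: "p = [:a:]" by (metis degree_eq_zeroE)
  with 0 have "h a = 0" by (simp add: map_poly_pCons hom_zero)
  have "a = 0"
  proof (rule ccontr)
    assume "a \<noteq> 0"
    then have "h (a * inverse a) = 1" by (simp add: hom_one)
    then show False using \<open>h a = 0\<close> by (simp only: hom_mult mult_zero_left zero_neq_one)
  qed
  then show ?case using a by simp
next
  interpret const_hom h by fact
  case (Suc n)
  then obtain c where c: "poly p c = 0" using alg_closed_imp_poly_has_root[of p] by auto
  then obtain q where q: "p = [:- c, 1:] * q" by (auto simp: poly_eq_0_iff_dvd)
  have q0: "q \<noteq> 0" using q Suc(2) by auto
  then have dq: "n = Polynomial.degree q"
    using degree_mult_eq[of "[:- c, 1:]" q] Suc(2) unfolding q by simp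
  have coeff: "coeff (map_poly h r) i = h (coeff r i)" for r i by (simp add: coeff_map_poly hom_zero)
  have "map_poly h p = map_poly h [:- c, 1:] * map_poly h q"
    by (rule poly_eqI) (simp only: q coeff coeff_mult hom_sum hom_mult)
  then have "(g - h c) * poly (map_poly h q) g = 0"
    using Suc.prems by (auto simp: map_poly_pCons hom_zero hom_one hom_uminus)
  moreover have "g - h c \<noteq> 0" using assms(2) by auto
  ultimately have "poly (map_poly h q) g = 0" by simp
  from Suc.hyps(1)[OF dq this] q0 show ?case by simp
qed

text \<open>As \<open>g\<close> is transcendental over the constants, sending it to \<open>0\<close>
  respects all relations; a maximal extension of this specialisation is a place.\<close>

theorem exists_place:
  fixes h :: "'a::alg_closed_field \<Rightarrow> 'b::field"
  assumes h: "const_hom h" and g: "g \<notin> range h"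
  shows "\<exists>\<Gamma>. spec_graph \<Gamma> \<and> (\<forall>c. (h c, c) \<in> \<Gamma>) \<and> (g, 0) \<in> \<Gamma> \<and>
    (\<forall>z. z \<noteq> 0 \<longrightarrow> (\<exists>c. (z, c) \<in> \<Gamma>) \<or> (inverse z, 0) \<in> \<Gamma>)"
proof -
  interpret const_hom h by fact
  have h0: "c = 0" if "h c = 0" for c
  proof (rule ccontr)
    assume "c \<noteq> 0"
    then have "h (c * inverse c) = 1" by (simp add: hom_one)
    then show False using that by (simp only: hom_mult mult_zero_left zero_neq_one)
  qed
  define \<Gamma>0 where "\<Gamma>0 = range (\<lambda>c. (h c, c))"
  have \<Gamma>0: "spec_graph \<Gamma>0"
    unfolding spec_graph_def \<Gamma>0_def
    using h0 hom_one hom_add hom_diff hom_mult by (auto simp: image_iff)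
  have "spec_graph (spec_extend \<Gamma>0 g 0)"
  proof (rule spec_graph_extend[OF \<Gamma>0])
    fix p q assume pq: "coeff_rel \<Gamma>0 p q" "poly p g = 0"
    then have "p = map_poly h q"
      by (intro poly_eqI) (auto simp: coeff_rel_def \<Gamma>0_def coeff_map_poly hom_zero)
    with pq(2) algebraic_over_alg_closed[OF h g] have "q = 0" by blast
    then show "poly q 0 = 0" by simp
  qed
  from maximal_spec_graph[OF this] obtain \<Gamma> where \<Gamma>: "spec_graph \<Gamma>" "spec_extend \<Gamma>0 g 0 \<subseteq> \<Gamma>"
    "\<And>\<Gamma>'. spec_graph \<Gamma>' \<Longrightarrow> \<Gamma> \<subseteq> \<Gamma>' \<Longrightarrow> \<Gamma>' = \<Gamma>" by blast
  have "(h c, c) \<in> \<Gamma>" for c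
    using spec_extend_superset[OF \<Gamma>0, of g 0] \<Gamma>(2) by (auto simp: \<Gamma>0_def)
  moreover have "(g, 0) \<in> \<Gamma>" using spec_extend_new[OF \<Gamma>0] \<Gamma>(2) by blast
  ultimately show ?thesis using maximal_spec_graph_valuation[OF \<Gamma>(1) _ \<Gamma>(3)] \<Gamma>(1) by blast
qed

section \<open>The local ring at a nonsingular point\<close>

lemma mdeg_eq_0: "mdeg n = 0 \<longleftrightarrow> n = 0"
proof
  assume "mdeg n = 0"
  then have "Poly_Mapping.lookup n i = 0" for i
    by (cases "i \<in> Poly_Mapping.keys n") (auto simp: mdeg_def in_keys_iff)
  then show "n = 0" by (intro poly_mapping_eqI) simp
qed simp

lemma mpol_var_induct [case_names const add var]:
  fixes F :: "'a::comm_ring_1 mpol"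
  assumes "\<And>c. P (Poly_Mapping.single 0 c)" "\<And>A B. P A \<Longrightarrow> P B \<Longrightarrow> P (A + B)"
    and "\<And>l n c. P (Poly_Mapping.single n c) \<Longrightarrow> P (mvar l * Poly_Mapping.single n c)"
  shows "P F"
proof (induction F rule: mpol_induct)
  case zero
  then show ?case using assms(1)[of 0] by simp
next
  case (single n c)
  show ?case
  proof (induction "mdeg n" arbitrary: n)
    case 0
    then have "n = 0" by (simp add: mdeg_eq_0)
    then show ?case using assms(1) by simp
  next
    case (Suc k)
    then have "n \<noteq> 0" by auto
    then obtain l where l: "Poly_Mapping.lookup n l \<noteq> 0"
      by (metis lookup_zero poly_mapping_eqI)
    define n' where "n' = n - Poly_Mapping.single l 1"
    have n: "n = Poly_Mapping.single l 1 + n'"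
      by (rule poly_mapping_eqI) (use l in \<open>auto simp: n'_def lookup_add lookup_minus lookup_single when_def\<close>)
    then have "mdeg n' = k" using Suc(2) by (simp add: mdeg_add)
    then have "P (mvar l * Poly_Mapping.single n' c)" using Suc(1) assms(3) by blast
    then show ?case by (simp add: n mvar_def mult_single)
  qed
next
  case (add A B)
  then show ?case using assms(2) by blast
qed

abbreviation cst :: "'a \<Rightarrow> 'a::comm_ring_1 mpol" where
  "cst c \<equiv> Poly_Mapping.single 0 c"

lemma partial_deriv_add: "partial_deriv j (F + G) = partial_deriv j F + partial_deriv j G"
  unfolding partial_deriv_def
  by (rule setsum_keys_plus_distrib[where
        f = "\<lambda>m c. Poly_Mapping.single (m - Poly_Mapping.single j 1) (of_nat (Poly_Mapping.lookup m j) * c)"])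
     (auto simp: single_add algebra_simps)

lemma partial_deriv_zero: "partial_deriv j 0 = 0"
  by (simp add: partial_deriv_def)

lemma partial_deriv_single:
  "partial_deriv j (Poly_Mapping.single n c) =
     Poly_Mapping.single (n - Poly_Mapping.single j 1) (of_nat (Poly_Mapping.lookup n j) * c)"
  by (simp add: partial_deriv_def)

lemma partial_deriv_mvar_mult:
  fixes c :: "'a::comm_ring_1"
  shows "subst_mpol id (partial_deriv j (mvar l * Poly_Mapping.single n c)) v =
    (if j = l then subst_mpol id (Poly_Mapping.single n c) v else 0) +
    v l * subst_mpol id (partial_deriv j (Poly_Mapping.single n c)) v"
proof -
  have E: "subst_mpol id (partial_deriv j (mvar l * Poly_Mapping.single n c)) v =
    of_nat (Poly_Mapping.lookup (Poly_Mapping.single l 1 + n) j) * c *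
      mono_eval v (Poly_Mapping.single l 1 + n - Poly_Mapping.single j 1)"
    by (simp add: mvar_def mult_single partial_deriv_single id_hom.subst_single)
  \<comment> \<open>Subtraction of exponents is truncated, so moving \<open>single l 1\<close> out
    is valid only if \<open>j\<close> occurs in \<open>n\<close>; otherwise the factor
    \<open>of_nat 0\<close> annihilates both sides.\<close>
  have mono: "of_nat (Poly_Mapping.lookup n j) * mono_eval v (Poly_Mapping.single l 1 + n - Poly_Mapping.single j 1) =
      of_nat (Poly_Mapping.lookup n j) * (v l * mono_eval v (n - Poly_Mapping.single j 1))"
  proof (cases "Poly_Mapping.lookup n j = 0")
    case False
    then have "Poly_Mapping.single l 1 + n - Poly_Mapping.single j 1 =
        Poly_Mapping.single l 1 + (n - Poly_Mapping.single j 1)"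
      by (intro poly_mapping_eqI) (auto simp: lookup_add lookup_minus lookup_single when_def)
    then show ?thesis by (simp add: mono_eval_add)
  qed simp
  show ?thesis
  proof (cases "j = l")
    case True
    then have "Poly_Mapping.single l 1 + n - Poly_Mapping.single j 1 = n" by simp
    then show ?thesis using mono True unfolding E
      by (simp add: lookup_add partial_deriv_single id_hom.subst_single algebra_simps)
  next
    case False
    then show ?thesis using mono unfolding E
      by (simp add: lookup_add lookup_single partial_deriv_single id_hom.subst_single algebra_simps)
  qed
qed

text \<open>The remainder is written as a combination of the \<open>\<xi> j\<close> with
  coefficients vanishing at \<open>v\<close>, that is, inside the square of the maximal ideal. This
  is the shape to which Nakayama's lemma applies.\<close>

lemma taylor2:
  fixes F :: "'a::comm_ring_1 mpol" and v :: "nat \<Rightarrow> 'a"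
  defines "\<xi> \<equiv> \<lambda>j. mvar j - cst (v j)"
  assumes "form m d F"
  shows "\<exists>a. (\<forall>k. subst_mpol id (a k) v = 0) \<and>
    F = cst (subst_mpol id F v) + (\<Sum>j\<le>m. cst (subst_mpol id (partial_deriv j F) v) * \<xi> j) + (\<Sum>j\<le>m. a j * \<xi> j)"
proof -
  define T where "T = (\<lambda>F. \<exists>a. (\<forall>k. subst_mpol id (a k) v = 0) \<and>
    F = cst (subst_mpol id F v) + (\<Sum>j\<le>m. cst (subst_mpol id (partial_deriv j F) v) * \<xi> j) + (\<Sum>j\<le>m. a j * \<xi> j))"
  have \<xi>0: "subst_mpol id (\<xi> j) v = 0" for j by (simp add: \<xi>_def id_hom.subst_diff)
  have single: "T (Poly_Mapping.single n c)" if "Poly_Mapping.keys n \<subseteq> {..m}" for n c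
    using that
  proof (induction "mdeg n" arbitrary: n)
    case 0
    then have "n = 0" by (simp add: mdeg_eq_0)
    then show ?case unfolding T_def
      by (intro exI[of _ "\<lambda>_. 0"]) (simp add: partial_deriv_single)
  next
    case (Suc k)
    then have "n \<noteq> 0" by auto
    then obtain l where l: "Poly_Mapping.lookup n l \<noteq> 0"
      by (metis lookup_zero poly_mapping_eqI)
    then have lm: "l \<le> m" using Suc.prems by (auto simp: in_keys_iff subset_iff)
    define n' where "n' = n - Poly_Mapping.single l 1"
    have n: "n = Poly_Mapping.single l 1 + n'"
      by (rule poly_mapping_eqI) (use l in \<open>auto simp: n'_def lookup_add lookup_minus lookup_single when_def\<close>)
    have "Poly_Mapping.keys n' \<subseteq> {..m}"
      using Suc.prems by (auto simp: n'_def in_keys_iff lookup_minus subset_iff)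
    moreover have "k = mdeg n'" using n Suc(2) by (simp add: mdeg_add)
    ultimately have "T (Poly_Mapping.single n' c)" using Suc(1) by blast
    then obtain a where a: "\<And>k. subst_mpol id (a k) v = 0"
      and eq: "Poly_Mapping.single n' c = cst (subst_mpol id (Poly_Mapping.single n' c) v) +
        (\<Sum>j\<le>m. cst (subst_mpol id (partial_deriv j (Poly_Mapping.single n' c)) v) * \<xi> j) + (\<Sum>j\<le>m. a j * \<xi> j)"
      unfolding T_def by blast
    define G where "G = Poly_Mapping.single n' c"
    let ?\<delta> = "\<lambda>j F. subst_mpol id (partial_deriv j F) v"
    \<comment> \<open>Multiplying by \<open>mvar l = cst (v l) + \<xi> l\<close> moves the linear
      part of \<open>G\<close> times \<open>\<xi> l\<close> into the remainder.\<close>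
    define a' where "a' = (\<lambda>j. cst (?\<delta> j G) * \<xi> l + a j * mvar l)"
    have F: "Poly_Mapping.single n c = mvar l * G" by (simp add: n G_def mvar_def mult_single)
    have \<delta>: "?\<delta> j (mvar l * G) = (if j = l then subst_mpol id G v else 0) + v l * ?\<delta> j G" for j
      unfolding G_def by (rule partial_deriv_mvar_mult)
    have x: "mvar l = cst (v l) + \<xi> l" by (simp add: \<xi>_def)
    have eqG: "G = cst (subst_mpol id G v) + (\<Sum>j\<le>m. cst (?\<delta> j G) * \<xi> j) + (\<Sum>j\<le>m. a j * \<xi> j)"
      using eq by (simp add: G_def)
    have s1: "(\<Sum>j\<le>m. cst (?\<delta> j (mvar l * G)) * \<xi> j) =
        cst (subst_mpol id G v) * \<xi> l + cst (v l) * (\<Sum>j\<le>m. cst (?\<delta> j G) * \<xi> j)"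
    proof -
      have "(\<Sum>j\<le>m. cst (?\<delta> j (mvar l * G)) * \<xi> j) =
          (\<Sum>j\<le>m. (if j = l then cst (subst_mpol id G v) * \<xi> l else 0) + cst (v l) * (cst (?\<delta> j G) * \<xi> j))"
        unfolding \<delta> by (intro sum.cong) (auto simp: single_add mpol_hom.hom_mult algebra_simps)
      then show ?thesis using lm by (simp add: sum.distrib sum_distrib_left)
    qed
    have s2: "(\<Sum>j\<le>m. a' j * \<xi> j) = \<xi> l * (\<Sum>j\<le>m. cst (?\<delta> j G) * \<xi> j) + mvar l * (\<Sum>j\<le>m. a j * \<xi> j)"
      by (simp add: a'_def sum.distrib sum_distrib_left algebra_simps)
    have "mvar l * G = cst (subst_mpol id (mvar l * G) v) + (\<Sum>j\<le>m. cst (?\<delta> j (mvar l * G)) * \<xi> j) + (\<Sum>j\<le>m. a' j * \<xi> j)"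
      unfolding s1 s2
      by (subst eqG) (simp add: x id_hom.subst_mult id_hom.subst_add \<xi>0 mpol_hom.hom_mult algebra_simps)
    moreover have "subst_mpol id (a' k) v = 0" for k
      by (simp add: a'_def id_hom.subst_add id_hom.subst_mult a \<xi>0)
    ultimately show ?case unfolding F T_def by blast
  qed
  have add: "T (A + B)" if "T A" "T B" for A B
  proof -
    from that obtain a b where "\<And>k. subst_mpol id (a k) v = 0" "\<And>k. subst_mpol id (b k) v = 0"
      and A: "A = cst (subst_mpol id A v) + (\<Sum>j\<le>m. cst (subst_mpol id (partial_deriv j A) v) * \<xi> j) + (\<Sum>j\<le>m. a j * \<xi> j)"
      and B: "B = cst (subst_mpol id B v) + (\<Sum>j\<le>m. cst (subst_mpol id (partial_deriv j B) v) * \<xi> j) + (\<Sum>j\<le>m. b j * \<xi> j)"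
      unfolding T_def by blast
    moreover have "A + B = cst (subst_mpol id (A + B) v) +
        (\<Sum>j\<le>m. cst (subst_mpol id (partial_deriv j (A + B)) v) * \<xi> j) + (\<Sum>j\<le>m. (a j + b j) * \<xi> j)"
      by (subst A, subst B)
         (simp add: partial_deriv_add id_hom.subst_add single_add sum.distrib algebra_simps)
    ultimately show ?thesis unfolding T_def
      by (intro exI[of _ "\<lambda>j. a j + b j"]) (auto simp: id_hom.subst_add)
  qed
  have "T F"
    by (induction F rule: mpol_induct)
       (use single[of 0 0] single add assms(2) in \<open>auto simp: form_alt\<close>)
  then show ?thesis unfolding T_def .
qed

lemma mono_eval_eq_0: "j \<in> Poly_Mapping.keys n \<Longrightarrow> x j = 0 \<Longrightarrow> mono_eval x n = 0"
  unfolding mono_eval_def by (intro prod_zero) (auto simp: in_keys_iff zero_power intro!: bexI[of _ j])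

text \<open>Powers of \<open>mvar i\<close> bring the summands to one degree, and monomials in
  variables beyond \<open>m\<close> are dropped. One \<open>F\<close> serves points, power series
  and Laurent series at the same time.\<close>

lemma homogenize:
  fixes f :: "'a::comm_ring_1 mpol"
  assumes "i \<le> m"
  shows "\<exists>d F. form m d F \<and> (\<forall>x. x i = 1 \<longrightarrow> (\<forall>j>m. x j = 0) \<longrightarrow> subst_mpol id F x = subst_mpol id f x) \<and>
    (\<forall>x. x i = 1 \<longrightarrow> (\<forall>j>m. x j = 0) \<longrightarrow> subst_mpol fps_const F x = subst_mpol fps_const f x) \<and>
    (\<forall>x. x i = 1 \<longrightarrow> (\<forall>j>m. x j = 0) \<longrightarrow> subst_mpol fls_const F x = subst_mpol fls_const f x)"
proof -
  define T where "T = (\<lambda>f :: 'a mpol. \<exists>d F. form m d F \<and>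
    (\<forall>x. x i = 1 \<longrightarrow> (\<forall>j>m. x j = 0) \<longrightarrow> subst_mpol id F x = subst_mpol id f x) \<and>
    (\<forall>x. x i = 1 \<longrightarrow> (\<forall>j>m. x j = 0) \<longrightarrow> subst_mpol fps_const F x = subst_mpol fps_const f x) \<and>
    (\<forall>x. x i = 1 \<longrightarrow> (\<forall>j>m. x j = 0) \<longrightarrow> subst_mpol fls_const F x = subst_mpol fls_const f x))"
  have "T f"
  proof (induction f rule: mpol_induct)
    case zero
    show ?case unfolding T_def by (intro exI[of _ 0] exI[of _ "0 :: 'a mpol"]) simp
  next
    case (single n c)
    show ?case
    proof (cases "Poly_Mapping.keys n \<subseteq> {..m}")
      case True
      then show ?thesis unfolding T_def by (intro exI[of _ "mdeg n"] exI[of _ "Poly_Mapping.single n c"]) (simp add: form_single)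
    next
      case False
      then obtain j where j: "j \<in> Poly_Mapping.keys n" "j > m"
        by (meson atMost_iff not_le subsetI)
      then show ?thesis unfolding T_def
        by (intro exI[of _ 0] exI[of _ "0 :: 'a mpol"])
           (simp add: id_hom.subst_single fps_hom.subst_single fls_hom.subst_single mono_eval_eq_0[OF j(1)])
    qed
  next
    case (add A B)
    then obtain d F e G where F: "form m d F"
        "\<forall>x. x i = 1 \<longrightarrow> (\<forall>j>m. x j = 0) \<longrightarrow> subst_mpol id F x = subst_mpol id A x"
        "\<forall>x. x i = 1 \<longrightarrow> (\<forall>j>m. x j = 0) \<longrightarrow> subst_mpol fps_const F x = subst_mpol fps_const A x"
      "\<forall>x. x i = 1 \<longrightarrow> (\<forall>j>m. x j = 0) \<longrightarrow> subst_mpol fls_const F x = subst_mpol fls_const A x"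
      and G: "form m e G"
        "\<forall>x. x i = 1 \<longrightarrow> (\<forall>j>m. x j = 0) \<longrightarrow> subst_mpol id G x = subst_mpol id B x"
        "\<forall>x. x i = 1 \<longrightarrow> (\<forall>j>m. x j = 0) \<longrightarrow> subst_mpol fps_const G x = subst_mpol fps_const B x"
      "\<forall>x. x i = 1 \<longrightarrow> (\<forall>j>m. x j = 0) \<longrightarrow> subst_mpol fls_const G x = subst_mpol fls_const B x" unfolding T_def by blast
    have x: "form m e (mvar i ^ e :: 'a mpol)" "form m d (mvar i ^ d :: 'a mpol)"
      using form_power[OF form_mvar[OF assms], of e] form_power[OF form_mvar[OF assms], of d] by simp_all
    have "form m (d + e) (F * mvar i ^ e + G * mvar i ^ d)"
      using form_mult[OF F(1) x(1)] form_mult[OF G(1) x(2)] by (simp add: form_add add.commute)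
    then show ?case using F(2-4) G(2-4) unfolding T_def
      by (intro exI[of _ "d + e"] exI[of _ "F * mvar i ^ e + G * mvar i ^ d"])
         (simp add: id_hom.subst_add id_hom.subst_mult id_hom.subst_power
            fps_hom.subst_add fps_hom.subst_mult fps_hom.subst_power
          fls_hom.subst_add fls_hom.subst_mult fls_hom.subst_power)
  qed
  then show ?thesis unfolding T_def .
qed

section \<open>Coordinate vectors\<close>

definition unit_vec :: "nat \<Rightarrow> nat \<Rightarrow> 'a::field" where
  "unit_vec j = (\<lambda>k. if k = j then 1 else 0)"

lemma unit_vec_at [simp]: "unit_vec j j = 1"
  by (simp add: unit_vec_def)

lemma independent_unit_vecs:
  "\<not> coord_space.dependent (unit_vec ` {..<n} :: (nat \<Rightarrow> 'a::field) set) \<and> card (unit_vec ` {..<n} :: (nat \<Rightarrow> 'a) set) = n"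
proof (induction n)
  case (Suc n)
  have "v n = 0" if "v \<in> coord_space.span (unit_vec ` {..<n})" for v :: "nat \<Rightarrow> 'a"
    using that
  proof (induction rule: coord_space.span_induct_alt)
    case base show ?case by simp
  next
    case (step c x y) then show ?case by (auto simp: scale_vec_def unit_vec_def)
  qed
  from this[of "unit_vec n"] have "unit_vec n \<notin> coord_space.span (unit_vec ` {..<n} :: (nat \<Rightarrow> 'a) set)"
    by (auto simp: unit_vec_at)
  moreover from this have "unit_vec n \<notin> (unit_vec ` {..<n} :: (nat \<Rightarrow> 'a) set)"
    using coord_space.span_base[of "unit_vec n"] by (elim contrapos_nn)
  ultimately show ?case using Suc
    by (simp add: lessThan_Suc coord_space.independent_insert)
qed (simp add: coord_space.independent_empty)

lemma sum_fun_eval: "(\<Sum>j\<in>J. f j) k = (\<Sum>j\<in>J. f j k :: 'b::comm_monoid_add)"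
  by (induction J rule: infinite_finite_induct) auto

lemma sum_unit_vecs:
  fixes v :: "nat \<Rightarrow> 'a::field"
  assumes "\<And>j. j > m \<Longrightarrow> v j = 0"
  shows "v \<in> coord_space.span (unit_vec ` {..<Suc m})"
proof -
  have "v = (\<Sum>j<Suc m. scale_vec (v j) (unit_vec j))"
  proof
    fix k
    have "(\<Sum>j<Suc m. scale_vec (v j) (unit_vec j)) k = (\<Sum>j<Suc m. if k = j then v j else 0)"
      unfolding sum_fun_eval by (intro sum.cong) (auto simp: scale_vec_def unit_vec_def)
    also have "\<dots> = v k" using assms[of k] by (auto simp: not_less)
    finally show "v k = (\<Sum>j<Suc m. scale_vec (v j) (unit_vec j)) k" by simp
  qed
  then show ?thesis
    by (metis (no_types, lifting) coord_space.span_base coord_space.span_scale coord_space.span_sum imageI)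
qed

section \<open>Affine charts of a nonsingular curve\<close>

locale ns_curve =
  fixes m :: nat and X :: "'a::{alg_closed_field,field_char_0} point set"
  assumes nonsing: "nonsingular_curve m X"
begin

lemma curve_X: "proj_curve m X"
  using nonsing by (simp add: nonsingular_curve_def)

lemma X_space: "X \<subseteq> proj_space m"
  by (rule proj_curve_space[OF curve_X])

text \<open>Keeps \<open>m - 1\<close> in the Jacobian criterion from being truncated: projective
  \<open>0\<close>-space is a single point, while a curve is infinite.\<close>

lemma m_pos: "m \<ge> 1"
proof (rule ccontr)
  assume "\<not> m \<ge> 1"
  then have m: "m = 0" by simp
  have "p = proj_point (unit_vec 0)" if "p \<in> proj_space 0" for p :: "'a point"
  proof -
    obtain v where v: "v \<in> p" using proj_space_nonempty[OF \<open>p \<in> proj_space 0\<close>] by auto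
    have "v 0 \<noteq> 0" using proj_spaceD(2,3)[OF that v] by (metis ext gr0I zero_fun_apply)
    moreover have "v = scale_vec (v 0) (unit_vec 0)"
      using proj_spaceD(3)[OF that v] by (auto simp: scale_vec_def unit_vec_def fun_eq_iff)
    ultimately show ?thesis using proj_spaceD(1)[OF that v] proj_point_scale by metis
  qed
  then have "X \<subseteq> {proj_point (unit_vec 0)}" using X_space m by blast
  then show False using infinite_proj_curve[OF curve_X] finite_subset by blast
qed

end

text \<open>The chart in which coordinate \<open>i\<close> is \<open>1\<close>, with
  \<open>v\<close> the affine coordinates of \<open>\<gamma>\<close>. The local ring at
  \<open>\<gamma>\<close> is not constructed; its elements appear through polynomials
  \<open>q\<close> with \<open>ev q \<noteq> 0\<close> that serve as denominators.\<close>

locale ns_chart = ns_curve m X for m :: nat and X :: "'a::{alg_closed_field,field_char_0} point set" +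
  fixes \<gamma> :: "'a point" and v :: "nat \<Rightarrow> 'a" and i :: nat
  assumes \<gamma>: "\<gamma> \<in> X" and v: "v \<in> \<gamma>" and i: "i \<le> m" and vi: "v i = 1"
begin

definition ev :: "'a mpol \<Rightarrow> 'a" where "ev f = subst_mpol id f v"

lemma ev_simps [simp]: "ev 0 = 0" "ev 1 = 1" "ev (f + g) = ev f + ev g" "ev (f - g) = ev f - ev g"
  "ev (- f) = - ev f" "ev (f * g) = ev f * ev g" "ev (cst c) = c" "ev (mvar j) = v j" "ev (f ^ n) = ev f ^ n"
  by (simp_all add: ev_def id_hom.subst_add id_hom.subst_diff id_hom.subst_mult id_hom.subst_uminus id_hom.subst_power)

text \<open>The ideal of the affine part of \<open>X\<close> in the chart.\<close>

definition aff :: "'a mpol \<Rightarrow> bool" where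
  "aff f \<longleftrightarrow> (\<forall>p\<in>X. \<forall>u\<in>p. u i = 1 \<longrightarrow> subst_mpol id f u = 0)"

lemma aff_ops: "aff 0" "aff f \<Longrightarrow> aff g \<Longrightarrow> aff (f + g)" "aff f \<Longrightarrow> aff g \<Longrightarrow> aff (f - g)"
  "aff f \<Longrightarrow> aff (h * f)" "aff f \<Longrightarrow> aff (f * h)"
  by (auto simp: aff_def id_hom.subst_add id_hom.subst_diff id_hom.subst_mult)

lemma aff_ev: "aff f \<Longrightarrow> ev f = 0"
  using \<gamma> v vi by (auto simp: aff_def ev_def)

lemma v_out: "j > m \<Longrightarrow> v j = 0"
  using proj_spaceD(3) X_space \<gamma> v by blast

text \<open>The factor \<open>mvar i\<close> makes the product vanish at the points outside the
  chart, about which \<open>aff\<close> says nothing.\<close>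

lemma aff_form:
  assumes "form m d F" "\<And>u. u i = 1 \<Longrightarrow> (\<forall>j>m. u j = 0) \<Longrightarrow> subst_mpol id F u = subst_mpol id f u"
  shows "aff f \<longleftrightarrow> (\<forall>p\<in>X. vanishes_at (mvar i * F) p)"
proof
  have form: "form m (1 + d) (mvar i * F)" by (rule form_mult[OF form_mvar[OF i] assms(1)])
  show "aff f" if van: "\<forall>p\<in>X. vanishes_at (mvar i * F) p"
    unfolding aff_def
  proof (intro ballI impI)
    fix p u assume u: "p \<in> X" "u \<in> p" "u i = 1"
    then have sp: "p \<in> proj_space m" using X_space by blast
    have "subst_mpol id (mvar i * F) u = 0" using van u(1,2) by (auto simp: vanishes_at_def)
    then show "subst_mpol id f u = 0"
      using assms(2)[of u] u(3) proj_spaceD(3)[OF sp u(2)] by (simp add: id_hom.subst_mult)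
  qed
  show "\<forall>p\<in>X. vanishes_at (mvar i * F) p" if f: "aff f"
  proof
    fix p assume p: "p \<in> X"
    then have sp: "p \<in> proj_space m" using X_space by blast
    obtain u where u: "u \<in> p" using proj_space_nonempty[OF sp] by auto
    show "vanishes_at (mvar i * F) p"
    proof (cases "u i = 0")
      case True
      then show ?thesis using vanishes_at_iff[OF sp u form] by (simp add: id_hom.subst_mult)
    next
      case False
      define u' where "u' = scale_vec (inverse (u i)) u"
      have p': "p = proj_point u'"
        using proj_spaceD(1)[OF sp u] proj_point_scale[of "inverse (u i)" u] False by (simp add: u'_def)
      then have u': "u' \<in> p" using proj_point_self by blast
      have "u' i = 1" using False by (simp add: u'_def scale_vec_def)
      then have "subst_mpol id F u' = 0"
        using f p u' assms(2)[of u'] proj_spaceD(3)[OF sp u'] by (auto simp: aff_def)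
      then show ?thesis using vanishes_at_iff[OF sp u' form] by (simp add: id_hom.subst_mult)
    qed
  qed
qed

lemma mvar_i_not_vanishing: "\<not> (\<forall>p\<in>X. vanishes_at (mvar i) p)"
  using \<gamma> v vi unfolding vanishes_at_def by (metis id_hom.subst_mvar zero_neq_one)

lemma aff_prime:
  assumes "aff (f * g)"
  shows "aff f \<or> aff g"
proof -
  obtain d F where F: "form m d F" "\<And>u. u i = 1 \<Longrightarrow> (\<forall>j>m. u j = 0) \<Longrightarrow> subst_mpol id F u = subst_mpol id f u"
    using homogenize[OF i, of f] by blast
  obtain e G where G: "form m e G" "\<And>u. u i = 1 \<Longrightarrow> (\<forall>j>m. u j = 0) \<Longrightarrow> subst_mpol id G u = subst_mpol id g u"
    using homogenize[OF i, of g] by blast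
  have "\<forall>p\<in>X. vanishes_at (mvar i * (F * G)) p"
    using assms aff_form[OF form_mult[OF F(1) G(1)], of "f * g"] F(2) G(2) by (simp add: id_hom.subst_mult)
  then have "\<forall>p\<in>X. vanishes_at ((mvar i * F) * (mvar i * G)) p"
    using i by (auto simp: vanishes_at_def id_hom.subst_mult)
  then show ?thesis
    using irreducible_form_prime[OF _ form_mult[OF form_mvar[OF i] F(1)] form_mult[OF form_mvar[OF i] G(1)]]
      aff_form[OF F] aff_form[OF G] curve_X by (auto simp: proj_curve_def)
qed

definition \<xi> :: "nat \<Rightarrow> 'a mpol" where "\<xi> j = mvar j - cst (v j)"

lemma ev_xi [simp]: "ev (\<xi> j) = 0"
  by (simp add: \<xi>_def)

text \<open>Divisibility by \<open>u\<close> in the local ring of \<open>X\<close> at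
  \<open>\<gamma>\<close>, with the denominator cleared.\<close>

definition div_by :: "'a mpol \<Rightarrow> 'a mpol \<Rightarrow> bool" where
  "div_by u a \<longleftrightarrow> (\<exists>q b. ev q \<noteq> 0 \<and> aff (q * a - u * b))"

lemma div_by_aff: "aff a \<Longrightarrow> div_by u a"
  unfolding div_by_def by (intro exI[of _ 1] exI[of _ 0]) simp

lemma div_by_mult: "div_by u a \<Longrightarrow> div_by u (c * a)"
proof -
  assume "div_by u a"
  then obtain q b where q: "ev q \<noteq> 0" "aff (q * a - u * b)" by (auto simp: div_by_def)
  have "q * (c * a) - u * (c * b) = c * (q * a - u * b)" by (simp add: algebra_simps)
  with q show ?thesis unfolding div_by_def using aff_ops(4)[OF q(2), of c] by metis
qed

lemma div_by_add: "div_by u a \<Longrightarrow> div_by u a' \<Longrightarrow> div_by u (a + a')"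
proof -
  assume "div_by u a" "div_by u a'"
  then obtain q b q' b' where q: "ev q \<noteq> 0" "aff (q * a - u * b)" "ev q' \<noteq> 0" "aff (q' * a' - u * b')"
    by (auto simp: div_by_def)
  have "(q * q') * (a + a') - u * (q' * b + q * b') = q' * (q * a - u * b) + q * (q' * a' - u * b')"
    by (simp add: algebra_simps)
  then have "aff ((q * q') * (a + a') - u * (q' * b + q * b'))" using q aff_ops by simp
  moreover have "ev (q * q') \<noteq> 0" using q by simp
  ultimately show ?thesis unfolding div_by_def by blast
qed

lemma div_by_sum: "(\<And>j. j \<in> J \<Longrightarrow> div_by u (a j)) \<Longrightarrow> div_by u (\<Sum>j\<in>J. a j)"
  by (induction J rule: infinite_finite_induct) (auto intro: div_by_add div_by_aff aff_ops)

lemma div_by_cancel: "ev r \<noteq> 0 \<Longrightarrow> div_by u (r * a) \<Longrightarrow> div_by u a"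
  unfolding div_by_def by (metis (no_types, lifting) ev_simps(6) mult.assoc mult_eq_0_iff)

text \<open>Nakayama's lemma modulo \<open>u\<close> by Gaussian elimination. The pivot
  \<open>Q l - A l l\<close> has nonzero value at \<open>\<gamma>\<close>. Rows are multiplied by
  the pivot rather than divided, which is why general diagonal entries \<open>Q j\<close> are
  allowed.\<close>

lemma nakayama:
  assumes "finite J" "\<And>j. j \<in> J \<Longrightarrow> ev (Q j) \<noteq> 0" "\<And>j k. j \<in> J \<Longrightarrow> k \<in> J \<Longrightarrow> ev (A j k) = 0"
    "\<And>j. j \<in> J \<Longrightarrow> div_by u (Q j * x j - (\<Sum>k\<in>J. A j k * x k))"
  shows "\<forall>j\<in>J. div_by u (x j)"
  using assms
proof (induction J arbitrary: Q A rule: finite_induct)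
  case (insert l J)
  define R where "R = Q l - A l l"
  have R: "ev R \<noteq> 0" using insert.prems by (simp add: R_def)
  have sumJ: "(\<Sum>k\<in>insert l J. A j k * x k) = A j l * x l + (\<Sum>k\<in>J. A j k * x k)" for j
    using insert.hyps by simp
  have "Q l * x l - (A l l * x l + (\<Sum>k\<in>J. A l k * x k)) = R * x l - (\<Sum>k\<in>J. A l k * x k)"
    by (simp add: R_def algebra_simps)
  then have Rl: "div_by u (R * x l - (\<Sum>k\<in>J. A l k * x k))"
    using insert.prems(3)[of l] by (simp only: sumJ insertI1)
  have IH: "\<forall>j\<in>J. div_by u (x j)"
  proof (rule insert.IH[of "\<lambda>j. R * Q j" "\<lambda>j k. R * A j k + A j l * A l k"])
    fix j assume j: "j \<in> J"
    show "ev (R * Q j) \<noteq> 0" using R insert.prems j by simp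
    show "ev (R * A j k + A j l * A l k) = 0" if "k \<in> J" for k using insert.prems j that by simp
    have "div_by u (R * (Q j * x j - (\<Sum>k\<in>insert l J. A j k * x k)) + A j l * (R * x l - (\<Sum>k\<in>J. A l k * x k)))"
      using insert.prems(3)[of j] j by (intro div_by_add div_by_mult Rl) auto
    also have "R * (Q j * x j - (\<Sum>k\<in>insert l J. A j k * x k)) + A j l * (R * x l - (\<Sum>k\<in>J. A l k * x k)) =
        R * Q j * x j - (R * (\<Sum>k\<in>J. A j k * x k) + A j l * (\<Sum>k\<in>J. A l k * x k))"
      unfolding sumJ by (simp add: algebra_simps)
    also have "R * (\<Sum>k\<in>J. A j k * x k) + A j l * (\<Sum>k\<in>J. A l k * x k) = (\<Sum>k\<in>J. (R * A j k + A j l * A l k) * x k)"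
      by (simp add: sum_distrib_left sum.distrib algebra_simps)
    finally show "div_by u (R * Q j * x j - (\<Sum>k\<in>J. (R * A j k + A j l * A l k) * x k))" .
  qed
  then have "div_by u (\<Sum>k\<in>J. A l k * x k)" by (intro div_by_sum div_by_mult) auto
  from div_by_add[OF Rl this] have "div_by u (R * x l)" by simp
  with R have "div_by u (x l)" by (rule div_by_cancel)
  with IH show ?case by simp
qed simp

text \<open>Shows that \<open>unit_vec i\<close>, whose pairing with \<open>v\<close> is
  \<open>1\<close>, lies outside the span of the gradients.\<close>

lemma gradient_orthogonal:
  assumes "F \<in> vanishing_forms m X"
  shows "(\<Sum>j\<le>m. subst_mpol id (partial_deriv j F) v * v j) = 0"
proof -
  from assms obtain d where d: "form m d F" and F: "\<forall>p\<in>X. vanishes_at F p" by (auto simp: vanishing_forms_def)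
  text \<open>Euler's identity\<close>
  define T where "T = (\<lambda>G :: 'a mpol. (\<Sum>j\<le>m. subst_mpol id (partial_deriv j G) v * v j) = of_nat d * subst_mpol id G v)"
  have "T F"
  proof (induction F rule: mpol_induct)
    case zero
    show ?case by (simp add: T_def partial_deriv_zero)
  next
    case (single n c)
    then have n: "Poly_Mapping.keys n \<subseteq> {..m}" "mdeg n = d" using d by (auto simp: form_alt)
    have *: "subst_mpol id (partial_deriv j (Poly_Mapping.single n c)) v * v j =
        of_nat (Poly_Mapping.lookup n j) * (c * mono_eval v n)" for j
    proof (cases "Poly_Mapping.lookup n j = 0")
      case False
      then have "n = (n - Poly_Mapping.single j 1) + Poly_Mapping.single j 1"
        by (intro poly_mapping_eqI) (auto simp: lookup_add lookup_minus lookup_single when_def)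
      then have "mono_eval v n = mono_eval v (n - Poly_Mapping.single j 1) * v j"
        by (metis mono_eval_add mono_eval_single power_one_right)
      then show ?thesis by (simp add: partial_deriv_single id_hom.subst_single)
    qed (simp add: partial_deriv_single)
    have "(\<Sum>j\<le>m. of_nat (Poly_Mapping.lookup n j) :: 'a) = of_nat d"
      using mdeg_superset[of "{..m}" n] n by simp
    then show ?case unfolding T_def * by (simp add: id_hom.subst_single flip: sum_distrib_right)
  next
    case (add A B)
    then show ?case by (simp add: T_def partial_deriv_add id_hom.subst_add distrib_right distrib_left sum.distrib)
  qed
  moreover have "subst_mpol id F v = 0" using F \<gamma> v by (auto simp: vanishes_at_def)
  ultimately show ?thesis by (simp add: T_def)
qed

end

section \<open>Parametrisations at a nonsingular point\<close>

context ns_chart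
begin

lemma xi_eval: "subst_mpol id (\<xi> j) u = u j - v j"
  by (simp add: \<xi>_def id_hom.subst_diff)

lemma aff_xi_i: "aff (\<xi> i)"
  by (simp add: aff_def xi_eval vi)

lemma aff_xi_out: "j > m \<Longrightarrow> aff (\<xi> j)"
  unfolding aff_def xi_eval using v_out X_space proj_spaceD(3) by fastforce

text \<open>The gradients have rank \<open>m - 1\<close>, and \<open>unit_vec i\<close>, expressing
  that \<open>\<xi> i\<close> is zero in the chart, raises it to \<open>m\<close>. One more
  coordinate vector \<open>unit_vec l\<close> completes a basis of the space of dimension
  \<open>m + 1\<close>. Hence each \<open>\<xi> j\<close> is a multiple of \<open>\<xi> l\<close> up
  to second order terms, and these are removed by Nakayama's lemma.\<close>

lemma tangent_coordinate: "\<exists>l\<le>m. \<forall>j. div_by (\<xi> l) (\<xi> j)"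
proof -
  define grad where "grad = (\<lambda>F j. subst_mpol id (partial_deriv j F) v)"
  define W where "W = {grad F | F. F \<in> vanishing_forms m X}"
  define E where "E = (unit_vec ` {..<Suc m} :: (nat \<Rightarrow> 'a) set)"
  have E: "\<not> coord_space.dependent E" "card E = Suc m" "finite E"
    using independent_unit_vecs[of "Suc m", where ?'a = 'a] unfolding E_def by blast+
  have dimW: "coord_space.dim W = m - 1"
    using nonsing \<gamma> v unfolding nonsingular_curve_def W_def grad_def by blast
  have WE: "W \<subseteq> coord_space.span E"
  proof
    fix r assume "r \<in> W"
    then obtain F d where F: "r = grad F" "form m d F" by (auto simp: W_def vanishing_forms_def)
    have "partial_deriv j F = 0" if "j > m" for j
      unfolding partial_deriv_def
    proof (rule sum.neutral, rule ballI)
      fix n assume "n \<in> Poly_Mapping.keys F"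
      then have "Poly_Mapping.keys n \<subseteq> {..m}" using F(2) by (simp add: form_alt)
      then have "j \<notin> Poly_Mapping.keys n" using that by auto
      then show "Poly_Mapping.single (n - Poly_Mapping.single j 1)
          (of_nat (Poly_Mapping.lookup n j) * Poly_Mapping.lookup F n) = 0" by (simp add: in_keys_iff)
    qed
    then show "r \<in> coord_space.span E" unfolding E_def using F(1)
      by (intro sum_unit_vecs) (simp add: grad_def)
  qed
  obtain B where B: "B \<subseteq> W" "\<not> coord_space.dependent B" "W \<subseteq> coord_space.span B" "card B = coord_space.dim W"
    using coord_space.basis_exists by blast
  have bound: "finite S \<and> card S \<le> Suc m" if "\<not> coord_space.dependent S" "S \<subseteq> coord_space.span E" for S
    using coord_space.independent_span_bound[OF E(3) that] E(2) by simp
  have BE: "B \<subseteq> coord_space.span E" using B(1) WE by blast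
  have finB: "finite B" using bound[OF B(2) BE] by simp
  have orth: "(\<Sum>j\<le>m. r j * v j) = 0" if "r \<in> coord_space.span B" for r
    using that
  proof (induction rule: coord_space.span_induct_alt)
    case base show ?case by simp
  next
    case (step c x y)
    then obtain F where "x = grad F" "F \<in> vanishing_forms m X" using B(1) by (auto simp: W_def)
    then have "(\<Sum>j\<le>m. x j * v j) = 0" using gradient_orthogonal by (simp add: grad_def)
    then have "c * (\<Sum>j\<le>m. x j * v j) + (\<Sum>j\<le>m. y j * v j) = 0" using step by simp
    then show ?case by (simp add: scale_vec_def distrib_right sum.distrib sum_distrib_left mult.assoc)
  qed
  have unit_sum: "(\<Sum>k\<le>m. (if k = j then f k else 0)) = f j" if "j \<le> m" for f :: "nat \<Rightarrow> 'b::comm_monoid_add" and j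
    using that by simp
  have "(\<Sum>j\<le>m. unit_vec i j * v j) = 1"
    using unit_sum[OF i, of v] vi by (simp add: unit_vec_def if_distrib[of "\<lambda>c. c * _"] cong: if_cong)
  then have ei: "unit_vec i \<notin> coord_space.span B" using orth[of "unit_vec i"] by auto
  define B1 where "B1 = insert (unit_vec i) B"
  have "unit_vec i \<notin> B" using ei coord_space.span_base by metis
  then have B1: "\<not> coord_space.dependent B1" "card B1 = m" "finite B1"
    using coord_space.independent_insert[of "unit_vec i" B] ei B(2,4) dimW finB m_pos by (auto simp: B1_def)
  have Espan: "unit_vec j \<in> coord_space.span E" if "j \<le> m" for j
    using that coord_space.span_base[of "unit_vec j" E] by (auto simp: E_def)
  have "\<exists>l\<le>m. unit_vec l \<notin> coord_space.span B1"
  proof (rule ccontr)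
    assume "\<not> ?thesis"
    then have "E \<subseteq> coord_space.span B1" by (auto simp: E_def less_Suc_eq_le)
    from coord_space.independent_span_bound[OF B1(3) E(1) this] E(2) B1(2) show False by simp
  qed
  then obtain l where l: "l \<le> m" "unit_vec l \<notin> coord_space.span B1" by auto
  define B2 where "B2 = insert (unit_vec l) B1"
  have "unit_vec l \<notin> B1" using l(2) coord_space.span_base by metis
  then have B2: "\<not> coord_space.dependent B2" "card B2 = Suc m" "finite B2"
    using coord_space.independent_insert[of "unit_vec l" B1] l B1 by (auto simp: B2_def)
  have B2E: "B2 \<subseteq> coord_space.span E" using BE Espan i l(1) by (auto simp: B2_def B1_def)
  have span: "unit_vec j \<in> coord_space.span B2" if j: "j \<le> m" for j
  proof (rule ccontr)
    assume *: "unit_vec j \<notin> coord_space.span B2"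
    then have "unit_vec j \<notin> B2" using coord_space.span_base by metis
    moreover have "\<not> coord_space.dependent (insert (unit_vec j) B2)"
      using coord_space.independent_insert[of "unit_vec j" B2] * B2(1) by auto
    ultimately show False using bound[of "insert (unit_vec j) B2"] B2E Espan[OF j] B2(2,3) by auto
  qed
  \<comment> \<open>\<open>P r \<beta> a\<close> says that the linear form with coefficients
    \<open>r\<close> equals \<open>\<beta>\<close> times \<open>\<xi> l\<close> on the curve, up to
    second order. The vectors admitting this form a subspace, so a basis suffices.\<close>
  define P where "P = (\<lambda>r \<beta> a. (\<forall>k. ev (a k) = 0) \<and>
    aff ((\<Sum>k\<le>m. cst (r k) * \<xi> k) - cst \<beta> * \<xi> l - (\<Sum>k\<le>m. a k * \<xi> k)))"
  define K where "K = {r. \<exists>\<beta> a. P r \<beta> a}"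
  have unit_xi: "(\<Sum>k\<le>m. cst (unit_vec j k) * \<xi> k) = \<xi> j" if "j \<le> m" for j
  proof -
    have "(\<Sum>k\<le>m. cst (unit_vec j k) * \<xi> k) = (\<Sum>k\<le>m. if k = j then \<xi> k else 0)"
      by (intro sum.cong) (auto simp: unit_vec_def)
    then show ?thesis using that by simp
  qed
  have "coord_space.subspace K"
    unfolding coord_space.subspace_def
  proof (intro conjI ballI allI)
    have "P 0 0 (\<lambda>_. 0)" by (simp add: P_def aff_ops)
    then show "0 \<in> K" unfolding K_def by blast
  next
    fix r r' assume "r \<in> K" "r' \<in> K"
    then obtain \<beta> a \<beta>' a' where P: "P r \<beta> a" "P r' \<beta>' a'" by (auto simp: K_def)
    have "P (r + r') (\<beta> + \<beta>') (\<lambda>k. a k + a' k)"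
      using P unfolding P_def
      by (auto simp: single_add distrib_right sum.distrib algebra_simps dest: aff_ops(2))
    then show "r + r' \<in> K" unfolding K_def by blast
  next
    fix c r assume "r \<in> K"
    then obtain \<beta> a where P: "P r \<beta> a" by (auto simp: K_def)
    have "cst c * ((\<Sum>k\<le>m. cst (r k) * \<xi> k) - cst \<beta> * \<xi> l - (\<Sum>k\<le>m. a k * \<xi> k)) =
        (\<Sum>k\<le>m. cst (scale_vec c r k) * \<xi> k) - cst (c * \<beta>) * \<xi> l - (\<Sum>k\<le>m. (cst c * a k) * \<xi> k)"
      by (simp add: scale_vec_def mpol_hom.hom_mult sum_distrib_left right_diff_distrib mult.assoc)
    moreover have "aff (cst c * ((\<Sum>k\<le>m. cst (r k) * \<xi> k) - cst \<beta> * \<xi> l - (\<Sum>k\<le>m. a k * \<xi> k)))"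
      using P by (intro aff_ops(4)) (simp add: P_def)
    ultimately have "P (scale_vec c r) (c * \<beta>) (\<lambda>k. cst c * a k)" using P by (simp add: P_def)
    then show "scale_vec c r \<in> K" unfolding K_def by blast
  qed
  moreover have "B2 \<subseteq> K"
  proof
    fix r assume "r \<in> B2"
    then consider "r \<in> B" | "r = unit_vec i" | "r = unit_vec l" by (auto simp: B2_def B1_def)
    then show "r \<in> K"
    proof cases
      case 1
      then obtain F where F: "r = grad F" "F \<in> vanishing_forms m X" using B(1) by (auto simp: W_def)
      then obtain d where d: "form m d F" "\<forall>p\<in>X. vanishes_at F p" by (auto simp: vanishing_forms_def)
      then have affF: "aff F" by (auto simp: aff_def vanishes_at_def)
      then have evF: "ev F = 0" by (rule aff_ev)
      obtain a where a: "\<And>k. subst_mpol id (a k) v = 0"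
        "F = cst (subst_mpol id F v) + (\<Sum>j\<le>m. cst (subst_mpol id (partial_deriv j F) v) * (mvar j - cst (v j))) +
          (\<Sum>j\<le>m. a j * (mvar j - cst (v j)))"
        using taylor2[OF d(1), of v] by blast
      have F': "F = (\<Sum>j\<le>m. cst (r j) * \<xi> j) + (\<Sum>j\<le>m. a j * \<xi> j)"
        using a(2) evF by (simp add: ev_def F(1) grad_def \<xi>_def)
      have "F = (\<Sum>k\<le>m. cst (r k) * \<xi> k) - cst 0 * \<xi> l - (\<Sum>k\<le>m. (- a k) * \<xi> k)"
        by (subst F') (simp add: sum_negf)
      then have "P r 0 (\<lambda>k. - a k)" using affF a(1) by (simp add: P_def ev_def id_hom.subst_uminus)
      then show ?thesis unfolding K_def by blast
    next
      case 2
      then have "P r 0 (\<lambda>_. 0)" using aff_xi_i by (simp add: P_def unit_xi i)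
      then show ?thesis unfolding K_def by blast
    next
      case 3
      then have "P r 1 (\<lambda>_. 0)" by (simp add: P_def unit_xi l aff_ops)
      then show ?thesis unfolding K_def by blast
    qed
  qed
  ultimately have "coord_space.span B2 \<subseteq> K" by (intro coord_space.span_minimal)
  with span have "\<forall>j\<in>{..m}. \<exists>\<beta> a. P (unit_vec j) \<beta> a" by (auto simp: K_def)
  then obtain \<beta> A where A: "\<And>j. j \<le> m \<Longrightarrow> P (unit_vec j) (\<beta> j) (A j)" by (metis atMost_iff)
  have "\<forall>j\<in>{..m}. div_by (\<xi> l) (\<xi> j)"
  proof (rule nakayama[of _ "\<lambda>_. 1" A])
    fix j assume j: "j \<in> {..m}"
    show "ev (A j k) = 0" for k using A[of j] j by (simp add: P_def)
    have "aff (\<xi> j - cst (\<beta> j) * \<xi> l - (\<Sum>k\<le>m. A j k * \<xi> k))"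
      using A[of j] j by (simp add: P_def unit_xi)
    then have "aff (1 * (1 * \<xi> j - (\<Sum>k\<le>m. A j k * \<xi> k)) - \<xi> l * cst (\<beta> j))"
      by (simp add: algebra_simps)
    then show "div_by (\<xi> l) (1 * \<xi> j - (\<Sum>k\<le>m. A j k * \<xi> k))"
      unfolding div_by_def by (intro exI[of _ 1] exI[of _ "cst (\<beta> j)"]) simp
  qed simp_all
  then have "div_by (\<xi> l) (\<xi> j)" for j
    using div_by_aff[OF aff_xi_out[of j]] by (cases "j \<le> m") auto
  with l(1) show ?thesis by blast
qed

text \<open>The maximal ideal at \<open>v\<close> is generated by the \<open>\<xi> j\<close>, and
  one of them divides all the others.\<close>

lemma uniformizer_exists: "\<exists>l\<le>m. \<forall>a. ev a = 0 \<longrightarrow> div_by (\<xi> l) a"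
proof -
  obtain l where l: "l \<le> m" "\<And>j. div_by (\<xi> l) (\<xi> j)" using tangent_coordinate by blast
  have "div_by (\<xi> l) (a - cst (ev a))" for a
  proof (induction a rule: mpol_var_induct)
    case (const c)
    show ?case by (simp add: div_by_aff aff_ops)
  next
    case (add A B)
    have eq: "A + B - cst (ev (A + B)) = (A - cst (ev A)) + (B - cst (ev B))" by (simp add: single_add)
    show ?case unfolding eq by (rule div_by_add[OF add])
  next
    case (var k n c)
    let ?G = "Poly_Mapping.single n c"
    have "mvar k * ?G - cst (ev (mvar k * ?G)) = mvar k * (?G - cst (ev ?G)) + cst (ev ?G) * \<xi> k"
      by (simp add: \<xi>_def algebra_simps mult_single)
    then show ?case using div_by_add[OF div_by_mult[OF var] div_by_mult[OF l(2)]] by metis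
  qed
  then have "div_by (\<xi> l) a" if "ev a = 0" for a using that by (metis diff_zero single_zero)
  with l(1) show ?thesis by blast
qed

text \<open>The parametrisations of \<open>point_param\<close> normalised to the chart: coordinate
  \<open>i\<close> is the one equal to \<open>1\<close>, and the constant terms form
  \<open>v\<close> itself instead of a multiple.\<close>

definition param :: "(nat \<Rightarrow> 'a fps) \<Rightarrow> bool" where
  "param x \<longleftrightarrow> x i = 1 \<and> (\<forall>j>m. x j = 0) \<and> (\<lambda>j. fps_nth (x j) 0) = v \<and>
     (\<forall>F\<in>vanishing_forms m X. subst_mpol fps_const F x = 0) \<and> (\<exists>j\<le>m. fps_nth (x j) 1 \<noteq> 0)"

lemma param_nth_0: "param x \<Longrightarrow> fps_nth (subst_mpol fps_const f x) 0 = ev f"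
  by (simp add: param_def subst_fps_nth_0 ev_def)

lemma param_unit: "param x \<Longrightarrow> ev q \<noteq> 0 \<Longrightarrow> subst_mpol fps_const q x \<noteq> 0 \<and> subdegree (subst_mpol fps_const q x) = 0"
  using param_nth_0[of x q] by (metis fps_nonzero_nth subdegree_eq_0_iff)

lemma param_aff:
  assumes x: "param x" and f: "aff f"
  shows "subst_mpol fps_const f x = 0"
proof -
  obtain d F where F: "form m d F" "\<forall>x. x i = 1 \<longrightarrow> (\<forall>j>m. x j = 0) \<longrightarrow> subst_mpol id F x = subst_mpol id f x"
    "\<forall>x. x i = 1 \<longrightarrow> (\<forall>j>m. x j = 0) \<longrightarrow> subst_mpol fps_const F x = subst_mpol fps_const f x"
    using homogenize[OF i, of f] by blast
  have "\<forall>p\<in>X. vanishes_at (mvar i * F) p" using aff_form[OF F(1), of f] F(2) f by blast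
  moreover have "form m (1 + d) (mvar i * F)" by (rule form_mult[OF form_mvar[OF i] F(1)])
  ultimately have "mvar i * F \<in> vanishing_forms m X" unfolding vanishing_forms_def by blast
  then have "subst_mpol fps_const (mvar i * F) x = 0" using x by (simp add: param_def)
  then show ?thesis using F(3) x by (simp add: fps_hom.subst_mult param_def)
qed

end

section \<open>Power series expansion along a uniformiser\<close>

locale ns_local = ns_chart m X \<gamma> v i
  for m :: nat and X :: "'a::{alg_closed_field,field_char_0} point set" and \<gamma> v i +
  fixes l :: nat
  assumes l: "l \<le> m" and div_u: "\<And>a. ev a = 0 \<Longrightarrow> div_by (\<xi> l) a"
begin

abbreviation u :: "'a mpol" where "u \<equiv> \<xi> l"

text \<open>Otherwise every \<open>\<xi> j\<close> would vanish on the chart, leaving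
  \<open>\<gamma>\<close> as its only point, and \<open>mvar i\<close> would vanish at the
  infinitely many other points of \<open>X\<close>.\<close>

lemma not_aff_u: "\<not> aff u"
proof
  assume u: "aff u"
  have xi: "aff (\<xi> j)" for j
  proof -
    obtain q b where q: "ev q \<noteq> 0" "aff (q * \<xi> j - u * b)" using div_u[of "\<xi> j"] by (auto simp: div_by_def)
    have "aff (q * \<xi> j)" using aff_ops(2)[OF q(2) aff_ops(5)[OF u, of b]] by simp
    then show ?thesis using aff_prime[of q "\<xi> j"] aff_ev[of q] q(1) by blast
  qed
  have "vanishes_at (mvar i) p" if p: "p \<in> X" "p \<noteq> \<gamma>" for p
  proof (rule ccontr)
    assume nv: "\<not> vanishes_at (mvar i) p"
    have sp: "p \<in> proj_space m" using X_space p by blast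
    then obtain w where w: "w \<in> p" using proj_space_nonempty by blast
    have wi: "w i \<noteq> 0" using nv vanishes_at_iff[OF sp w form_mvar[OF i]] by simp
    define w' where "w' = scale_vec (inverse (w i)) w"
    have pw': "p = proj_point w'"
      using proj_spaceD(1)[OF sp w] proj_point_scale[of "inverse (w i)" w] wi by (simp add: w'_def)
    then have w': "w' \<in> p" using proj_point_self by blast
    have "w' i = 1" using wi by (simp add: w'_def scale_vec_def)
    then have "w' j = v j" for j using xi[of j] p(1) w' by (auto simp: aff_def xi_eval)
    then have "w' = v" by blast
    then have "p = \<gamma>" using pw' proj_spaceD(1)[OF _ v] X_space \<gamma> by blast
    with p(2) show False by simp
  qed
  then have "X - {\<gamma>} \<subseteq> {p \<in> X. vanishes_at (mvar i) p}" by blast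
  moreover have "infinite (X - {\<gamma>})" using infinite_proj_curve[OF curve_X] by simp
  ultimately have "infinite {p \<in> X. vanishes_at (mvar i) p}" using finite_subset by blast
  then show False using form_vanishes_on_curve[OF curve_X form_mvar[OF i]] mvar_i_not_vanishing by blast
qed

lemma aff_u_power: "aff (u ^ n * w) \<Longrightarrow> ev w = 0"
proof (induction n)
  case 0
  then show ?case using aff_ev by simp
next
  case (Suc n)
  then have "aff (u * (u ^ n * w))" by (simp add: mult.assoc)
  then show ?case using aff_prime not_aff_u Suc.IH by blast
qed

definition trunc :: "nat \<Rightarrow> 'a fps \<Rightarrow> 'a mpol" where
  "trunc n s = (\<Sum>k<n. cst (fps_nth s k) * u ^ k)"

text \<open>\<open>s\<close> is the image of \<open>a\<close> in the completed local ring: for every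
  \<open>n\<close> the partial sum agrees with \<open>a\<close> modulo \<open>u ^ n\<close>, after a
  denominator is cleared.\<close>

definition expands :: "'a mpol \<Rightarrow> 'a fps \<Rightarrow> bool" where
  "expands a s \<longleftrightarrow> (\<forall>n. \<exists>q b. ev q \<noteq> 0 \<and> aff (q * (a - trunc n s) - u ^ n * b))"

lemma expands_exists: "\<exists>s. expands a s"
proof -
  have "\<exists>q1 b1. ev q1 \<noteq> 0 \<and> aff (q1 * (b - cst (ev b / ev q) * q) - u * b1)" if "ev q \<noteq> 0" for q b
    using div_u[of "b - cst (ev b / ev q) * q"] that by (simp add: div_by_def)
  then obtain Q1 B1 where step: "\<And>q b. ev q \<noteq> 0 \<Longrightarrow> ev (Q1 q b) \<noteq> 0 \<and>
      aff (Q1 q b * (b - cst (ev b / ev q) * q) - u * B1 q b)" by metis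
  \<comment> \<open>A state \<open>(q, b)\<close> after \<open>n\<close> steps means that the
    remainder is \<open>u ^ n * b / q\<close>. The next coefficient is the value
    \<open>ev b / ev q\<close>, and the rest is divided by \<open>u\<close> again.\<close>
  define st where "st = rec_nat (1, a) (\<lambda>n qb. (Q1 (fst qb) (snd qb) * fst qb, B1 (fst qb) (snd qb)))"
  have st0: "st 0 = (1, a)" and stS: "st (Suc n) = (Q1 (fst (st n)) (snd (st n)) * fst (st n), B1 (fst (st n)) (snd (st n)))" for n
    by (simp_all add: st_def)
  define s where "s = Abs_fps (\<lambda>n. ev (snd (st n)) / ev (fst (st n)))"
  have "ev (fst (st n)) \<noteq> 0 \<and> aff (fst (st n) * (a - trunc n s) - u ^ n * snd (st n))" for n
  proof (induction n)
    case 0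
    show ?case by (simp add: st0 trunc_def aff_ops)
  next
    case (Suc n)
    define q b where "q = fst (st n)" and "b = snd (st n)"
    have IH: "ev q \<noteq> 0" "aff (q * (a - trunc n s) - u ^ n * b)" using Suc by (simp_all add: q_def b_def)
    define q1 b1 where "q1 = Q1 q b" and "b1 = B1 q b"
    have st: "ev q1 \<noteq> 0" "aff (q1 * (b - cst (ev b / ev q) * q) - u * b1)"
      using step[OF IH(1), of b] by (simp_all add: q1_def b1_def)
    have tr: "trunc (Suc n) s = trunc n s + cst (ev b / ev q) * u ^ n"
      by (simp add: trunc_def s_def b_def q_def)
    have "q1 * q * (a - trunc (Suc n) s) - u ^ Suc n * b1 =
        q1 * (q * (a - trunc n s) - u ^ n * b) + u ^ n * (q1 * (b - cst (ev b / ev q) * q) - u * b1)"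
      unfolding tr by (simp add: algebra_simps)
    then have "aff (q1 * q * (a - trunc (Suc n) s) - u ^ Suc n * b1)"
      using IH st by (simp add: aff_ops)
    then show ?case using IH(1) st(1) by (simp add: stS q_def b_def q1_def b1_def)
  qed
  then show ?thesis unfolding expands_def by blast
qed

text \<open>At the first index where two expansions differ, their cross-multiplied difference is
  \<open>u ^ n\<close> times a polynomial with nonzero value, against
  \<open>aff_u_power\<close>.\<close>

lemma expands_unique:
  assumes "expands a s" "expands a s'"
  shows "s = s'"
proof (rule ccontr)
  assume "s \<noteq> s'"
  then have ex: "\<exists>n. fps_nth s n \<noteq> fps_nth s' n" by (auto simp: fps_eq_iff)
  define n where "n = (LEAST n. fps_nth s n \<noteq> fps_nth s' n)"
  have n: "fps_nth s n \<noteq> fps_nth s' n" "\<And>k. k < n \<Longrightarrow> fps_nth s k = fps_nth s' k"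
    unfolding n_def using LeastI_ex[OF ex] not_less_Least by blast+
  obtain q b where q: "ev q \<noteq> 0" "aff (q * (a - trunc (Suc n) s) - u ^ Suc n * b)"
    using assms(1) unfolding expands_def by blast
  obtain q' b' where q': "ev q' \<noteq> 0" "aff (q' * (a - trunc (Suc n) s') - u ^ Suc n * b')"
    using assms(2) unfolding expands_def by blast
  define \<delta> where "\<delta> = fps_nth s n - fps_nth s' n"
  have tr: "trunc (Suc n) s = trunc (Suc n) s' + cst \<delta> * u ^ n"
    by (simp add: trunc_def n(2) \<delta>_def single_diff algebra_simps)
  have "q * (q' * (a - trunc (Suc n) s') - u ^ Suc n * b') - q' * (q * (a - trunc (Suc n) s) - u ^ Suc n * b) =
      u ^ n * (q * q' * cst \<delta> - u * (q * b' - q' * b))"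
    unfolding tr by (simp add: algebra_simps)
  then have "aff (u ^ n * (q * q' * cst \<delta> - u * (q * b' - q' * b)))"
    using q q' by (metis aff_ops(3,4))
  then have "ev (q * q' * cst \<delta> - u * (q * b' - q' * b)) = 0" by (rule aff_u_power)
  then show False using q(1) q'(1) n(1) by (simp add: \<delta>_def)
qed

lemma trunc_add: "trunc n (s + s') = trunc n s + trunc n s'"
  by (simp add: trunc_def single_add distrib_right sum.distrib)

lemma trunc_mult: "\<exists>R. trunc n s * trunc n s' = trunc n (s * s') + u ^ n * R"
proof -
  \<comment> \<open>Truncations are polynomials in one variable evaluated at \<open>u\<close>. The
    product is computed before evaluation, where agreement of the low coefficients is divisibility
    by \<open>monom 1 n\<close>.\<close>
  define \<pi> where "\<pi> = (\<lambda>p :: 'a poly. poly (map_poly cst p) u)"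
  have coeff: "coeff (map_poly cst p) k = cst (coeff p k)" for p :: "'a poly" and k
    by (simp add: coeff_map_poly)
  interpret \<pi>: const_hom \<pi>
  proof
    show "\<pi> (p + q) = \<pi> p + \<pi> q" for p q
    proof -
      have "map_poly cst (p + q) = map_poly cst p + map_poly cst q"
        by (rule poly_eqI) (simp add: coeff single_add)
      then show ?thesis by (simp add: \<pi>_def)
    qed
    show "\<pi> (p * q) = \<pi> p * \<pi> q" for p q
    proof -
      have "map_poly cst (p * q) = map_poly cst p * map_poly cst q"
        by (rule poly_eqI) (simp add: coeff coeff_mult mpol_hom.hom_sum mult_single)
      then show ?thesis by (simp add: \<pi>_def)
    qed
    show "\<pi> 1 = 1" by (simp add: \<pi>_def)
  qed
  have mono: "\<pi> (monom c k) = cst c * u ^ k" for c k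
    by (simp add: \<pi>_def map_poly_monom poly_monom)
  define P where "P = (\<lambda>s :: 'a fps. \<Sum>k<n. monom (fps_nth s k) k)"
  have tr: "trunc n s = \<pi> (P s)" for s by (simp add: trunc_def P_def \<pi>.hom_sum mono)
  have cP: "coeff (P s) k = (if k < n then fps_nth s k else 0)" for s k
    by (simp add: P_def coeff_sum)
  have "coeff (P s * P s' - P (s * s')) k = 0" if "k < n" for k
  proof -
    have "coeff (P s * P s') k = (\<Sum>j\<le>k. fps_nth s j * fps_nth s' (k - j))"
      unfolding coeff_mult by (intro sum.cong) (use that in \<open>auto simp: cP\<close>)
    then show ?thesis using that by (simp add: cP fps_mult_nth atLeast0AtMost)
  qed
  then have "monom 1 n dvd P s * P s' - P (s * s')" by (simp add: monom_1_dvd_iff')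
  then obtain R where "P s * P s' - P (s * s') = monom 1 n * R" by auto
  then have "P s * P s' = P (s * s') + monom 1 n * R" by (simp add: algebra_simps)
  then have "\<pi> (P s) * \<pi> (P s') = \<pi> (P (s * s')) + \<pi> (monom 1 n) * \<pi> R"
    by (simp flip: \<pi>.hom_mult \<pi>.hom_add)
  then show ?thesis unfolding tr by (auto simp: mono)
qed

lemma expands_add:
  assumes "expands a s" "expands a' s'"
  shows "expands (a + a') (s + s')"
  unfolding expands_def
proof
  fix n
  obtain q b q' b' where q: "ev q \<noteq> 0" "aff (q * (a - trunc n s) - u ^ n * b)"
    and q': "ev q' \<noteq> 0" "aff (q' * (a' - trunc n s') - u ^ n * b')"
    using assms unfolding expands_def by metis
  have "(q * q') * (a + a' - trunc n (s + s')) - u ^ n * (q' * b + q * b') =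
      q' * (q * (a - trunc n s) - u ^ n * b) + q * (q' * (a' - trunc n s') - u ^ n * b')"
    by (simp add: trunc_add algebra_simps)
  then have "aff ((q * q') * (a + a' - trunc n (s + s')) - u ^ n * (q' * b + q * b'))"
    using q q' by (simp add: aff_ops)
  moreover have "ev (q * q') \<noteq> 0" using q q' by simp
  ultimately show "\<exists>q b. ev q \<noteq> 0 \<and> aff (q * (a + a' - trunc n (s + s')) - u ^ n * b)" by blast
qed

lemma expands_mult:
  assumes "expands a s" "expands a' s'"
  shows "expands (a * a') (s * s')"
  unfolding expands_def
proof
  fix n
  obtain q b q' b' where q: "ev q \<noteq> 0" "aff (q * (a - trunc n s) - u ^ n * b)"
    and q': "ev q' \<noteq> 0" "aff (q' * (a' - trunc n s') - u ^ n * b')"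
    using assms unfolding expands_def by metis
  obtain R where R: "trunc n s * trunc n s' = trunc n (s * s') + u ^ n * R" using trunc_mult by blast
  have "(q * q') * (a * a' - trunc n (s * s')) - u ^ n * (q' * a' * b + q * trunc n s * b' + q * q' * R) =
      q' * a' * (q * (a - trunc n s) - u ^ n * b) + q * trunc n s * (q' * (a' - trunc n s') - u ^ n * b')
      + q * q' * (trunc n s * trunc n s' - (trunc n (s * s') + u ^ n * R))"
    by (simp add: algebra_simps)
  then have "aff ((q * q') * (a * a' - trunc n (s * s')) - u ^ n * (q' * a' * b + q * trunc n s * b' + q * q' * R))"
    using q q' R by (simp add: aff_ops)
  moreover have "ev (q * q') \<noteq> 0" using q q' by simp
  ultimately show "\<exists>q b. ev q \<noteq> 0 \<and> aff (q * (a * a' - trunc n (s * s')) - u ^ n * b)" by blast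
qed

lemma expands_const: "expands (cst c) (fps_const c)"
  unfolding expands_def
proof
  fix n
  show "\<exists>q b. ev q \<noteq> 0 \<and> aff (q * (cst c - trunc n (fps_const c)) - u ^ n * b)"
  proof (cases n)
    case 0
    then show ?thesis by (intro exI[of _ 1] exI[of _ "cst c"]) (simp add: trunc_def aff_ops)
  next
    case (Suc k)
    then have "trunc n (fps_const c) = cst c"
      by (simp add: trunc_def lessThan_Suc_eq_insert_0 sum.reindex)
    then show ?thesis by (intro exI[of _ 1] exI[of _ 0]) (simp add: aff_ops)
  qed
qed

lemma expands_u: "expands u fps_X"
  unfolding expands_def
proof
  fix n
  consider "n = 0" | "n = 1" | k where "n = Suc (Suc k)" by (metis One_nat_def old.nat.exhaust)
  then show "\<exists>q b. ev q \<noteq> 0 \<and> aff (q * (u - trunc n fps_X) - u ^ n * b)"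
  proof cases
    case 1
    then show ?thesis by (intro exI[of _ 1] exI[of _ u]) (simp add: trunc_def aff_ops)
  next
    case 2
    then show ?thesis by (intro exI[of _ 1] exI[of _ 1]) (simp add: trunc_def aff_ops)
  next
    case 3
    have "trunc n fps_X = (\<Sum>j<n. if j = 1 then u else 0)"
      unfolding trunc_def by (intro sum.cong) auto
    then have "trunc n fps_X = u" using 3 by simp
    then show ?thesis by (intro exI[of _ 1] exI[of _ 0]) (simp add: aff_ops)
  qed
qed

lemma expands_aff:
  assumes "expands a s" "aff (a - a')"
  shows "expands a' s"
  unfolding expands_def
proof
  fix n
  obtain q b where q: "ev q \<noteq> 0" "aff (q * (a - trunc n s) - u ^ n * b)"
    using assms unfolding expands_def by metis
  have eq: "q * (a' - trunc n s) - u ^ n * b = (q * (a - trunc n s) - u ^ n * b) - q * (a - a')"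
    by (simp add: algebra_simps)
  have "aff (q * (a' - trunc n s) - u ^ n * b)"
    unfolding eq by (rule aff_ops(3)[OF q(2) aff_ops(4)[OF assms(2)]])
  with q(1) show "\<exists>q b. ev q \<noteq> 0 \<and> aff (q * (a' - trunc n s) - u ^ n * b)" by blast
qed

lemma expands_nth_0:
  assumes "expands a s"
  shows "fps_nth s 0 = ev a"
proof -
  obtain q b where q: "ev q \<noteq> 0" "aff (q * (a - trunc 1 s) - u ^ 1 * b)"
    using assms unfolding expands_def by blast
  from aff_ev[OF q(2)] q(1) show ?thesis by (simp add: trunc_def)
qed

text \<open>Expansion is multiplicative and sends the ideal of the curve to zero, so the expansions
  of the coordinates satisfy its equations. The uniformiser itself expands to \<open>fps_X\<close>,
  which gives the nonzero linear coefficient.\<close>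

lemma param_exists: "\<exists>x. param x"
proof -
  obtain x where x: "\<And>j. expands (mvar j) (x j)"
    by (rule that[of "\<lambda>j. SOME s. expands (mvar j) s"]) (rule someI_ex[OF expands_exists])
  have sub: "expands F (subst_mpol fps_const F x)" for F
  proof (induction F rule: mpol_var_induct)
    case (const c)
    then show ?case by (simp add: expands_const)
  next
    case (add A B)
    then show ?case by (simp add: fps_hom.subst_add expands_add)
  next
    case (var l n c)
    then show ?case using expands_mult[OF x var] by (simp add: fps_hom.subst_mult)
  qed
  have zero: "expands 0 0" and one: "expands 1 1"
    using expands_const[of 0] expands_const[of 1] by simp_all
  have aff0: "s = 0" if "aff a" "expands a s" for a s
    using expands_aff[OF zero, of a] aff_ops(3)[OF aff_ops(1) that(1)] expands_unique that(2) by blast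
  have "x i = 1"
    using expands_unique[OF expands_aff[OF x[of i], of 1] one] aff_xi_i by (simp add: \<xi>_def vi)
  moreover have "x j = 0" if "j > m" for j
    using aff0[OF _ x[of j]] aff_xi_out[OF that] v_out[OF that] by (simp add: \<xi>_def)
  moreover have "(\<lambda>j. fps_nth (x j) 0) = v" using expands_nth_0[OF x] by auto
  moreover have "subst_mpol fps_const F x = 0" if "F \<in> vanishing_forms m X" for F
  proof (rule aff0[OF _ sub])
    show "aff F" using that by (auto simp: aff_def vanishing_forms_def vanishes_at_def)
  qed
  moreover have "fps_nth (x l) 1 \<noteq> 0"
  proof -
    have "subst_mpol fps_const u x = fps_X" by (rule expands_unique[OF sub expands_u])
    then have "x l = fps_X + fps_const (v l)" by (simp add: \<xi>_def fps_hom.subst_diff algebra_simps)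
    then show ?thesis by simp
  qed
  ultimately show ?thesis using l unfolding param_def by blast
qed

text \<open>Some \<open>\<xi> j\<close> has order one along \<open>x\<close> by definition, and
  \<open>u\<close> divides it in the local ring; since \<open>u\<close> vanishes at
  \<open>\<gamma>\<close>, its order cannot be zero.\<close>

lemma param_subdegree_u:
  assumes x: "param x"
  shows "subst_mpol fps_const u x \<noteq> 0 \<and> subdegree (subst_mpol fps_const u x) = 1"
proof -
  from x obtain j where j: "j \<le> m" "fps_nth (x j) 1 \<noteq> 0" by (auto simp: param_def)
  let ?e = "\<lambda>f. subst_mpol fps_const f x"
  have "?e (\<xi> j) = x j - fps_const (v j)" by (simp add: \<xi>_def fps_hom.subst_diff)
  moreover have "fps_nth (x j) 0 = v j" using x by (auto simp: param_def)
  ultimately have xij: "subdegree (?e (\<xi> j)) = 1" "?e (\<xi> j) \<noteq> 0"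
    using j(2) by (auto intro!: subdegreeI simp: fps_eq_iff intro: exI[of _ 1])
  obtain q b where q: "ev q \<noteq> 0" "aff (q * \<xi> j - u * b)" using div_u[of "\<xi> j"] by (auto simp: div_by_def)
  have eq: "?e q * ?e (\<xi> j) = ?e u * ?e b"
    using param_aff[OF x q(2)] by (simp add: fps_hom.subst_diff fps_hom.subst_mult)
  have q0: "?e q \<noteq> 0" "subdegree (?e q) = 0" using param_unit[OF x q(1)] by auto
  then have "?e u * ?e b \<noteq> 0" using eq xij(2) by (metis no_zero_divisors)
  then have nz: "?e u \<noteq> 0" "?e b \<noteq> 0" by auto
  have "subdegree (?e u) + subdegree (?e b) = 1"
    using arg_cong[OF eq, of subdegree] q0 xij nz by simp
  moreover have "fps_nth (?e u) 0 = 0" using param_nth_0[OF x, of u] by simp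
  then have "subdegree (?e u) \<noteq> 0" using nz(1) by (metis nth_subdegree_nonzero)
  ultimately show ?thesis using nz(1) by simp
qed

text \<open>Factors \<open>u\<close> are divided out until a unit remains. The bound
  \<open>n\<close> is there because an element of the ideal can be divided indefinitely.\<close>

lemma decompose_upto: "(\<exists>e<n. \<exists>q b. ev q \<noteq> 0 \<and> ev b \<noteq> 0 \<and> aff (q * f - u ^ e * b)) \<or>
  (\<exists>q b. ev q \<noteq> 0 \<and> aff (q * f - u ^ n * b))"
proof (induction n)
  case 0
  have "ev 1 \<noteq> 0 \<and> aff (1 * f - u ^ 0 * f)" by (simp add: aff_ops)
  then show ?case by blast
next
  case (Suc n)
  show ?case
  proof (cases "\<exists>e<n. \<exists>q b. ev q \<noteq> 0 \<and> ev b \<noteq> 0 \<and> aff (q * f - u ^ e * b)")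
    case True
    then show ?thesis using less_SucI by blast
  next
    case False
    with Suc obtain q b where q: "ev q \<noteq> 0" "aff (q * f - u ^ n * b)" by blast
    show ?thesis
    proof (cases "ev b = 0")
      case True
      then obtain q1 b1 where q1: "ev q1 \<noteq> 0" "aff (q1 * b - u * b1)"
        using div_u[OF True] by (auto simp: div_by_def)
      have "q1 * q * f - u ^ Suc n * b1 = q1 * (q * f - u ^ n * b) + u ^ n * (q1 * b - u * b1)"
        by (simp add: algebra_simps)
      then have "aff (q1 * q * f - u ^ Suc n * b1)" using q q1 by (simp add: aff_ops)
      moreover have "ev (q1 * q) \<noteq> 0" using q q1 by simp
      ultimately show ?thesis by blast
    qed (use q in blast)
  qed
qed

lemma subdegree_decomposed:
  assumes x: "param x" and q: "ev q \<noteq> 0" "aff (q * f - u ^ e * b)" and f: "subst_mpol fps_const f x \<noteq> 0"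
  shows "e \<le> subdegree (subst_mpol fps_const f x)"
    "ev b \<noteq> 0 \<Longrightarrow> subdegree (subst_mpol fps_const f x) = e"
proof -
  let ?e = "\<lambda>f. subst_mpol fps_const f x"
  have eq: "?e q * ?e f = ?e u ^ e * ?e b"
    using param_aff[OF x q(2)] by (simp add: fps_hom.subst_diff fps_hom.subst_mult fps_hom.subst_power)
  have q0: "?e q \<noteq> 0" "subdegree (?e q) = 0" using param_unit[OF x q(1)] by auto
  then have "?e u ^ e * ?e b \<noteq> 0" using eq f by (metis no_zero_divisors)
  then have b: "?e b \<noteq> 0" by auto
  have s: "subdegree (?e f) = e + subdegree (?e b)"
    using arg_cong[OF eq, of subdegree] q0 b f param_subdegree_u[OF x] by simp
  then show "e \<le> subdegree (?e f)" by simp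
  show "subdegree (?e f) = e" if "ev b \<noteq> 0" using s param_unit[OF x that] by simp
qed

text \<open>A nonzero series bounds the number of divisions by its order.\<close>

lemma decompose:
  assumes x: "param x" and f: "subst_mpol fps_const f x \<noteq> 0"
  shows "\<exists>q b. ev q \<noteq> 0 \<and> ev b \<noteq> 0 \<and> aff (q * f - u ^ subdegree (subst_mpol fps_const f x) * b)"
proof -
  let ?n = "Suc (subdegree (subst_mpol fps_const f x))"
  have "\<not> (\<exists>q b. ev q \<noteq> 0 \<and> aff (q * f - u ^ ?n * b))"
    using subdegree_decomposed(1)[OF x _ _ f, of _ ?n] by fastforce
  with decompose_upto[of ?n f] obtain e q b where "ev q \<noteq> 0" "ev b \<noteq> 0" "aff (q * f - u ^ e * b)" by blast
  with subdegree_decomposed(2)[OF x this(1,3) f this(2)] show ?thesis by blast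
qed

text \<open>The order is the exponent in a decomposition into a power of \<open>u\<close> and a
  unit, which does not mention the parametrisation.\<close>

lemma subdegree_unique:
  assumes x: "param x" and x': "param x'"
  shows "subdegree (subst_mpol fps_const f x) = subdegree (subst_mpol fps_const f x')"
proof -
  have nz: "subst_mpol fps_const f y' \<noteq> 0" if nz: "subst_mpol fps_const f y \<noteq> 0" and y: "param y" "param y'" for y y'
  proof -
    obtain q b where q: "ev q \<noteq> 0" "ev b \<noteq> 0" "aff (q * f - u ^ subdegree (subst_mpol fps_const f y) * b)"
      using decompose[OF y(1) nz] by blast
    have "subst_mpol fps_const q y' * subst_mpol fps_const f y' =
        subst_mpol fps_const u y' ^ subdegree (subst_mpol fps_const f y) * subst_mpol fps_const b y'"
      using param_aff[OF y(2) q(3)] by (simp add: fps_hom.subst_diff fps_hom.subst_mult fps_hom.subst_power)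
    moreover have "\<dots> \<noteq> 0" using param_subdegree_u[OF y(2)] param_unit[OF y(2) q(2)] by simp
    ultimately show ?thesis by auto
  qed
  show ?thesis
  proof (cases "subst_mpol fps_const f x = 0")
    case True
    then show ?thesis using nz[OF _ x' x] by force
  next
    case False
    obtain q b where q: "ev q \<noteq> 0" "ev b \<noteq> 0" "aff (q * f - u ^ subdegree (subst_mpol fps_const f x) * b)"
      using decompose[OF x False] by blast
    from subdegree_decomposed(2)[OF x' q(1,3) nz[OF False x x'] q(2)] show ?thesis by simp
  qed
qed

end

section \<open>Forms vanishing along a parametrisation\<close>

context ns_chart
begin

lemma ns_local_exists: "\<exists>l. ns_local m X \<gamma> v i l"
  using uniformizer_exists ns_chart_axioms unfolding ns_local_def ns_local_axioms_def by blast

text \<open>Otherwise \<open>F\<close> vanishes at finitely many points only, but the polynomials that vanish along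
  \<open>x\<close> have zeros away from any finite set of points, since some coordinate of \<open>x\<close> is not constant.\<close>

lemma param_faithful:
  assumes x: "param x" and F: "form m d F" and Fx: "subst_mpol fps_const F x = 0"
  shows "\<forall>p\<in>X. vanishes_at F p"
proof (rule ccontr)
  assume nv: "\<not> ?thesis"
  define Y where "Y = {p \<in> X. vanishes_at F p}"
  have finY: "finite Y" using form_vanishes_on_curve[OF curve_X F] nv unfolding Y_def by blast
  \<comment> \<open>The zeros of \<open>F\<close> on \<open>X\<close> in the chart, each given by
    its normalised vector. The specialised point will lie in the same chart.\<close>
  define E where "E = {w :: nat \<Rightarrow> 'a. w i = 1 \<and> proj_point w \<in> Y}"
  have "inj_on proj_point E"
  proof (rule inj_onI)
    fix w w' assume w: "w \<in> E" "w' \<in> E" "proj_point w = proj_point w'"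
    then have "w' \<in> proj_point w" using proj_point_self by metis
    then obtain c where c: "w' = scale_vec c w" by (auto simp: proj_point_def)
    with w have "c = 1" by (simp add: E_def scale_vec_def)
    with c show "w = w'" by (simp add: scale_vec_def)
  qed
  moreover have "finite (proj_point ` E)" using finY by (rule rev_finite_subset) (auto simp: E_def)
  ultimately have finE: "finite E" using finite_imageD by blast
  from x obtain j where j: "j \<le> m" "fps_nth (x j) 1 \<noteq> 0" by (auto simp: param_def)
  \<comment> \<open>Nonzero because \<open>x j\<close> is not constant. A specialisation keeping
    \<open>b\<close> nonzero has a \<open>j\<close>-th coordinate different from those of all
    vectors in \<open>E\<close>.\<close>
  define b where "b = (\<Prod>w\<in>E. x j - fps_const (w j))"
  have "x j - fps_const c \<noteq> 0" for c
  proof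
    assume "x j - fps_const c = 0"
    then have "fps_nth (x j - fps_const c) 1 = 0" by simp
    with j(2) show False by simp
  qed
  then have b0: "b \<noteq> 0" using finE by (simp add: b_def)
  let ?R = "range (fps_const :: 'a \<Rightarrow> 'a fps)"
  have R: "sub_ring ?R" unfolding sub_ring_def
    by (auto simp flip: fps_const_1_eq_1)
  have S: "sub_ring (adjoin_list ?R x (Suc m))" by (rule sub_ring_adjoin_list[OF R])
  have bS: "b \<in> adjoin_list ?R x (Suc m)"
    unfolding b_def using finE
  proof (induction E rule: finite_induct)
    case (insert w E)
    have "x j \<in> adjoin_list ?R x (Suc m)" by (rule adjoin_list_gen[OF R]) (simp add: j(1) less_Suc_eq_le)
    moreover have "fps_const (w j) \<in> adjoin_list ?R x (Suc m)" using adjoin_list_mono[OF R, of 0 "Suc m" x] by auto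
    ultimately show ?case using insert by (simp add: sub_ringD[OF S] del: adjoin_list.simps)
  qed (simp add: sub_ringD[OF S] del: adjoin_list.simps)
  obtain a where a: "a \<in> ?R" "a \<noteq> 0" and ext: "\<forall>\<Gamma> :: ('a fps \<times> 'a) set.
    spec_graph \<Gamma> \<longrightarrow> Domain \<Gamma> = ?R \<longrightarrow> (\<forall>c. (a, c) \<in> \<Gamma> \<longrightarrow> c \<noteq> 0) \<longrightarrow>
    (\<exists>\<Gamma>'. spec_graph \<Gamma>' \<and> \<Gamma> \<subseteq> \<Gamma>' \<and> Domain \<Gamma>' = adjoin_list ?R x (Suc m) \<and> (\<forall>e. (b, e) \<in> \<Gamma>' \<longrightarrow> e \<noteq> 0))"
    using specialisation_extend_list[OF R bS b0, where ?'a = 'a] by (elim bexE conjE) (rule that)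
  define \<Gamma>0 where "\<Gamma>0 = range (\<lambda>c :: 'a. (fps_const c, c))"
  have mem\<Gamma>0: "(f, c) \<in> \<Gamma>0 \<longleftrightarrow> f = fps_const c" for f c by (auto simp: \<Gamma>0_def)
  have \<Gamma>0: "spec_graph \<Gamma>0" unfolding spec_graph_def by (simp add: mem\<Gamma>0)
  have dom: "Domain \<Gamma>0 = ?R" by (auto simp: \<Gamma>0_def)
  have "\<forall>c. (a, c) \<in> \<Gamma>0 \<longrightarrow> c \<noteq> 0" using a(2) by (auto simp: mem\<Gamma>0)
  from mp[OF mp[OF mp[OF spec[OF ext] \<Gamma>0] dom] this]
  obtain \<Gamma> where \<Gamma>: "spec_graph \<Gamma>" "\<Gamma>0 \<subseteq> \<Gamma>" "Domain \<Gamma> = adjoin_list ?R x (Suc m)"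
    "\<forall>e. (b, e) \<in> \<Gamma> \<longrightarrow> e \<noteq> 0" by (elim exE conjE) (rule that)
  have "\<exists>c. (x k, c) \<in> \<Gamma>" if "k \<le> m" for k
    using adjoin_list_gen[OF R, of k "Suc m" x] that unfolding \<Gamma>(3)[symmetric] by (simp add: Domain_iff)
  then obtain w0 where w0: "\<And>k. k \<le> m \<Longrightarrow> (x k, w0 k) \<in> \<Gamma>" by metis
  define w where "w = (\<lambda>k. if k \<le> m then w0 k else 0)"
  have w: "(x k, w k) \<in> \<Gamma>" if "k \<le> m" for k using w0 that by (simp add: w_def)
  have const: "(fps_const c, c) \<in> \<Gamma>" for c using \<Gamma>(2) mem\<Gamma>0 by blast
  have "w i = 1" using spec_graph_unique[OF \<Gamma>(1) w[OF i]] const[of 1] x by (simp add: param_def)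
  have van: "subst_mpol id G w = 0" if "form m e G" "subst_mpol fps_const G x = 0" for e G
  proof -
    have "(subst_mpol fps_const G x, subst_mpol id G w) \<in> \<Gamma>"
      by (rule spec_graph_subst[OF \<Gamma>(1) _ _ that(1)]) (rule const, rule w)
    then show ?thesis using that(2) spec_graphD(6)[OF \<Gamma>(1)] by simp
  qed
  have wsp: "proj_point w \<in> proj_space m"
  proof (rule proj_point_in_space)
    show "w \<noteq> 0"
    proof
      assume "w = 0"
      then have "w i = 0" by simp
      with \<open>w i = 1\<close> show False by simp
    qed
  qed (simp add: w_def)
  have "proj_point w \<in> X"
  proof -
    obtain S where S: "\<forall>F\<in>S. \<exists>d. form m d F" "X = {p \<in> proj_space m. \<forall>F\<in>S. vanishes_at F p}"
      using proj_curve_closed[OF curve_X] by (auto simp: proj_closed_def)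
    have "vanishes_at G (proj_point w)" if GS: "G \<in> S" for G
    proof -
      obtain e where e: "form m e G" using S GS by auto
      then have "G \<in> vanishing_forms m X" using S GS by (auto simp: vanishing_forms_def)
      then have "subst_mpol id G w = 0" using van[OF e] x by (simp add: param_def)
      then show ?thesis using vanishes_at_iff[OF wsp proj_point_self e] by simp
    qed
    then show ?thesis using S(2) wsp by blast
  qed
  moreover have "vanishes_at F (proj_point w)"
    using vanishes_at_iff[OF wsp proj_point_self F] van[OF F Fx] by simp
  ultimately have wE: "w \<in> E" using \<open>w i = 1\<close> by (simp add: E_def Y_def)
  have "(b, \<Prod>w'\<in>E. w j - w' j) \<in> \<Gamma>"
    unfolding b_def by (intro spec_graph_prod[OF \<Gamma>(1)] spec_graphD(4)[OF \<Gamma>(1)] w j const)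
  moreover have "(\<Prod>w'\<in>E. w j - w' j) = 0" using finE wE by (auto intro: prod_zero)
  ultimately show False using \<Gamma>(4) by auto
qed

end

section \<open>Rational functions on a nonsingular curve\<close>

text \<open>With coefficients \<open>c ^ k\<close>, the value at a vector is a nonzero polynomial in
  \<open>c\<close>; each point of \<open>S\<close> excludes finitely many \<open>c\<close>, and the
  field is infinite.\<close>

lemma avoiding_form:
  fixes S :: "'a::{field_char_0} point set"
  assumes "finite S" "S \<subseteq> proj_space m"
  shows "\<exists>H. form m 1 H \<and> (\<forall>p\<in>S. \<not> vanishes_at H p)"
proof -
  define H where "H = (\<lambda>c :: 'a. \<Sum>k\<le>m. cst (c ^ k) * mvar k)"
  have H: "form m 1 (H c)" for c
    unfolding H_def using form_mult[OF form_const form_mvar] by (intro form_sum) auto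
  have "finite {c. vanishes_at (H c) p}" if "p \<in> S" for p
  proof -
    have p: "p \<in> proj_space m" using that assms(2) by auto
    obtain v where v: "v \<in> p" using proj_space_nonempty[OF p] by auto
    define P where "P = (\<Sum>k\<le>m. monom (v k) k)"
    obtain k where k: "v k \<noteq> 0" "k \<le> m"
      using proj_spaceD(2,3)[OF p v] by (metis ext leI zero_fun_apply)
    have "coeff P k = v k" using k(2) by (simp add: P_def coeff_sum)
    then have "P \<noteq> 0" using k(1) by auto
    moreover have "subst_mpol id (H c) v = poly P c" for c
      by (simp add: H_def P_def id_hom.subst_sum id_hom.subst_mult poly_sum poly_monom mult.commute)
    ultimately show ?thesis
      using vanishes_at_iff[OF p v H] poly_roots_finite[of P] by simp
  qed
  then have "finite (\<Union>p\<in>S. {c. vanishes_at (H c) p})" using assms(1) by blast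
  then obtain c where "c \<notin> (\<Union>p\<in>S. {c. vanishes_at (H c) p})"
    using infinite_UNIV_char_0[where ?'a = 'a] by (metis ex_new_if_finite)
  then show ?thesis using H[of c] by blast
qed

section \<open>Expansions of forms and their quotients at all points\<close>

context ns_curve
begin

lemma X_nonempty: "X \<noteq> {}"
  using infinite_proj_curve[OF curve_X] by auto

definition van :: "'a mpol \<Rightarrow> bool" where "van F \<longleftrightarrow> (\<forall>p\<in>X. vanishes_at F p)"

lemma van_finite: "form m d F \<Longrightarrow> \<not> van F \<Longrightarrow> finite {p \<in> X. vanishes_at F p}"
  using form_vanishes_on_curve[OF curve_X, of d F] unfolding van_def by blast

lemma van_mult: "form m d F \<Longrightarrow> form m e G \<Longrightarrow> van (F * G) \<longleftrightarrow> van F \<or> van G"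
  using irreducible_form_prime[of m X d F e G] curve_X vanishes_at_mult[of _ m m d F m e G] X_space
  unfolding van_def proj_curve_def by blast

lemma chart_exists: "\<gamma> \<in> X \<Longrightarrow> \<exists>v i. ns_chart m X \<gamma> v i"
proof -
  assume \<gamma>: "\<gamma> \<in> X"
  then have sp: "\<gamma> \<in> proj_space m" using X_space by blast
  then obtain u where u: "u \<in> \<gamma>" using proj_space_nonempty by blast
  obtain i where i: "u i \<noteq> 0" "i \<le> m"
    using proj_spaceD(2,3)[OF sp u] by (metis ext leI zero_fun_apply)
  define v where "v = scale_vec (inverse (u i)) u"
  have "\<gamma> = proj_point v"
    using proj_spaceD(1)[OF sp u] proj_point_scale[of "inverse (u i)" u] i by (simp add: v_def)
  then have "v \<in> \<gamma>" using proj_point_self by blast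
  moreover have "v i = 1" using i by (simp add: v_def scale_vec_def)
  ultimately show ?thesis
    using \<gamma> i(2) ns_curve_axioms unfolding ns_chart_def ns_chart_axioms_def by blast
qed

definition ch_v :: "'a point \<Rightarrow> nat \<Rightarrow> 'a" where "ch_v \<gamma> = fst (SOME vi. ns_chart m X \<gamma> (fst vi) (snd vi))"
definition ch_i :: "'a point \<Rightarrow> nat" where "ch_i \<gamma> = snd (SOME vi. ns_chart m X \<gamma> (fst vi) (snd vi))"

lemma chart: "\<gamma> \<in> X \<Longrightarrow> ns_chart m X \<gamma> (ch_v \<gamma>) (ch_i \<gamma>)"
  unfolding ch_v_def ch_i_def
  by (rule someI_ex[of "\<lambda>vi. ns_chart m X \<gamma> (fst vi) (snd vi)"]) (use chart_exists in auto)

definition prm :: "'a point \<Rightarrow> nat \<Rightarrow> 'a fps" where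
  "prm \<gamma> = (SOME x. ns_chart.param m X (ch_v \<gamma>) (ch_i \<gamma>) x)"

lemma prm: "\<gamma> \<in> X \<Longrightarrow> ns_chart.param m X (ch_v \<gamma>) (ch_i \<gamma>) (prm \<gamma>)"
proof -
  assume "\<gamma> \<in> X"
  then interpret ns_chart m X \<gamma> "ch_v \<gamma>" "ch_i \<gamma>" by (rule chart)
  obtain l where "ns_local m X \<gamma> (ch_v \<gamma>) (ch_i \<gamma>) l" using ns_local_exists by blast
  then interpret ns_local m X \<gamma> "ch_v \<gamma>" "ch_i \<gamma>" l .
  show ?thesis unfolding prm_def by (rule someI_ex[OF param_exists])
qed

definition E :: "'a point \<Rightarrow> 'a mpol \<Rightarrow> 'a fls" where
  "E \<gamma> F = fps_to_fls (subst_mpol fps_const F (prm \<gamma>))"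

lemma E_alt: "E \<gamma> F = subst_mpol fls_const F (\<lambda>j. fps_to_fls (prm \<gamma> j))"
  unfolding E_def by (rule fps_to_fls_subst)

lemma E_ops [simp]: "E \<gamma> 0 = 0" "E \<gamma> 1 = 1" "E \<gamma> (F + G) = E \<gamma> F + E \<gamma> G" "E \<gamma> (F - G) = E \<gamma> F - E \<gamma> G"
  "E \<gamma> (F * G) = E \<gamma> F * E \<gamma> G" "E \<gamma> (F ^ n) = E \<gamma> F ^ n" "E \<gamma> (cst c) = fls_const c"
  by (simp_all add: E_alt fls_hom.subst_add fls_hom.subst_diff fls_hom.subst_mult fls_hom.subst_power)

lemma E_subdegree_ge: "fls_subdegree (E \<gamma> F) \<ge> 0"
  by (simp add: E_def fls_subdegree_fls_to_fps)

lemma E_eq_0_iff: "\<gamma> \<in> X \<Longrightarrow> form m d F \<Longrightarrow> E \<gamma> F = 0 \<longleftrightarrow> van F"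
proof -
  assume \<gamma>: "\<gamma> \<in> X" and F: "form m d F"
  interpret ns_chart m X \<gamma> "ch_v \<gamma>" "ch_i \<gamma>" using \<gamma> by (rule chart)
  have "subst_mpol fps_const F (prm \<gamma>) = 0 \<longleftrightarrow> van F"
  proof
    assume "van F"
    then have "F \<in> vanishing_forms m X" using F by (auto simp: van_def vanishing_forms_def)
    then show "subst_mpol fps_const F (prm \<gamma>) = 0" using prm[OF \<gamma>] by (simp add: param_def)
  qed (use param_faithful[OF prm[OF \<gamma>] F] van_def in blast)
  then show ?thesis by (simp add: E_def)
qed

lemma E_nth_0:
  assumes \<gamma>: "\<gamma> \<in> X" and F: "form m d F"
  shows "fls_nth (E \<gamma> F) 0 = 0 \<longleftrightarrow> vanishes_at F \<gamma>"
proof -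
  interpret ns_chart m X \<gamma> "ch_v \<gamma>" "ch_i \<gamma>" using \<gamma> by (rule chart)
  have "fls_nth (E \<gamma> F) 0 = ev F" using param_nth_0[OF prm[OF \<gamma>]] by (simp add: E_def)
  moreover have "vanishes_at F \<gamma> \<longleftrightarrow> ev F = 0"
    unfolding ev_def by (rule vanishes_at_iff[OF _ v F]) (use X_space \<gamma> in blast)
  ultimately show ?thesis by simp
qed

lemma E_subdegree_pos_iff:
  assumes \<gamma>: "\<gamma> \<in> X" and F: "form m d F" "\<not> van F"
  shows "fls_subdegree (E \<gamma> F) \<noteq> 0 \<longleftrightarrow> vanishes_at F \<gamma>"
proof -
  have "E \<gamma> F \<noteq> 0" using E_eq_0_iff[OF \<gamma> F(1)] F(2) by simp
  then have "fls_nth (E \<gamma> F) 0 = 0 \<longleftrightarrow> fls_subdegree (E \<gamma> F) \<noteq> 0"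
    using E_subdegree_ge[of \<gamma> F] fls_eq0_below_subdegree[of 0 "E \<gamma> F"] nth_fls_subdegree_nonzero
    by (metis antisym_conv1 leI)
  then show ?thesis using E_nth_0[OF \<gamma> F(1)] by simp
qed

definition rep :: "'a mpol \<Rightarrow> 'a mpol \<Rightarrow> bool" where
  "rep F G \<longleftrightarrow> (\<exists>d. form m d F \<and> form m d G) \<and> \<not> van G"

definition quo :: "'a point \<Rightarrow> 'a mpol \<Rightarrow> 'a mpol \<Rightarrow> 'a fls" where
  "quo \<gamma> F G = E \<gamma> F / E \<gamma> G"

lemma rep_E: "rep F G \<Longrightarrow> \<gamma> \<in> X \<Longrightarrow> E \<gamma> G \<noteq> 0"
  using E_eq_0_iff by (auto simp: rep_def)

lemma quo_eq_iff:
  assumes "rep F G" "rep F' G'" "\<gamma> \<in> X"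
  shows "quo \<gamma> F G = quo \<gamma> F' G' \<longleftrightarrow> van (F * G' - F' * G)"
proof -
  from assms obtain d d' where f: "form m d F" "form m d G" "form m d' F'" "form m d' G'" by (auto simp: rep_def)
  then have "form m (d + d') (F * G' - F' * G)"
    using form_mult[OF f(1,4)] form_mult[OF f(3,2)] by (simp add: form_diff add.commute)
  from E_eq_0_iff[OF assms(3) this] show ?thesis
    using rep_E[OF assms(1,3)] rep_E[OF assms(2,3)] by (simp add: quo_def frac_eq_eq)
qed

lemma quo_eq_0_iff:
  assumes "rep F G" "\<gamma> \<in> X"
  shows "quo \<gamma> F G = 0 \<longleftrightarrow> van F"
  using assms E_eq_0_iff[OF assms(2)] rep_E[OF assms] by (auto simp: quo_def rep_def)

lemma rep_add: "rep F G \<Longrightarrow> rep F' G' \<Longrightarrow> rep (F * G' + F' * G) (G * G')"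
  and rep_diff: "rep F G \<Longrightarrow> rep F' G' \<Longrightarrow> rep (F * G' - F' * G) (G * G')"
  and rep_mult: "rep F G \<Longrightarrow> rep F' G' \<Longrightarrow> rep (F * F') (G * G')"
proof -
  assume "rep F G" "rep F' G'"
  then obtain d d' where f: "form m d F" "form m d G" "form m d' F'" "form m d' G'" "\<not> van G" "\<not> van G'"
    by (auto simp: rep_def)
  then have "form m (d + d') (G * G')" "\<not> van (G * G')" "form m (d + d') (F * F')"
    "form m (d + d') (F * G')" "form m (d + d') (F' * G)"
    using form_mult[of m d G d' G'] van_mult[OF f(2,4)] form_mult[of m d F d' F'] form_mult[of m d F d' G']
      form_mult[of m d' F' d G] by (auto simp: add.commute)
  then show "rep (F * G' + F' * G) (G * G')" "rep (F * G' - F' * G) (G * G')" "rep (F * F') (G * G')"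
    unfolding rep_def using form_add form_diff by blast+
qed

lemma quo_ops:
  assumes "rep F G" "rep F' G'" "\<gamma> \<in> X"
  shows "quo \<gamma> (F * G' + F' * G) (G * G') = quo \<gamma> F G + quo \<gamma> F' G'"
    "quo \<gamma> (F * G' - F' * G) (G * G') = quo \<gamma> F G - quo \<gamma> F' G'"
    "quo \<gamma> (F * F') (G * G') = quo \<gamma> F G * quo \<gamma> F' G'"
  using rep_E[OF assms(1,3)] rep_E[OF assms(2,3)] by (simp_all add: quo_def field_simps)

lemma van_cst: "van (cst c) \<longleftrightarrow> c = 0"
proof -
  obtain p where "p \<in> X" using X_nonempty by blast
  then obtain v where "v \<in> p" "p \<in> X" using X_space proj_space_nonempty by blast
  then show ?thesis by (auto simp: van_def vanishes_at_def)
qed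

lemma rep_cst: "rep (cst c) 1"
  unfolding rep_def using van_cst[of 1] by (auto intro: exI[of _ 0])

lemma quo_cst: "quo \<gamma> (cst c) 1 = fls_const c"
  by (simp add: quo_def)

lemma rep_inverse: "rep F G \<Longrightarrow> \<not> van F \<Longrightarrow> rep G F"
  by (auto simp: rep_def)

lemma quo_inverse: "quo \<gamma> G F = inverse (quo \<gamma> F G)"
  by (simp add: quo_def)

section \<open>The function field and its expansions\<close>

definition \<gamma>0 :: "'a point" where "\<gamma>0 = (SOME p. p \<in> X)"

lemma \<gamma>0: "\<gamma>0 \<in> X"
  unfolding \<gamma>0_def using X_nonempty by (simp add: some_in_eq)

definition K :: "'a fls set" where
  "K = {quo \<gamma>0 F G | F G. rep F G}"

definition \<sigma> :: "'a point \<Rightarrow> 'a fls \<Rightarrow> 'a fls" where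
  "\<sigma> \<gamma> f = (let FG = SOME FG. rep (fst FG) (snd FG) \<and> quo \<gamma>0 (fst FG) (snd FG) = f in quo \<gamma> (fst FG) (snd FG))"

lemma \<sigma>_quo:
  assumes "rep F G" "\<gamma> \<in> X"
  shows "\<sigma> \<gamma> (quo \<gamma>0 F G) = quo \<gamma> F G"
proof -
  define FG where "FG = (SOME FG. rep (fst FG) (snd FG) \<and> quo \<gamma>0 (fst FG) (snd FG) = quo \<gamma>0 F G)"
  have FG: "rep (fst FG) (snd FG)" "quo \<gamma>0 (fst FG) (snd FG) = quo \<gamma>0 F G"
    using someI[of "\<lambda>FG. rep (fst FG) (snd FG) \<and> quo \<gamma>0 (fst FG) (snd FG) = quo \<gamma>0 F G" "(F, G)"] assms(1)
    unfolding FG_def by auto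
  then have "van (fst FG * G - F * snd FG)" using quo_eq_iff[OF FG(1) assms(1) \<gamma>0] by simp
  then have "quo \<gamma> (fst FG) (snd FG) = quo \<gamma> F G" using quo_eq_iff[OF FG(1) assms(1,2)] by simp
  then show ?thesis by (simp add: \<sigma>_def FG_def Let_def)
qed

lemma quo_in_K: "rep F G \<Longrightarrow> quo \<gamma>0 F G \<in> K"
  by (auto simp: K_def)

lemma K_elim: "f \<in> K \<Longrightarrow> \<exists>F G. rep F G \<and> f = quo \<gamma>0 F G \<and> (\<forall>\<gamma>\<in>X. \<sigma> \<gamma> f = quo \<gamma> F G)"
  using \<sigma>_quo unfolding K_def by blast

lemma K_add: "f \<in> K \<Longrightarrow> g \<in> K \<Longrightarrow> f + g \<in> K"
  and K_mult: "f \<in> K \<Longrightarrow> g \<in> K \<Longrightarrow> f * g \<in> K"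
  and K_diff: "f \<in> K \<Longrightarrow> g \<in> K \<Longrightarrow> f - g \<in> K"
proof -
  assume "f \<in> K" "g \<in> K"
  then obtain F G F' G' where *: "rep F G" "f = quo \<gamma>0 F G" "rep F' G'" "g = quo \<gamma>0 F' G'"
    by (auto simp: K_def)
  show "f + g \<in> K" "f * g \<in> K" "f - g \<in> K"
    using quo_in_K[OF rep_add[OF *(1,3)]] quo_in_K[OF rep_mult[OF *(1,3)]] quo_in_K[OF rep_diff[OF *(1,3)]]
      quo_ops[OF *(1,3) \<gamma>0] *(2,4) by simp_all
qed

lemma K_const: "fls_const c \<in> K"
  using quo_in_K[OF rep_cst] quo_cst by metis

lemma K_inverse: "f \<in> K \<Longrightarrow> inverse f \<in> K"
proof (cases "f = 0")
  case True
  then show ?thesis using K_const[of 0] by simp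
next
  case False
  assume "f \<in> K"
  then obtain F G where FG: "rep F G" "f = quo \<gamma>0 F G" by (auto simp: K_def)
  then have "\<not> van F" using False quo_eq_0_iff[OF _ \<gamma>0] by auto
  then show ?thesis using FG quo_in_K[OF rep_inverse] quo_inverse by metis
qed

lemma \<sigma>_add: "f \<in> K \<Longrightarrow> g \<in> K \<Longrightarrow> \<gamma> \<in> X \<Longrightarrow> \<sigma> \<gamma> (f + g) = \<sigma> \<gamma> f + \<sigma> \<gamma> g"
  and \<sigma>_mult: "f \<in> K \<Longrightarrow> g \<in> K \<Longrightarrow> \<gamma> \<in> X \<Longrightarrow> \<sigma> \<gamma> (f * g) = \<sigma> \<gamma> f * \<sigma> \<gamma> g"
proof -
  assume f: "f \<in> K" and g: "g \<in> K" and \<gamma>: "\<gamma> \<in> X"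
  from f obtain F G where FG: "rep F G" "f = quo \<gamma>0 F G" "\<And>\<gamma>. \<gamma> \<in> X \<Longrightarrow> \<sigma> \<gamma> f = quo \<gamma> F G"
    using K_elim by blast
  from g obtain F' G' where FG': "rep F' G'" "g = quo \<gamma>0 F' G'" "\<And>\<gamma>. \<gamma> \<in> X \<Longrightarrow> \<sigma> \<gamma> g = quo \<gamma> F' G'"
    using K_elim by blast
  show "\<sigma> \<gamma> (f + g) = \<sigma> \<gamma> f + \<sigma> \<gamma> g"
    using \<sigma>_quo[OF rep_add[OF FG(1) FG'(1)] \<gamma>] quo_ops(1)[OF FG(1) FG'(1) \<gamma>0] quo_ops(1)[OF FG(1) FG'(1) \<gamma>]
      FG(2,3) FG'(2,3) \<gamma> by simp
  show "\<sigma> \<gamma> (f * g) = \<sigma> \<gamma> f * \<sigma> \<gamma> g"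
    using \<sigma>_quo[OF rep_mult[OF FG(1) FG'(1)] \<gamma>] quo_ops(3)[OF FG(1) FG'(1) \<gamma>0] quo_ops(3)[OF FG(1) FG'(1) \<gamma>]
      FG(2,3) FG'(2,3) \<gamma> by simp
qed

lemma \<sigma>_const: "\<gamma> \<in> X \<Longrightarrow> \<sigma> \<gamma> (fls_const c) = fls_const c"
  using \<sigma>_quo[OF rep_cst] quo_cst by metis

lemma finite_support:
  assumes "f \<in> K" "f \<noteq> 0"
  shows "finite {\<gamma> \<in> X. fls_subdegree (\<sigma> \<gamma> f) \<noteq> 0}"
proof -
  from assms(1) obtain F G where FG: "rep F G" "f = quo \<gamma>0 F G" "\<And>\<gamma>. \<gamma> \<in> X \<Longrightarrow> \<sigma> \<gamma> f = quo \<gamma> F G"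
    using K_elim by blast
  then obtain d where d: "form m d F" "form m d G" "\<not> van G" by (auto simp: rep_def)
  have F: "\<not> van F" using FG(1,2) assms(2) quo_eq_0_iff[OF _ \<gamma>0] by auto
  have "{\<gamma> \<in> X. fls_subdegree (\<sigma> \<gamma> f) \<noteq> 0} \<subseteq> {p \<in> X. vanishes_at F p} \<union> {p \<in> X. vanishes_at G p}"
  proof
    fix \<gamma> assume "\<gamma> \<in> {\<gamma> \<in> X. fls_subdegree (\<sigma> \<gamma> f) \<noteq> 0}"
    then have \<gamma>: "\<gamma> \<in> X" "fls_subdegree (quo \<gamma> F G) \<noteq> 0" using FG(3) by auto
    have "E \<gamma> F \<noteq> 0" "E \<gamma> G \<noteq> 0" using E_eq_0_iff[OF \<gamma>(1)] d F by auto
    then have "fls_subdegree (E \<gamma> F) \<noteq> 0 \<or> fls_subdegree (E \<gamma> G) \<noteq> 0"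
      using \<gamma>(2) by (auto simp: quo_def fls_divide_subdegree)
    then show "\<gamma> \<in> {p \<in> X. vanishes_at F p} \<union> {p \<in> X. vanishes_at G p}"
      using E_subdegree_pos_iff[OF \<gamma>(1) d(1) F] E_subdegree_pos_iff[OF \<gamma>(1) d(2,3)] \<gamma>(1) by blast
  qed
  then show ?thesis using van_finite[OF d(1) F] van_finite[OF d(2,3)] finite_subset by blast
qed

text \<open>Some coordinate has a nonzero linear coefficient; subtracting its value times the
  coordinate that equals \<open>1\<close> leaves order exactly one.\<close>

lemma local_order_one:
  assumes "\<gamma> \<in> X"
  shows "\<exists>M. form m 1 M \<and> E \<gamma> M \<noteq> 0 \<and> fls_subdegree (E \<gamma> M) = 1"
proof -
  interpret ns_chart m X \<gamma> "ch_v \<gamma>" "ch_i \<gamma>" using assms by (rule chart)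
  note x = prm[OF assms]
  then obtain j where j: "j \<le> m" "fps_nth (prm \<gamma> j) 1 \<noteq> 0" by (auto simp: param_def)
  define M where "M = mvar j - cst (ch_v \<gamma> j) * mvar (ch_i \<gamma>)"
  have M: "form m 1 M" unfolding M_def
    using form_mvar[OF j(1)] form_mult[OF form_const form_mvar[OF i]] by (intro form_diff) auto
  have s: "subst_mpol fps_const M (prm \<gamma>) = prm \<gamma> j - fps_const (ch_v \<gamma> j)"
    using x by (simp add: M_def fps_hom.subst_diff fps_hom.subst_mult param_def)
  have "fps_nth (prm \<gamma> j) 0 = ch_v \<gamma> j" using x by (auto simp: param_def fun_eq_iff)
  then have "subdegree (prm \<gamma> j - fps_const (ch_v \<gamma> j)) = 1" "prm \<gamma> j - fps_const (ch_v \<gamma> j) \<noteq> 0"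
    using j(2) by (auto intro!: subdegreeI simp: fps_eq_iff intro: exI[of _ 1])
  then have "E \<gamma> M \<noteq> 0 \<and> fls_subdegree (E \<gamma> M) = 1"
    unfolding E_def s fls_subdegree_fls_to_fps fps_to_fls_eq_0_iff by simp
  then show ?thesis using M by blast
qed

lemma E_prod_subdegree:
  "finite I \<Longrightarrow> (\<And>i. i \<in> I \<Longrightarrow> E \<gamma> (F i) \<noteq> 0) \<Longrightarrow>
    E \<gamma> (\<Prod>i\<in>I. F i) \<noteq> 0 \<and> fls_subdegree (E \<gamma> (\<Prod>i\<in>I. F i)) = (\<Sum>i\<in>I. fls_subdegree (E \<gamma> (F i)))"
  by (induction I rule: finite_induct) auto

text \<open>The power of \<open>M\<close> gives order \<open>n\<close> at \<open>\<gamma>\<close>,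
  the linear forms \<open>L \<delta>\<close> vanish at the other points but not at
  \<open>\<gamma>\<close>, and the denominator is a power of a form with no zeros on
  \<open>S\<close>.\<close>

lemma approximation:
  assumes S: "finite S" "S \<subseteq> X" and \<gamma>: "\<gamma> \<in> S"
  shows "\<exists>f\<in>K. f \<noteq> 0 \<and> fls_subdegree (\<sigma> \<gamma> f) = int n \<and> (\<forall>\<delta>\<in>S - {\<gamma>}. fls_subdegree (\<sigma> \<delta> f) \<ge> int N)"
proof -
  have \<gamma>X: "\<gamma> \<in> X" using S \<gamma> by auto
  obtain M where M: "form m 1 M" "E \<gamma> M \<noteq> 0" "fls_subdegree (E \<gamma> M) = 1" using local_order_one[OF \<gamma>X] by blast
  have "\<forall>\<delta>\<in>S - {\<gamma>}. \<exists>L. form m 1 L \<and> vanishes_at L \<delta> \<and> \<not> vanishes_at L \<gamma>"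
    using separating_form[of _ m \<gamma>] S X_space \<gamma>X by blast
  then obtain L where L: "\<And>\<delta>. \<delta> \<in> S - {\<gamma>} \<Longrightarrow> form m 1 (L \<delta>)" "\<And>\<delta>. \<delta> \<in> S - {\<gamma>} \<Longrightarrow> vanishes_at (L \<delta>) \<delta>"
    "\<And>\<delta>. \<delta> \<in> S - {\<gamma>} \<Longrightarrow> \<not> vanishes_at (L \<delta>) \<gamma>" by metis
  obtain H where H: "form m 1 H" "\<And>p. p \<in> S \<Longrightarrow> \<not> vanishes_at H p"
    using avoiding_form[OF S(1), of m] S(2) X_space by blast
  define D where "D = n + (\<Sum>\<delta>\<in>S - {\<gamma>}. N)"
  define F where "F = M ^ n * (\<Prod>\<delta>\<in>S - {\<gamma>}. L \<delta> ^ N)"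
  have "form m (\<Sum>\<delta>\<in>S - {\<gamma>}. N) (\<Prod>\<delta>\<in>S - {\<gamma>}. L \<delta> ^ N)"
  proof (rule form_prod)
    show "form m N (L \<delta> ^ N)" if "\<delta> \<in> S - {\<gamma>}" for \<delta> using form_power[OF L(1)[OF that], of N] by simp
  qed
  then have F: "form m D F" unfolding F_def D_def using form_mult[OF form_power[OF M(1), of n]] by simp
  have HD: "form m D (H ^ D)" using form_power[OF H(1), of D] by simp
  have nvH: "\<not> van H" using H(2)[OF \<gamma>] \<gamma>X by (auto simp: van_def)
  have EH: "E \<delta> H \<noteq> 0" if "\<delta> \<in> X" for \<delta> using E_eq_0_iff[OF that H(1)] nvH by simp
  have subH: "fls_subdegree (E \<delta> H) = 0" if "\<delta> \<in> S" for \<delta>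
    using E_subdegree_pos_iff[OF _ H(1) nvH] H(2)[OF that] S(2) that by blast
  have "\<not> van (H ^ D)" using EH[OF \<gamma>X] E_eq_0_iff[OF \<gamma>X HD] by simp
  then have rep: "rep F (H ^ D)" using F HD by (auto simp: rep_def)
  have nvM: "\<not> van M" using M(2) E_eq_0_iff[OF \<gamma>X M(1)] by simp
  have nvL: "\<not> van (L \<delta>)" if "\<delta> \<in> S - {\<gamma>}" for \<delta> using L(3)[OF that] \<gamma>X by (auto simp: van_def)
  have EL: "E p (L \<delta>) \<noteq> 0" if "p \<in> X" "\<delta> \<in> S - {\<gamma>}" for p \<delta>
    using E_eq_0_iff[OF that(1) L(1)[OF that(2)]] nvL[OF that(2)] by simp
  have EM: "E p M \<noteq> 0" if "p \<in> X" for p using E_eq_0_iff[OF that M(1)] nvM by simp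
  have sub: "quo p F (H ^ D) \<noteq> 0 \<and> fls_subdegree (quo p F (H ^ D)) =
      int n * fls_subdegree (E p M) + (\<Sum>\<delta>\<in>S - {\<gamma>}. int N * fls_subdegree (E p (L \<delta>)))" if p: "p \<in> S" for p
  proof -
    have pX: "p \<in> X" using p S by auto
    have P: "E p (\<Prod>\<delta>\<in>S - {\<gamma>}. L \<delta> ^ N) \<noteq> 0 \<and> fls_subdegree (E p (\<Prod>\<delta>\<in>S - {\<gamma>}. L \<delta> ^ N)) =
        (\<Sum>\<delta>\<in>S - {\<gamma>}. fls_subdegree (E p (L \<delta> ^ N)))"
      by (rule E_prod_subdegree) (use S EL[OF pX] in auto)
    have "fls_subdegree (E p (L \<delta> ^ N)) = int N * fls_subdegree (E p (L \<delta>))" for \<delta>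
      by (simp add: fls_subdegree_pow)
    then show ?thesis using P EM[OF pX] EH[OF pX] subH[OF p]
      by (simp add: quo_def F_def fls_divide_subdegree fls_subdegree_pow)
  qed
  have nonneg: "0 \<le> (\<Sum>\<delta>\<in>S'. int N * fls_subdegree (E p (L \<delta>)))" for p S'
    using E_subdegree_ge by (intro sum_nonneg) auto
  let ?f = "quo \<gamma>0 F (H ^ D)"
  have "?f \<noteq> 0"
    using sub[OF \<gamma>] quo_eq_0_iff[OF rep \<gamma>X] quo_eq_0_iff[OF rep \<gamma>0] by simp
  moreover have "fls_subdegree (\<sigma> \<gamma> ?f) = int n"
  proof -
    have "fls_subdegree (E \<gamma> (L \<delta>)) = 0" if "\<delta> \<in> S - {\<gamma>}" for \<delta>
      using E_subdegree_pos_iff[OF \<gamma>X L(1)[OF that] nvL[OF that]] L(3)[OF that] by simp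
    then show ?thesis using sub[OF \<gamma>] M(3) \<sigma>_quo[OF rep \<gamma>X] by simp
  qed
  moreover have "fls_subdegree (\<sigma> \<delta> ?f) \<ge> int N" if \<delta>: "\<delta> \<in> S - {\<gamma>}" for \<delta>
  proof -
    have \<delta>X: "\<delta> \<in> X" using \<delta> S by auto
    have "fls_subdegree (E \<delta> (L \<delta>)) \<ge> 1"
      using E_subdegree_pos_iff[OF \<delta>X L(1)[OF \<delta>] nvL[OF \<delta>]] L(2)[OF \<delta>] E_subdegree_ge[of \<delta> "L \<delta>"] by linarith
    then have "int N \<le> int N * fls_subdegree (E \<delta> (L \<delta>))" by (simp add: mult_le_cancel_left1)
    also have "\<dots> \<le> (\<Sum>\<epsilon>\<in>S - {\<gamma>}. int N * fls_subdegree (E \<delta> (L \<epsilon>)))"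
      by (rule member_le_sum[OF \<delta>]) (use S E_subdegree_ge in auto)
    also have "\<dots> \<le> fls_subdegree (\<sigma> \<delta> ?f)"
      using sub[of \<delta>] \<delta> \<sigma>_quo[OF rep \<delta>X] E_subdegree_ge[of \<delta> M] by simp
    finally show ?thesis .
  qed
  ultimately show ?thesis using quo_in_K[OF rep] by blast
qed

lemma point_on_X:
  assumes w: "w i = 1" "\<And>j. j > m \<Longrightarrow> w j = 0"
    and "\<And>F d. form m d F \<Longrightarrow> van F \<Longrightarrow> subst_mpol id F w = 0"
  shows "proj_point w \<in> X"
proof -
  have wsp: "proj_point w \<in> proj_space m"
  proof (rule proj_point_in_space[OF _ w(2)])
    show "w \<noteq> 0" using w(1) by (metis zero_fun_apply zero_neq_one)
  qed
  obtain S where S: "\<forall>F\<in>S. \<exists>d. form m d F" "X = {p \<in> proj_space m. \<forall>F\<in>S. vanishes_at F p}"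
    using proj_curve_closed[OF curve_X] by (auto simp: proj_closed_def)
  have "vanishes_at G (proj_point w)" if GS: "G \<in> S" for G
  proof -
    obtain e where e: "form m e G" using S GS by auto
    have "van G" unfolding van_def using S(2) GS by blast
    then show ?thesis using vanishes_at_iff[OF wsp proj_point_self e] assms(3)[OF e] by simp
  qed
  then show ?thesis using S(2) wsp by blast
qed

end

section \<open>Homomorphisms and places\<close>

lemma const_hom_map_poly:
  assumes "const_hom h"
  shows "const_hom (map_poly h)"
proof -
  interpret const_hom h by fact
  have coeff: "coeff (map_poly h p) k = h (coeff p k)" for p k by (simp add: coeff_map_poly hom_zero)
  show ?thesis
    by unfold_locales
      (auto intro!: poly_eqI simp: coeff coeff_mult hom_add hom_sum hom_mult hom_one hom_zero)
qed

lemma const_hom_poly: "const_hom (\<lambda>p. poly p x)"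
  by unfold_locales auto

lemma const_hom_comp: "const_hom h \<Longrightarrow> const_hom k \<Longrightarrow> const_hom (\<lambda>x. k (h x))"
  by (simp add: const_hom_def)

lemma const_hom_fls_const: "const_hom (fls_const :: 'a::comm_ring_1 \<Rightarrow> 'a fls)"
  by (rule fls_hom.const_hom_axioms)

lemma spec_graph_range:
  assumes "const_hom \<theta>" "const_hom \<psi>" "\<And>r. \<theta> r = 0 \<Longrightarrow> r = 0"
  shows "spec_graph (range (\<lambda>r. (\<theta> r, \<psi> r)))"
proof -
  interpret \<theta>: const_hom \<theta> by fact
  interpret \<psi>: const_hom \<psi> by fact
  show ?thesis
    unfolding spec_graph_def
  proof (intro conjI allI impI)
    show "(1, 1) \<in> range (\<lambda>r. (\<theta> r, \<psi> r))" by (rule range_eqI[of _ _ 1]) (simp add: \<theta>.hom_one \<psi>.hom_one)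
    show "c = 0" if "(0, c) \<in> range (\<lambda>r. (\<theta> r, \<psi> r))" for c
    proof -
      from that obtain r where "0 = \<theta> r" "c = \<psi> r" by auto
      then show ?thesis using assms(3)[of r] \<psi>.hom_zero by simp
    qed
  next
    fix b c b' c' assume "(b, c) \<in> range (\<lambda>r. (\<theta> r, \<psi> r))" "(b', c') \<in> range (\<lambda>r. (\<theta> r, \<psi> r))"
    then obtain r r' where r: "b = \<theta> r" "c = \<psi> r" "b' = \<theta> r'" "c' = \<psi> r'" by auto
    show "(b + b', c + c') \<in> range (\<lambda>r. (\<theta> r, \<psi> r))"
      unfolding r by (rule range_eqI[of _ _ "r + r'"]) (simp add: \<theta>.hom_add \<psi>.hom_add)
    show "(b - b', c - c') \<in> range (\<lambda>r. (\<theta> r, \<psi> r))"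
      unfolding r by (rule range_eqI[of _ _ "r - r'"]) (simp add: \<theta>.hom_diff \<psi>.hom_diff)
    show "(b * b', c * c') \<in> range (\<lambda>r. (\<theta> r, \<psi> r))"
      unfolding r by (rule range_eqI[of _ _ "r * r'"]) (simp add: \<theta>.hom_mult \<psi>.hom_mult)
  qed
qed

lemma sub_ring_subst:
  assumes "sub_ring R" "\<And>c. h c \<in> R" "\<And>i. i \<le> m \<Longrightarrow> x i \<in> R" "form m d F"
  shows "subst_mpol h F x \<in> R"
proof -
  have prod: "(\<Prod>i\<in>I. f i) \<in> R" if "\<And>i. i \<in> I \<Longrightarrow> f i \<in> R" for I and f :: "nat \<Rightarrow> _"
    using that by (induction I rule: infinite_finite_induct) (auto intro: sub_ringD[OF assms(1)])
  show ?thesis unfolding subst_mpol_def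
    by (intro sub_ring_sum[OF assms(1)] sub_ringD(5)[OF assms(1)] assms(2) prod sub_ring_power[OF assms(1)] assms(3))
       (use assms(4) in \<open>auto simp: form_alt\<close>)
qed

text \<open>Picks an element of least valuation; dividing homogeneous coordinates by it makes all of
  them finite at the place.\<close>

lemma dominating_element:
  fixes \<Gamma> :: "('b::field \<times> 'a::comm_ring_1) set"
  assumes \<Gamma>: "spec_graph \<Gamma>" and val: "\<And>z. z \<noteq> 0 \<Longrightarrow> (\<exists>c. (z, c) \<in> \<Gamma>) \<or> (inverse z, 0) \<in> \<Gamma>"
    and A: "finite A" "A \<noteq> {}" "\<And>a. a \<in> A \<Longrightarrow> a \<noteq> 0"
  shows "\<exists>b\<in>A. \<forall>a\<in>A. \<exists>c. (inverse b * a, c) \<in> \<Gamma>"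
  using A
proof (induction A rule: finite_ne_induct)
  case (singleton x)
  then show ?case using spec_graphD(1)[OF \<Gamma>] by auto
next
  case (insert x A)
  then obtain b where b: "b \<in> A" "\<forall>a\<in>A. \<exists>c. (inverse b * a, c) \<in> \<Gamma>" by auto
  have nz: "b \<noteq> 0" "x \<noteq> 0" using insert b by auto
  show ?case
  proof (cases "\<exists>c. (inverse b * x, c) \<in> \<Gamma>")
    case True
    with b show ?thesis by auto
  next
    case False
    with val[of "inverse b * x"] nz have bx: "(inverse x * b, 0) \<in> \<Gamma>" by (simp add: mult.commute)
    have "\<exists>c. (inverse x * a, c) \<in> \<Gamma>" if a: "a \<in> insert x A" for a
    proof (cases "a = x")
      case True
      then show ?thesis using nz spec_graphD(1)[OF \<Gamma>] by auto
    next
      case False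
      with a b obtain c where c: "(inverse b * a, c) \<in> \<Gamma>" by auto
      have eq: "(inverse x * b) * (inverse b * a) = inverse x * a" using nz by simp
      show ?thesis using spec_graphD(5)[OF \<Gamma> bx c] unfolding eq by blast
    qed
    then show ?thesis by blast
  qed
qed

context ns_curve
begin

text \<open>A function without poles that is not constant would have a place at which it is infinite;
  the place is centred at a point of the curve, whose local ring is a discrete valuation ring,
  hence contained in the ring of the place.\<close>

lemma no_poles_imp_const:
  assumes f: "f \<in> K" and reg: "\<And>\<gamma>. \<gamma> \<in> X \<Longrightarrow> fls_subdegree (\<sigma> \<gamma> f) \<ge> 0"
  shows "f \<in> range fls_const"
proof (rule ccontr)
  assume nc: "f \<notin> range fls_const"
  then have f0: "f \<noteq> 0" using fls_const_0 by (metis rangeI)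
  define g where "g = inverse f"
  have "g \<notin> range fls_const"
  proof
    assume "g \<in> range fls_const"
    then obtain c where "g = fls_const c" by auto
    then have "f = fls_const (inverse c)" unfolding g_def by (metis fls_inverse_const inverse_inverse_eq)
    with nc show False by simp
  qed
  from exists_place[OF const_hom_fls_const this] obtain \<Gamma> where
    \<Gamma>: "spec_graph \<Gamma>" and const: "\<And>c. (fls_const c, c) \<in> \<Gamma>" and g: "(g, 0) \<in> \<Gamma>"
    and val: "\<And>z. z \<noteq> 0 \<Longrightarrow> (\<exists>c. (z, c) \<in> \<Gamma>) \<or> (inverse z, 0) \<in> \<Gamma>" by blast
  \<comment> \<open>Elements with nonzero value are units of the valuation ring.\<close>
  have unit: "\<exists>c'. (inverse z, c') \<in> \<Gamma> \<and> c * c' = 1" if z: "(z, c) \<in> \<Gamma>" "c \<noteq> 0" for z c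
  proof -
    have "z \<noteq> 0" using z spec_graphD(6)[OF \<Gamma>] by blast
    then have "(\<exists>c'. (inverse z, c') \<in> \<Gamma>) \<or> (z, 0) \<in> \<Gamma>" using val[of "inverse z"] by simp
    then obtain c' where c': "(inverse z, c') \<in> \<Gamma>" using z spec_graph_unique[OF \<Gamma> z(1)] by blast
    from spec_graphD(5)[OF \<Gamma> z(1) c'] \<open>z \<noteq> 0\<close> have "(1, c * c') \<in> \<Gamma>" by simp
    with c' show ?thesis using spec_graph_unique[OF \<Gamma> _ spec_graphD(1)[OF \<Gamma>]] by blast
  qed
  define Xc where "Xc = (\<lambda>j. fps_to_fls (prm \<gamma>0 j))"
  have E_Xc: "E \<gamma>0 F = subst_mpol fls_const F Xc" for F by (simp add: E_alt Xc_def)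
  have base: "ns_chart.param m X (ch_v \<gamma>0) (ch_i \<gamma>0) (prm \<gamma>0)" and ch: "ns_chart m X \<gamma>0 (ch_v \<gamma>0) (ch_i \<gamma>0)"
    using prm[OF \<gamma>0] chart[OF \<gamma>0] by auto
  have Xout: "Xc j = 0" if "j > m" for j
    using base that unfolding ns_chart.param_def[OF ch] by (simp add: Xc_def)
  have "Xc (ch_i \<gamma>0) = 1" "ch_i \<gamma>0 \<le> m"
    using base ns_chart.i[OF ch] unfolding ns_chart.param_def[OF ch] by (simp_all add: Xc_def)
  then have A: "Xc ` {j. j \<le> m \<and> Xc j \<noteq> 0} \<noteq> {}" by force
  have "\<exists>b\<in>Xc ` {j. j \<le> m \<and> Xc j \<noteq> 0}. \<forall>a\<in>Xc ` {j. j \<le> m \<and> Xc j \<noteq> 0}. \<exists>c. (inverse b * a, c) \<in> \<Gamma>"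
    by (rule dominating_element[OF \<Gamma> val _ A]) auto
  then obtain b where b: "b \<in> Xc ` {j. j \<le> m \<and> Xc j \<noteq> 0}"
    "\<forall>a\<in>Xc ` {j. j \<le> m \<and> Xc j \<noteq> 0}. \<exists>c. (inverse b * a, c) \<in> \<Gamma>" ..
  from b(1) obtain i' where i': "i' \<le> m" "Xc i' \<noteq> 0" "b = Xc i'" by blast
  have i'3: "\<exists>c. (inverse (Xc i') * Xc j, c) \<in> \<Gamma>" if "j \<le> m" "Xc j \<noteq> 0" for j
    using bspec[OF b(2), of "Xc j"] that unfolding i'(3) by blast
  note i' = i'(1,2) i'3
  \<comment> \<open>The generic point rescaled by a dominating coordinate. Its residue vector
    \<open>w\<close> is nonzero, as one entry is \<open>1\<close>, and represents the centre of the
    place.\<close>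
  define Y0 where "Y0 = (\<lambda>j. inverse (Xc i') * Xc j)"
  have "\<exists>c. (Y0 j, c) \<in> \<Gamma>" for j
    using i'(3)[of j] Xout[of j] spec_graphD(2)[OF \<Gamma>] by (cases "j \<le> m \<and> Xc j \<noteq> 0") (auto simp: Y0_def)
  then obtain w where w: "\<And>j. (Y0 j, w j) \<in> \<Gamma>" by metis
  have wi: "w i' = 1"
    using w[of i'] i'(2) spec_graph_unique[OF \<Gamma> _ spec_graphD(1)[OF \<Gamma>]] by (simp add: Y0_def)
  have wout: "w j = 0" if "j > m" for j
    using w[of j] Xout[OF that] spec_graphD(6)[OF \<Gamma>] by (simp add: Y0_def)
  have scaleY0: "subst_mpol fls_const F Y0 = inverse (Xc i') ^ d * E \<gamma>0 F" if "form m d F" for F d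
    unfolding Y0_def E_Xc by (rule fls_hom.subst_form_scale[OF that])
  have pX: "proj_point w \<in> X"
  proof (rule point_on_X[of w i', OF wi wout])
    fix F d assume F: "form m d F" "van F"
    have "(subst_mpol fls_const F Y0, subst_mpol id F w) \<in> \<Gamma>"
      by (rule spec_graph_subst_all[OF \<Gamma> const w])
    moreover have "subst_mpol fls_const F Y0 = 0"
      using scaleY0[OF F(1)] E_eq_0_iff[OF \<gamma>0 F(1)] F(2) by simp
    ultimately show "subst_mpol id F w = 0" using spec_graphD(6)[OF \<Gamma>] by simp
  qed
  define p where "p = proj_point w"
  define v i where "v = ch_v p" and "i = ch_i p"
  interpret ns_chart m X p v i unfolding v_def i_def using chart[OF pX] by (simp add: p_def)
  obtain l where "ns_local m X p v i l" using ns_local_exists by blast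
  then interpret ns_local m X p v i l .
  note x = prm[OF pX, folded p_def, folded v_def i_def]
  from v obtain c where c: "v = scale_vec c w" "c \<noteq> 0" by (auto simp: p_def proj_point_def)
  have cw: "c * w i = 1" using vi c(1) by (simp add: scale_vec_def)
  then have "w i \<noteq> 0" by auto
  then have Y0i: "Y0 i \<noteq> 0" using w[of i] spec_graphD(6)[OF \<Gamma>] by metis
  then have Xi: "Xc i \<noteq> 0" by (auto simp: Y0_def)
  obtain c' where c': "(inverse (Y0 i), c') \<in> \<Gamma>" "w i * c' = 1" using unit[OF w \<open>w i \<noteq> 0\<close>] by blast
  have "c' = c" using c'(2) cw by (metis mult.commute mult.left_neutral mult.assoc)
  \<comment> \<open>Rescaled once more to the chart chosen at the centre \<open>p\<close>, so that
    the residues become \<open>v\<close>.\<close>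
  define Y where "Y = (\<lambda>j. inverse (Xc i) * Xc j)"
  have Y: "(Y j, v j) \<in> \<Gamma>" for j
  proof -
    have "Y j = inverse (Y0 i) * Y0 j" using i'(2) Xi by (simp add: Y_def Y0_def)
    then show ?thesis using spec_graphD(5)[OF \<Gamma> c'(1) w[of j]] c(1) \<open>c' = c\<close> by (simp add: scale_vec_def)
  qed
  have Yi: "Y i = 1" and Yout: "\<And>j. j > m \<Longrightarrow> Y j = 0" using Xi Xout by (simp_all add: Y_def)
  let ?e = "\<lambda>a. subst_mpol fls_const a Y"
  have eval: "(?e a, ev a) \<in> \<Gamma>" for a
    unfolding ev_def by (rule spec_graph_subst_all[OF \<Gamma> const Y])
  have scaleY: "?e F = inverse (Xc i) ^ d * E \<gamma>0 F" if "form m d F" for F d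
    unfolding Y_def E_Xc by (rule fls_hom.subst_form_scale[OF that])
  have affY: "?e a = 0" if "aff a" for a
  proof -
    obtain d F where F: "form m d F" "\<forall>x. x i = 1 \<longrightarrow> (\<forall>j>m. x j = 0) \<longrightarrow> subst_mpol id F x = subst_mpol id a x"
      "\<forall>x. x i = 1 \<longrightarrow> (\<forall>j>m. x j = 0) \<longrightarrow> subst_mpol fls_const F x = subst_mpol fls_const a x"
      using homogenize[OF i, of a] by blast
    have "van (mvar i * F)" unfolding van_def using aff_form[OF F(1), of a] F(2) that by blast
    then have "E \<gamma>0 (mvar i * F) = 0" using E_eq_0_iff[OF \<gamma>0 form_mult[OF form_mvar[OF i] F(1)]] by simp
    then have "E \<gamma>0 F = 0" using Xi by (simp add: E_Xc fls_hom.subst_mult)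
    then show ?thesis using scaleY[OF F(1)] F(3) Yi Yout by simp
  qed
  have rel: "?e q * ?e F = ?e u ^ e * ?e b" if "aff (q * F - u ^ e * b)" for q F e b
    using affY[OF that] by (simp add: fls_hom.subst_diff fls_hom.subst_mult fls_hom.subst_power)
  obtain F G where FG: "rep F G" "f = quo \<gamma>0 F G" "\<And>\<gamma>. \<gamma> \<in> X \<Longrightarrow> \<sigma> \<gamma> f = quo \<gamma> F G" using K_elim[OF f] by blast
  then obtain d where d: "form m d F" "form m d G" "\<not> van G" by (auto simp: rep_def)
  have F: "\<not> van F" using FG(1,2) f0 quo_eq_0_iff[OF _ \<gamma>0] by auto
  have nz: "E p F \<noteq> 0" "E p G \<noteq> 0" "E \<gamma>0 G \<noteq> 0"
    using E_eq_0_iff[OF \<gamma> d(1)] E_eq_0_iff[OF \<gamma> d(2)] E_eq_0_iff[OF \<gamma>0 d(2)] F d(3) by auto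
  define e e' where "e = subdegree (subst_mpol fps_const F (prm p))" and "e' = subdegree (subst_mpol fps_const G (prm p))"
  obtain q b where q: "ev q \<noteq> 0" "ev b \<noteq> 0" "aff (q * F - u ^ e * b)"
    using decompose[OF x, of F] nz(1) unfolding e_def by (auto simp: E_def)
  obtain q' b' where q': "ev q' \<noteq> 0" "ev b' \<noteq> 0" "aff (q' * G - u ^ e' * b')"
    using decompose[OF x, of G] nz(2) unfolding e'_def by (auto simp: E_def)
  have "fls_subdegree (\<sigma> p f) = int e - int e'"
    using FG(3)[OF \<gamma>] nz unfolding quo_def E_def e_def e'_def
    by (simp add: fls_divide_subdegree fls_subdegree_fls_to_fps)
  \<comment> \<open>The absence of a pole at \<open>p\<close> gives \<open>f\<close> as a
    nonnegative power of \<open>u\<close> times a unit of the local ring, and both are finite at the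
    place.\<close>
  then have ee': "e' \<le> e" using reg[OF \<gamma>] by simp
  have fY: "f * ?e G = ?e F" using nz(3) by (simp add: FG(2) quo_def scaleY[OF d(1)] scaleY[OF d(2)])
  have nzY: "?e a \<noteq> 0" if "ev a \<noteq> 0" for a using eval[of a] spec_graphD(6)[OF \<Gamma>] that by metis
  have "?e G \<noteq> 0" using nz(3) Xi by (simp add: scaleY[OF d(2)])
  then have "?e q' * ?e G \<noteq> 0" using nzY[OF q'(1)] by simp
  then have u0: "?e u ^ e' \<noteq> 0" unfolding rel[OF q'(3)] by auto
  have "(f * ?e q * ?e b') * ?e u ^ e' = f * ?e q * (?e q' * ?e G)" unfolding rel[OF q'(3)] by (simp add: mult_ac)
  also have "\<dots> = ?e q' * (?e q * ?e F)" by (simp add: mult_ac flip: fY)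
  also have "\<dots> = (?e u ^ (e - e') * ?e b * ?e q') * ?e u ^ e'"
    unfolding rel[OF q(3)] using ee' by (simp add: mult_ac flip: power_add)
  finally have key: "f * ?e q * ?e b' = ?e u ^ (e - e') * ?e b * ?e q'"
    by (simp only: mult_right_cancel[OF u0])
  have "(?e q * ?e b', ev q * ev b') \<in> \<Gamma>" by (rule spec_graphD(5)[OF \<Gamma> eval eval])
  with unit q(1) q'(2) obtain c1 where c1: "(inverse (?e q * ?e b'), c1) \<in> \<Gamma>" by fastforce
  have "(?e u ^ (e - e') * ?e b * ?e q', ev u ^ (e - e') * ev b * ev q') \<in> \<Gamma>"
    by (intro spec_graphD(5)[OF \<Gamma>] spec_graph_power[OF \<Gamma>] eval)
  note prod = spec_graphD(5)[OF \<Gamma> this c1]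
  have "(?e u ^ (e - e') * ?e b * ?e q') * inverse (?e q * ?e b') = f"
    unfolding key[symmetric] using nzY[OF q(1)] nzY[OF q'(2)] by (simp add: field_simps)
  with prod obtain c2 where "(f, c2) \<in> \<Gamma>" by auto
  \<comment> \<open>\<open>f\<close> has a finite value although its inverse has value
    \<open>0\<close>.\<close>
  from spec_graphD(5)[OF \<Gamma> this g] f0 have "(1, 0) \<in> \<Gamma>" by (simp add: g_def)
  then show False using spec_graph_unique[OF \<Gamma> _ spec_graphD(1)[OF \<Gamma>]] by (metis zero_neq_one)
qed

end

text \<open>The value of a polynomial in two variables, \<open>f\<close> replacing the outer and
  \<open>g\<close> the inner variable.\<close>

definition eval2 :: "'a::field fls \<Rightarrow> 'a fls \<Rightarrow> 'a poly poly \<Rightarrow> 'a fls" where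
  "eval2 f g \<Phi> = poly (map_poly (\<lambda>c. poly (map_poly fls_const c) g) \<Phi>) f"

lemma const_hom_eval2: "const_hom (eval2 f g)"
  unfolding eval2_def
  by (intro const_hom_comp[OF _ const_hom_poly] const_hom_map_poly const_hom_fls_const)

lemma eval2_simps:
  "eval2 f g [:0, 1:] = f" "eval2 f g [:[:0, 1:]:] = g" "eval2 f g [:[:c:]:] = fls_const c"
  by (simp_all add: eval2_def map_poly_pCons)

context ns_curve
begin

text \<open>If \<open>f\<close> and \<open>g\<close> were algebraically independent, then for a suitable \<open>d\<close> the value pairs
  \<open>(c, d)\<close> of \<open>(f, g)\<close> would be attained for infinitely many \<open>c\<close>, so that \<open>g\<close> would take the value
  \<open>d\<close> at infinitely many points of the curve.\<close>

lemma algebraically_dependent: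
  assumes f: "f \<in> K" and g: "g \<in> K" "g \<notin> range fls_const"
  shows "\<exists>\<Phi>. \<Phi> \<noteq> 0 \<and> eval2 f g \<Phi> = 0"
proof (rule ccontr)
  assume contra: "\<not> ?thesis"
  then have indep: "eval2 f g \<Phi> = 0 \<Longrightarrow> \<Phi> = 0" for \<Phi> by blast
  define \<psi> where "\<psi> = (\<lambda>d c (\<Phi> :: 'a poly poly). poly (map_poly (\<lambda>q. poly q d) \<Phi>) c)"
  have \<psi>: "const_hom (\<psi> d c)" for d c
    unfolding \<psi>_def by (intro const_hom_comp[OF _ const_hom_poly] const_hom_map_poly const_hom_poly)
  define \<Gamma>2 where "\<Gamma>2 = (\<lambda>d c. range (\<lambda>\<Phi>. (eval2 f g \<Phi>, \<psi> d c \<Phi>)))"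
  have \<Gamma>2: "spec_graph (\<Gamma>2 d c)" for d c
    unfolding \<Gamma>2_def by (rule spec_graph_range[OF const_hom_eval2 \<psi> indep])
  define R where "R = range (eval2 f g)"
  have dom: "Domain (\<Gamma>2 d c) = R" for d c by (auto simp: \<Gamma>2_def R_def)
  have R: "sub_ring R" using sub_ring_Domain[OF \<Gamma>2] dom by metis
  obtain F1 F2 where F: "rep F1 F2" "f = quo \<gamma>0 F1 F2" using f by (auto simp: K_def)
  obtain G1 G2 where G: "rep G1 G2" "g = quo \<gamma>0 G1 G2" using g(1) by (auto simp: K_def)
  obtain d1 where d1: "form m d1 F1" "form m d1 F2" "\<not> van F2" using F(1) by (auto simp: rep_def)
  obtain d2 where d2: "form m d2 G1" "form m d2 G2" "\<not> van G2" using G(1) by (auto simp: rep_def)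
  define Xc where "Xc = (\<lambda>j. fps_to_fls (prm \<gamma>0 j))"
  have E_Xc: "E \<gamma>0 F = subst_mpol fls_const F Xc" for F by (simp add: E_alt Xc_def)
  have base: "ns_chart.param m X (ch_v \<gamma>0) (ch_i \<gamma>0) (prm \<gamma>0)" and ch: "ns_chart m X \<gamma>0 (ch_v \<gamma>0) (ch_i \<gamma>0)"
    using prm[OF \<gamma>0] chart[OF \<gamma>0] by auto
  define i where "i = ch_i \<gamma>0"
  have Xi: "Xc i = 1" "i \<le> m"
    using base ns_chart.i[OF ch] unfolding ns_chart.param_def[OF ch] by (simp_all add: Xc_def i_def)
  have EF: "f * E \<gamma>0 F2 = E \<gamma>0 F1" "E \<gamma>0 F2 \<noteq> 0" and EG: "g * E \<gamma>0 G2 = E \<gamma>0 G1" "E \<gamma>0 G2 \<noteq> 0"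
    using E_eq_0_iff[OF \<gamma>0 d1(2)] d1(3) E_eq_0_iff[OF \<gamma>0 d2(2)] d2(3) F(2) G(2) by (simp_all add: quo_def)
  let ?S = "adjoin_list R Xc (Suc m)"
  have S: "sub_ring ?S" by (rule sub_ring_adjoin_list[OF R])
  have constR: "fls_const c \<in> R" for c unfolding R_def by (metis eval2_simps(3) rangeI)
  have SE: "E \<gamma>0 F \<in> ?S" if "form m d F" for F d
    unfolding E_Xc
  proof (rule sub_ring_subst[OF S _ _ that])
    show "fls_const c \<in> ?S" for c using adjoin_list_mono[OF R, of 0 "Suc m" Xc] constR by (auto simp del: adjoin_list.simps(2))
    show "Xc j \<in> ?S" if "j \<le> m" for j by (rule adjoin_list_gen[OF R]) (simp add: that less_Suc_eq_le)
  qed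
  \<comment> \<open>Keeping \<open>b\<close> nonzero keeps both denominators nonzero at the
    specialised point, where \<open>f\<close> and \<open>g\<close> then take the prescribed
    values.\<close>
  define b where "b = E \<gamma>0 F2 * E \<gamma>0 G2"
  have bS: "b \<in> ?S" unfolding b_def by (rule sub_ringD(5)[OF S SE[OF d1(2)] SE[OF d2(2)]])
  have b0: "b \<noteq> 0" using EF(2) EG(2) by (simp add: b_def)
  obtain a where a: "a \<in> R" "a \<noteq> 0" and ext: "\<forall>\<Gamma> :: ('a fls \<times> 'a) set.
    spec_graph \<Gamma> \<longrightarrow> Domain \<Gamma> = R \<longrightarrow> (\<forall>c. (a, c) \<in> \<Gamma> \<longrightarrow> c \<noteq> 0) \<longrightarrow>
    (\<exists>\<Gamma>'. spec_graph \<Gamma>' \<and> \<Gamma> \<subseteq> \<Gamma>' \<and> Domain \<Gamma>' = ?S \<and> (\<forall>e. (b, e) \<in> \<Gamma>' \<longrightarrow> e \<noteq> 0))"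
    using specialisation_extend_list[OF R bS b0, where ?'a = 'a] by (elim bexE conjE) (rule that)
  obtain \<Phi> where \<Phi>: "a = eval2 f g \<Phi>" using a(1) by (auto simp: R_def)
  have "\<Phi> \<noteq> 0" using a(2) \<Phi> by (auto simp: eval2_def)
  have inf: "\<exists>d. poly Q d \<noteq> 0" if "Q \<noteq> 0" for Q :: "'a poly"
    using poly_roots_finite[OF that] infinite_UNIV_char_0[where ?'a = 'a]
    by (metis (mono_tags, lifting) UNIV_I finite_subset mem_Collect_eq subsetI)
  \<comment> \<open>For this \<open>d\<close> the condition imposed by \<open>a\<close> is a nonzero
    polynomial in \<open>c\<close>, so it excludes only finitely many \<open>c\<close>.\<close>
  obtain d where d: "poly (lead_coeff \<Phi>) d \<noteq> 0" using inf[of "lead_coeff \<Phi>"] \<open>\<Phi> \<noteq> 0\<close> by auto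
  define \<Psi> where "\<Psi> = map_poly (\<lambda>q. poly q d) \<Phi>"
  have "coeff \<Psi> (Polynomial.degree \<Phi>) \<noteq> 0" using d by (simp add: \<Psi>_def coeff_map_poly)
  then have "\<Psi> \<noteq> 0" by auto
  define C where "C = {c. poly \<Psi> c \<noteq> 0}"
  have "finite (- C)" using poly_roots_finite[OF \<open>\<Psi> \<noteq> 0\<close>] by (simp add: C_def Compl_eq)
  then have "infinite C" using infinite_UNIV_char_0[where ?'a = 'a] by (metis Compl_partition finite_UnI)
  have "\<exists>w. w i = 1 \<and> proj_point w \<in> X \<and> vanishes_at (G1 - cst d * G2) (proj_point w) \<and>
      subst_mpol id F2 w \<noteq> 0 \<and> subst_mpol id F1 w = c * subst_mpol id F2 w" if c: "c \<in> C" for c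
  proof -
    have "\<forall>e. (a, e) \<in> \<Gamma>2 d c \<longrightarrow> e \<noteq> 0"
    proof (intro allI impI)
      fix e assume e: "(a, e) \<in> \<Gamma>2 d c"
      have "(a, \<psi> d c \<Phi>) \<in> \<Gamma>2 d c" unfolding \<Gamma>2_def \<Phi> by blast
      then have "e = \<psi> d c \<Phi>" using spec_graph_unique[OF \<Gamma>2 e] by blast
      then show "e \<noteq> 0" using c by (simp add: C_def \<psi>_def \<Psi>_def)
    qed
    from mp[OF mp[OF mp[OF spec[OF ext] \<Gamma>2] dom] this]
    obtain \<Gamma> where \<Gamma>: "spec_graph \<Gamma>" "\<Gamma>2 d c \<subseteq> \<Gamma>" "Domain \<Gamma> = ?S" "\<forall>e. (b, e) \<in> \<Gamma> \<longrightarrow> e \<noteq> 0"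
      by (elim exE conjE) (rule that)
    have in2: "(eval2 f g \<Phi>, \<psi> d c \<Phi>) \<in> \<Gamma>" for \<Phi> using \<Gamma>(2) by (auto simp: \<Gamma>2_def)
    have const: "(fls_const k, k) \<in> \<Gamma>" for k
      using in2[of "[:[:k:]:]"] by (simp add: eval2_simps \<psi>_def map_poly_pCons)
    have fc: "(f, c) \<in> \<Gamma>" using in2[of "[:0, 1:]"] by (simp add: eval2_simps \<psi>_def map_poly_pCons)
    have gd: "(g, d) \<in> \<Gamma>" using in2[of "[:[:0, 1:]:]"] by (simp add: eval2_simps \<psi>_def map_poly_pCons)
    have "\<exists>e. (Xc j, e) \<in> \<Gamma>" if "j \<le> m" for j
      using adjoin_list_gen[OF R, of j "Suc m" Xc] that unfolding \<Gamma>(3)[symmetric] by (simp add: Domain_iff)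
    then obtain w0 where w0: "\<And>j. j \<le> m \<Longrightarrow> (Xc j, w0 j) \<in> \<Gamma>" by metis
    define w where "w = (\<lambda>j. if j \<le> m then w0 j else 0)"
    have w: "(Xc j, w j) \<in> \<Gamma>" if "j \<le> m" for j using w0 that by (simp add: w_def)
    have eval: "(E \<gamma>0 F, subst_mpol id F w) \<in> \<Gamma>" if "form m e F" for F e
      unfolding E_Xc by (rule spec_graph_subst[OF \<Gamma>(1) _ _ that]) (rule const, rule w)
    have wi: "w i = 1" using spec_graph_unique[OF \<Gamma>(1) w[OF Xi(2)]] spec_graphD(1)[OF \<Gamma>(1)] Xi(1) by simp
    have pX: "proj_point w \<in> X"
    proof (rule point_on_X[of w i, OF wi])
      fix F e assume "form m e F" "van F"
      then show "subst_mpol id F w = 0"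
        using eval[of e F] E_eq_0_iff[OF \<gamma>0, of e F] spec_graphD(6)[OF \<Gamma>(1)] by simp
    qed (simp add: w_def)
    have "(b, subst_mpol id F2 w * subst_mpol id G2 w) \<in> \<Gamma>"
      unfolding b_def by (rule spec_graphD(5)[OF \<Gamma>(1) eval[OF d1(2)] eval[OF d2(2)]])
    then have nz: "subst_mpol id F2 w \<noteq> 0" using \<Gamma>(4) by fastforce
    have F1: "subst_mpol id F1 w = c * subst_mpol id F2 w"
      using spec_graphD(5)[OF \<Gamma>(1) fc eval[OF d1(2)]] eval[OF d1(1)] spec_graph_unique[OF \<Gamma>(1)] EF(1) by metis
    have G1: "subst_mpol id G1 w = d * subst_mpol id G2 w"
      using spec_graphD(5)[OF \<Gamma>(1) gd eval[OF d2(2)]] eval[OF d2(1)] spec_graph_unique[OF \<Gamma>(1)] EG(1) by metis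
    have "form m d2 (G1 - cst d * G2)" using form_diff[OF d2(1)] form_mult[OF form_const[of m d] d2(2)] by simp
    then have "vanishes_at (G1 - cst d * G2) (proj_point w)"
      using vanishes_at_iff[OF _ proj_point_self, of w m m d2 "G1 - cst d * G2"] pX X_space G1
      by (auto simp: id_hom.subst_diff id_hom.subst_mult)
    with wi pX nz F1 show ?thesis by blast
  qed
  then obtain w where w: "\<And>c. c \<in> C \<Longrightarrow> w c i = 1" "\<And>c. c \<in> C \<Longrightarrow> proj_point (w c) \<in> X"
    "\<And>c. c \<in> C \<Longrightarrow> vanishes_at (G1 - cst d * G2) (proj_point (w c))"
    "\<And>c. c \<in> C \<Longrightarrow> subst_mpol id F2 (w c) \<noteq> 0 \<and> subst_mpol id F1 (w c) = c * subst_mpol id F2 (w c)" by metis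
  \<comment> \<open>The point determines \<open>c\<close> as the value of
    \<open>F1 / F2\<close>.\<close>
  have "inj_on (\<lambda>c. proj_point (w c)) C"
  proof (rule inj_onI)
    fix c c' assume c: "c \<in> C" "c' \<in> C" "proj_point (w c) = proj_point (w c')"
    then have "w c' \<in> proj_point (w c)" using proj_point_self by metis
    then obtain k where k: "w c' = scale_vec k (w c)" by (auto simp: proj_point_def)
    with w(1)[OF c(1)] w(1)[OF c(2)] have "k = 1" by (simp add: scale_vec_def)
    with k have "w c' = w c" by (simp add: scale_vec_def)
    then show "c = c'" using w(4)[OF c(1)] w(4)[OF c(2)] by simp
  qed
  then have "infinite ((\<lambda>c. proj_point (w c)) ` C)" using \<open>infinite C\<close> finite_imageD by blast
  moreover have "(\<lambda>c. proj_point (w c)) ` C \<subseteq> {p \<in> X. vanishes_at (G1 - cst d * G2) p}" using w by auto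
  ultimately have inf: "infinite {p \<in> X. vanishes_at (G1 - cst d * G2) p}" using finite_subset by blast
  have form: "form m d2 (G1 - cst d * G2)" using form_diff[OF d2(1)] form_mult[OF form_const[of m d] d2(2)] by simp
  have "E \<gamma>0 (G1 - cst d * G2) = 0"
    using E_eq_0_iff[OF \<gamma>0 form] van_finite[OF form] inf by blast
  then have "g * E \<gamma>0 G2 = fls_const d * E \<gamma>0 G2" using EG(1) by simp
  then have "g = fls_const d" using EG(2) by simp
  with g(2) show False by simp
qed

text \<open>Away from the zeros of \<open>mvar i\<close> the quotients of coordinates are regular.
  If all their linear coefficients vanished, every coordinate would be proportional to coordinate
  \<open>i\<close> to first order; the coordinate equal to \<open>1\<close> then makes the linear
  coefficient of coordinate \<open>i\<close> zero, hence all of them.\<close>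

lemma coordinate_differentials:
  "\<exists>\<Xi>\<subseteq>K. finite \<Xi> \<and> finite {\<gamma> \<in> X. \<not> (\<exists>\<xi>\<in>\<Xi>. fls_deriv (\<sigma> \<gamma> \<xi>) \<noteq> 0 \<and> fls_subdegree (fls_deriv (\<sigma> \<gamma> \<xi>)) = 0)}"
proof -
  have ch: "ns_chart m X \<gamma>0 (ch_v \<gamma>0) (ch_i \<gamma>0)" using chart[OF \<gamma>0] .
  define i where "i = ch_i \<gamma>0"
  have i: "i \<le> m" using ns_chart.i[OF ch] by (simp add: i_def)
  note xi = form_mvar[OF i]
  have nv: "\<not> van (mvar i)" unfolding van_def i_def by (rule ns_chart.mvar_i_not_vanishing[OF ch])
  have rep: "rep (mvar j) (mvar i)" if "j \<le> m" for j
    using form_mvar[OF that] xi nv by (auto simp: rep_def)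
  define \<Xi> where "\<Xi> = (\<lambda>j. quo \<gamma>0 (mvar j) (mvar i)) ` {..m}"
  have "\<exists>\<xi>\<in>\<Xi>. fls_deriv (\<sigma> \<gamma> \<xi>) \<noteq> 0 \<and> fls_subdegree (fls_deriv (\<sigma> \<gamma> \<xi>)) = 0"
    if \<gamma>: "\<gamma> \<in> X" "\<not> vanishes_at (mvar i) \<gamma>" for \<gamma>
  proof -
    note chg = chart[OF \<gamma>(1)]
    note x = prm[OF \<gamma>(1), unfolded ns_chart.param_def[OF chg]]
    let ?x = "prm \<gamma>"
    have xi0: "fps_nth (?x i) 0 \<noteq> 0" using E_nth_0[OF \<gamma>(1) xi] \<gamma>(2) by (simp add: E_def)
    then have xi0': "?x i \<noteq> 0" by auto
    define z where "z = (\<lambda>j. ?x j * inverse (?x i))"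
    have xz: "?x j = z j * ?x i" for j using xi0 by (simp add: z_def mult.assoc inverse_mult_eq_1)
    have \<sigma>z: "\<sigma> \<gamma> (quo \<gamma>0 (mvar j) (mvar i)) = fps_to_fls (z j)" if "j \<le> m" for j
    proof -
      have "\<sigma> \<gamma> (quo \<gamma>0 (mvar j) (mvar i)) = fps_to_fls (?x j) / fps_to_fls (?x i)"
        using \<sigma>_quo[OF rep[OF that] \<gamma>(1)] by (simp add: quo_def E_def)
      also have "fps_to_fls (?x j) = fps_to_fls (z j) * fps_to_fls (?x i)" by (subst xz) (simp add: fls_times_fps_to_fls)
      finally show ?thesis using xi0' by simp
    qed
    have x1: "fps_nth (?x j) 1 = fps_nth (z j) 0 * fps_nth (?x i) 1 + fps_nth (z j) 1 * fps_nth (?x i) 0" for j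
      by (subst xz) (simp add: fps_mult_nth)
    have "\<exists>j\<le>m. fps_nth (z j) 1 \<noteq> 0"
    proof (rule ccontr)
      assume "\<not> ?thesis"
      then have z1: "fps_nth (z j) 1 = 0" if "j \<le> m" for j using that by blast
      define k where "k = ch_i \<gamma>"
      have k: "?x k = 1" "k \<le> m" using x ns_chart.i[OF chg] by (auto simp: k_def)
      have "fps_nth (z k) 0 * fps_nth (?x i) 0 = 1"
        using arg_cong[OF xz[of k], of "\<lambda>f. fps_nth f 0"] k(1) by simp
      then have "fps_nth (z k) 0 \<noteq> 0" by auto
      then have "fps_nth (?x i) 1 = 0" using x1[of k] z1[OF k(2)] k(1) by simp
      then have "fps_nth (?x j) 1 = 0" if "j \<le> m" for j using x1[of j] z1[OF that] by simp
      with x show False by auto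
    qed
    then obtain j where j: "j \<le> m" "fps_nth (z j) 1 \<noteq> 0" by auto
    have "fps_nth (fps_deriv (z j)) 0 \<noteq> 0" using j(2) by simp
    then have "fps_deriv (z j) \<noteq> 0" "subdegree (fps_deriv (z j)) = 0"
      unfolding subdegree_eq_0_iff by (metis fps_zero_nth, blast)
    then have "fls_deriv (fps_to_fls (z j)) \<noteq> 0 \<and> fls_subdegree (fls_deriv (fps_to_fls (z j))) = 0"
      by (simp add: fls_deriv_fps_to_fls fls_subdegree_fls_to_fps)
    moreover have "quo \<gamma>0 (mvar j) (mvar i) \<in> \<Xi>" using j(1) by (simp add: \<Xi>_def)
    ultimately show ?thesis unfolding \<sigma>z[OF j(1), symmetric] by blast
  qed
  then have "{\<gamma> \<in> X. \<not> (\<exists>\<xi>\<in>\<Xi>. fls_deriv (\<sigma> \<gamma> \<xi>) \<noteq> 0 \<and> fls_subdegree (fls_deriv (\<sigma> \<gamma> \<xi>)) = 0)} \<subseteq>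
      {p \<in> X. vanishes_at (mvar i) p}" by blast
  then have "finite {\<gamma> \<in> X. \<not> (\<exists>\<xi>\<in>\<Xi>. fls_deriv (\<sigma> \<gamma> \<xi>) \<noteq> 0 \<and> fls_subdegree (fls_deriv (\<sigma> \<gamma> \<xi>)) = 0)}"
    using van_finite[OF xi nv] finite_subset by blast
  moreover have "\<Xi> \<subseteq> K" using quo_in_K[OF rep] by (auto simp: \<Xi>_def)
  moreover have "finite \<Xi>" by (simp add: \<Xi>_def)
  ultimately show ?thesis by blast
qed

end

section \<open>Fields of functions with places\<close>

definition fls_scale :: "'a::field \<Rightarrow> 'a fls \<Rightarrow> 'a fls" where
  "fls_scale c f = fls_const c * f"

interpretation fls_space: vector_space fls_scale
  by unfold_locales (auto simp: fls_scale_def algebra_simps fls_plus_const[symmetric])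

lemma fls_sum_nonzero:
  fixes g :: "'i \<Rightarrow> 'a::field fls"
  assumes "finite I" "i \<in> I" "g i \<noteq> 0"
    and "\<And>j. j \<in> I \<Longrightarrow> j \<noteq> i \<Longrightarrow> g j = 0 \<or> fls_subdegree (g j) > fls_subdegree (g i)"
  shows "(\<Sum>j\<in>I. g j) \<noteq> 0"
proof -
  let ?n = "fls_subdegree (g i)"
  have "fls_nth (\<Sum>j\<in>I. g j) ?n = (\<Sum>j\<in>I. if j = i then fls_nth (g i) ?n else 0)"
    unfolding fls_nth_sum
  proof (rule sum.cong[OF refl])
    fix j assume "j \<in> I"
    then show "fls_nth (g j) ?n = (if j = i then fls_nth (g i) ?n else 0)"
      using assms(4)[of j] by (cases "j = i") (auto simp: fls_eq0_below_subdegree)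
  qed
  also have "\<dots> = fls_nth (g i) ?n" using assms(1,2) by simp
  finally have "fls_nth (\<Sum>j\<in>I. g j) ?n \<noteq> 0" using assms(3) by simp
  then show ?thesis by auto
qed

text \<open>For infinite support the sum is the empty multiset, hence the finiteness assumption in
  \<open>count_fun_mset\<close>.\<close>

definition fun_mset :: "'p set \<Rightarrow> ('p \<Rightarrow> nat) \<Rightarrow> 'p multiset" where
  "fun_mset P n = (\<Sum>\<gamma> | \<gamma> \<in> P \<and> n \<gamma> \<noteq> 0. replicate_mset (n \<gamma>) \<gamma>)"

lemma count_fun_mset:
  assumes "finite {\<gamma> \<in> P. n \<gamma> \<noteq> 0}"
  shows "count (fun_mset P n) \<gamma> = (if \<gamma> \<in> P then n \<gamma> else 0)"
proof -
  have "count (fun_mset P n) \<gamma> = (\<Sum>\<delta> | \<delta> \<in> P \<and> n \<delta> \<noteq> 0. if \<delta> = \<gamma> then n \<gamma> else 0)"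
    unfolding fun_mset_def count_sum by (intro sum.cong) auto
  then show ?thesis using assms by (auto simp: sum.delta)
qed

lemma size_fun_mset: "size (fun_mset P n) = (\<Sum>\<gamma> | \<gamma> \<in> P \<and> n \<gamma> \<noteq> 0. n \<gamma>)"
  by (simp add: fun_mset_def size_multiset_sum)

text \<open>Collects the facts about functions on which divisors, linear series and differentials
  rest. The places are abstract points, and each \<open>\<sigma> \<gamma>\<close> is an embedding of
  \<open>K\<close> over the constants.\<close>

locale places =
  fixes K :: "'a::{alg_closed_field,field_char_0} fls set" and P :: "'p set" and \<sigma> :: "'p \<Rightarrow> 'a fls \<Rightarrow> 'a fls"
  assumes K_const: "fls_const c \<in> K"
    and K_add: "f \<in> K \<Longrightarrow> g \<in> K \<Longrightarrow> f + g \<in> K"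
    and K_mult: "f \<in> K \<Longrightarrow> g \<in> K \<Longrightarrow> f * g \<in> K"
    and K_inverse: "f \<in> K \<Longrightarrow> inverse f \<in> K"
    and \<sigma>_add: "f \<in> K \<Longrightarrow> g \<in> K \<Longrightarrow> \<gamma> \<in> P \<Longrightarrow> \<sigma> \<gamma> (f + g) = \<sigma> \<gamma> f + \<sigma> \<gamma> g"
    and \<sigma>_mult: "f \<in> K \<Longrightarrow> g \<in> K \<Longrightarrow> \<gamma> \<in> P \<Longrightarrow> \<sigma> \<gamma> (f * g) = \<sigma> \<gamma> f * \<sigma> \<gamma> g"
    and \<sigma>_const: "\<gamma> \<in> P \<Longrightarrow> \<sigma> \<gamma> (fls_const c) = fls_const c"
    and finite_support: "f \<in> K \<Longrightarrow> f \<noteq> 0 \<Longrightarrow> finite {\<gamma> \<in> P. fls_subdegree (\<sigma> \<gamma> f) \<noteq> 0}"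
    and no_poles: "f \<in> K \<Longrightarrow> (\<And>\<gamma>. \<gamma> \<in> P \<Longrightarrow> fls_subdegree (\<sigma> \<gamma> f) \<ge> 0) \<Longrightarrow> f \<in> range fls_const"
    and approximation: "finite S \<Longrightarrow> S \<subseteq> P \<Longrightarrow> \<gamma> \<in> S \<Longrightarrow> \<exists>f\<in>K. f \<noteq> 0 \<and> fls_subdegree (\<sigma> \<gamma> f) = int n \<and>
      (\<forall>\<delta>\<in>S - {\<gamma>}. fls_subdegree (\<sigma> \<delta> f) \<ge> int N)"
    and algebraically_dependent: "f \<in> K \<Longrightarrow> g \<in> K \<Longrightarrow> g \<notin> range fls_const \<Longrightarrow> \<exists>\<Phi>. \<Phi> \<noteq> 0 \<and> eval2 f g \<Phi> = 0"
    and coordinate_differentials: "\<exists>\<Xi>\<subseteq>K. finite \<Xi> \<and> finite {\<gamma> \<in> P.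
      \<not> (\<exists>\<xi>\<in>\<Xi>. fls_deriv (\<sigma> \<gamma> \<xi>) \<noteq> 0 \<and> fls_subdegree (fls_deriv (\<sigma> \<gamma> \<xi>)) = 0)}"
begin

section \<open>Orders of functions\<close>

definition v :: "'p \<Rightarrow> 'a fls \<Rightarrow> int" where "v \<gamma> f = fls_subdegree (\<sigma> \<gamma> f)"

lemma K_0 [simp]: "0 \<in> K" and K_1 [simp]: "1 \<in> K"
  using K_const[of 0] K_const[of 1] by simp_all

lemma K_uminus: "f \<in> K \<Longrightarrow> - f \<in> K"
  using K_mult[OF K_const[of "- 1"], of f] by simp

lemma K_diff: "f \<in> K \<Longrightarrow> g \<in> K \<Longrightarrow> f - g \<in> K"
  using K_add[OF _ K_uminus, of f g] by simp

lemma K_power: "f \<in> K \<Longrightarrow> f ^ n \<in> K"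
  by (induction n) (auto intro: K_mult)

lemma K_sum: "(\<And>i. i \<in> I \<Longrightarrow> f i \<in> K) \<Longrightarrow> (\<Sum>i\<in>I. f i) \<in> K"
  by (induction I rule: infinite_finite_induct) (auto intro: K_add)

lemma K_divide: "f \<in> K \<Longrightarrow> g \<in> K \<Longrightarrow> f / g \<in> K"
  by (simp add: divide_inverse K_mult K_inverse)

lemma K_scale: "f \<in> K \<Longrightarrow> fls_scale c f \<in> K"
  by (simp add: fls_scale_def K_mult K_const)

lemma K_poly: "f \<in> K \<Longrightarrow> (\<And>i. coeff p i \<in> K) \<Longrightarrow> poly p f \<in> K"
  unfolding poly_altdef by (intro K_sum K_mult K_power)

lemma \<sigma>_0 [simp]: "\<gamma> \<in> P \<Longrightarrow> \<sigma> \<gamma> 0 = 0" and \<sigma>_1 [simp]: "\<gamma> \<in> P \<Longrightarrow> \<sigma> \<gamma> 1 = 1"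
  using \<sigma>_const[of \<gamma> 0] \<sigma>_const[of \<gamma> 1] by simp_all

lemma \<sigma>_uminus: "f \<in> K \<Longrightarrow> \<gamma> \<in> P \<Longrightarrow> \<sigma> \<gamma> (- f) = - \<sigma> \<gamma> f"
  using \<sigma>_add[of f "- f" \<gamma>] by (simp add: K_uminus eq_neg_iff_add_eq_0 add.commute)

lemma \<sigma>_diff: "f \<in> K \<Longrightarrow> g \<in> K \<Longrightarrow> \<gamma> \<in> P \<Longrightarrow> \<sigma> \<gamma> (f - g) = \<sigma> \<gamma> f - \<sigma> \<gamma> g"
  using \<sigma>_add[of f "- g" \<gamma>] by (simp add: K_uminus \<sigma>_uminus)

lemma \<sigma>_power: "f \<in> K \<Longrightarrow> \<gamma> \<in> P \<Longrightarrow> \<sigma> \<gamma> (f ^ n) = \<sigma> \<gamma> f ^ n"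
  by (induction n) (auto simp: \<sigma>_mult K_power)

lemma \<sigma>_sum: "(\<And>i. i \<in> I \<Longrightarrow> f i \<in> K) \<Longrightarrow> \<gamma> \<in> P \<Longrightarrow> \<sigma> \<gamma> (\<Sum>i\<in>I. f i) = (\<Sum>i\<in>I. \<sigma> \<gamma> (f i))"
  by (induction I rule: infinite_finite_induct) (auto simp: \<sigma>_add K_sum)

lemma \<sigma>_eq_0: "f \<in> K \<Longrightarrow> \<gamma> \<in> P \<Longrightarrow> \<sigma> \<gamma> f = 0 \<longleftrightarrow> f = 0"
proof
  assume f: "f \<in> K" "\<gamma> \<in> P" "\<sigma> \<gamma> f = 0"
  show "f = 0"
  proof (rule ccontr)
    assume "f \<noteq> 0"
    then have "\<sigma> \<gamma> (f * inverse f) = 1" using f by simp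
    then show False using \<sigma>_mult[OF f(1) K_inverse[OF f(1)] f(2)] f(3) by simp
  qed
qed simp

lemma \<sigma>_inverse: "f \<in> K \<Longrightarrow> \<gamma> \<in> P \<Longrightarrow> \<sigma> \<gamma> (inverse f) = inverse (\<sigma> \<gamma> f)"
proof (cases "f = 0")
  case False
  assume f: "f \<in> K" "\<gamma> \<in> P"
  have "\<sigma> \<gamma> f * \<sigma> \<gamma> (inverse f) = 1"
    using \<sigma>_mult[OF f(1) K_inverse[OF f(1)] f(2)] False f by simp
  then show ?thesis by (metis inverse_unique)
qed simp

lemma \<sigma>_divide: "f \<in> K \<Longrightarrow> g \<in> K \<Longrightarrow> \<gamma> \<in> P \<Longrightarrow> \<sigma> \<gamma> (f / g) = \<sigma> \<gamma> f / \<sigma> \<gamma> g"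
  by (simp add: divide_inverse \<sigma>_mult K_inverse \<sigma>_inverse)

lemma \<sigma>_scale: "f \<in> K \<Longrightarrow> \<gamma> \<in> P \<Longrightarrow> \<sigma> \<gamma> (fls_scale c f) = fls_scale c (\<sigma> \<gamma> f)"
  by (simp add: fls_scale_def \<sigma>_mult K_const \<sigma>_const)

lemma \<sigma>_poly:
  assumes "f \<in> K" "\<gamma> \<in> P" "\<And>i. coeff p i \<in> K"
  shows "\<sigma> \<gamma> (poly p f) = poly (map_poly (\<sigma> \<gamma>) p) (\<sigma> \<gamma> f)"
proof -
  have deg: "Polynomial.degree (map_poly (\<sigma> \<gamma>) p) = Polynomial.degree p"
  proof (cases "p = 0")
    case False
    then have "coeff (map_poly (\<sigma> \<gamma>) p) (Polynomial.degree p) \<noteq> 0"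
      using \<sigma>_eq_0[OF assms(3) assms(2)] assms(2) by (simp add: coeff_map_poly)
    then show ?thesis by (intro antisym le_degree degree_le) (simp_all add: coeff_map_poly coeff_eq_0 assms(2))
  qed simp
  show ?thesis
    unfolding poly_altdef deg using assms
    by (simp add: \<sigma>_sum K_mult K_power \<sigma>_mult \<sigma>_power coeff_map_poly)
qed

lemma v_const [simp]: "\<gamma> \<in> P \<Longrightarrow> v \<gamma> (fls_const c) = 0"
  by (simp add: v_def \<sigma>_const)

lemma v_1 [simp]: "\<gamma> \<in> P \<Longrightarrow> v \<gamma> 1 = 0"
  by (simp add: v_def)

lemma v_mult: "f \<in> K \<Longrightarrow> g \<in> K \<Longrightarrow> f \<noteq> 0 \<Longrightarrow> g \<noteq> 0 \<Longrightarrow> \<gamma> \<in> P \<Longrightarrow> v \<gamma> (f * g) = v \<gamma> f + v \<gamma> g"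
  by (simp add: v_def \<sigma>_mult \<sigma>_eq_0)

lemma v_inverse: "f \<in> K \<Longrightarrow> \<gamma> \<in> P \<Longrightarrow> v \<gamma> (inverse f) = - v \<gamma> f"
  by (cases "f = 0") (simp_all add: v_def \<sigma>_inverse)

lemma v_divide: "f \<in> K \<Longrightarrow> g \<in> K \<Longrightarrow> f \<noteq> 0 \<Longrightarrow> g \<noteq> 0 \<Longrightarrow> \<gamma> \<in> P \<Longrightarrow> v \<gamma> (f / g) = v \<gamma> f - v \<gamma> g"
  by (simp add: divide_inverse v_mult K_inverse v_inverse)

lemma v_power: "f \<in> K \<Longrightarrow> \<gamma> \<in> P \<Longrightarrow> v \<gamma> (f ^ n) = int n * v \<gamma> f"
  by (simp add: v_def \<sigma>_power fls_subdegree_pow)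

lemma v_add: "f \<in> K \<Longrightarrow> g \<in> K \<Longrightarrow> f + g \<noteq> 0 \<Longrightarrow> \<gamma> \<in> P \<Longrightarrow> min (v \<gamma> f) (v \<gamma> g) \<le> v \<gamma> (f + g)"
  unfolding v_def using fls_plus_subdegree[of "\<sigma> \<gamma> f" "\<sigma> \<gamma> g"] \<sigma>_eq_0[of "f + g" \<gamma>]
  by (simp add: \<sigma>_add K_add)

lemma v_scale: "f \<in> K \<Longrightarrow> c \<noteq> 0 \<Longrightarrow> \<gamma> \<in> P \<Longrightarrow> v \<gamma> (fls_scale c f) = v \<gamma> f"
  by (cases "f = 0") (simp_all add: fls_scale_def v_mult K_const)

lemma v_zero_imp_const:
  assumes "f \<in> K" "\<And>\<gamma>. \<gamma> \<in> P \<Longrightarrow> v \<gamma> f = 0"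
  shows "\<exists>c. f = fls_const c"
  using no_poles[OF assms(1)] assms(2) by (auto simp: v_def)

text \<open>Divisor of zeros; the divisor of poles is \<open>zer (inverse f)\<close>.\<close>

definition zer :: "'a fls \<Rightarrow> 'p multiset" where
  "zer f = fun_mset P (\<lambda>\<gamma>. nat (v \<gamma> f))"

lemma count_zer: "f \<in> K \<Longrightarrow> f \<noteq> 0 \<Longrightarrow> count (zer f) \<gamma> = (if \<gamma> \<in> P then nat (v \<gamma> f) else 0)"
  unfolding zer_def
  by (intro count_fun_mset rev_finite_subset[OF finite_support[of f]]) (auto simp: v_def)

text \<open>The Riemann-Roch space of \<open>A\<close>.\<close>

definition L :: "'p multiset \<Rightarrow> 'a fls set" where
  "L A = {f \<in> K. f = 0 \<or> (\<forall>\<gamma>\<in>P. - int (count A \<gamma>) \<le> v \<gamma> f)}"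

lemma L_K: "f \<in> L A \<Longrightarrow> f \<in> K"
  by (simp add: L_def)

lemma L_1: "1 \<in> L A"
  by (simp add: L_def)

lemma subspace_L: "fls_space.subspace (L A)"
  unfolding fls_space.subspace_def
proof (intro conjI ballI allI)
  show "0 \<in> L A" by (simp add: L_def)
  show "f + g \<in> L A" if f: "f \<in> L A" and g: "g \<in> L A" for f g
  proof (cases "f = 0 \<or> g = 0 \<or> f + g = 0")
    case True
    then show ?thesis using f g K_add by (auto simp: L_def)
  next
    case False
    then have "- int (count A \<gamma>) \<le> v \<gamma> (f + g)" if "\<gamma> \<in> P" for \<gamma>
      using f g that v_add[of f g \<gamma>] by (fastforce simp: L_def)
    then show ?thesis using f g by (simp add: L_def K_add)
  qed
  show "fls_scale c f \<in> L A" if f: "f \<in> L A" for c f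
  proof (cases "c = 0")
    case True
    then show ?thesis by (simp add: L_def fls_scale_def)
  next
    case False
    then show ?thesis using f v_scale[of f c] by (auto simp: L_def K_scale)
  qed
qed

text \<open>Without poles only constants remain, and each further point costs at most one dimension,
  since a single Laurent coefficient decides whether the new pole is used. A spanning set is
  asserted because \<open>dim\<close> is informative only once finite dimension is known.\<close>

lemma L_spanned: "\<exists>T. finite T \<and> card T \<le> size A + 1 \<and> L A \<subseteq> fls_space.span T"
proof (induction A)
  case empty
  have "f \<in> fls_space.span {1}" if f: "f \<in> L {#}" for f
  proof -
    have "f \<in> range fls_const" using no_poles[OF L_K[OF f]] f by (fastforce simp: L_def v_def)
    then obtain c where "f = fls_scale c 1" by (auto simp: fls_scale_def)
    then show ?thesis using fls_space.span_scale[OF fls_space.span_base] by blast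
  qed
  then show ?case by (intro exI[of _ "{1}"]) auto
next
  case (add \<gamma> A)
  then obtain T where T: "finite T" "card T \<le> size A + 1" "L A \<subseteq> fls_space.span T" by auto
  \<comment> \<open>The order that only the added copy of \<open>\<gamma>\<close> permits; functions
    whose coefficient there is zero already lie in \<open>L A\<close>.\<close>
  define n where "n = - int (count A \<gamma>) - 1"
  have drop: "f \<in> L A" if f: "f \<in> L (add_mset \<gamma> A)" and nth: "\<gamma> \<in> P \<Longrightarrow> fls_nth (\<sigma> \<gamma> f) n = 0" for f
  proof (cases "f = 0")
    case False
    have "- int (count A \<delta>) \<le> v \<delta> f" if \<delta>: "\<delta> \<in> P" for \<delta>
    proof (cases "\<delta> = \<gamma>")
      case True
      have ge: "n \<le> v \<gamma> f" using f False \<delta> True by (auto simp: L_def n_def)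
      have "fls_nth (\<sigma> \<gamma> f) (v \<gamma> f) \<noteq> 0" using False \<sigma>_eq_0[OF L_K[OF f]] \<delta> True by (simp add: v_def)
      then have "v \<gamma> f \<noteq> n" using nth True \<delta> by auto
      with ge show ?thesis using True by (simp add: n_def)
    next
      case neq: False
      then show ?thesis using f False \<delta> by (auto simp: L_def)
    qed
    then show ?thesis using L_K[OF f] by (simp add: L_def)
  qed (simp add: L_def)
  show ?case
  proof (cases "\<gamma> \<in> P \<and> (\<exists>f0\<in>L (add_mset \<gamma> A). fls_nth (\<sigma> \<gamma> f0) n \<noteq> 0)")
    case False
    then have "L (add_mset \<gamma> A) \<subseteq> L A" using drop by blast
    then show ?thesis using T by (intro exI[of _ T]) auto
  next
    case True
    then obtain f0 where f0: "\<gamma> \<in> P" "f0 \<in> L (add_mset \<gamma> A)" "fls_nth (\<sigma> \<gamma> f0) n \<noteq> 0" by auto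
    have "f \<in> fls_space.span (insert f0 T)" if f: "f \<in> L (add_mset \<gamma> A)" for f
    proof -
      define c where "c = fls_nth (\<sigma> \<gamma> f) n / fls_nth (\<sigma> \<gamma> f0) n"
      note sub = subspace_L[of "add_mset \<gamma> A"]
      have "f - fls_scale c f0 \<in> L (add_mset \<gamma> A)"
        by (intro fls_space.subspace_diff[OF sub f] fls_space.subspace_scale[OF sub f0(2)])
      moreover have "fls_nth (\<sigma> \<gamma> (f - fls_scale c f0)) n = 0"
        unfolding \<sigma>_diff[OF L_K[OF f] K_scale[OF L_K[OF f0(2)]] f0(1)] \<sigma>_scale[OF L_K[OF f0(2)] f0(1)]
        using f0(3) by (simp add: fls_scale_def c_def)
      ultimately have "f - fls_scale c f0 \<in> L A" by (rule drop)
      then have "f - fls_scale c f0 \<in> fls_space.span (insert f0 T)"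
        using T(3) fls_space.span_mono[of T "insert f0 T"] by blast
      moreover have "fls_scale c f0 \<in> fls_space.span (insert f0 T)"
        by (intro fls_space.span_scale fls_space.span_base) simp
      ultimately show ?thesis by (metis diff_add_cancel fls_space.span_add)
    qed
    moreover have "card (insert f0 T) \<le> size (add_mset \<gamma> A) + 1"
      using T(1,2) by (auto simp: card_insert_if)
    ultimately show ?thesis using T(1) by (intro exI[of _ "insert f0 T"]) auto
  qed
qed

text \<open>Independence is required of the family rather than of its set of values, so distinct
  indices automatically carry distinct functions and can be counted.\<close>

lemma family_bound:
  assumes I: "finite I" and g: "\<And>i. i \<in> I \<Longrightarrow> g i \<in> L A"
    and ind: "\<And>a. (\<Sum>i\<in>I. fls_const (a i) * g i) = 0 \<Longrightarrow> \<forall>i\<in>I. a i = 0"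
  shows "card I \<le> size A + 1"
proof -
  have inj: "inj_on g I"
  proof (rule inj_onI, rule ccontr)
    fix i j assume ij: "i \<in> I" "j \<in> I" "g i = g j" "i \<noteq> j"
    define a :: "_ \<Rightarrow> 'a" where "a = (\<lambda>k. if k = i then 1 else if k = j then - 1 else 0)"
    have "(\<Sum>k\<in>I. fls_const (a k) * g k) = (\<Sum>k\<in>I. (if k = i then g i else 0) - (if k = j then g j else 0))"
      by (rule sum.cong) (use ij(4) in \<open>auto simp: a_def\<close>)
    also have "\<dots> = 0" using I ij by (simp add: sum_subtractf)
    finally show False using ind[of a] ij(1) by (auto simp: a_def)
  qed
  have "\<not> fls_space.dependent (g ` I)"
  proof
    assume "fls_space.dependent (g ` I)"
    then obtain u where u: "\<exists>x\<in>g ` I. u x \<noteq> 0" "(\<Sum>x\<in>g ` I. fls_scale (u x) x) = 0"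
      using fls_space.dependent_finite[of "g ` I"] I by auto
    then have "(\<Sum>i\<in>I. fls_const (u (g i)) * g i) = 0"
      by (simp add: sum.reindex[OF inj] fls_scale_def)
    with ind[of "\<lambda>i. u (g i)"] u(1) show False by auto
  qed
  moreover obtain T where T: "finite T" "card T \<le> size A + 1" "L A \<subseteq> fls_space.span T" using L_spanned by blast
  ultimately have "card (g ` I) \<le> card T"
    using fls_space.independent_span_bound[OF T(1), of "g ` I"] g by blast
  then show ?thesis using T(2) card_image[OF inj] by simp
qed

text \<open>At a pole the highest power dominates all lower ones.\<close>

lemma poly_at_pole:
  fixes F :: "'a fls" and c :: "'a poly"
  assumes "fls_subdegree F < 0" "c \<noteq> 0"
  shows "poly (map_poly fls_const c) F \<noteq> 0 \<and>
    fls_subdegree (poly (map_poly fls_const c) F) = int (Polynomial.degree c) * fls_subdegree F"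
  using assms(2)
proof (induction c)
  case (pCons a c)
  have F: "F \<noteq> 0" using assms(1) by auto
  show ?case
  proof (cases "c = 0")
    case True
    then show ?thesis using pCons by (simp add: map_poly_pCons)
  next
    case False
    let ?q = "poly (map_poly fls_const c) F"
    have IH: "?q \<noteq> 0" "fls_subdegree ?q = int (Polynomial.degree c) * fls_subdegree F" using pCons False by auto
    then have s: "F * ?q \<noteq> 0" "fls_subdegree (F * ?q) = int (Suc (Polynomial.degree c)) * fls_subdegree F"
      using F by (simp_all add: algebra_simps)
    have "fls_subdegree (F * ?q) < 0"
      unfolding s(2) using assms(1) by (simp add: mult_pos_neg)
    then have lt: "fls_subdegree (F * ?q) < fls_subdegree (fls_const a)" by simp
    have "fls_subdegree (fls_const a + F * ?q) = fls_subdegree (F * ?q)"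
      by (rule fls_subdegree_add_eq2[OF s(1) lt])
    moreover have "fls_const a + F * ?q \<noteq> 0"
    proof
      assume "fls_const a + F * ?q = 0"
      with calculation lt show False by simp
    qed
    ultimately show ?thesis using s False by (simp add: map_poly_pCons)
  qed
qed simp

text \<open>The functions \<open>u (\<gamma>, j)\<close> with order \<open>j\<close> at the pole \<open>\<gamma>\<close>, \<open>j\<close> less than the order of the pole, and
  high order at the other poles are linearly independent over the polynomials in \<open>f\<close>; hence the
  \<open>u (\<gamma>, j) / f\<^sup>l\<close>, \<open>l \<le> s\<close>, are linearly independent over the constants, and as their poles are
  bounded by a fixed divisor and \<open>s\<close> times the zeros of \<open>f\<close>, counting them for large \<open>s\<close> gives the
  claim.\<close>

lemma poles_le_zeros:
  assumes f: "f \<in> K" "f \<notin> range fls_const"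
  shows "size (zer (inverse f)) \<le> size (zer f)"
proof (rule ccontr)
  assume contra: "\<not> ?thesis"
  have f0: "f \<noteq> 0" using f(2) fls_const_0 by (metis rangeI)
  define n where "n = (\<lambda>\<gamma>. nat (- v \<gamma> f))"
  define S where "S = {\<gamma> \<in> P. n \<gamma> \<noteq> 0}"
  have finS: "finite S" unfolding S_def n_def
    by (rule rev_finite_subset[OF finite_support[OF f(1) f0]]) (auto simp: v_def)
  have vS: "v \<gamma> f = - int (n \<gamma>)" "n \<gamma> > 0" "\<gamma> \<in> P" if "\<gamma> \<in> S" for \<gamma>
    using that by (auto simp: S_def n_def)
  \<comment> \<open>One index for each pole counted with multiplicity.\<close>
  define I where "I = (SIGMA \<gamma>:S. {..<n \<gamma>})"
  have finI: "finite I" using finS by (simp add: I_def)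
  have "size (zer (inverse f)) = (\<Sum>\<gamma>\<in>S. n \<gamma>)"
    unfolding zer_def size_fun_mset S_def n_def
    by (intro sum.cong) (auto simp: v_inverse f(1))
  then have cardI: "card I = size (zer (inverse f))" using finS by (simp add: I_def)
  \<comment> \<open>Large enough for all poles at once: at a pole \<open>\<gamma>\<close>, the
    functions belonging to other poles start at order at least \<open>n \<gamma>\<close>.\<close>
  define N where "N = (\<Sum>\<gamma>\<in>S. n \<gamma>)"
  have nN: "n \<gamma> \<le> N" if "\<gamma> \<in> S" for \<gamma> unfolding N_def using finS that by (intro member_le_sum) auto
  have "\<forall>i\<in>I. \<exists>u\<in>K. u \<noteq> 0 \<and> v (fst i) u = int (snd i) \<and> (\<forall>\<delta>\<in>S - {fst i}. int N \<le> v \<delta> u)"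
    unfolding v_def using approximation[OF finS] by (fastforce simp: I_def S_def)
  then obtain u where u: "\<And>i. i \<in> I \<Longrightarrow> u i \<in> K" "\<And>i. i \<in> I \<Longrightarrow> u i \<noteq> 0"
    "\<And>i. i \<in> I \<Longrightarrow> v (fst i) (u i) = int (snd i)" "\<And>i \<delta>. i \<in> I \<Longrightarrow> \<delta> \<in> S \<Longrightarrow> \<delta> \<noteq> fst i \<Longrightarrow> int N \<le> v \<delta> (u i)"
    by (metis DiffI singletonD)
  define q where "q = (\<lambda>c :: 'a poly. poly (map_poly fls_const c) f)"
  have qK: "q c \<in> K" for c
    unfolding q_def by (intro K_poly f(1)) (simp add: coeff_map_poly K_const)
  have q_v: "q c \<noteq> 0 \<and> v \<gamma> (q c) = - int (Polynomial.degree c * n \<gamma>)" if c: "c \<noteq> 0" and \<gamma>: "\<gamma> \<in> S" for c \<gamma>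
  proof -
    have "\<sigma> \<gamma> (q c) = poly (map_poly (\<sigma> \<gamma>) (map_poly fls_const c)) (\<sigma> \<gamma> f)"
      unfolding q_def by (intro \<sigma>_poly f(1) vS(3)[OF \<gamma>]) (simp add: coeff_map_poly K_const)
    also have "map_poly (\<sigma> \<gamma>) (map_poly fls_const c) = map_poly fls_const c"
      by (rule poly_eqI) (simp add: coeff_map_poly vS(3)[OF \<gamma>] \<sigma>_const)
    finally have s: "\<sigma> \<gamma> (q c) = poly (map_poly fls_const c) (\<sigma> \<gamma> f)" .
    have "fls_subdegree (\<sigma> \<gamma> f) < 0" using vS[OF \<gamma>] by (simp add: v_def)
    from poly_at_pole[OF this c] show ?thesis
      using vS(1)[OF \<gamma>] \<sigma>_eq_0[OF qK vS(3)[OF \<gamma>], of c] by (auto simp: v_def s)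
  qed
  have indep: "c i = 0" if zero: "(\<Sum>i\<in>I. q (c i) * u i) = 0" and i: "i \<in> I" for c i
  proof (rule ccontr)
    assume ci: "c i \<noteq> 0"
    \<comment> \<open>Take a term with coefficient of greatest degree \<open>M\<close> and look at
      its pole \<open>\<gamma>\<close>. Terms belonging to other poles have larger order there.
      Those belonging to \<open>\<gamma>\<close> have order \<open>j\<close> minus a multiple of
      \<open>n \<gamma>\<close>; equal orders would force equal \<open>j\<close> modulo
      \<open>n \<gamma>\<close>, so the minimum is attained once and cannot cancel.\<close>
    define I' where "I' = {i\<in>I. c i \<noteq> 0}"
    have I': "finite I'" "i \<in> I'" using finI i ci by (auto simp: I'_def)
    define dg where "dg = (\<lambda>i. Polynomial.degree (c i))"
    define M where "M = Max (dg ` I')"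
    have "M \<in> dg ` I'" unfolding M_def using I' by (intro Max_in) auto
    then obtain i0 where i0: "i0 \<in> I'" "dg i0 = M" by auto
    have dgM: "dg i \<le> M" if "i \<in> I'" for i unfolding M_def using I' that by (intro Max_ge) auto
    define \<gamma> where "\<gamma> = fst i0"
    have \<gamma>: "\<gamma> \<in> S" "\<gamma> \<in> P" using i0(1) vS(3) by (auto simp: I'_def I_def \<gamma>_def)
    define t where "t = (\<lambda>i. q (c i) * u i)"
    have tK: "t i \<in> K" if "i \<in> I'" for i using u(1)[of i] that qK K_mult by (auto simp: t_def I'_def)
    have t: "t i \<noteq> 0" "v \<gamma> (t i) = v \<gamma> (u i) - int (dg i * n \<gamma>)" if "i \<in> I'" for i
      using that q_v[OF _ \<gamma>(1), of "c i"] u(1,2)[of i] v_mult[OF qK[of "c i"] u(1)[of i] _ u(2)[of i] \<gamma>(2)]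
      by (auto simp: I'_def t_def dg_def)
    have "Min ((\<lambda>i. v \<gamma> (t i)) ` I') \<in> (\<lambda>i. v \<gamma> (t i)) ` I'" using I' by (intro Min_in) auto
    then obtain i1 where i1_min: "i1 \<in> I'" "v \<gamma> (t i1) = Min ((\<lambda>i. v \<gamma> (t i)) ` I')" by auto
    have "v \<gamma> (t i1) \<le> v \<gamma> (t i)" if "i \<in> I'" for i
      unfolding i1_min(2) using I'(1) that by (intro Min_le) auto
    note i1 = i1_min(1) this
    have i0v: "v \<gamma> (t i0) < int (n \<gamma>) - int (M * n \<gamma>)"
      using t(2)[OF i0(1)] u(3)[of i0] i0 by (auto simp: I'_def I_def \<gamma>_def)
    have far: "v \<gamma> (t i) > v \<gamma> (t i0)" if "i \<in> I'" "fst i \<noteq> \<gamma>" for i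
    proof -
      have "int N \<le> v \<gamma> (u i)" using u(4)[of i \<gamma>] that \<gamma>(1) by (auto simp: I'_def)
      moreover have "int (dg i * n \<gamma>) \<le> int (M * n \<gamma>)"
        unfolding of_nat_le_iff using dgM[OF that(1)] by (rule mult_right_mono) simp
      ultimately show ?thesis using t(2)[OF that(1)] i0v nN[OF \<gamma>(1)] by linarith
    qed
    have i1\<gamma>: "fst i1 = \<gamma>" using far[OF i1(1)] i1(2)[OF i0(1)] by force
    have neq: "v \<gamma> (t i) > v \<gamma> (t i1)" if "i \<in> I'" "i \<noteq> i1" for i
    proof (cases "fst i = \<gamma>")
      case False
      then show ?thesis using far[OF that(1)] i1(2)[OF i0(1)] by simp
    next
      case True
      then have ne: "snd i \<noteq> snd i1" using that(2) i1\<gamma> by (auto simp: prod_eq_iff)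
      have lt: "snd i < n \<gamma>" "snd i1 < n \<gamma>" using that(1) i1(1) True i1\<gamma> by (auto simp: I'_def I_def)
      have v1: "v \<gamma> (t i) = int (snd i) - int (dg i * n \<gamma>)" "v \<gamma> (t i1) = int (snd i1) - int (dg i1 * n \<gamma>)"
        using t(2)[OF that(1)] t(2)[OF i1(1)] u(3)[of i] u(3)[of i1] that(1) i1(1) True i1\<gamma>
        by (simp_all add: I'_def)
      have "v \<gamma> (t i) \<noteq> v \<gamma> (t i1)"
      proof
        assume "v \<gamma> (t i) = v \<gamma> (t i1)"
        then have "int (snd i + dg i1 * n \<gamma>) = int (snd i1 + dg i * n \<gamma>)" using v1 by simp
        then have "snd i + dg i1 * n \<gamma> = snd i1 + dg i * n \<gamma>" by (simp only: of_nat_eq_iff)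
        then have "(snd i + dg i1 * n \<gamma>) mod n \<gamma> = (snd i1 + dg i * n \<gamma>) mod n \<gamma>" by simp
        then show False using lt ne by simp
      qed
      then show ?thesis using i1(2)[OF that(1)] by simp
    qed
    have "(\<Sum>i\<in>I'. \<sigma> \<gamma> (t i)) \<noteq> 0"
    proof (rule fls_sum_nonzero[OF I'(1) i1(1)])
      show "\<sigma> \<gamma> (t i1) \<noteq> 0" using \<sigma>_eq_0[OF tK \<gamma>(2)] t(1) i1(1) by blast
    qed (use neq in \<open>auto simp: v_def\<close>)
    then have "(\<Sum>i\<in>I'. t i) \<noteq> 0" using \<sigma>_sum[of I' t \<gamma>] tK \<gamma>(2) by auto
    moreover have "(\<Sum>i\<in>I'. t i) = (\<Sum>i\<in>I. t i)"
      unfolding I'_def by (rule sum.mono_neutral_left) (auto simp: finI t_def q_def)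
    ultimately show False using zero by (simp add: t_def)
  qed
  define D where "D = (\<Sum>i\<in>I. zer (inverse (u i)))"
  have D: "- int (count D \<gamma>) \<le> v \<gamma> (u i)" if "i \<in> I" "\<gamma> \<in> P" for i \<gamma>
  proof -
    have "count (zer (inverse (u i))) \<gamma> \<le> count D \<gamma>"
      unfolding D_def count_sum using finI that(1) by (intro member_le_sum) auto
    moreover have "count (zer (inverse (u i))) \<gamma> = nat (- v \<gamma> (u i))"
      using that u(1,2)[OF that(1)] by (simp add: count_zer K_inverse v_inverse)
    ultimately show ?thesis by linarith
  qed
  \<comment> \<open>With \<open>z = size (zer f)\<close> and at least \<open>z + 1\<close> poles,
    the count would give \<open>(z + 1) * (s + 1) \<le> size D + s * z + 1\<close>, which fails as
    soon as \<open>s > size D\<close>.\<close>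
  define s where "s = size D + 1"
  define A where "A = D + repeat_mset s (zer f)"
  define g where "g = (\<lambda>(i, l). u i * inverse f ^ l)"
  have "card (I \<times> {..s}) \<le> size A + 1"
  proof (rule family_bound[of _ g])
    fix il assume il: "il \<in> I \<times> {..s}"
    obtain i l where [simp]: "il = (i, l)" by (cases il)
    have i: "i \<in> I" "l \<le> s" using il by auto
    have gK: "g il \<in> K" using u(1)[OF i(1)] f(1) by (simp add: g_def K_mult K_power K_inverse)
    have "- int (count A \<gamma>) \<le> v \<gamma> (g il)" if \<gamma>: "\<gamma> \<in> P" for \<gamma>
    proof -
      have "v \<gamma> (g il) = v \<gamma> (u i) - int l * v \<gamma> f"
        using u(1,2)[OF i(1)] f(1) f0 \<gamma>
        by (simp add: g_def v_mult K_power K_inverse v_power v_inverse)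
      moreover have "int l * v \<gamma> f \<le> int s * int (nat (v \<gamma> f))"
      proof -
        have "int l * v \<gamma> f \<le> int l * int (nat (v \<gamma> f))" by (intro mult_left_mono) auto
        also have "\<dots> \<le> int s * int (nat (v \<gamma> f))" using i(2) by (intro mult_right_mono) auto
        finally show ?thesis .
      qed
      ultimately show ?thesis using D[OF i(1) \<gamma>] \<gamma> by (simp add: A_def count_zer[OF f(1) f0])
    qed
    then show "g il \<in> L A" using gK by (simp add: L_def)
  next
    fix a assume zero: "(\<Sum>il\<in>I \<times> {..s}. fls_const (a il) * g il) = 0"
    \<comment> \<open>Multiplication by \<open>f ^ s\<close> clears the powers of
      \<open>inverse f\<close> and turns the coefficient of each \<open>u i\<close> into a
      polynomial in \<open>f\<close>.\<close>
    define c where "c = (\<lambda>i. \<Sum>l\<le>s. monom (a (i, l)) (s - l))"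
    have qc: "q (c i) = (\<Sum>l\<le>s. fls_const (a (i, l)) * f ^ (s - l))" for i
    proof -
      interpret q: const_hom q unfolding q_def
        by (intro const_hom_comp[OF _ const_hom_poly] const_hom_map_poly const_hom_fls_const)
      have "q (monom b k) = fls_const b * f ^ k" for b k by (simp add: q_def map_poly_monom poly_monom)
      then show ?thesis by (simp add: c_def q.hom_sum)
    qed
    have "0 = f ^ s * (\<Sum>il\<in>I \<times> {..s}. fls_const (a il) * g il)" using zero by simp
    also have "\<dots> = (\<Sum>i\<in>I. \<Sum>l\<le>s. f ^ s * (fls_const (a (i, l)) * g (i, l)))"
      by (simp add: sum_distrib_left sum.cartesian_product)
    also have "\<dots> = (\<Sum>i\<in>I. q (c i) * u i)"
      unfolding qc sum_distrib_right using f0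
      by (intro sum.cong refl) (simp add: g_def power_diff field_simps)
    finally have "(\<Sum>i\<in>I. q (c i) * u i) = 0" by simp
    then have c0: "c i = 0" if "i \<in> I" for i using indep that by blast
    show "\<forall>il\<in>I \<times> {..s}. a il = 0"
    proof
      fix il assume il: "il \<in> I \<times> {..s}"
      obtain i l where [simp]: "il = (i, l)" by (cases il)
      have i: "i \<in> I" "l \<le> s" using il by auto
      have "coeff (c i) (s - l) = (\<Sum>k\<le>s. if k = l then a (i, k) else 0)"
        unfolding c_def coeff_sum using i(2) by (intro sum.cong) auto
      also have "\<dots> = a (i, l)" using i(2) by simp
      finally show "a il = 0" using c0[OF i(1)] by simp
    qed
  qed (simp add: finI)
  then have "card I * Suc s \<le> size D + s * size (zer f) + 1"
    by (simp add: A_def card_cartesian_product)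
  moreover have "Suc (size (zer f)) * Suc s \<le> card I * Suc s"
    using contra cardI by (intro mult_right_mono) auto
  ultimately show False by (simp add: s_def algebra_simps)
qed

text \<open>The inequality between poles and zeros is applied to \<open>f\<close> and to
  \<open>inverse f\<close>.\<close>

theorem degree_principal:
  assumes f: "f \<in> K" "f \<noteq> 0"
  shows "size (zer (inverse f)) = size (zer f)"
proof (cases "f \<in> range fls_const")
  case True
  then obtain c where "f = fls_const c" by auto
  then have "zer f = fun_mset P (\<lambda>_. 0)" "zer (inverse f) = fun_mset P (\<lambda>_. 0)"
    unfolding zer_def fun_mset_def by (auto intro!: sum.cong simp: fls_inverse_const)
  then show ?thesis by simp
next
  case False
  have "inverse f \<notin> range fls_const"
  proof
    assume "inverse f \<in> range fls_const"
    then obtain c where "inverse f = fls_const c" by auto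
    then have "f = fls_const (inverse c)" by (metis fls_inverse_const inverse_inverse_eq)
    with False show False by simp
  qed
  from poles_le_zeros[OF K_inverse[OF f(1)] this] poles_le_zeros[OF f(1) False] show ?thesis by simp
qed

end

section \<open>Linear series\<close>

context places
begin

text \<open>Multiplicities are compared at \<open>P\<close> only; supports are controlled by
  separate hypotheses.\<close>

definition dequiv :: "'p multiset \<Rightarrow> 'p multiset \<Rightarrow> bool" where
  "dequiv A B \<longleftrightarrow> (\<exists>f\<in>K. f \<noteq> 0 \<and> (\<forall>\<gamma>\<in>P. int (count A \<gamma>) = int (count B \<gamma>) + v \<gamma> f))"

lemma dequiv_refl: "dequiv A A"
  unfolding dequiv_def by (intro bexI[of _ 1]) simp_all

lemma dequiv_size:
  assumes "dequiv A B" "set_mset A \<subseteq> P" "set_mset B \<subseteq> P"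
  shows "size A = size B"
proof -
  from assms(1) obtain f where f: "f \<in> K" "f \<noteq> 0" "\<And>\<gamma>. \<gamma> \<in> P \<Longrightarrow> int (count A \<gamma>) = int (count B \<gamma>) + v \<gamma> f"
    by (auto simp: dequiv_def)
  have "A + zer (inverse f) = B + zer f"
  proof (rule multiset_eqI)
    fix \<gamma>
    show "count (A + zer (inverse f)) \<gamma> = count (B + zer f) \<gamma>"
    proof (cases "\<gamma> \<in> P")
      case True
      then show ?thesis using f(3)[OF True]
        by (simp add: count_zer f(1,2) K_inverse v_inverse)
    next
      case False
      then have "\<gamma> \<notin># A" "\<gamma> \<notin># B" using assms(2,3) by auto
      with False show ?thesis by (simp add: count_zer f(1,2) K_inverse not_in_iff)
    qed
  qed
  then have "size A + size (zer (inverse f)) = size B + size (zer f)" by (metis size_union)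
  then show ?thesis using degree_principal[OF f(1,2)] by simp
qed

text \<open>The effective divisor \<open>A + div f\<close>; for nonzero \<open>f\<close> in
  \<open>L A\<close> the conversion by \<open>nat\<close> loses nothing.\<close>

definition plus_div :: "'p multiset \<Rightarrow> 'a fls \<Rightarrow> 'p multiset" where
  "plus_div A f = fun_mset P (\<lambda>\<gamma>. nat (int (count A \<gamma>) + v \<gamma> f))"

lemma count_plus_div:
  assumes "f \<in> L A" "f \<noteq> 0"
  shows "int (count (plus_div A f) \<gamma>) = (if \<gamma> \<in> P then int (count A \<gamma>) + v \<gamma> f else 0)"
proof -
  have "{\<gamma> \<in> P. nat (int (count A \<gamma>) + v \<gamma> f) \<noteq> 0} \<subseteq> set_mset A \<union> {\<gamma> \<in> P. v \<gamma> f \<noteq> 0}"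
    by (auto simp: not_in_iff)
  moreover have "finite {\<gamma> \<in> P. v \<gamma> f \<noteq> 0}" using finite_support[OF L_K[OF assms(1)] assms(2)] by (simp add: v_def)
  ultimately have "finite {\<gamma> \<in> P. nat (int (count A \<gamma>) + v \<gamma> f) \<noteq> 0}"
    using finite_subset by blast
  then have "count (plus_div A f) \<gamma> = (if \<gamma> \<in> P then nat (int (count A \<gamma>) + v \<gamma> f) else 0)"
    unfolding plus_div_def by (rule count_fun_mset)
  moreover have "0 \<le> int (count A \<gamma>) + v \<gamma> f" if "\<gamma> \<in> P"
    using assms that by (fastforce simp: L_def)
  ultimately show ?thesis by simp
qed

lemma set_plus_div: "f \<in> L A \<Longrightarrow> f \<noteq> 0 \<Longrightarrow> set_mset (plus_div A f) \<subseteq> P"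
  using count_plus_div[of f A] by (metis count_greater_zero_iff of_nat_0_less_iff order_less_irrefl subsetI)

lemma plus_div_eqI:
  assumes "f \<in> L A" "f \<noteq> 0" "set_mset B \<subseteq> P" "\<And>\<gamma>. \<gamma> \<in> P \<Longrightarrow> int (count B \<gamma>) = int (count A \<gamma>) + v \<gamma> f"
  shows "plus_div A f = B"
proof (rule multiset_eqI)
  fix \<gamma>
  have "int (count (plus_div A f) \<gamma>) = int (count B \<gamma>)"
    using count_plus_div[OF assms(1,2), of \<gamma>] assms(3,4) by (cases "\<gamma> \<in> P") (auto simp: not_in_iff subset_iff)
  then show "count (plus_div A f) \<gamma> = count B \<gamma>" by simp
qed

lemma dequiv_plus_div: "f \<in> L A \<Longrightarrow> f \<noteq> 0 \<Longrightarrow> dequiv (plus_div A f) A"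
  unfolding dequiv_def using L_K count_plus_div by (intro bexI[of _ f]) auto

text \<open>Multiplication by \<open>f\<close> shifts orders by \<open>div f\<close>, which
  identifies the two spaces and allows the reference divisor to be changed.\<close>

lemma L_plus_div:
  assumes "f \<in> L A" "f \<noteq> 0" "g \<in> K"
  shows "g \<in> L (plus_div A f) \<longleftrightarrow> f * g \<in> L A"
proof (cases "g = 0")
  case False
  have "(- int (count (plus_div A f) \<gamma>) \<le> v \<gamma> g) \<longleftrightarrow> (- int (count A \<gamma>) \<le> v \<gamma> (f * g))" if "\<gamma> \<in> P" for \<gamma>
    using that count_plus_div[OF assms(1,2), of \<gamma>] v_mult[OF L_K[OF assms(1)] assms(3) assms(2) False that] by auto
  then show ?thesis using assms False by (auto simp: L_def K_mult)
qed (use assms in \<open>simp add: L_def\<close>)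

lemma plus_div_plus_div:
  assumes "f \<in> L A" "f \<noteq> 0" "g \<in> L (plus_div A f)" "g \<noteq> 0"
  shows "plus_div (plus_div A f) g = plus_div A (f * g)"
proof -
  have fg: "f * g \<in> L A" using L_plus_div[OF assms(1,2) L_K[OF assms(3)]] assms(3) by simp
  show ?thesis
  proof (rule plus_div_eqI[OF assms(3,4) set_plus_div[OF fg]])
    fix \<gamma> assume "\<gamma> \<in> P"
    then show "int (count (plus_div A (f * g)) \<gamma>) = int (count (plus_div A f) \<gamma>) + v \<gamma> g"
      using count_plus_div[OF assms(1,2), of \<gamma>] count_plus_div[OF fg, of \<gamma>] assms
        v_mult[OF L_K[OF assms(1)] L_K[OF assms(3)] assms(2,4), of \<gamma>] by simp
  qed (use assms in simp)
qed

text \<open>The quotient of the two functions has neither zeros nor poles, so members of a series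
  correspond to functions up to scalars.\<close>

lemma plus_div_eq_imp_scale:
  assumes "f \<in> L A" "f \<noteq> 0" "g \<in> L A" "g \<noteq> 0" "plus_div A f = plus_div A g"
  shows "\<exists>c. f = fls_scale c g"
proof -
  have "v \<gamma> (f / g) = 0" if "\<gamma> \<in> P" for \<gamma>
    using count_plus_div[OF assms(1,2), of \<gamma>] count_plus_div[OF assms(3,4), of \<gamma>] assms(5) that
      v_divide[OF L_K[OF assms(1)] L_K[OF assms(3)] assms(2,4) that] by simp
  then obtain c where "f / g = fls_const c"
    using v_zero_imp_const[OF K_divide[OF L_K[OF assms(1)] L_K[OF assms(3)]]] by blast
  then have "f = fls_const c * g" using assms(4) by (simp add: field_simps)
  then show ?thesis by (auto simp: fls_scale_def)
qed

lemma plus_div_scale: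
  assumes "f \<in> L A" "f \<noteq> 0" "c \<noteq> 0"
  shows "plus_div A (fls_scale c f) = plus_div A f"
proof (rule plus_div_eqI)
  show "fls_scale c f \<in> L A" by (rule fls_space.subspace_scale[OF subspace_L assms(1)])
  show "fls_scale c f \<noteq> 0" using assms by simp
  show "set_mset (plus_div A f) \<subseteq> P" by (rule set_plus_div[OF assms(1,2)])
  show "int (count (plus_div A f) \<gamma>) = int (count A \<gamma>) + v \<gamma> (fls_scale c f)" if "\<gamma> \<in> P" for \<gamma>
    using count_plus_div[OF assms(1,2), of \<gamma>] v_scale[OF L_K[OF assms(1)] assms(3) that] that by simp
qed

lemma finite_basis:
  assumes "U \<subseteq> L A"
  obtains B where "B \<subseteq> U" "\<not> fls_space.dependent B" "U \<subseteq> fls_space.span B" "card B = fls_space.dim U" "finite B"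
proof -
  obtain B where B: "B \<subseteq> U" "\<not> fls_space.dependent B" "U \<subseteq> fls_space.span B" "card B = fls_space.dim U"
    using fls_space.basis_exists by blast
  obtain T where T: "finite T" "L A \<subseteq> fls_space.span T" using L_spanned by blast
  then have "finite B" using fls_space.independent_span_bound[OF T(1) B(2)] B(1) assms by blast
  with B that show ?thesis by blast
qed

lemma dim_strict_mono:
  assumes "U \<subset> W" "W \<subseteq> L A" "fls_space.subspace U"
  shows "fls_space.dim U < fls_space.dim W"
proof -
  obtain B where B: "B \<subseteq> U" "\<not> fls_space.dependent B" "U \<subseteq> fls_space.span B" "card B = fls_space.dim U" "finite B"
    by (rule finite_basis[OF subset_trans[OF psubset_imp_subset[OF assms(1)] assms(2)]]) (rule that)
  obtain B' where B': "B' \<subseteq> W" "W \<subseteq> fls_space.span B'" "card B' = fls_space.dim W" "finite B'"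
    by (rule finite_basis[OF assms(2)]) (rule that)
  obtain w where w: "w \<in> W" "w \<notin> U" using assms(1) by blast
  have "fls_space.span B \<subseteq> U" by (rule fls_space.span_minimal[OF B(1) assms(3)])
  with w have ws: "w \<notin> fls_space.span B" by blast
  then have "w \<notin> B" using fls_space.span_base by blast
  have "\<not> fls_space.dependent (insert w B)" using fls_space.independent_insert[of w B] ws B(2) by auto
  moreover have "insert w B \<subseteq> fls_space.span B'" using B(1) assms(1) w(1) B'(2) by blast
  ultimately have "card (insert w B) \<le> card B'" using fls_space.independent_span_bound[OF B'(4)] by blast
  then show ?thesis using \<open>w \<notin> B\<close> B(4,5) B'(3) by simp
qed

lemma dim_mono: "U \<subseteq> W \<Longrightarrow> W \<subseteq> L A \<Longrightarrow> fls_space.subspace U \<Longrightarrow> fls_space.dim U \<le> fls_space.dim W"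
  using dim_strict_mono[of U W A] by (cases "U = W") (auto simp: psubset_eq)

lemma fls_scale_mult: "h * fls_scale c f = fls_scale c (h * f)"
  by (simp add: fls_scale_def)

lemma subspace_mult: "fls_space.subspace U \<Longrightarrow> fls_space.subspace ((*) h ` U)"
  unfolding fls_space.subspace_def
proof (intro conjI ballI allI; elim conjE)
  assume U: "0 \<in> U" "\<forall>x\<in>U. \<forall>y\<in>U. x + y \<in> U" "\<forall>c. \<forall>x\<in>U. fls_scale c x \<in> U"
  show "0 \<in> (*) h ` U" using U(1) by (rule rev_image_eqI) simp
  show "x + y \<in> (*) h ` U" if "x \<in> (*) h ` U" "y \<in> (*) h ` U" for x y
    using that U(2) by (auto simp flip: distrib_left)
  show "fls_scale c x \<in> (*) h ` U" if "x \<in> (*) h ` U" for c x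
    using that U(3) by (auto simp flip: fls_scale_mult)
qed

lemma dim_mult_le:
  assumes "U \<subseteq> L A"
  shows "fls_space.dim ((*) h ` U) \<le> fls_space.dim U"
proof -
  obtain B where B: "U \<subseteq> fls_space.span B" "card B = fls_space.dim U" "finite B"
    by (rule finite_basis[OF assms]) (rule that)
  have "h * f \<in> fls_space.span ((*) h ` B)" if "f \<in> fls_space.span B" for f
    using that
  proof (induction rule: fls_space.span_induct_alt)
    case base
    show ?case by (simp add: fls_space.span_zero)
  next
    case (step c x y)
    have "h * x \<in> fls_space.span ((*) h ` B)" using step(1) by (intro fls_space.span_base imageI)
    then have "fls_scale c (h * x) + h * y \<in> fls_space.span ((*) h ` B)"
      using step(2) by (intro fls_space.span_add fls_space.span_scale)
    then show ?case by (simp add: distrib_left fls_scale_mult)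
  qed
  then have "(*) h ` U \<subseteq> fls_space.span ((*) h ` B)" using B(1) by blast
  then have "fls_space.dim ((*) h ` U) \<le> card ((*) h ` B)" using B(3) by (intro fls_space.dim_le_card) auto
  also have "\<dots> \<le> card B" using B(3) by (rule card_image_le)
  finally show ?thesis using B(2) by simp
qed

section \<open>Linear series and complete classes\<close>

definition lin_g :: "nat \<Rightarrow> nat \<Rightarrow> 'p multiset set \<Rightarrow> bool" where
  "lin_g n r G \<longleftrightarrow> (\<exists>A U. set_mset A \<subseteq> P \<and> size A = n \<and> fls_space.subspace U \<and> U \<subseteq> L A \<and>
     fls_space.dim U = r + 1 \<and> G = {plus_div A f | f. f \<in> U \<and> f \<noteq> 0})"

text \<open>Dividing \<open>U\<close> by the function that cuts out \<open>A'\<close> makes this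
  member the reference divisor, represented by the function \<open>1\<close>. Multiplying back shows
  that the dimension is unchanged.\<close>

lemma lin_g_rebase:
  assumes "lin_g n r G" "A' \<in> G"
  shows "set_mset A' \<subseteq> P \<and> size A' = n \<and> (\<exists>U. fls_space.subspace U \<and> U \<subseteq> L A' \<and>
    fls_space.dim U = r + 1 \<and> 1 \<in> U \<and> G = {plus_div A' f | f. f \<in> U \<and> f \<noteq> 0})"
proof -
  from assms(1) obtain A U where A: "set_mset A \<subseteq> P" "size A = n" "fls_space.subspace U" "U \<subseteq> L A"
    "fls_space.dim U = r + 1" "G = {plus_div A f | f. f \<in> U \<and> f \<noteq> 0}" by (auto simp: lin_g_def)
  with assms(2) obtain f0 where f0: "f0 \<in> U" "f0 \<noteq> 0" "A' = plus_div A f0" by auto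
  have f0L: "f0 \<in> L A" using f0 A by blast
  have A'P: "set_mset A' \<subseteq> P" using set_plus_div[OF f0L f0(2)] f0(3) by simp
  have "size A' = n" using dequiv_size[OF dequiv_plus_div[OF f0L f0(2)]] A'P A(1,2) f0(3) by simp
  define U' where "U' = (*) (inverse f0) ` U"
  have U: "U = (*) f0 ` U'" unfolding U'_def image_image using f0(2) by (simp flip: mult.assoc)
  have U'L: "U' \<subseteq> L A'"
  proof
    fix g assume "g \<in> U'"
    then obtain f where f: "f \<in> U" "g = inverse f0 * f" by (auto simp: U'_def)
    have gK: "g \<in> K" using f A(4) L_K f0L K_mult K_inverse by blast
    have "f0 * g = f" using f0(2) f(2) by simp
    then show "g \<in> L A'" using L_plus_div[OF f0L f0(2) gK] f(1) A(4) f0(3) by auto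
  qed
  have "fls_space.dim U' \<le> fls_space.dim U" unfolding U'_def by (rule dim_mult_le[OF A(4)])
  moreover have "fls_space.dim U \<le> fls_space.dim U'" using dim_mult_le[OF U'L, of f0] U by simp
  ultimately have "fls_space.dim U' = r + 1" using A(5) by simp
  moreover have "1 \<in> U'" unfolding U'_def using f0 by (intro image_eqI[of _ _ f0]) auto
  moreover have "fls_space.subspace U'" unfolding U'_def by (rule subspace_mult[OF A(3)])
  moreover have "G = {plus_div A' f | f. f \<in> U' \<and> f \<noteq> 0}"
  proof (intro set_eqI iffI)
    fix B assume "B \<in> G"
    then obtain f where f: "f \<in> U" "f \<noteq> 0" "B = plus_div A f" using A(6) by auto
    define g where "g = inverse f0 * f"
    have g: "g \<in> U'" "g \<noteq> 0" "f0 * g = f" using f f0 by (auto simp: U'_def g_def)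
    have "B = plus_div A' g"
      using plus_div_plus_div[OF f0L f0(2) _ g(2)] U'L g f(3) f0(3) by auto
    with g show "B \<in> {plus_div A' f | f. f \<in> U' \<and> f \<noteq> 0}" by blast
  next
    fix B assume "B \<in> {plus_div A' f | f. f \<in> U' \<and> f \<noteq> 0}"
    then obtain g where g: "g \<in> U'" "g \<noteq> 0" "B = plus_div A' g" by auto
    have "f0 * g \<in> U" using g(1) U by blast
    moreover have "B = plus_div A (f0 * g)"
      using plus_div_plus_div[OF f0L f0(2) _ g(2)] U'L g f0(3) by auto
    ultimately show "B \<in> G" using A(6) g(2) f0(2) by auto
  qed
  ultimately show ?thesis using A'P \<open>size A' = n\<close> U'L by blast
qed

lemma lin_g_nonempty: "lin_g n r G \<Longrightarrow> G \<noteq> {}"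
proof -
  assume "lin_g n r G"
  then obtain A U where A: "U \<subseteq> L A" "fls_space.dim U = r + 1" "G = {plus_div A f | f. f \<in> U \<and> f \<noteq> 0}"
    by (auto simp: lin_g_def)
  have "\<not> U \<subseteq> {0}"
  proof
    assume "U \<subseteq> {0}"
    then have "fls_space.dim U \<le> card ({} :: 'a fls set)" by (intro fls_space.dim_le_card) auto
    with A(2) show False by simp
  qed
  with A(3) show ?thesis by auto
qed

definition cls :: "'p multiset \<Rightarrow> 'p multiset set" where
  "cls A = {B. set_mset B \<subseteq> P \<and> dequiv B A}"

lemma cls_alt:
  assumes "set_mset A \<subseteq> P"
  shows "cls A = {plus_div A f | f. f \<in> L A \<and> f \<noteq> 0}"
proof (intro set_eqI iffI)
  fix B assume "B \<in> cls A"
  then obtain f where f: "set_mset B \<subseteq> P" "f \<in> K" "f \<noteq> 0" "\<And>\<gamma>. \<gamma> \<in> P \<Longrightarrow> int (count B \<gamma>) = int (count A \<gamma>) + v \<gamma> f"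
    by (auto simp: cls_def dequiv_def)
  then have "- int (count A \<gamma>) \<le> v \<gamma> f" if "\<gamma> \<in> P" for \<gamma> using f(4)[OF that] by linarith
  then have "f \<in> L A" using f(2) by (simp add: L_def)
  with plus_div_eqI[OF this f(3,1,4)] f(3) show "B \<in> {plus_div A f | f. f \<in> L A \<and> f \<noteq> 0}" by blast
next
  fix B assume "B \<in> {plus_div A f | f. f \<in> L A \<and> f \<noteq> 0}"
  then show "B \<in> cls A" using set_plus_div dequiv_plus_div by (auto simp: cls_def)
qed

lemma cls_self: "set_mset A \<subseteq> P \<Longrightarrow> A \<in> cls A"
  by (simp add: cls_def dequiv_refl)

definition cdim :: "'p multiset \<Rightarrow> nat" where "cdim A = fls_space.dim (L A) - 1"

text \<open>The function \<open>1\<close> lies in \<open>L A\<close>, so the subtraction in the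
  definition of \<open>cdim\<close> is exact.\<close>

lemma cdim: "fls_space.dim (L A) = cdim A + 1"
proof -
  obtain B where B: "L A \<subseteq> fls_space.span B" "card B = fls_space.dim (L A)" "finite B"
    by (rule finite_basis[OF order_refl[of "L A"]]) (rule that)
  have "fls_space.dim (L A) \<noteq> 0"
  proof
    assume "fls_space.dim (L A) = 0"
    then have "B = {}" using B(2,3) by simp
    then show False using B(1) L_1[of A] by auto
  qed
  then show ?thesis by (simp add: cdim_def)
qed

lemma lin_g_cls: "set_mset A \<subseteq> P \<Longrightarrow> lin_g (size A) (cdim A) (cls A)"
  unfolding lin_g_def by (intro exI[of _ A] exI[of _ "L A"]) (simp add: cls_alt subspace_L cdim)

text \<open>Over the reference divisor \<open>A\<close> everything is a comparison of
  \<open>U\<close> with \<open>L A\<close>. Equal dimension forces \<open>U = L A\<close>, and so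
  does equality of the collections, because a member determines its function up to a scalar.\<close>

lemma lin_g_subset_cls:
  assumes "lin_g n r G" "A \<in> G"
  shows "G \<subseteq> cls A" "r \<le> cdim A" "r = cdim A \<Longrightarrow> G = cls A" "G = cls A \<Longrightarrow> r = cdim A"
proof -
  obtain U where A: "set_mset A \<subseteq> P" and U: "fls_space.subspace U" "U \<subseteq> L A"
    "fls_space.dim U = r + 1" "1 \<in> U" "G = {plus_div A f | f. f \<in> U \<and> f \<noteq> 0}"
    using lin_g_rebase[OF assms] by blast
  show "G \<subseteq> cls A" unfolding cls_alt[OF A] U(5) using U(2) by blast
  show "r \<le> cdim A" using dim_mono[OF U(2) subset_refl U(1)] U(3) cdim[of A] by simp
  show "G = cls A" if "r = cdim A"
  proof -
    have "U = L A" using dim_strict_mono[OF _ subset_refl U(1), of A] U(2,3) cdim[of A] that by fastforce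
    then show ?thesis using U(5) cls_alt[OF A] by simp
  qed
  show "r = cdim A" if G: "G = cls A"
  proof -
    have "f \<in> U" if f: "f \<in> L A" for f
    proof (cases "f = 0")
      case False
      then have "plus_div A f \<in> G" using f G cls_alt[OF A] by auto
      then obtain g where g: "g \<in> U" "g \<noteq> 0" "plus_div A f = plus_div A g" using U(5) by auto
      then obtain c where "f = fls_scale c g" using plus_div_eq_imp_scale[OF f False _ g(2,3)] U(2) by blast
      then show ?thesis using fls_space.subspace_scale[OF U(1) g(1)] by simp
    qed (use fls_space.subspace_0[OF U(1)] in simp)
    then have "U = L A" using U(2) by blast
    then show ?thesis using U(3) cdim[of A] by simp
  qed
qed

lemma lin_g_set: "lin_g n r G \<Longrightarrow> A \<in> G \<Longrightarrow> set_mset A \<subseteq> P" and lin_g_size: "lin_g n r G \<Longrightarrow> A \<in> G \<Longrightarrow> size A = n"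
  using lin_g_rebase by blast+

definition complete_lin :: "nat \<Rightarrow> nat \<Rightarrow> 'p multiset set \<Rightarrow> bool" where
  "complete_lin n t G \<longleftrightarrow> lin_g n t G \<and> \<not> (\<exists>s G'. s > t \<and> lin_g n s G' \<and> G \<subset> G')"

text \<open>A series through \<open>A\<close> is contained in the series of all of
  \<open>L A\<close>, and the inclusion is strict only if the dimension is smaller.\<close>

lemma complete_lin_iff:
  assumes "A \<in> G"
  shows "complete_lin n t G \<longleftrightarrow> set_mset A \<subseteq> P \<and> n = size A \<and> G = cls A \<and> t = cdim A"
proof
  assume c: "complete_lin n t G"
  then have g: "lin_g n t G" by (simp add: complete_lin_def)
  have A: "set_mset A \<subseteq> P" "size A = n" using lin_g_set[OF g assms] lin_g_size[OF g assms] by auto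
  note sub = lin_g_subset_cls[OF g assms]
  have "G = cls A"
  proof (rule ccontr)
    assume "G \<noteq> cls A"
    then have "t < cdim A" "G \<subset> cls A" using sub by fastforce+
    then show False using c lin_g_cls[OF A(1)] A(2) unfolding complete_lin_def by blast
  qed
  with sub A show "set_mset A \<subseteq> P \<and> n = size A \<and> G = cls A \<and> t = cdim A" by blast
next
  assume A: "set_mset A \<subseteq> P \<and> n = size A \<and> G = cls A \<and> t = cdim A"
  have "\<not> (\<exists>s G'. s > t \<and> lin_g n s G' \<and> G \<subset> G')"
  proof (intro notI, elim exE conjE)
    fix s G' assume "lin_g n s G'" "G \<subset> G'"
    moreover from this have "A \<in> G'" using assms by blast
    ultimately have "G' \<subseteq> cls A" using lin_g_subset_cls(1) by blast
    with \<open>G \<subset> G'\<close> A show False by blast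
  qed
  then show "complete_lin n t G" using A lin_g_cls[of A] by (simp add: complete_lin_def)
qed

section \<open>Differentials\<close>

lemma \<sigma>_eval2:
  assumes "f \<in> K" "g \<in> K" "\<gamma> \<in> P"
  shows "eval2 f g \<Phi> \<in> K" "\<sigma> \<gamma> (eval2 f g \<Phi>) = eval2 (\<sigma> \<gamma> f) (\<sigma> \<gamma> g) \<Phi>"
proof -
  have inner: "poly (map_poly fls_const c) g \<in> K" for c
    by (intro K_poly assms) (simp add: coeff_map_poly K_const)
  have \<sigma>inner: "\<sigma> \<gamma> (poly (map_poly fls_const c) g) = poly (map_poly fls_const c) (\<sigma> \<gamma> g)" for c
  proof -
    have "map_poly (\<sigma> \<gamma>) (map_poly fls_const c) = map_poly fls_const c"
      by (rule poly_eqI) (simp add: coeff_map_poly assms \<sigma>_const)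
    then show ?thesis using \<sigma>_poly[OF assms(2,3), of "map_poly fls_const c"] by (simp add: coeff_map_poly K_const)
  qed
  have co: "coeff (map_poly (\<lambda>c. poly (map_poly fls_const c) g) \<Phi>) i = poly (map_poly fls_const (coeff \<Phi> i)) g" for i
    by (simp add: coeff_map_poly)
  show "eval2 f g \<Phi> \<in> K" unfolding eval2_def by (intro K_poly assms) (simp add: co inner)
  have "map_poly (\<sigma> \<gamma>) (map_poly (\<lambda>c. poly (map_poly fls_const c) g) \<Phi>) =
      map_poly (\<lambda>c. poly (map_poly fls_const c) (\<sigma> \<gamma> g)) \<Phi>"
    by (rule poly_eqI) (simp add: coeff_map_poly assms \<sigma>inner)
  then show "\<sigma> \<gamma> (eval2 f g \<Phi>) = eval2 (\<sigma> \<gamma> f) (\<sigma> \<gamma> g) \<Phi>"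
    unfolding eval2_def using \<sigma>_poly[OF assms(1,3)] by (simp add: co inner)
qed

end

lemma deriv_poly_const:
  "fls_deriv (poly (map_poly fls_const c) G) = poly (map_poly fls_const (pderiv c)) G * fls_deriv G"
  for G :: "'a::field_char_0 fls"
proof (induction c)
  case (pCons a c)
  interpret h: const_hom "\<lambda>c. poly (map_poly fls_const c) G"
    by (intro const_hom_comp[OF _ const_hom_poly] const_hom_map_poly const_hom_fls_const)
  have "poly (map_poly fls_const (pderiv (pCons a c))) G =
      poly (map_poly fls_const c) G + G * poly (map_poly fls_const (pderiv c)) G"
    unfolding pderiv_pCons h.hom_add by (simp add: map_poly_pCons)
  then show ?case using pCons.IH by (simp add: map_poly_pCons algebra_simps)
qed simp

text \<open>The chain rule in two variables: \<open>map_poly pderiv\<close> differentiates in the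
  inner variable, \<open>pderiv\<close> in the outer one.\<close>

lemma deriv_eval2:
  "fls_deriv (eval2 F G \<Phi>) = eval2 F G (map_poly pderiv \<Phi>) * fls_deriv G + eval2 F G (pderiv \<Phi>) * fls_deriv F"
  for G :: "'a::field_char_0 fls"
proof (induction \<Phi>)
  case 0
  show ?case by (simp add: eval2_def)
next
  case (pCons c \<Phi>)
  interpret h: const_hom "eval2 F G" by (rule const_hom_eval2)
  have e: "eval2 F G (pCons c \<Phi>) = poly (map_poly fls_const c) G + F * eval2 F G \<Phi>" for c \<Phi>
    by (simp add: eval2_def map_poly_pCons)
  have 1: "map_poly pderiv (pCons c \<Phi>) = pCons (pderiv c) (map_poly pderiv \<Phi>)"
    by (simp add: map_poly_pCons)
  show ?case
    unfolding e 1 pderiv_pCons h.hom_add using pCons.IH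
    by (simp add: e deriv_poly_const algebra_simps)
qed

context places
begin

definition dv :: "'p \<Rightarrow> 'a fls \<Rightarrow> int" where "dv \<gamma> f = fls_subdegree (fls_deriv (\<sigma> \<gamma> f))"

text \<open>In characteristic zero only constant Laurent series have derivative zero, and
  \<open>\<sigma> \<gamma>\<close> is injective over the constants.\<close>

lemma deriv_nonzero:
  assumes "f \<in> K" "f \<notin> range fls_const" "\<gamma> \<in> P"
  shows "fls_deriv (\<sigma> \<gamma> f) \<noteq> 0"
proof
  assume "fls_deriv (\<sigma> \<gamma> f) = 0"
  then obtain c where "\<sigma> \<gamma> f = fls_const c" unfolding fls_deriv_eq_0_iff by blast
  then have "\<sigma> \<gamma> (f - fls_const c) = 0" using assms by (simp add: \<sigma>_diff K_const \<sigma>_const)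
  then have "f = fls_const c" using \<sigma>_eq_0[OF K_diff[OF assms(1) K_const] assms(3)] by simp
  with assms(2) show False by blast
qed

text \<open>Implicit differentiation of an algebraic relation between \<open>f\<close> and
  \<open>g\<close>. The resulting quotient \<open>h\<close> of partial derivatives is a function in
  \<open>K\<close>, so one \<open>h\<close> works at all places.\<close>

lemma differential_ratio:
  assumes f: "f \<in> K" and g: "g \<in> K" "g \<notin> range fls_const"
  shows "\<exists>h\<in>K. \<forall>\<gamma>\<in>P. fls_deriv (\<sigma> \<gamma> f) = \<sigma> \<gamma> h * fls_deriv (\<sigma> \<gamma> g)"
proof (cases "P = {}")
  case True
  then show ?thesis using K_0 by blast
next
  case False
  then obtain \<gamma>1 where \<gamma>1: "\<gamma>1 \<in> P" by blast
  define Q where "Q = (\<lambda>\<Phi>. \<Phi> \<noteq> 0 \<and> eval2 f g \<Phi> = 0)"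
  have "\<exists>\<Phi>. Q \<Phi>" using algebraically_dependent[OF f g] by (simp add: Q_def)
  then obtain \<Phi>1 where \<Phi>1: "Q \<Phi>1" ..
  define \<Phi> where "\<Phi> = (ARG_MIN Polynomial.degree \<Phi>. Q \<Phi>)"
  have \<Phi>: "Q \<Phi>" and min: "\<And>\<Psi>. Q \<Psi> \<Longrightarrow> Polynomial.degree \<Phi> \<le> Polynomial.degree \<Psi>"
    unfolding \<Phi>_def by (rule arg_min_natI[of Q, OF \<Phi>1], rule arg_min_nat_le)
  \<comment> \<open>A relation free of \<open>f\<close> would make \<open>g\<close> algebraic over
    the constants, hence constant.\<close>
  have deg: "Polynomial.degree \<Phi> > 0"
  proof (rule ccontr)
    assume "\<not> Polynomial.degree \<Phi> > 0"
    then obtain c where c: "\<Phi> = [:c:]" by (metis degree_eq_zeroE gr0I)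
    then have "poly (map_poly fls_const c) g = 0" using \<Phi> by (simp add: Q_def eval2_def map_poly_pCons)
    then have "c = 0" using algebraic_over_alg_closed[OF const_hom_fls_const g(2)] by blast
    with c \<Phi> show False by (simp add: Q_def)
  qed
  \<comment> \<open>Characteristic zero keeps the derivative nonzero; having smaller degree than the
    minimal relation, it is not a relation and can be divided by.\<close>
  have pd: "pderiv \<Phi> \<noteq> 0" using deg by (simp add: pderiv_eq_0_iff)
  have "Polynomial.degree (pderiv \<Phi>) < Polynomial.degree \<Phi>" using deg by (simp add: degree_pderiv)
  then have T: "eval2 f g (pderiv \<Phi>) \<noteq> 0" using min[of "pderiv \<Phi>"] pd by (auto simp: Q_def)
  define h where "h = - eval2 f g (map_poly pderiv \<Phi>) / eval2 f g (pderiv \<Phi>)"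
  have hK: "h \<in> K" unfolding h_def by (intro K_divide K_uminus \<sigma>_eval2(1)[OF f g(1) \<gamma>1])
  have "fls_deriv (\<sigma> \<gamma> f) = \<sigma> \<gamma> h * fls_deriv (\<sigma> \<gamma> g)" if \<gamma>: "\<gamma> \<in> P" for \<gamma>
  proof -
    note ev = \<sigma>_eval2[OF f g(1) \<gamma>]
    have "eval2 (\<sigma> \<gamma> f) (\<sigma> \<gamma> g) \<Phi> = 0" using ev(2)[of \<Phi>] \<Phi> \<gamma> by (simp add: Q_def)
    then have "eval2 (\<sigma> \<gamma> f) (\<sigma> \<gamma> g) (map_poly pderiv \<Phi>) * fls_deriv (\<sigma> \<gamma> g) +
        eval2 (\<sigma> \<gamma> f) (\<sigma> \<gamma> g) (pderiv \<Phi>) * fls_deriv (\<sigma> \<gamma> f) = 0"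
      using deriv_eval2[of "\<sigma> \<gamma> f" "\<sigma> \<gamma> g" \<Phi>] by simp
    then have eq: "fls_deriv (\<sigma> \<gamma> f) * eval2 (\<sigma> \<gamma> f) (\<sigma> \<gamma> g) (pderiv \<Phi>) =
        - eval2 (\<sigma> \<gamma> f) (\<sigma> \<gamma> g) (map_poly pderiv \<Phi>) * fls_deriv (\<sigma> \<gamma> g)"
      by (simp add: eq_neg_iff_add_eq_0 add.commute mult.commute)
    have T\<gamma>: "eval2 (\<sigma> \<gamma> f) (\<sigma> \<gamma> g) (pderiv \<Phi>) \<noteq> 0"
      using \<sigma>_eq_0[OF ev(1) \<gamma>] T by (simp flip: ev(2))
    have "\<sigma> \<gamma> h = - eval2 (\<sigma> \<gamma> f) (\<sigma> \<gamma> g) (map_poly pderiv \<Phi>) / eval2 (\<sigma> \<gamma> f) (\<sigma> \<gamma> g) (pderiv \<Phi>)"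
      unfolding h_def \<sigma>_divide[OF K_uminus[OF ev(1)] ev(1) \<gamma>] \<sigma>_uminus[OF ev(1) \<gamma>] ev(2) ..
    then have hT: "\<sigma> \<gamma> h * eval2 (\<sigma> \<gamma> f) (\<sigma> \<gamma> g) (pderiv \<Phi>) = - eval2 (\<sigma> \<gamma> f) (\<sigma> \<gamma> g) (map_poly pderiv \<Phi>)"
      using T\<gamma> by simp
    have "fls_deriv (\<sigma> \<gamma> f) * eval2 (\<sigma> \<gamma> f) (\<sigma> \<gamma> g) (pderiv \<Phi>) =
        (\<sigma> \<gamma> h * fls_deriv (\<sigma> \<gamma> g)) * eval2 (\<sigma> \<gamma> f) (\<sigma> \<gamma> g) (pderiv \<Phi>)"
      unfolding eq hT[symmetric] by (simp only: mult_ac)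
    then show ?thesis by (simp only: mult_right_cancel[OF T\<gamma>])
  qed
  with hK show ?thesis by blast
qed

lemma dv_ratio:
  assumes "f \<in> K" "f \<notin> range fls_const" "g \<in> K" "g \<notin> range fls_const" "P \<noteq> {}"
  shows "\<exists>h\<in>K. h \<noteq> 0 \<and> (\<forall>\<gamma>\<in>P. dv \<gamma> f = v \<gamma> h + dv \<gamma> g)"
proof -
  obtain h where h: "h \<in> K" "\<And>\<gamma>. \<gamma> \<in> P \<Longrightarrow> fls_deriv (\<sigma> \<gamma> f) = \<sigma> \<gamma> h * fls_deriv (\<sigma> \<gamma> g)"
    using differential_ratio[OF assms(1,3,4)] by blast
  have \<sigma>h: "\<sigma> \<gamma> h \<noteq> 0" if "\<gamma> \<in> P" for \<gamma> using deriv_nonzero[OF assms(1,2) that] h(2)[OF that] by auto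
  have "dv \<gamma> f = v \<gamma> h + dv \<gamma> g" if "\<gamma> \<in> P" for \<gamma>
    unfolding dv_def v_def h(2)[OF that] using \<sigma>h[OF that] deriv_nonzero[OF assms(3,4) that] by simp
  moreover have "h \<noteq> 0" using \<sigma>h assms(5) \<sigma>_0 by blast
  ultimately show ?thesis using h(1) by blast
qed

text \<open>At almost every place one of finitely many coordinate functions has a differential of
  order zero, and its quotient by \<open>dg\<close> is a function, which has order zero almost
  everywhere.\<close>

lemma finite_differential:
  assumes "g \<in> K" "g \<notin> range fls_const"
  shows "finite {\<gamma> \<in> P. dv \<gamma> g \<noteq> 0}"
proof (cases "P = {}")
  case False
  obtain \<Xi> where \<Xi>: "\<Xi> \<subseteq> K" "finite \<Xi>" and bad: "finite {\<gamma> \<in> P.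
      \<not> (\<exists>\<xi>\<in>\<Xi>. fls_deriv (\<sigma> \<gamma> \<xi>) \<noteq> 0 \<and> fls_subdegree (fls_deriv (\<sigma> \<gamma> \<xi>)) = 0)}" (is "finite ?B")
    using coordinate_differentials by blast
  define \<Xi>' where "\<Xi>' = {\<xi>\<in>\<Xi>. \<xi> \<notin> range fls_const}"
  have "\<forall>\<xi>\<in>\<Xi>'. \<exists>h\<in>K. h \<noteq> 0 \<and> (\<forall>\<gamma>\<in>P. dv \<gamma> \<xi> = v \<gamma> h + dv \<gamma> g)"
    using dv_ratio[OF _ _ assms False] \<Xi>(1) by (auto simp: \<Xi>'_def)
  then obtain h where h: "\<And>\<xi>. \<xi> \<in> \<Xi>' \<Longrightarrow> h \<xi> \<in> K" "\<And>\<xi>. \<xi> \<in> \<Xi>' \<Longrightarrow> h \<xi> \<noteq> 0"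
    "\<And>\<xi> \<gamma>. \<xi> \<in> \<Xi>' \<Longrightarrow> \<gamma> \<in> P \<Longrightarrow> dv \<gamma> \<xi> = v \<gamma> (h \<xi>) + dv \<gamma> g" by metis
  have "finite (\<Union>\<xi>\<in>\<Xi>'. {\<gamma> \<in> P. v \<gamma> (h \<xi>) \<noteq> 0})"
    using \<Xi>(2) finite_support h(1,2) by (auto simp: \<Xi>'_def v_def)
  moreover have "{\<gamma> \<in> P. dv \<gamma> g \<noteq> 0} \<subseteq> ?B \<union> (\<Union>\<xi>\<in>\<Xi>'. {\<gamma> \<in> P. v \<gamma> (h \<xi>) \<noteq> 0})"
  proof
    fix \<gamma> assume \<gamma>: "\<gamma> \<in> {\<gamma> \<in> P. dv \<gamma> g \<noteq> 0}"
    show "\<gamma> \<in> ?B \<union> (\<Union>\<xi>\<in>\<Xi>'. {\<gamma> \<in> P. v \<gamma> (h \<xi>) \<noteq> 0})"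
    proof (cases "\<gamma> \<in> ?B")
      case False
      then obtain \<xi> where \<xi>: "\<xi> \<in> \<Xi>" "fls_deriv (\<sigma> \<gamma> \<xi>) \<noteq> 0" "dv \<gamma> \<xi> = 0" using \<gamma> by (auto simp: dv_def)
      have "\<xi> \<in> \<Xi>'"
        using \<xi> \<gamma> by (auto simp: \<Xi>'_def \<sigma>_const)
      then show ?thesis using h(3)[of \<xi> \<gamma>] \<xi>(3) \<gamma> by auto
    qed simp
  qed
  ultimately show ?thesis using bad finite_subset by blast
qed simp

text \<open>The local shape of the pencil spanned by \<open>1\<close> and \<open>z\<close>:
  \<open>s\<close> is the generic order and \<open>w\<close>, up to scalars, the unique element of
  higher order. At a pole of \<open>z\<close> these are \<open>v \<gamma> z\<close> and
  \<open>1\<close>; elsewhere they are \<open>0\<close> and \<open>z\<close> minus its value. Both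
  cases give the same formula for the order of \<open>dz\<close>.\<close>

lemma pencil_at_point:
  assumes z: "z \<in> K" "z \<notin> range fls_const" and \<gamma>: "\<gamma> \<in> P"
  defines "U \<equiv> {fls_const a + fls_const b * z | a b. True}"
  shows "\<exists>w\<in>U. \<exists>s. w \<noteq> 0 \<and> (\<forall>f\<in>U. f \<noteq> 0 \<longrightarrow> s \<le> v \<gamma> f) \<and> (\<exists>f\<in>U. f \<noteq> 0 \<and> v \<gamma> f = s) \<and> s < v \<gamma> w \<and>
    (\<forall>f\<in>U. f \<noteq> 0 \<longrightarrow> s < v \<gamma> f \<longrightarrow> (\<exists>c. c \<noteq> 0 \<and> f = fls_scale c w)) \<and>
    dv \<gamma> z = v \<gamma> w + s - 1 \<and> (s = 0 \<or> s < 0 \<and> v \<gamma> w = 0)"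
proof (cases "v \<gamma> z < 0")
  case True
  have z0: "z \<noteq> 0" using z(2) fls_const_0 by (metis rangeI)
  have vz: "v \<gamma> (fls_const a + fls_const b * z) = v \<gamma> z" if "b \<noteq> 0" for a b
  proof -
    have "\<sigma> \<gamma> (fls_const a + fls_const b * z) = fls_const a + fls_const b * \<sigma> \<gamma> z"
      using z \<gamma> by (simp add: \<sigma>_add \<sigma>_mult K_mult K_const \<sigma>_const)
    moreover have "fls_subdegree (fls_const a + fls_const b * \<sigma> \<gamma> z) = fls_subdegree (fls_const b * \<sigma> \<gamma> z)"
      using True that \<sigma>_eq_0[OF z(1) \<gamma>] z0 by (intro fls_subdegree_add_eq2) (auto simp: v_def)
    ultimately show ?thesis using that \<sigma>_eq_0[OF z(1) \<gamma>] z0 by (simp add: v_def)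
  qed
  have dz: "dv \<gamma> z = v \<gamma> z - 1" unfolding dv_def v_def using True by (intro fls_subdegree_deriv) (simp add: v_def)
  have 1: "1 \<in> U" unfolding U_def by (rule CollectI, rule exI[of _ 1], rule exI[of _ 0]) simp
  have zU: "z \<in> U" unfolding U_def by (rule CollectI, rule exI[of _ 0], rule exI[of _ 1]) simp
  have lower: "v \<gamma> z \<le> v \<gamma> f" if "f \<in> U" for f
  proof -
    from that obtain a b where f: "f = fls_const a + fls_const b * z" by (auto simp: U_def)
    show ?thesis using vz[of b a] f True \<gamma> by (cases "b = 0") auto
  qed
  have scale: "\<exists>c. c \<noteq> 0 \<and> f = fls_scale c 1" if "f \<in> U" "f \<noteq> 0" "v \<gamma> z < v \<gamma> f" for f
  proof -
    from that(1) obtain a b where f: "f = fls_const a + fls_const b * z" by (auto simp: U_def)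
    then have "b = 0" using vz[of b a] that(3) by auto
    then show ?thesis using f that(2) by (auto simp: fls_scale_def)
  qed
  show ?thesis
    by (rule bexI[OF _ 1], rule exI[of _ "v \<gamma> z"])
       (use lower scale zU z0 dz True \<gamma> in auto)
next
  case False
  define c0 where "c0 = fls_nth (\<sigma> \<gamma> z) 0"
  define w where "w = z - fls_const c0"
  have wK: "w \<in> K" unfolding w_def by (intro K_diff z K_const)
  have w0: "w \<noteq> 0" using z(2) by (auto simp: w_def)
  have \<sigma>w: "\<sigma> \<gamma> w = \<sigma> \<gamma> z - fls_const c0" using z \<gamma> by (simp add: w_def \<sigma>_diff K_const \<sigma>_const)
  have vw: "v \<gamma> w > 0"
  proof -
    have "\<sigma> \<gamma> w \<noteq> 0" using \<sigma>_eq_0[OF wK \<gamma>] w0 by simp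
    then have "1 \<le> fls_subdegree (\<sigma> \<gamma> w)"
    proof (rule fls_subdegree_geI)
      fix k :: int assume "k < 1"
      then show "fls_nth (\<sigma> \<gamma> w) k = 0" using False by (cases "k = 0") (auto simp: \<sigma>w c0_def v_def)
    qed
    then show ?thesis by (simp add: v_def)
  qed
  have dz: "dv \<gamma> z = v \<gamma> w - 1"
  proof -
    have "fls_deriv (\<sigma> \<gamma> w) = fls_deriv (\<sigma> \<gamma> z)" by (simp add: \<sigma>w)
    moreover have "fls_subdegree (fls_deriv (\<sigma> \<gamma> w)) = fls_subdegree (\<sigma> \<gamma> w) - 1"
      using vw by (intro fls_subdegree_deriv) (simp add: v_def)
    ultimately show ?thesis by (simp add: dv_def v_def)
  qed
  have wU: "w \<in> U" unfolding U_def by (rule CollectI, rule exI[of _ "- c0"], rule exI[of _ 1]) (simp add: w_def)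
  have 1: "1 \<in> U" unfolding U_def by (rule CollectI, rule exI[of _ 1], rule exI[of _ 0]) simp
  have form: "\<exists>a b. f = fls_const a + fls_const b * w" if "f \<in> U" for f
  proof -
    from that obtain a b where "f = fls_const a + fls_const b * z" by (auto simp: U_def)
    then have "f = fls_const (a + b * c0) + fls_const b * w" by (simp add: w_def algebra_simps flip: fls_plus_const)
    then show ?thesis by blast
  qed
  have va: "v \<gamma> (fls_const a + fls_const b * w) = 0" if "a \<noteq> 0" for a b
  proof -
    have "\<sigma> \<gamma> (fls_const a + fls_const b * w) = fls_const a + fls_const b * \<sigma> \<gamma> w"
      using wK \<gamma> by (simp add: \<sigma>_add \<sigma>_mult K_mult K_const \<sigma>_const)
    moreover have "fls_subdegree (fls_const a + fls_const b * \<sigma> \<gamma> w) = fls_subdegree (fls_const a)" if "b \<noteq> 0"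
      using vw that \<open>a \<noteq> 0\<close> \<sigma>_eq_0[OF wK \<gamma>] w0 by (intro fls_subdegree_add_eq1) (auto simp: v_def)
    ultimately show ?thesis by (cases "b = 0") (simp_all add: v_def)
  qed
  have lower: "0 \<le> v \<gamma> f" if fU: "f \<in> U" "f \<noteq> 0" for f
  proof -
    obtain a b where f: "f = fls_const a + fls_const b * w" using form[OF fU(1)] by blast
    show ?thesis
    proof (cases "a = 0")
      case True
      with f fU(2) have "b \<noteq> 0" by auto
      then show ?thesis using f True vw v_scale[OF wK \<open>b \<noteq> 0\<close> \<gamma>] by (simp add: fls_scale_def)
    qed (use va f in simp)
  qed
  have scale: "\<exists>c. c \<noteq> 0 \<and> f = fls_scale c w" if fU: "f \<in> U" "f \<noteq> 0" "0 < v \<gamma> f" for f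
  proof -
    obtain a b where f: "f = fls_const a + fls_const b * w" using form[OF fU(1)] by blast
    then have "a = 0" using va[of a b] fU(3) by auto
    then show ?thesis using f fU(2) by (auto simp: fls_scale_def)
  qed
  have "\<exists>f\<in>U. f \<noteq> 0 \<and> v \<gamma> f = 0" using 1 \<gamma> by (intro bexI[of _ 1]) auto
  then show ?thesis
    by (intro bexI[OF _ wU] exI[of _ 0]) (use lower scale dz w0 vw in auto)
qed

end

section \<open>The Jacobian of a pencil\<close>

text \<open>For the pencil spanned by \<open>1\<close> and \<open>z\<close> in \<open>L A\<close>, the Jacobian is \<open>2 A\<close> plus the divisor of the
  differential of \<open>z\<close>; the poles of \<open>z\<close> account for the fixed part.\<close>

lemma Jac_pencil:
  fixes P :: "'c::field point set"
  assumes model: "curve_with_model wC C m P \<phi>"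
    and "places K P \<sigma>" "places.lin_g K P \<sigma> n 1 G" "A \<in> G"
  shows "\<exists>z\<in>K. z \<notin> range fls_const \<and> set_mset (curve_with_model.Jac P G) \<subseteq> P \<and>
    (\<forall>\<gamma>\<in>P. int (count (curve_with_model.Jac P G) \<gamma>) = 2 * int (count A \<gamma>) + places.dv \<sigma> \<gamma> z)"
proof -
  interpret places K P \<sigma> by fact
  obtain U where A: "set_mset A \<subseteq> P" and U: "fls_space.subspace U" "U \<subseteq> L A" "fls_space.dim U = 2" "1 \<in> U"
    "G = {plus_div A f | f. f \<in> U \<and> f \<noteq> 0}"
    using lin_g_rebase[OF assms(3,4)] by auto
  \<comment> \<open>With \<open>A\<close> as reference divisor the pencil contains \<open>1\<close>,
    which is completed by some \<open>z\<close> to a basis.\<close>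
  have "\<not> fls_space.dependent {1 :: 'a fls}" by simp
  then obtain B where B: "{1} \<subseteq> B" "B \<subseteq> U" "\<not> fls_space.dependent B" "U \<subseteq> fls_space.span B"
    using fls_space.maximal_independent_subset_extend[of "{1}" U] U(4) by auto
  have cardB: "card B = 2" using fls_space.basis_card_eq_dim[OF B(2,4,3)] U(3) by simp
  then obtain z where z: "B = {1, z}" "z \<noteq> 1"
    using B(1) by (auto simp: card_2_iff)
  have zU: "z \<in> U" using B(2) z(1) by auto
  have zK: "z \<in> K" using zU U(2) L_K by blast
  have Ueq: "U = {fls_const a + fls_const b * z | a b. True}"
  proof (intro set_eqI iffI)
    fix f assume "f \<in> U"
    then have "f \<in> fls_space.span {1, z}" using B(4) z(1) by blast
    then obtain a b where "f - fls_scale a 1 = fls_scale b z"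
      by (auto simp: fls_space.span_insert fls_space.span_singleton)
    then show "f \<in> {fls_const a + fls_const b * z | a b. True}"
      by (auto simp: fls_scale_def algebra_simps)
  next
    fix f assume "f \<in> {fls_const a + fls_const b * z | a b. True}"
    then obtain a b where "f = fls_scale a 1 + fls_scale b z" by (auto simp: fls_scale_def)
    then show "f \<in> U" using U(1,4) zU by (auto intro: fls_space.subspace_add fls_space.subspace_scale)
  qed
  have znc: "z \<notin> range fls_const"
  proof
    assume "z \<in> range fls_const"
    then obtain c where "z = fls_scale c 1" by (auto simp: fls_scale_def)
    then have "z \<in> fls_space.span {1}" using fls_space.span_scale[OF fls_space.span_base] by blast
    moreover have "B - {z} = {1}" using z by auto
    ultimately have "z \<in> fls_space.span (B - {z})" by simp
    then have "fls_space.dependent B" using z(1) by (auto simp: fls_space.dependent_def)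
    with B(3) show False by blast
  qed
  define R where "R = (\<lambda>\<gamma> w s. w \<noteq> 0 \<and> (\<forall>f\<in>U. f \<noteq> 0 \<longrightarrow> s \<le> v \<gamma> f) \<and> (\<exists>f\<in>U. f \<noteq> 0 \<and> v \<gamma> f = s) \<and> s < v \<gamma> w \<and>
    (\<forall>f\<in>U. f \<noteq> 0 \<longrightarrow> s < v \<gamma> f \<longrightarrow> (\<exists>c. c \<noteq> 0 \<and> f = fls_scale c w)) \<and>
    dv \<gamma> z = v \<gamma> w + s - 1 \<and> (s = 0 \<or> s < 0 \<and> v \<gamma> w = 0))"
  have "\<forall>\<gamma>\<in>P. \<exists>w\<in>U. \<exists>s. R \<gamma> w s"
    unfolding R_def using pencil_at_point[OF zK znc, folded Ueq] by (intro ballI)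
  then obtain w s where "\<forall>\<gamma>\<in>P. w \<gamma> \<in> U \<and> R \<gamma> (w \<gamma>) (s \<gamma>)" by metis
  then have ws: "\<And>\<gamma>. \<gamma> \<in> P \<Longrightarrow> w \<gamma> \<in> U \<and> w \<gamma> \<noteq> 0"
    "\<And>\<gamma> f. \<gamma> \<in> P \<Longrightarrow> f \<in> U \<Longrightarrow> f \<noteq> 0 \<Longrightarrow> s \<gamma> \<le> v \<gamma> f"
    "\<And>\<gamma>. \<gamma> \<in> P \<Longrightarrow> \<exists>f\<in>U. f \<noteq> 0 \<and> v \<gamma> f = s \<gamma>"
    "\<And>\<gamma>. \<gamma> \<in> P \<Longrightarrow> s \<gamma> < v \<gamma> (w \<gamma>)"
    "\<And>\<gamma> f. \<gamma> \<in> P \<Longrightarrow> f \<in> U \<Longrightarrow> f \<noteq> 0 \<Longrightarrow> s \<gamma> < v \<gamma> f \<Longrightarrow> \<exists>c. c \<noteq> 0 \<and> f = fls_scale c (w \<gamma>)"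
    "\<And>\<gamma>. \<gamma> \<in> P \<Longrightarrow> dv \<gamma> z = v \<gamma> (w \<gamma>) + s \<gamma> - 1 \<and> (s \<gamma> = 0 \<or> s \<gamma> < 0 \<and> v \<gamma> (w \<gamma>) = 0)"
    unfolding R_def by blast+
  have cnt: "int (count (plus_div A f) \<gamma>) = int (count A \<gamma>) + v \<gamma> f" if "f \<in> U" "f \<noteq> 0" "\<gamma> \<in> P" for f \<gamma>
    using count_plus_div[of f A \<gamma>] that U(2) by auto
  define D where "D = Inf G"
  have Gne: "G \<noteq> {}" using assms(4) by auto
  \<comment> \<open>The infimum of multisets is taken pointwise, and the least order
    \<open>s \<gamma>\<close> is attained in \<open>U\<close>.\<close>
  have D: "int (count D \<gamma>) = int (count A \<gamma>) + s \<gamma>" if \<gamma>: "\<gamma> \<in> P" for \<gamma>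
  proof -
    have Inf: "count D \<gamma> = Inf ((\<lambda>B. count B \<gamma>) ` G)"
      unfolding D_def by (rule count_Inf_multiset_nonempty[OF Gne])
    obtain f where f: "f \<in> U" "f \<noteq> 0" "v \<gamma> f = s \<gamma>" using ws(3)[OF \<gamma>] by blast
    have "count D \<gamma> = count (plus_div A f) \<gamma>"
      unfolding Inf
    proof (rule cInf_eq_minimum)
      show "count (plus_div A f) \<gamma> \<in> (\<lambda>B. count B \<gamma>) ` G" using f U(5) by auto
      fix k assume "k \<in> (\<lambda>B. count B \<gamma>) ` G"
      then obtain g where g: "g \<in> U" "g \<noteq> 0" "k = count (plus_div A g) \<gamma>" using U(5) by auto
      show "count (plus_div A f) \<gamma> \<le> k"
        using cnt[OF f(1,2) \<gamma>] cnt[OF g(1,2) \<gamma>] ws(2)[OF \<gamma> g(1,2)] f(3) g(3) by linarith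
    qed
    then show ?thesis using cnt[OF f(1,2) \<gamma>] f(3) by simp
  qed
  have Dle: "D \<subseteq># B" if "B \<in> G" for B
    unfolding D_def by (rule mset_subset_eqI) (simp add: count_Inf_multiset_nonempty[OF Gne] cInf_lower that)
  have DP: "set_mset D \<subseteq> P" using Dle[OF assms(4)] A set_mset_mono by blast
  define G' where "G' = (\<lambda>B. B - D) ` G"
  have mm: "int (curve_with_model.member_mult G' \<gamma>) = v \<gamma> (w \<gamma>) - s \<gamma>" if \<gamma>: "\<gamma> \<in> P" for \<gamma>
  proof -
    have w: "w \<gamma> \<in> U" "w \<gamma> \<noteq> 0" using ws(1)[OF \<gamma>] by auto
    have c: "int (count (plus_div A f - D) \<gamma>) = v \<gamma> f - s \<gamma>" if "f \<in> U" "f \<noteq> 0" for f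
      using cnt[OF that \<gamma>] D[OF \<gamma>] ws(2)[OF \<gamma> that] by simp
    \<comment> \<open>After removal of \<open>D\<close>, a member contains \<open>\<gamma>\<close>
      exactly if its function has order above \<open>s \<gamma>\<close>; such functions are
      multiples of \<open>w \<gamma>\<close> and cut out the same member.\<close>
    have the: "(THE B. B \<in> G' \<and> \<gamma> \<in># B) = plus_div A (w \<gamma>) - D"
    proof (rule the_equality)
      have "int (count (plus_div A (w \<gamma>) - D) \<gamma>) > 0" using c[OF w] ws(4)[OF \<gamma>] by simp
      then have "\<gamma> \<in># plus_div A (w \<gamma>) - D" by (simp only: of_nat_0_less_iff count_greater_zero_iff)
      moreover have "plus_div A (w \<gamma>) - D \<in> G'" unfolding G'_def U(5) using w by blast
      ultimately show "plus_div A (w \<gamma>) - D \<in> G' \<and> \<gamma> \<in># plus_div A (w \<gamma>) - D" by blast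
      fix B assume B: "B \<in> G' \<and> \<gamma> \<in># B"
      then obtain f where f: "f \<in> U" "f \<noteq> 0" "B = plus_div A f - D" by (auto simp: G'_def U(5))
      have "0 < int (count B \<gamma>)" using B by (simp only: of_nat_0_less_iff count_greater_zero_iff)
      then have "s \<gamma> < v \<gamma> f" using c[OF f(1,2)] f(3) by simp
      then obtain k where "k \<noteq> 0" "f = fls_scale k (w \<gamma>)" using ws(5)[OF \<gamma> f(1,2)] by blast
      then show "B = plus_div A (w \<gamma>) - D" using plus_div_scale[of "w \<gamma>" A k] w U(2) f(3) by auto
    qed
    show ?thesis unfolding curve_with_model.member_mult_def[OF model] the by (rule c[OF w])
  qed
  have free: "curve_with_model.Jac_free P G' = fun_mset P (\<lambda>\<gamma>. curve_with_model.member_mult G' \<gamma> - 1)"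
    unfolding curve_with_model.Jac_free_def[OF model] fun_mset_def by (intro sum.cong) auto
  \<comment> \<open>If \<open>s \<gamma> = 0\<close>, the order of \<open>dz\<close> is the
    multiplicity minus one, which is positive; if \<open>s \<gamma> < 0\<close>, it is
    \<open>s \<gamma> - 1\<close>.\<close>
  have "{\<gamma> \<in> P. curve_with_model.member_mult G' \<gamma> - 1 \<noteq> 0} \<subseteq> {\<gamma> \<in> P. dv \<gamma> z \<noteq> 0}"
  proof
    fix \<gamma> assume "\<gamma> \<in> {\<gamma> \<in> P. curve_with_model.member_mult G' \<gamma> - 1 \<noteq> 0}"
    then have \<gamma>: "\<gamma> \<in> P" "int (curve_with_model.member_mult G' \<gamma>) \<ge> 2" by auto
    then show "\<gamma> \<in> {\<gamma> \<in> P. dv \<gamma> z \<noteq> 0}" using mm[OF \<gamma>(1)] ws(6)[OF \<gamma>(1)] by auto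
  qed
  then have fin: "finite {\<gamma> \<in> P. curve_with_model.member_mult G' \<gamma> - 1 \<noteq> 0}"
    using finite_differential[OF zK znc] finite_subset by blast
  have Jac: "curve_with_model.Jac P G = D + D + fun_mset P (\<lambda>\<gamma>. curve_with_model.member_mult G' \<gamma> - 1)"
    unfolding curve_with_model.Jac_def[OF model] using free unfolding G'_def D_def by simp
  have "int (count (curve_with_model.Jac P G) \<gamma>) = 2 * int (count A \<gamma>) + dv \<gamma> z" if \<gamma>: "\<gamma> \<in> P" for \<gamma>
  proof -
    \<comment> \<open>With \<open>a = count A \<gamma>\<close> the count is
      \<open>2 * (a + s) + (v w - s - 1) = 2 * a + (v w + s - 1)\<close>; the natural subtraction is
      exact as \<open>s < v w\<close>.\<close>
    have "int (curve_with_model.member_mult G' \<gamma> - 1) = v \<gamma> (w \<gamma>) - s \<gamma> - 1"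
      using mm[OF \<gamma>] ws(4)[OF \<gamma>] by linarith
    moreover have "count (curve_with_model.Jac P G) \<gamma> =
        count D \<gamma> + count D \<gamma> + (curve_with_model.member_mult G' \<gamma> - 1)"
      unfolding Jac count_union count_fun_mset[OF fin] using \<gamma> by simp
    ultimately show ?thesis using D[OF \<gamma>] ws(6)[OF \<gamma>] by linarith
  qed
  moreover have "set_mset (curve_with_model.Jac P G) \<subseteq> P"
  proof
    fix \<gamma> assume "\<gamma> \<in># curve_with_model.Jac P G"
    then have "count (curve_with_model.Jac P G) \<gamma> \<noteq> 0" by simp
    then have "count D \<gamma> \<noteq> 0 \<or> count (fun_mset P (\<lambda>\<gamma>. curve_with_model.member_mult G' \<gamma> - 1)) \<gamma> \<noteq> 0"
      unfolding Jac by auto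
    then show "\<gamma> \<in> P" unfolding count_fun_mset[OF fin] using DP by (auto split: if_splits)
  qed
  ultimately show ?thesis using zK znc by blast
qed

section \<open>The curve and its nonsingular model\<close>

lemma subst_form_map:
  fixes F :: "'a::field mpol"
  assumes "form w d F"
  shows "subst_mpol id F (form_map w G v) = subst_mpol id (mcomp F G) v"
  unfolding id_hom.subst_mcomp
  by (rule id_hom.subst_form_cong[OF assms]) (simp add: form_map_def)

lemma mcomp_mult: "mcomp (F * F') G = mcomp F G * mcomp F' G"
  and mcomp_add: "mcomp (F + F') G = mcomp F G + mcomp F' G"
  and mcomp_cst: "mcomp (cst c) G = cst c"
  by (simp_all add: mcomp_def mpol_hom.subst_mult mpol_hom.subst_add)

locale curve_model = curve_with_model w C m X \<phi>
  for w :: nat and C :: "'a::{alg_closed_field,field_char_0} point set"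
    and m :: nat and X :: "'a point set" and \<phi> :: "'a point \<Rightarrow> 'a point"
begin

sublocale ns: ns_curve m X
  using model by unfold_locales (simp add: nonsingular_model_def)

sublocale pl: places ns.K X ns.\<sigma>
  by unfold_locales
    (fact ns.K_const ns.K_add ns.K_mult ns.K_inverse ns.\<sigma>_add ns.\<sigma>_mult ns.\<sigma>_const
      ns.finite_support ns.no_poles_imp_const ns.approximation ns.algebraically_dependent
      ns.coordinate_differentials)+

definition vanC :: "'a mpol \<Rightarrow> bool" where "vanC F \<longleftrightarrow> (\<forall>p\<in>C. vanishes_at F p)"

lemma C_space: "C \<subseteq> proj_space w"
  by (rule proj_curve_space[OF curve])

lemma infinite_C: "infinite C"
  by (rule infinite_proj_curve[OF curve])

lemma infinite_X: "infinite X"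
  by (rule infinite_proj_curve[OF ns.curve_X])

lemma vanC_infinite: "form w d F \<Longrightarrow> infinite {p \<in> C. vanishes_at F p} \<Longrightarrow> vanC F"
  using form_vanishes_on_curve[OF curve] unfolding vanC_def by blast

lemma van_infinite: "form m d F \<Longrightarrow> infinite {p \<in> X. vanishes_at F p} \<Longrightarrow> ns.van F"
  using form_vanishes_on_curve[OF ns.curve_X] unfolding ns.van_def by blast

lemma vanC_mult: "form w d F \<Longrightarrow> form w e G \<Longrightarrow> vanC (F * G) \<longleftrightarrow> vanC F \<or> vanC G"
  using irreducible_form_prime[of w C d F e G] curve vanishes_at_mult[of _ w w d F w e G] C_space
  unfolding vanC_def proj_curve_def by blast

lemma finite_intersection_iff: "form w d F \<Longrightarrow> finite_intersection F \<longleftrightarrow> \<not> vanC F"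
proof
  assume F: "form w d F"
  show "\<not> vanC F" if fin: "finite_intersection F"
  proof
    assume "vanC F"
    then have "{p \<in> C. vanishes_at F p} = C" by (auto simp: vanC_def)
    with fin infinite_C show False by (simp add: finite_intersection_def)
  qed
  show "finite_intersection F" if "\<not> vanC F"
    using vanC_infinite[OF F] that unfolding finite_intersection_def by blast
qed

lemma finite_Int_closed:
  assumes "proj_closed m Z" "p \<in> X" "p \<notin> Z"
  shows "finite (X \<inter> Z)"
proof (rule finite_proper_closed[OF ns.curve_X])
  show "proj_closed m (X \<inter> Z)" by (rule proj_closed_Int[OF proj_curve_closed[OF ns.curve_X] assms(1)])
qed (use assms in blast)

lemma finite_Int_closed_C:
  assumes "proj_closed w Z" "p \<in> C" "p \<notin> Z"
  shows "finite (C \<inter> Z)"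
proof (rule finite_proper_closed[OF curve])
  show "proj_closed w (C \<inter> Z)" by (rule proj_closed_Int[OF proj_curve_closed[OF curve] assms(1)])
qed (use assms in blast)

text \<open>Proper closed subsets of curves are finite, so the open sets of the birational
  isomorphism are cofinite.\<close>

lemma birational:
  obtains Z Z' where "finite (X \<inter> Z)" "finite (C \<inter> Z')" "bij_betw \<phi> (X - Z) (C - Z')"
    "morphism_on w m (C - Z') (inv_into (X - Z) \<phi>)"
proof -
  obtain Z Z' where Z: "proj_closed m Z" "proj_closed w Z'" "X - Z \<noteq> {}" "C - Z' \<noteq> {}"
    "bij_betw \<phi> (X - Z) (C - Z')" "morphism_on w m (C - Z') (inv_into (X - Z) \<phi>)"
    using model unfolding nonsingular_model_def by blast
  have "finite (X \<inter> Z)" "finite (C \<inter> Z')"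
    using Z finite_Int_closed[OF Z(1)] finite_Int_closed_C[OF Z(2)] by blast+
  with that Z show ?thesis by blast
qed

section \<open>Local representations of the map to the curve\<close>

definition local_map :: "'a point \<Rightarrow> (nat \<Rightarrow> 'a mpol) \<Rightarrow> bool" where
  "local_map \<gamma> G \<longleftrightarrow> \<gamma> \<in> X \<and> represents_near m w X \<phi> \<gamma> G"

lemma local_map_exists: "\<gamma> \<in> X \<Longrightarrow> \<exists>G. local_map \<gamma> G"
  using model unfolding nonsingular_model_def morphism_on_def local_map_def by blast

lemma local_mapE:
  assumes "local_map \<gamma> G"
  obtains e Z where "\<And>i. i \<le> w \<Longrightarrow> form m e (G i)" "finite (X \<inter> Z)" "\<gamma> \<in> X - Z"
    "\<And>u. u \<in> X - Z \<Longrightarrow> local_map u G"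
    "\<And>u v. u \<in> X - Z \<Longrightarrow> v \<in> u \<Longrightarrow> form_map w G v \<noteq> 0 \<and> \<phi> u = proj_point (form_map w G v)"
proof -
  obtain e Z where e: "\<forall>i\<le>w. form m e (G i)" and Z: "proj_closed m Z" "\<gamma> \<notin> Z"
    "\<forall>u\<in>X - Z. \<forall>v\<in>u. form_map w G v \<noteq> 0 \<and> \<phi> u = proj_point (form_map w G v)"
    using assms unfolding local_map_def represents_near_def by blast
  have \<gamma>: "\<gamma> \<in> X" using assms by (simp add: local_map_def)
  have "local_map u G" if "u \<in> X - Z" for u
    using that e Z unfolding local_map_def represents_near_def by blast
  then show ?thesis using that[of e Z] e Z \<gamma> finite_Int_closed[OF Z(1) \<gamma> Z(2)] by blast
qed

lemma \<phi>_space: "\<gamma> \<in> X \<Longrightarrow> \<phi> \<gamma> \<in> C"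
  using model by (auto simp: nonsingular_model_def)

lemma vanishes_local_map:
  assumes G: "local_map \<gamma> G" and F: "form w d F"
  shows "vanishes_at F (\<phi> \<gamma>) \<longleftrightarrow> vanishes_at (mcomp F G) \<gamma>"
proof -
  obtain e Z where e: "\<And>i. i \<le> w \<Longrightarrow> form m e (G i)" and Z: "\<gamma> \<in> X - Z"
    "\<And>u v. u \<in> X - Z \<Longrightarrow> v \<in> u \<Longrightarrow> form_map w G v \<noteq> 0 \<and> \<phi> u = proj_point (form_map w G v)"
    using local_mapE[OF G] by metis
  have \<gamma>: "\<gamma> \<in> X" using G by (simp add: local_map_def)
  have sp: "\<gamma> \<in> proj_space m" using \<gamma> ns.X_space by blast
  obtain v where v: "v \<in> \<gamma>" using proj_space_nonempty[OF sp] by auto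
  have \<phi>: "\<phi> \<gamma> = proj_point (form_map w G v)" using Z v by blast
  have "form_map w G v \<in> \<phi> \<gamma>" unfolding \<phi> by (rule proj_point_self)
  moreover have "\<phi> \<gamma> \<in> proj_space w" using \<phi>_space[OF \<gamma>] C_space by blast
  ultimately have "vanishes_at F (\<phi> \<gamma>) \<longleftrightarrow> subst_mpol id F (form_map w G v) = 0"
    using vanishes_at_iff F by blast
  also have "\<dots> \<longleftrightarrow> vanishes_at (mcomp F G) \<gamma>"
    unfolding subst_form_map[OF F] using vanishes_at_iff[OF sp v form_mcomp[OF F e]] by simp
  finally show ?thesis .
qed

text \<open>Values correspond at all but finitely many points, and \<open>\<phi>\<close> is
  injective off a finite set. Vanishing on one curve therefore gives infinitely many zeros on the
  other, which suffices.\<close>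

lemma van_mcomp_iff:
  assumes G: "local_map \<gamma> G" and F: "form w d F"
  shows "ns.van (mcomp F G) \<longleftrightarrow> vanC F"
proof -
  obtain e Z where e: "\<And>i. i \<le> w \<Longrightarrow> form m e (G i)" and Z: "finite (X \<inter> Z)"
    "\<And>u. u \<in> X - Z \<Longrightarrow> local_map u G"
    using local_mapE[OF G] by metis
  have iff: "vanishes_at F (\<phi> u) \<longleftrightarrow> vanishes_at (mcomp F G) u" if "u \<in> X - Z" for u
    by (rule vanishes_local_map[OF Z(2)[OF that] F])
  have inf: "infinite (X - Z)" using infinite_X Z(1) by (metis Diff_Diff_Int Diff_infinite_finite Int_Diff inf.idem)
  show ?thesis
  proof
    assume "vanC F"
    then have "X - Z \<subseteq> {p \<in> X. vanishes_at (mcomp F G) p}" using iff \<phi>_space by (auto simp: vanC_def)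
    then have "infinite {p \<in> X. vanishes_at (mcomp F G) p}" using inf finite_subset by blast
    moreover have "form m (d * e) (mcomp F G)" by (rule form_mcomp[OF F e])
    ultimately show "ns.van (mcomp F G)" using van_infinite by blast
  next
    assume "ns.van (mcomp F G)"
    then have sub: "\<phi> ` (X - Z) \<subseteq> {p \<in> C. vanishes_at F p}" using iff \<phi>_space by (auto simp: ns.van_def)
    obtain Zb Zb' where Zb: "finite (X \<inter> Zb)" "bij_betw \<phi> (X - Zb) (C - Zb')" using birational by metis
    have "X - Z - (X \<inter> Zb) \<subseteq> X - Zb" by auto
    then have "inj_on \<phi> (X - Z - (X \<inter> Zb))" using Zb(2) by (meson bij_betw_def inj_on_subset)
    moreover have "infinite (X - Z - (X \<inter> Zb))" using inf Zb(1) by simp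
    ultimately have "infinite (\<phi> ` (X - Z - (X \<inter> Zb)))" using finite_imageD by blast
    moreover have "\<phi> ` (X - Z - (X \<inter> Zb)) \<subseteq> {p \<in> C. vanishes_at F p}" using sub by blast
    ultimately have "infinite {p \<in> C. vanishes_at F p}" using finite_subset by blast
    then show "vanC F" by (rule vanC_infinite[OF F])
  qed
qed

lemma E_mcomp: "ns.E \<gamma> (mcomp F G) = subst_mpol fls_const F (\<lambda>i. ns.E \<gamma> (G i))"
  by (simp add: ns.E_alt fls_hom.subst_mcomp)

lemma local_map_component:
  assumes "local_map \<gamma> G"
  shows "\<exists>l\<le>w. \<not> vanishes_at (G l) \<gamma>"
proof -
  obtain e Z where e: "\<And>i. i \<le> w \<Longrightarrow> form m e (G i)" and Z: "\<gamma> \<in> X - Z"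
    "\<And>u v. u \<in> X - Z \<Longrightarrow> v \<in> u \<Longrightarrow> form_map w G v \<noteq> 0 \<and> \<phi> u = proj_point (form_map w G v)"
    using local_mapE[OF assms] by metis
  have sp: "\<gamma> \<in> proj_space m" using Z(1) ns.X_space by blast
  obtain v where v: "v \<in> \<gamma>" using proj_space_nonempty[OF sp] by auto
  have "form_map w G v \<noteq> 0" using Z v by blast
  then obtain l where "form_map w G v l \<noteq> 0" by (metis ext zero_fun_apply)
  then have "l \<le> w" "subst_mpol id (G l) v \<noteq> 0" by (auto simp: form_map_def split: if_splits)
  then show ?thesis using vanishes_at_iff[OF sp v e] by blast
qed

text \<open>Both tuples represent \<open>\<phi>\<close> at almost all points, so their two by two
  minors have infinitely many zeros on \<open>X\<close>.\<close>

lemma local_maps_proportional: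
  assumes G: "local_map \<gamma>1 G" and G': "local_map \<gamma>2 G'" and jl: "j \<le> w" "l \<le> w"
  shows "ns.van (G j * G' l - G l * G' j)"
proof -
  obtain e Z where e: "\<And>i. i \<le> w \<Longrightarrow> form m e (G i)" and Z: "finite (X \<inter> Z)"
    "\<And>u v. u \<in> X - Z \<Longrightarrow> v \<in> u \<Longrightarrow> form_map w G v \<noteq> 0 \<and> \<phi> u = proj_point (form_map w G v)"
    using local_mapE[OF G] by metis
  obtain e' Z' where e': "\<And>i. i \<le> w \<Longrightarrow> form m e' (G' i)" and Z': "finite (X \<inter> Z')"
    "\<And>u v. u \<in> X - Z' \<Longrightarrow> v \<in> u \<Longrightarrow> form_map w G' v \<noteq> 0 \<and> \<phi> u = proj_point (form_map w G' v)"
    using local_mapE[OF G'] by metis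
  have form: "form m (e + e') (G j * G' l - G l * G' j)"
    using form_mult[OF e[OF jl(1)] e'[OF jl(2)]] form_mult[OF e[OF jl(2)] e'[OF jl(1)]] by (rule form_diff)
  have "vanishes_at (G j * G' l - G l * G' j) u" if u: "u \<in> X - (X \<inter> Z \<union> X \<inter> Z')" for u
  proof -
    have sp: "u \<in> proj_space m" using u ns.X_space by blast
    obtain v where v: "v \<in> u" using proj_space_nonempty[OF sp] by auto
    have "proj_point (form_map w G v) = proj_point (form_map w G' v)"
      using Z(2)[OF _ v] Z'(2)[OF _ v] u by auto
    then have "form_map w G' v \<in> proj_point (form_map w G v)" using proj_point_self by metis
    then obtain c where c: "form_map w G' v = scale_vec c (form_map w G v)" by (auto simp: proj_point_def)
    have "subst_mpol id (G' i) v = c * subst_mpol id (G i) v" if "i \<le> w" for i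
      using fun_cong[OF c, of i] that by (simp add: form_map_def scale_vec_def)
    then show ?thesis using vanishes_at_iff[OF sp v form] jl by (simp add: id_hom.subst_diff id_hom.subst_mult)
  qed
  then have "X - (X \<inter> Z \<union> X \<inter> Z') \<subseteq> {p \<in> X. vanishes_at (G j * G' l - G l * G' j) p}" by blast
  moreover have "infinite (X - (X \<inter> Z \<union> X \<inter> Z'))" using infinite_X Z(1) Z'(1) by simp
  ultimately have "infinite {p \<in> X. vanishes_at (G j * G' l - G l * G' j) p}" using finite_subset by blast
  then show ?thesis by (rule van_infinite[OF form])
qed

text \<open>Proportionality gives a common factor between the expanded components, and a form of
  degree \<open>d\<close> picks up its \<open>d\<close>-th power. The point \<open>\<gamma>\<close>
  is arbitrary: neither tuple has to represent \<open>\<phi>\<close> near it.\<close>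

lemma local_map_change:
  assumes G: "local_map \<gamma>1 G" and G': "local_map \<gamma>2 G'" and l: "l \<le> w" "\<not> ns.van (G' l)"
    and \<gamma>: "\<gamma> \<in> X" and F: "form w d F"
  shows "ns.E \<gamma> (G l) \<noteq> 0" "ns.E \<gamma> (mcomp F G) = (ns.E \<gamma> (G l) / ns.E \<gamma> (G' l)) ^ d * ns.E \<gamma> (mcomp F G')"
proof -
  obtain e where e: "\<And>i. i \<le> w \<Longrightarrow> form m e (G i)" using local_mapE[OF G] by metis
  obtain e' where e': "\<And>i. i \<le> w \<Longrightarrow> form m e' (G' i)" using local_mapE[OF G'] by metis
  have El': "ns.E \<gamma> (G' l) \<noteq> 0" using ns.E_eq_0_iff[OF \<gamma> e'[OF l(1)]] l(2) by simp
  have rel: "ns.E \<gamma> (G j) * ns.E \<gamma> (G' l) = ns.E \<gamma> (G l) * ns.E \<gamma> (G' j)" if "j \<le> w" for j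
  proof -
    have form: "form m (e + e') (G j * G' l - G l * G' j)"
      using form_mult[OF e[OF that] e'[OF l(1)]] form_mult[OF e[OF l(1)] e'[OF that]] by (rule form_diff)
    have "ns.E \<gamma> (G j * G' l - G l * G' j) = 0"
      using local_maps_proportional[OF G G' that l(1)] ns.E_eq_0_iff[OF \<gamma> form] by simp
    then show ?thesis by simp
  qed
  obtain j where j: "j \<le> w" "\<not> vanishes_at (G j) \<gamma>1" using local_map_component[OF G] by blast
  have "\<gamma>1 \<in> X" using G by (simp add: local_map_def)
  with j(2) have "\<not> ns.van (G j)" by (auto simp: ns.van_def)
  then have "ns.E \<gamma> (G j) \<noteq> 0" using ns.E_eq_0_iff[OF \<gamma> e[OF j(1)]] by simp
  then have "ns.E \<gamma> (G j) * ns.E \<gamma> (G' l) \<noteq> 0" using El' by simp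
  then show "ns.E \<gamma> (G l) \<noteq> 0" unfolding rel[OF j(1)] by auto
  let ?a = "ns.E \<gamma> (G l) / ns.E \<gamma> (G' l)"
  have "ns.E \<gamma> (G j) = ?a * ns.E \<gamma> (G' j)" if "j \<le> w" for j
    using rel[OF that] El' by (simp add: field_simps)
  then have "subst_mpol fls_const F (\<lambda>i. ns.E \<gamma> (G i)) = subst_mpol fls_const F (\<lambda>i. ?a * ns.E \<gamma> (G' i))"
    by (intro fls_hom.subst_form_cong[OF F]) auto
  then show "ns.E \<gamma> (mcomp F G) = ?a ^ d * ns.E \<gamma> (mcomp F G')"
    unfolding E_mcomp using fls_hom.subst_form_scale[OF F, of ?a "\<lambda>i. ns.E \<gamma> (G' i)"] by (simp only:)
qed

section \<open>Intersection multiplicities\<close>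

lemma point_param_prm: "\<gamma> \<in> X \<Longrightarrow> point_param m X \<gamma> (ns.prm \<gamma>)"
proof -
  assume \<gamma>: "\<gamma> \<in> X"
  note ch = ns.chart[OF \<gamma>]
  show ?thesis
    using ns.prm[OF \<gamma>] ns_chart.i[OF ch] ns_chart.v[OF ch]
    unfolding ns_chart.param_def[OF ch] point_param_def by auto
qed

text \<open>Multiplication by the unit \<open>s\<close> turns an arbitrary parametrisation into a
  \<open>param\<close> of the chosen chart without changing orders, and there
  \<open>subdegree_unique\<close> applies.\<close>

lemma point_param_subdegree:
  assumes \<gamma>: "\<gamma> \<in> X" and x: "point_param m X \<gamma> x" and H: "form m d H"
  shows "subdegree (subst_mpol fps_const H x) = subdegree (subst_mpol fps_const H (ns.prm \<gamma>))"
proof -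
  interpret ns_chart m X \<gamma> "ns.ch_v \<gamma>" "ns.ch_i \<gamma>" by (rule ns.chart[OF \<gamma>])
  obtain l where "ns_local m X \<gamma> (ns.ch_v \<gamma>) (ns.ch_i \<gamma>) l" using ns_local_exists by blast
  then interpret ns_local m X \<gamma> "ns.ch_v \<gamma>" "ns.ch_i \<gamma>" l .
  let ?v = "ns.ch_v \<gamma>" and ?i = "ns.ch_i \<gamma>"
  from x obtain k where k: "k \<le> m" "x k = 1" by (auto simp: point_param_def)
  have x0: "(\<lambda>i. fps_nth (x i) 0) \<in> \<gamma>" and xout: "\<And>j. j > m \<Longrightarrow> x j = 0"
    and xF: "\<And>F. F \<in> vanishing_forms m X \<Longrightarrow> subst_mpol fps_const F x = 0"
    and x1: "\<exists>i\<le>m. fps_nth (x i) 1 \<noteq> 0" using x by (auto simp: point_param_def)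
  have sp: "\<gamma> \<in> proj_space m" using ns.X_space \<gamma> by blast
  have "\<gamma> = proj_point ?v" by (rule proj_spaceD(1)[OF sp v])
  with x0 obtain c where c: "c \<noteq> 0" "(\<lambda>i. fps_nth (x i) 0) = scale_vec c ?v" by (auto simp: proj_point_def)
  have xi0: "fps_nth (x ?i) 0 = c" using fun_cong[OF c(2), of ?i] vi by (simp add: scale_vec_def)
  define s where "s = inverse (x ?i)"
  have s: "s * x ?i = 1" using xi0 c(1) by (simp add: s_def inverse_mult_eq_1)
  have s0: "fps_nth s 0 = inverse c" by (simp add: s_def xi0)
  define y where "y = (\<lambda>j. s * x j)"
  have xy: "x j = y j * x ?i" for j using s by (simp add: y_def mult_ac)
  have "param y"
    unfolding param_def
  proof (intro conjI)
    show "y ?i = 1" using s by (simp add: y_def)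
    show "\<forall>j>m. y j = 0" using xout by (simp add: y_def)
    show "(\<lambda>j. fps_nth (y j) 0) = ?v"
    proof
      fix j show "fps_nth (y j) 0 = ?v j"
        using fun_cong[OF c(2), of j] c(1) by (simp add: y_def s0 scale_vec_def)
    qed
    show "\<forall>F\<in>vanishing_forms m X. subst_mpol fps_const F y = 0"
    proof
      fix F assume F: "F \<in> vanishing_forms m X"
      then obtain d where "form m d F" by (auto simp: vanishing_forms_def)
      then show "subst_mpol fps_const F y = 0"
        unfolding y_def using fps_hom.subst_form_scale[of m d F s x] xF[OF F] by simp
    qed
    \<comment> \<open>If \<open>y\<close> had no linear terms, those of \<open>x\<close> would all
      be multiples of the linear coefficient of coordinate \<open>?i\<close>; the coordinate
      \<open>k\<close> equal to \<open>1\<close> forces that one to be zero, and then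
      \<open>x\<close> has none either.\<close>
    show "\<exists>j\<le>m. fps_nth (y j) 1 \<noteq> 0"
    proof (rule ccontr)
      assume "\<not> ?thesis"
      then have y1: "fps_nth (y j) 1 = 0" if "j \<le> m" for j using that by blast
      have x1': "fps_nth (x j) 1 = fps_nth (y j) 0 * fps_nth (x ?i) 1" if "j \<le> m" for j
        by (subst xy) (use y1[OF that] in \<open>simp add: fps_mult_nth\<close>)
      have "fps_nth (y k) 0 * fps_nth (x ?i) 0 = 1"
        using arg_cong[OF xy[of k], of "\<lambda>f. fps_nth f 0"] k(2) by simp
      then have "fps_nth (x ?i) 1 = 0" using x1'[OF k(1)] k(2) by auto
      then show False using x1' x1 by auto
    qed
  qed
  from subdegree_unique[OF this ns.prm[OF \<gamma>], of H]
  have "subdegree (subst_mpol fps_const H y) = subdegree (subst_mpol fps_const H (ns.prm \<gamma>))" .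
  moreover have "subst_mpol fps_const H y = s ^ d * subst_mpol fps_const H x"
    unfolding y_def by (rule fps_hom.subst_form_scale[OF H])
  moreover have "subdegree (s ^ d * subst_mpol fps_const H x) = subdegree (subst_mpol fps_const H x)"
  proof (cases "subst_mpol fps_const H x = 0")
    case False
    have "s \<noteq> 0" "subdegree s = 0" using s0 c(1) by (auto simp: subdegree_eq_0_iff)
    with False show ?thesis by simp
  qed simp
  ultimately show ?thesis by simp
qed

text \<open>Each choice in \<open>branch_param\<close> drops out: the parametrisation by
  \<open>point_param_subdegree\<close>, the local representation by \<open>local_map_change\<close>,
  and the affine coordinate \<open>k\<close> because it only contributes a unit factor.\<close>

lemma branch_param_subdegree:
  assumes \<gamma>: "\<gamma> \<in> X" and G: "local_map \<gamma> G" and F: "form w d F" and y: "branch_param \<gamma> y"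
  shows "int (subdegree (subst_mpol fps_const F y)) = fls_subdegree (ns.E \<gamma> (mcomp F G))"
proof -
  from y obtain x G' k where x: "point_param m X \<gamma> x" and G'r: "represents_near m w X \<phi> \<gamma> G'" and k: "k \<le> w"
    "fps_nth (subst_mpol fps_const (G' k) x) 0 \<noteq> 0"
    "y = (\<lambda>j. if j \<le> w then subst_mpol fps_const (G' j) x * inverse (subst_mpol fps_const (G' k) x) else 0)"
    by (auto simp: branch_param_def)
  have G': "local_map \<gamma> G'" using \<gamma> G'r by (simp add: local_map_def)
  obtain e where e: "\<And>i. i \<le> w \<Longrightarrow> form m e (G i)" using local_mapE[OF G] by metis
  obtain e' Z' where e': "\<And>i. i \<le> w \<Longrightarrow> form m e' (G' i)" and Z': "\<gamma> \<in> X - Z'"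
    "\<And>u v. u \<in> X - Z' \<Longrightarrow> v \<in> u \<Longrightarrow> form_map w G' v \<noteq> 0 \<and> \<phi> u = proj_point (form_map w G' v)"
    using local_mapE[OF G'] by metis
  let ?s = "inverse (subst_mpol fps_const (G' k) x)"
  have "subst_mpol fps_const F y = subst_mpol fps_const F (\<lambda>j. ?s * subst_mpol fps_const (G' j) x)"
    by (rule fps_hom.subst_form_cong[OF F]) (simp add: k(3))
  also have "\<dots> = ?s ^ d * subst_mpol fps_const (mcomp F G') x"
    unfolding fps_hom.subst_mcomp by (rule fps_hom.subst_form_scale[OF F])
  finally have Fy: "subst_mpol fps_const F y = ?s ^ d * subst_mpol fps_const (mcomp F G') x" .
  have s0: "?s \<noteq> 0" "subdegree ?s = 0"
    using k(2) by (auto simp: subdegree_eq_0_iff)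
  have "subdegree (subst_mpol fps_const F y) = subdegree (subst_mpol fps_const (mcomp F G') x)"
    unfolding Fy using s0 by (cases "subst_mpol fps_const (mcomp F G') x = 0") simp_all
  also have "\<dots> = subdegree (subst_mpol fps_const (mcomp F G') (ns.prm \<gamma>))"
    by (rule point_param_subdegree[OF \<gamma> x form_mcomp[OF F e']])
  finally have 1: "int (subdegree (subst_mpol fps_const F y)) = fls_subdegree (ns.E \<gamma> (mcomp F G'))"
    by (simp add: ns.E_def fls_subdegree_fls_to_fps)
  obtain l where l: "l \<le> w" "\<not> vanishes_at (G l) \<gamma>" using local_map_component[OF G] by blast
  then have nl: "\<not> ns.van (G l)" using \<gamma> by (auto simp: ns.van_def)
  \<comment> \<open>Vanishing of component \<open>l\<close> at \<open>\<gamma>\<close> means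
    vanishing of \<open>mvar l\<close> at \<open>\<phi> \<gamma>\<close>, whatever the
    representation.\<close>
  have "\<not> vanishes_at (G' l) \<gamma>"
  proof
    assume v: "vanishes_at (G' l) \<gamma>"
    have L: "form w 1 (mvar l)" by (rule form_mvar[OF l(1)])
    have comp: "mcomp (mvar l) H = H l" for H by (simp add: mcomp_def)
    show False using vanishes_local_map[OF G L] vanishes_local_map[OF G' L] v l(2) by (simp add: comp)
  qed
  then have nl': "\<not> ns.van (G' l)" using \<gamma> by (auto simp: ns.van_def)
  have sub: "fls_subdegree (ns.E \<gamma> (G l)) = 0" "fls_subdegree (ns.E \<gamma> (G' l)) = 0"
    using ns.E_subdegree_pos_iff[OF \<gamma> e[OF l(1)] nl] ns.E_subdegree_pos_iff[OF \<gamma> e'[OF l(1)] nl'] l(2)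
      \<open>\<not> vanishes_at (G' l) \<gamma>\<close> by simp_all
  have nz: "ns.E \<gamma> (G l) \<noteq> 0" "ns.E \<gamma> (G' l) \<noteq> 0"
    using ns.E_eq_0_iff[OF \<gamma> e[OF l(1)]] ns.E_eq_0_iff[OF \<gamma> e'[OF l(1)]] nl nl' by simp_all
  have "fls_subdegree (ns.E \<gamma> (mcomp F G')) = fls_subdegree (ns.E \<gamma> (mcomp F G))"
    unfolding local_map_change(2)[OF G' G l(1) nl \<gamma> F]
    using sub nz by (cases "ns.E \<gamma> (mcomp F G) = 0") (simp_all add: fls_divide_subdegree fls_subdegree_pow)
  with 1 show ?thesis by simp
qed

lemma branch_param_exists:
  assumes \<gamma>: "\<gamma> \<in> X"
  shows "\<exists>y. branch_param \<gamma> y"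
proof -
  obtain G where G: "local_map \<gamma> G" using local_map_exists[OF \<gamma>] by blast
  obtain e where e: "\<And>i. i \<le> w \<Longrightarrow> form m e (G i)" using local_mapE[OF G] by metis
  obtain k where k: "k \<le> w" "\<not> vanishes_at (G k) \<gamma>" using local_map_component[OF G] by blast
  have "fps_nth (subst_mpol fps_const (G k) (ns.prm \<gamma>)) 0 \<noteq> 0"
    using ns.E_nth_0[OF \<gamma> e[OF k(1)]] k(2) by (simp add: ns.E_def)
  then show ?thesis unfolding branch_param_def
    using point_param_prm[OF \<gamma>] G k(1) unfolding local_map_def by blast
qed

text \<open>Resolves the definite description: some parametrisation exists, and all of them give the
  same order.\<close>

lemma int_mult:
  assumes G: "local_map \<gamma> G" and F: "form w d F"
  shows "int (int_mult \<gamma> F) = fls_subdegree (ns.E \<gamma> (mcomp F G))"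
proof -
  have \<gamma>: "\<gamma> \<in> X" using G by (simp add: local_map_def)
  obtain y where y: "branch_param \<gamma> y" using branch_param_exists[OF \<gamma>] by blast
  have "int_mult \<gamma> F = subdegree (subst_mpol fps_const F y)"
    unfolding int_mult_def
  proof (rule the_equality)
    fix n assume "\<exists>y. branch_param \<gamma> y \<and> n = subdegree (subst_mpol fps_const F y)"
    then obtain y' where y': "branch_param \<gamma> y'" "n = subdegree (subst_mpol fps_const F y')" by blast
    show "n = subdegree (subst_mpol fps_const F y)"
      using branch_param_subdegree[OF \<gamma> G F y] branch_param_subdegree[OF \<gamma> G F y'(1)] y'(2) by simp
  qed (use y in blast)
  then show ?thesis using branch_param_subdegree[OF \<gamma> G F y] by simp
qed

lemma int_mult_pos_iff:
  assumes \<gamma>: "\<gamma> \<in> X" and F: "form w d F" "\<not> vanC F"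
  shows "int_mult \<gamma> F \<noteq> 0 \<longleftrightarrow> vanishes_at F (\<phi> \<gamma>)"
proof -
  obtain G where G: "local_map \<gamma> G" using local_map_exists[OF \<gamma>] by blast
  obtain e where e: "\<And>i. i \<le> w \<Longrightarrow> form m e (G i)" using local_mapE[OF G] by metis
  show ?thesis
    using int_mult[OF G F(1)] van_mcomp_iff[OF G F(1)] F(2) vanishes_local_map[OF G F(1)]
      ns.E_subdegree_pos_iff[OF \<gamma> form_mcomp[OF F(1) e]] by fastforce
qed

lemma int_mult_mult:
  assumes \<gamma>: "\<gamma> \<in> X" and F: "form w d F" "\<not> vanC F" and F': "form w d' F'" "\<not> vanC F'"
  shows "int_mult \<gamma> (F * F') = int_mult \<gamma> F + int_mult \<gamma> F'"
proof -
  obtain G where G: "local_map \<gamma> G" using local_map_exists[OF \<gamma>] by blast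
  obtain e where e: "\<And>i. i \<le> w \<Longrightarrow> form m e (G i)" using local_mapE[OF G] by metis
  have "ns.E \<gamma> (mcomp F G) \<noteq> 0" "ns.E \<gamma> (mcomp F' G) \<noteq> 0"
    using ns.E_eq_0_iff[OF \<gamma> form_mcomp[OF F(1) e]] van_mcomp_iff[OF G F(1)] F(2)
      ns.E_eq_0_iff[OF \<gamma> form_mcomp[OF F'(1) e]] van_mcomp_iff[OF G F'(1)] F'(2) by simp_all
  then have "int (int_mult \<gamma> (F * F')) = int (int_mult \<gamma> F) + int (int_mult \<gamma> F')"
    unfolding int_mult[OF G F(1)] int_mult[OF G F'(1)] int_mult[OF G form_mult[OF F(1) F'(1)]] by (simp add: mcomp_mult)
  then show ?thesis by linarith
qed

end

lemma mpol_fls_pair: "vector_space_pair (scale_mpol :: 'a \<Rightarrow> 'a mpol \<Rightarrow> 'a mpol) (fls_scale :: 'a::field \<Rightarrow> 'a fls \<Rightarrow> 'a fls)"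
  by unfold_locales

lemma fls_mpol_pair: "vector_space_pair (fls_scale :: 'a::field \<Rightarrow> 'a fls \<Rightarrow> 'a fls) (scale_mpol :: 'a \<Rightarrow> 'a mpol \<Rightarrow> 'a mpol)"
  by unfold_locales

context curve_model
begin

section \<open>Forms as functions on the model\<close>

definition G0 :: "nat \<Rightarrow> 'a mpol" where "G0 = (SOME G. local_map ns.\<gamma>0 G)"

lemma G0: "local_map ns.\<gamma>0 G0"
  unfolding G0_def by (rule someI_ex[OF local_map_exists[OF ns.\<gamma>0]])

text \<open>The common degree of the components of \<open>G0\<close> is fixed by a choice, so forms
  of equal degree pull back to forms of literally equal degree, as \<open>rep\<close>
  requires.\<close>

lemma form_G0:
  assumes "form w d F"
  shows "form m (d * (SOME e. \<forall>i\<le>w. form m e (G0 i))) (mcomp F G0)"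
proof (rule form_mcomp[OF assms])
  have "\<exists>e. \<forall>i\<le>w. form m e (G0 i)" using local_mapE[OF G0] by metis
  then have "\<forall>i\<le>w. form m (SOME e. \<forall>i\<le>w. form m e (G0 i)) (G0 i)" by (rule someI_ex)
  then show "\<And>i. i \<le> w \<Longrightarrow> form m (SOME e. \<forall>i\<le>w. form m e (G0 i)) (G0 i)" by blast
qed

text \<open>The function \<open>F / H\<close> on the curve, pulled back by the single tuple
  \<open>G0\<close>; its use at other points rests on the cancellation of the factor in
  \<open>local_map_change\<close>.\<close>

definition \<theta> :: "'a mpol \<Rightarrow> 'a mpol \<Rightarrow> 'a fls" where
  "\<theta> H F = ns.quo ns.\<gamma>0 (mcomp F G0) (mcomp H G0)"

lemma rep_\<theta>: "form w d F \<Longrightarrow> form w d H \<Longrightarrow> \<not> vanC H \<Longrightarrow> ns.rep (mcomp F G0) (mcomp H G0)"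
  unfolding ns.rep_def using form_G0 van_mcomp_iff[OF G0] by blast

lemma \<theta>_K: "form w d F \<Longrightarrow> form w d H \<Longrightarrow> \<not> vanC H \<Longrightarrow> \<theta> H F \<in> ns.K"
  unfolding \<theta>_def by (rule ns.quo_in_K[OF rep_\<theta>])

lemma \<theta>_eq_0: "form w d F \<Longrightarrow> form w d H \<Longrightarrow> \<not> vanC H \<Longrightarrow> \<theta> H F = 0 \<longleftrightarrow> vanC F"
  unfolding \<theta>_def using ns.quo_eq_0_iff[OF rep_\<theta> ns.\<gamma>0] van_mcomp_iff[OF G0] by blast

lemma E_G0_nonzero: "form w d H \<Longrightarrow> \<not> vanC H \<Longrightarrow> ns.E ns.\<gamma>0 (mcomp H G0) \<noteq> 0"
  using ns.E_eq_0_iff[OF ns.\<gamma>0 form_G0] van_mcomp_iff[OF G0] by blast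

lemma \<theta>_add: "\<theta> H (F + F') = \<theta> H F + \<theta> H F'"
  by (simp add: \<theta>_def ns.quo_def mcomp_add add_divide_distrib)

lemma \<theta>_scale: "\<theta> H (scale_mpol c F) = fls_scale c (\<theta> H F)"
  by (simp add: \<theta>_def ns.quo_def scale_mpol_eq mcomp_mult mcomp_cst fls_scale_def)

lemma linear_\<theta>: "Vector_Spaces.linear scale_mpol fls_scale (\<theta> H)"
  unfolding Vector_Spaces.linear_iff
  using mpol_space.vector_space_axioms fls_space.vector_space_axioms \<theta>_add \<theta>_scale by blast

lemma \<theta>_mult: "\<theta> (H * H') (F * F') = \<theta> H F * \<theta> H' F'"
  by (simp add: \<theta>_def ns.quo_def mcomp_mult)

lemma \<theta>_self: "form w d H \<Longrightarrow> \<not> vanC H \<Longrightarrow> \<theta> H H = 1"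
  using E_G0_nonzero by (simp add: \<theta>_def ns.quo_def)

text \<open>At \<open>\<gamma>\<close> the tuple \<open>G0\<close> is replaced by one representing
  \<open>\<phi>\<close> there; numerator and denominator have the same degree, so the correction
  factors cancel.\<close>

lemma v_\<theta>:
  assumes F: "form w d F" "\<not> vanC F" and H: "form w d H" "\<not> vanC H" and \<gamma>: "\<gamma> \<in> X"
  shows "pl.v \<gamma> (\<theta> H F) = int (int_mult \<gamma> F) - int (int_mult \<gamma> H)"
proof -
  obtain G where G: "local_map \<gamma> G" using local_map_exists[OF \<gamma>] by blast
  obtain e where e: "\<And>i. i \<le> w \<Longrightarrow> form m e (G i)" using local_mapE[OF G] by metis
  obtain l where l: "l \<le> w" "\<not> vanishes_at (G l) \<gamma>" using local_map_component[OF G] by blast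
  then have nl: "\<not> ns.van (G l)" using \<gamma> by (auto simp: ns.van_def)
  note change = local_map_change[OF G0 G l(1) nl \<gamma>]
  have El: "ns.E \<gamma> (G l) \<noteq> 0" using ns.E_eq_0_iff[OF \<gamma> e[OF l(1)]] nl by simp
  have nz: "ns.E \<gamma> (mcomp F G) \<noteq> 0" "ns.E \<gamma> (mcomp H G) \<noteq> 0"
    using ns.E_eq_0_iff[OF \<gamma> form_mcomp[OF F(1) e]] van_mcomp_iff[OF G F(1)] F(2)
      ns.E_eq_0_iff[OF \<gamma> form_mcomp[OF H(1) e]] van_mcomp_iff[OF G H(1)] H(2) by simp_all
  have "ns.\<sigma> \<gamma> (\<theta> H F) = ns.E \<gamma> (mcomp F G0) / ns.E \<gamma> (mcomp H G0)"
    unfolding \<theta>_def ns.\<sigma>_quo[OF rep_\<theta>[OF F(1) H] \<gamma>] by (simp only: ns.quo_def)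
  also have "\<dots> = ns.E \<gamma> (mcomp F G) / ns.E \<gamma> (mcomp H G)"
    unfolding change(2)[OF F(1)] change(2)[OF H(1)] using change(1)[OF F(1)] El by simp
  finally show ?thesis
    unfolding pl.v_def int_mult[OF G F(1)] int_mult[OF G H(1)] using nz by (simp add: fls_divide_subdegree)
qed

lemma finite_int_mult:
  assumes F: "form w d F" "\<not> vanC F"
  shows "finite {\<gamma> \<in> X. int_mult \<gamma> F \<noteq> 0}"
proof -
  obtain Z where Z: "finite (X \<inter> Z)" "\<And>u. u \<in> X - Z \<Longrightarrow> local_map u G0"
    using local_mapE[OF G0] by metis
  have "{\<gamma> \<in> X. int_mult \<gamma> F \<noteq> 0} \<subseteq> (X \<inter> Z) \<union> {\<gamma> \<in> X. vanishes_at (mcomp F G0) \<gamma>}"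
    using int_mult_pos_iff[OF _ F] vanishes_local_map[OF Z(2) F(1)] by blast
  moreover have "finite {\<gamma> \<in> X. vanishes_at (mcomp F G0) \<gamma>}"
    using ns.van_finite[OF form_G0[OF F(1)]] van_mcomp_iff[OF G0 F(1)] F(2) by blast
  ultimately show ?thesis using Z(1) finite_subset by blast
qed

lemma count_cut_out:
  assumes "form w d F" "\<not> vanC F"
  shows "count (cut_out F) \<gamma> = (if \<gamma> \<in> X then int_mult \<gamma> F else 0)"
proof -
  have "cut_out F = fun_mset X (\<lambda>\<gamma>. int_mult \<gamma> F)" by (simp add: cut_out_def fun_mset_def)
  then show ?thesis using count_fun_mset[OF finite_int_mult[OF assms]] by simp
qed

lemma set_cut_out: "form w d F \<Longrightarrow> \<not> vanC F \<Longrightarrow> set_mset (cut_out F) \<subseteq> X"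
  using count_cut_out by (metis count_eq_zero_iff subsetI)

lemma cut_out_mult:
  assumes "form w d F" "\<not> vanC F" "form w e F'" "\<not> vanC F'"
  shows "cut_out (F * F') = cut_out F + cut_out F'"
proof (rule multiset_eqI)
  fix \<gamma>
  have "form w (d + e) (F * F')" "\<not> vanC (F * F')" using assms vanC_mult form_mult by blast+
  then show "count (cut_out (F * F')) \<gamma> = count (cut_out F + cut_out F') \<gamma>"
    using count_cut_out int_mult_mult[OF _ assms] assms by simp
qed

lemma v_\<theta>_cut_out:
  assumes "form w d F" "\<not> vanC F" "form w d H" "\<not> vanC H" "\<gamma> \<in> X"
  shows "pl.v \<gamma> (\<theta> H F) = int (count (cut_out F) \<gamma>) - int (count (cut_out H) \<gamma>)"
  using v_\<theta>[OF assms] count_cut_out assms by simp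

lemma \<theta>_L:
  assumes "form w d F" "form w d H" "\<not> vanC H"
  shows "\<theta> H F \<in> pl.L (cut_out H)"
  using \<theta>_K[OF assms] \<theta>_eq_0[OF assms] v_\<theta>_cut_out[OF assms(1) _ assms(2,3)] by (auto simp: pl.L_def)

lemma vanC_one: "\<not> vanC 1"
proof -
  obtain p where p: "p \<in> C" using infinite_C by fastforce
  then obtain v where "v \<in> p" using C_space proj_space_nonempty by blast
  with p show ?thesis by (auto simp: vanC_def vanishes_at_def)
qed

text \<open>Through the centre of each branch passes a linear form that misses another point of
  \<open>C\<close>; the product of these forms contains \<open>A\<close> in its section.\<close>

lemma cut_out_covers:
  assumes "set_mset A \<subseteq> X"
  shows "\<exists>d T. form w d T \<and> \<not> vanC T \<and> A \<subseteq># cut_out T"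
  using assms
proof (induction A)
  case empty
  show ?case using form_one vanC_one by (metis empty_le)
next
  case (add \<gamma> A)
  then obtain d T where T: "form w d T" "\<not> vanC T" "A \<subseteq># cut_out T" by auto
  have \<gamma>: "\<gamma> \<in> X" using add.prems by simp
  obtain q where q: "q \<in> C" "q \<noteq> \<phi> \<gamma>" using infinite_C by (metis finite.emptyI finite_insert finite_subset singletonI subsetI insertI1)
  obtain M where M: "form w 1 M" "vanishes_at M (\<phi> \<gamma>)" "\<not> vanishes_at M q"
    using separating_form[of "\<phi> \<gamma>" w q] q \<phi>_space[OF \<gamma>] C_space by blast
  have nv: "\<not> vanC M" using M(3) q(1) by (auto simp: vanC_def)
  have "\<gamma> \<in># cut_out M"
    using int_mult_pos_iff[OF \<gamma> M(1) nv] M(2) count_cut_out[OF M(1) nv, of \<gamma>] \<gamma> by (simp flip: count_greater_zero_iff)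
  then have "{#\<gamma>#} + A \<subseteq># cut_out M + cut_out T" using T(3) by (intro subset_mset.add_mono) simp_all
  moreover have "form w (1 + d) (M * T)" "\<not> vanC (M * T)" using M(1) nv T(1,2) vanC_mult form_mult by blast+
  ultimately show ?case using cut_out_mult[OF M(1) nv T(1,2)] by (intro exI[of _ "1 + d"] exI[of _ "M * T"]) simp
qed

text \<open>Pulling back along the inverse of \<open>\<phi>\<close> expresses every function on the model through forms
  on the ambient space of \<open>C\<close>.\<close>

lemma K_forms:
  assumes "f \<in> ns.K"
  shows "\<exists>d H F. form w d H \<and> \<not> vanC H \<and> form w d F \<and> f = \<theta> H F"
proof -
  obtain H1 H2 where H: "ns.rep H1 H2" "f = ns.quo ns.\<gamma>0 H1 H2" using ns.K_elim[OF assms] by blast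
  then obtain d where d: "form m d H1" "form m d H2" "\<not> ns.van H2" by (auto simp: ns.rep_def)
  obtain Z Z' where Z: "finite (X \<inter> Z)" "finite (C \<inter> Z')" "bij_betw \<phi> (X - Z) (C - Z')"
    "morphism_on w m (C - Z') (inv_into (X - Z) \<phi>)" using birational by metis
  have "infinite (C - (C \<inter> Z'))" using infinite_C Z(2) by simp
  then have "C - (C \<inter> Z') \<noteq> {}" by (metis finite.emptyI)
  then obtain q where q: "q \<in> C - Z'" by blast
  then obtain G' where "represents_near w m (C - Z') (inv_into (X - Z) \<phi>) q G'"
    using Z(4) unfolding morphism_on_def by blast
  then obtain e Y where e: "\<forall>i\<le>m. form w e (G' i)" and Y: "proj_closed w Y" "q \<notin> Y"
    and G': "\<forall>u\<in>C - Z' - Y. \<forall>v\<in>u. form_map m G' v \<noteq> 0 \<and> inv_into (X - Z) \<phi> u = proj_point (form_map m G' v)"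
    unfolding represents_near_def by blast
  obtain e0 Z0 where e0: "\<And>i. i \<le> w \<Longrightarrow> form m e0 (G0 i)" and Z0: "finite (X \<inter> Z0)"
    "\<And>u v. u \<in> X - Z0 \<Longrightarrow> v \<in> u \<Longrightarrow> form_map w G0 v \<noteq> 0 \<and> \<phi> u = proj_point (form_map w G0 v)"
    using local_mapE[OF G0] by metis
  have finY: "finite (C \<inter> Y)" using finite_Int_closed_C[OF Y(1) _ Y(2)] q by blast
  have inj: "inj_on \<phi> (X - Z)" using Z(3) by (rule bij_betw_imp_inj_on)
  have "finite ({u \<in> X - Z. \<phi> u \<in> C \<inter> Y})"
    using finite_vimage_IntI[OF finY inj] by (rule finite_subset[rotated]) auto
  then have finbad: "finite ((X \<inter> Z) \<union> (X \<inter> Z0) \<union> {u \<in> X - Z. \<phi> u \<in> C \<inter> Y})" (is "finite ?B") using Z(1) Z0(1) by blast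
  \<comment> \<open>Forms on the space of \<open>X\<close> are pulled back along a representation of
    the inverse of \<open>\<phi>\<close> near \<open>q\<close>.\<close>
  define F where "F = (\<lambda>H. mcomp H G')"
  have FF: "form w (d * e) (F H1)" "form w (d * e) (F H2)" unfolding F_def using d e by (auto intro: form_mcomp)
  \<comment> \<open>At almost all points the composite of both representations multiplies the
    coordinates by a scalar, hence forms of degree \<open>d\<close> by a factor that is the same for
    \<open>H1\<close> and \<open>H2\<close>.\<close>
  have key: "\<exists>c x. c \<noteq> 0 \<and> x \<in> p \<and> (\<forall>H. form m d H \<longrightarrow> subst_mpol id (mcomp (F H) G0) x = c * subst_mpol id H x)"
    if p: "p \<in> X - ?B" for p
  proof -
    have sp: "p \<in> proj_space m" using p ns.X_space by blast
    obtain x where x: "x \<in> p" using proj_space_nonempty[OF sp] by auto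
    have pZ: "p \<in> X - Z" using p by blast
    have u: "\<phi> p \<in> C - Z'" using Z(3) pZ by (auto simp: bij_betw_def)
    then have uY: "\<phi> p \<in> C - Z' - Y" using p by blast
    define y where "y = form_map w G0 x"
    have y: "\<phi> p = proj_point y" using Z0(2)[OF _ x] p by (auto simp: y_def)
    have yu: "y \<in> \<phi> p" unfolding y by (rule proj_point_self)
    have "inv_into (X - Z) \<phi> (\<phi> p) = proj_point (form_map m G' y)" using G' uY yu by blast
    then have pp: "p = proj_point (form_map m G' y)" using inv_into_f_f[OF inj pZ] by simp
    then have "form_map m G' y \<in> proj_point x"
      using proj_spaceD(1)[OF sp x] proj_point_self by metis
    then obtain c where c: "c \<noteq> 0" "form_map m G' y = scale_vec c x" by (auto simp: proj_point_def)
    have "subst_mpol id (mcomp (F H) G0) x = c ^ d * subst_mpol id H x" if Hf: "form m d H" for H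
    proof -
      have fH: "form w (d * e) (F H)" unfolding F_def using Hf e by (auto intro: form_mcomp)
      have "subst_mpol id (mcomp (F H) G0) x = subst_mpol id (F H) y"
        unfolding y_def subst_form_map[OF fH] ..
      also have "\<dots> = subst_mpol id H (form_map m G' y)"
        unfolding F_def using subst_form_map[OF Hf] by simp
      also have "\<dots> = c ^ d * subst_mpol id H x"
        unfolding c(2) scale_vec_def by (rule id_hom.subst_form_scale[OF Hf])
      finally show ?thesis .
    qed
    then show ?thesis using x c(1) by (intro exI[of _ "c ^ d"] exI[of _ x]) simp
  qed
  have inf: "infinite (X - ?B)" using infinite_X finbad by simp
  have nv: "\<not> vanC (F H2)"
  proof
    assume "vanC (F H2)"
    then have v: "ns.van (mcomp (F H2) G0)" using van_mcomp_iff[OF G0 FF(2)] by simp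
    have "vanishes_at H2 p" if p: "p \<in> X - ?B" for p
    proof -
      obtain c x where cx: "c \<noteq> 0" "x \<in> p" "\<forall>H. form m d H \<longrightarrow> subst_mpol id (mcomp (F H) G0) x = c * subst_mpol id H x"
        using key[OF p] by blast
      have pX: "p \<in> X" using p by blast
      then have sp: "p \<in> proj_space m" using ns.X_space by blast
      have "vanishes_at (mcomp (F H2) G0) p" using v pX by (simp add: ns.van_def)
      then have "subst_mpol id (mcomp (F H2) G0) x = 0" using cx(2) by (simp add: vanishes_at_def)
      then show ?thesis using cx(1,3) d(2) vanishes_at_iff[OF sp cx(2) d(2)] by simp
    qed
    then have "X - ?B \<subseteq> {p \<in> X. vanishes_at H2 p}" by blast
    then have "infinite {p \<in> X. vanishes_at H2 p}" using inf finite_subset by blast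
    then show False using van_infinite[OF d(2)] d(3) by blast
  qed
  \<comment> \<open>Cross-multiplied, the common factor cancels and the difference has infinitely
    many zeros.\<close>
  let ?D = "H1 * mcomp (F H2) G0 - mcomp (F H1) G0 * H2"
  obtain e1 where e1: "form m e1 (mcomp (F H1) G0)" "form m e1 (mcomp (F H2) G0)" using form_G0[OF FF(1)] form_G0[OF FF(2)] by blast
  have formD: "form m (d + e1) ?D"
    using form_mult[OF d(1) e1(2)] form_mult[OF e1(1) d(2)] by (simp add: form_diff add.commute)
  have "vanishes_at ?D p" if p: "p \<in> X - ?B" for p
  proof -
    obtain c x where cx: "c \<noteq> 0" "x \<in> p" "\<forall>H. form m d H \<longrightarrow> subst_mpol id (mcomp (F H) G0) x = c * subst_mpol id H x"
      using key[OF p] by blast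
    have sp: "p \<in> proj_space m" using p ns.X_space by blast
    show ?thesis
      unfolding vanishes_at_iff[OF sp cx(2) formD] using cx(3) d(1,2)
      by (simp add: id_hom.subst_diff id_hom.subst_mult)
  qed
  then have "X - ?B \<subseteq> {p \<in> X. vanishes_at ?D p}" by blast
  then have "infinite {p \<in> X. vanishes_at ?D p}" using inf finite_subset by blast
  then have "ns.van ?D" using van_infinite[OF formD] by blast
  then have "f = \<theta> (F H2) (F H1)"
    unfolding H(2) \<theta>_def using ns.quo_eq_iff[OF H(1) rep_\<theta>[OF FF nv] ns.\<gamma>0] by blast
  then show ?thesis using FF nv by blast
qed

lemma common_denominator:
  assumes "finite B" "B \<subseteq> ns.K"
  shows "\<exists>d H. form w d H \<and> \<not> vanC H \<and> (\<forall>b\<in>B. \<exists>F. form w d F \<and> b = \<theta> H F)"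
  using assms
proof (induction B rule: finite_induct)
  case empty
  show ?case using form_one vanC_one by blast
next
  case (insert b B)
  then obtain d H where H: "form w d H" "\<not> vanC H" "\<And>b. b \<in> B \<Longrightarrow> \<exists>F. form w d F \<and> b = \<theta> H F" by auto
  obtain e H' F' where H': "form w e H'" "\<not> vanC H'" "form w e F'" "b = \<theta> H' F'" using K_forms[of b] insert.prems by auto
  have HH: "form w (d + e) (H * H')" "\<not> vanC (H * H')" using H H' vanC_mult form_mult by blast+
  have "\<exists>F. form w (d + e) F \<and> x = \<theta> (H * H') F" if x: "x \<in> insert b B" for x
  proof (cases "x = b")
    case True
    have "b = \<theta> (H * H') (H * F')" using H'(4) by (simp add: \<theta>_mult \<theta>_self[OF H(1,2)])
    with True show ?thesis using form_mult[OF H(1) H'(3)] by blast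
  next
    case False
    then obtain F where F: "form w d F" "x = \<theta> H F" using H(3) x by blast
    have "x = \<theta> (H * H') (F * H')" using F(2) by (simp add: \<theta>_mult \<theta>_self[OF H'(1,2)])
    then show ?thesis using form_mult[OF F(1) H'(1)] by blast
  qed
  then show ?case using HH by blast
qed

section \<open>The dimension of a series\<close>

lemma Series_alt:
  assumes "\<And>F. F \<in> V \<Longrightarrow> form w d F"
  shows "Series V = {cut_out F | F. F \<in> V \<and> \<not> vanC F}"
  unfolding Series_def using finite_intersection_iff assms by blast

lemma cut_out_eq_imp:
  assumes F: "form w d F" "\<not> vanC F" and F': "form w d F'" "\<not> vanC F'" and eq: "cut_out F = cut_out F'"
    and H: "form w d H" "\<not> vanC H"
  shows "\<exists>c. \<theta> H F = \<theta> H (scale_mpol c F')"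
proof -
  have K: "\<theta> F' F \<in> ns.K" by (rule \<theta>_K[OF F(1) F'])
  have "pl.v \<gamma> (\<theta> F' F) = 0" if "\<gamma> \<in> X" for \<gamma> using v_\<theta>_cut_out[OF F F' that] eq by simp
  then obtain c where c: "\<theta> F' F = fls_const c" using pl.v_zero_imp_const[OF K] by blast
  have "\<theta> H F = \<theta> F' F * \<theta> H F'"
    using E_G0_nonzero[OF F'] by (simp add: \<theta>_def ns.quo_def)
  then show ?thesis unfolding c by (auto simp: \<theta>_scale fls_scale_def)
qed

lemma cut_out_\<theta>:
  assumes F: "form w d F" "\<not> vanC F" and F': "form w d F'" and H: "form w d H" "\<not> vanC H" and eq: "\<theta> H F = \<theta> H F'"
  shows "\<not> vanC F' \<and> cut_out F = cut_out F'"
proof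
  show nv: "\<not> vanC F'" using \<theta>_eq_0[OF F(1) H] \<theta>_eq_0[OF F' H] F(2) eq by simp
  show "cut_out F = cut_out F'"
  proof (rule multiset_eqI)
    fix \<gamma> show "count (cut_out F) \<gamma> = count (cut_out F') \<gamma>"
      using v_\<theta>[OF F H, of \<gamma>] v_\<theta>[OF F' nv H, of \<gamma>] eq count_cut_out[OF F] count_cut_out[OF F' nv] by simp
  qed
qed

text \<open>Forms in \<open>V\<close> vanishing on \<open>C\<close> are the kernel of
  \<open>\<theta> H\<close>, and nonzero functions up to scalars correspond to the sets cut out. A
  least subsystem with the same sections thus has the dimension of the image.\<close>

lemma Series_dim:
  assumes V: "linear_system w d V" and F0: "F0 \<in> V" "\<not> vanC F0" and H: "form w d H" "\<not> vanC H"
  shows "fls_space.dim (\<theta> H ` V) = Series_dim V + 1"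
proof -
  have sub: "mpol_space.subspace V" and forms: "\<And>F. F \<in> V \<Longrightarrow> form w d F" using V by (auto simp: linear_system_def)
  interpret mf: vector_space_pair scale_mpol "fls_scale :: 'a \<Rightarrow> 'a fls \<Rightarrow> 'a fls" by (rule mpol_fls_pair)
  interpret fm: vector_space_pair "fls_scale :: 'a \<Rightarrow> 'a fls \<Rightarrow> 'a fls" scale_mpol by (rule fls_mpol_pair)
  let ?U = "\<theta> H ` V"
  define r where "r = fls_space.dim ?U - 1"
  have UL: "?U \<subseteq> pl.L (cut_out H)" using \<theta>_L[OF forms H] by blast
  obtain B where B: "B \<subseteq> ?U" "\<not> fls_space.dependent B" "?U \<subseteq> fls_space.span B" "card B = fls_space.dim ?U" "finite B"
    by (rule pl.finite_basis[OF UL]) (rule that)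
  have Usub: "fls_space.subspace ?U" by (rule mf.linear_subspace_image[OF linear_\<theta> sub])
  have spanB: "fls_space.span B = ?U" using fls_space.span_minimal[OF B(1) Usub] B(3) by blast
  have nz: "\<theta> H F0 \<noteq> 0" using \<theta>_eq_0[OF forms[OF F0(1)] H] F0(2) by simp
  have "B \<noteq> {}" using nz F0(1) B(3) by auto
  then have "card B > 0" using B(5) by (simp add: card_gt_0_iff)
  then have dimU: "fls_space.dim ?U = r + 1" using B(4) by (simp add: r_def)
  \<comment> \<open>A linear right inverse selects one form for every function, so its image meets
    the kernel trivially and still cuts out every member.\<close>
  obtain g where g: "range g \<subseteq> V" "Vector_Spaces.linear fls_scale scale_mpol g" "\<And>f. f \<in> ?U \<Longrightarrow> \<theta> H (g f) = f"
    using mf.linear_exists_right_inverse_on[OF linear_\<theta> sub, of H] by auto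
  have injg: "inj_on g ?U" using g(3) by (metis inj_onI)
  define W where "W = g ` ?U"
  have Wspan: "W = mpol_space.span (g ` B)" unfolding W_def using fm.linear_span_image[OF g(2), of B] spanB by simp
  have "mpol_space.independent (g ` B)"
    using fm.linear_independent_injective_image[OF g(2) B(2)] injg spanB by simp
  then have "mpol_space.dim W = card (g ` B)" unfolding Wspan by (rule mpol_space.dim_span_eq_card_independent)
  also have "\<dots> = r + 1" using card_image[OF inj_on_subset[OF injg B(1)]] B(4) dimU by simp
  finally have dimW: "mpol_space.dim W = r + 1" .
  have WV: "W \<subseteq> V" using g(1) by (auto simp: W_def)
  have "\<theta> H (g (\<theta> H F0)) = \<theta> H F0" using g(3) F0(1) by blast
  then have "g (\<theta> H F0) \<noteq> 0" using nz \<theta>_scale[of H 0 0] by (auto simp: fls_scale_def)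
  then have "W \<noteq> {0}" using F0(1) by (auto simp: W_def)
  then have lsW: "linear_system w d W"
    using mpol_space.subspace_span[of "g ` B"] forms WV unfolding linear_system_def Wspan[symmetric] by blast
  have "Series V \<subseteq> Series W"
  proof
    fix A assume "A \<in> Series V"
    then obtain F where F: "F \<in> V" "\<not> vanC F" "A = cut_out F" using Series_alt[of V d] forms by auto
    define F' where "F' = g (\<theta> H F)"
    have F': "F' \<in> W" "\<theta> H F = \<theta> H F'" using F(1) g(3)[of "\<theta> H F"] by (auto simp: W_def F'_def)
    have fW: "form w d f" if "f \<in> W" for f using that WV forms by blast
    have "\<not> vanC F' \<and> cut_out F = cut_out F'"
      by (rule cut_out_\<theta>[OF forms[OF F(1)] F(2) fW[OF F'(1)] H F'(2)])
    then show "A \<in> Series W" using F'(1) F(3) Series_alt[of W d, OF fW] by blast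
  qed
  then have ex: "\<exists>W d. W \<subseteq> V \<and> linear_system w d W \<and> mpol_space.dim W = r + 1 \<and> Series V \<subseteq> Series W"
    using WV lsW dimW by blast
  \<comment> \<open>Equal sections force the functions to be proportional, so a subsystem cutting
    out all of \<open>Series V\<close> has image containing the whole of \<open>?U\<close>.\<close>
  have "r \<le> s" if "\<exists>W d. W \<subseteq> V \<and> linear_system w d W \<and> mpol_space.dim W = s + 1 \<and> Series V \<subseteq> Series W" for s
  proof -
    from that obtain W d' where W: "W \<subseteq> V" "linear_system w d' W" "mpol_space.dim W = s + 1" "Series V \<subseteq> Series W" by blast
    have Ws: "mpol_space.subspace W" using W(2) by (simp add: linear_system_def)
    have fW: "form w d f" if "f \<in> W" for f using that W(1) forms by blast
    have sub: "?U \<subseteq> \<theta> H ` W"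
    proof
      fix f assume "f \<in> ?U"
      then obtain F where F: "F \<in> V" "f = \<theta> H F" by blast
      show "f \<in> \<theta> H ` W"
      proof (cases "vanC F")
        case True
        then have "f = \<theta> H 0" using \<theta>_eq_0[OF forms[OF F(1)] H] \<theta>_scale[of H 0 0] F(2) by (simp add: fls_scale_def)
        then show ?thesis using mpol_space.subspace_0[OF Ws] by blast
      next
        case False
        then have "cut_out F \<in> Series W" using W(4) Series_alt[of V d, OF forms] F(1) by blast
        then obtain F' where F': "F' \<in> W" "\<not> vanC F'" "cut_out F = cut_out F'" using Series_alt[of W d, OF fW] by auto
        obtain c where "\<theta> H F = \<theta> H (scale_mpol c F')"
          using cut_out_eq_imp[OF forms[OF F(1)] False fW[OF F'(1)] F'(2,3) H] by blast
        then show ?thesis using F(2) mpol_space.subspace_scale[OF Ws F'(1)] by blast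
      qed
    qed
    obtain B' where B': "B' \<subseteq> W" "W \<subseteq> mpol_space.span B'" "card B' = mpol_space.dim W"
      using mpol_space.basis_exists[of W] by metis
    have fin: "finite B'" using B'(3) W(3) by (intro card_ge_0_finite) simp
    have "?U \<subseteq> fls_space.span (\<theta> H ` B')"
      using sub B'(2) mf.linear_span_image[OF linear_\<theta>, of H B'] by blast
    then have "fls_space.dim ?U \<le> card (\<theta> H ` B')" using fin by (intro fls_space.dim_le_card) auto
    also have "\<dots> \<le> card B'" by (rule card_image_le[OF fin])
    finally show ?thesis using dimU B'(3) W(3) by simp
  qed
  then have "Series_dim V = r" unfolding Series_dim_def using ex by (intro Least_equality) auto
  then show ?thesis using dimU by simp
qed

text \<open>The reference divisor is the member \<open>cut_out H - D\<close> of one form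
  \<open>H\<close>, and the functions are the quotients by \<open>H\<close>; removing the fixed part
  \<open>D\<close> does not affect differences of members.\<close>

lemma is_g_imp_lin_g:
  assumes "is_g n r G"
  shows "pl.lin_g n r G"
proof -
  obtain V d D where V: "linear_system w d V" "Series V \<noteq> {}" "Series_dim V = r" "\<forall>A\<in>Series V. D \<subseteq># A"
    "G = (\<lambda>A. A - D) ` Series V" "\<forall>A\<in>G. size A = n"
    using assms unfolding is_g_def by blast
  have forms: "\<And>F. F \<in> V \<Longrightarrow> form w d F" using V(1) by (auto simp: linear_system_def)
  have S: "Series V = {cut_out F | F. F \<in> V \<and> \<not> vanC F}" by (rule Series_alt[OF forms])
  obtain H where H: "H \<in> V" "\<not> vanC H" using V(2) unfolding S by blast
  note fH = forms[OF H(1)]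
  define A where "A = cut_out H - D"
  have D: "D \<subseteq># cut_out F" if "F \<in> V" "\<not> vanC F" for F using V(4) that unfolding S by blast
  have cD: "int (count (cut_out F - D) \<gamma>) = int (count (cut_out F) \<gamma>) - int (count D \<gamma>)" if "F \<in> V" "\<not> vanC F" for F \<gamma>
    using mset_subset_eq_count[OF D[OF that], of \<gamma>] by simp
  have A: "set_mset A \<subseteq> X" "size A = n"
    using set_cut_out[OF fH H(2)] V(5,6) H S unfolding A_def by (auto dest: in_diffD)
  have vF: "int (count (cut_out F - D) \<gamma>) = int (count A \<gamma>) + pl.v \<gamma> (\<theta> H F)" if "F \<in> V" "\<not> vanC F" "\<gamma> \<in> X" for F \<gamma>
    unfolding A_def cD[OF that(1,2)] cD[OF H] v_\<theta>_cut_out[OF forms[OF that(1)] that(2) fH H(2) that(3)] by simp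
  have U: "fls_space.subspace (\<theta> H ` V)"
    using vector_space_pair.linear_subspace_image[OF mpol_fls_pair linear_\<theta>] V(1) by (auto simp: linear_system_def)
  have UL: "\<theta> H F \<in> pl.L A" if F: "F \<in> V" for F
  proof (cases "vanC F")
    case True
    then show ?thesis using \<theta>_eq_0[OF forms[OF F] fH H(2)] by (simp add: pl.L_def)
  next
    case False
    have "- int (count A \<gamma>) \<le> pl.v \<gamma> (\<theta> H F)" if "\<gamma> \<in> X" for \<gamma> using vF[OF F False that] by linarith
    then show ?thesis using \<theta>_K[OF forms[OF F] fH H(2)] by (simp add: pl.L_def)
  qed
  have pd: "pl.plus_div A (\<theta> H F) = cut_out F - D" if F: "F \<in> V" "\<not> vanC F" for F
  proof (rule pl.plus_div_eqI[OF UL[OF F(1)]])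
    show "\<theta> H F \<noteq> 0" using \<theta>_eq_0[OF forms[OF F(1)] fH H(2)] F(2) by simp
    show "set_mset (cut_out F - D) \<subseteq> X" using set_cut_out[OF forms[OF F(1)] F(2)] by (auto dest: in_diffD)
  qed (use vF[OF F] in simp)
  have "G = {pl.plus_div A f | f. f \<in> \<theta> H ` V \<and> f \<noteq> 0}"
  proof (intro set_eqI iffI)
    fix B assume "B \<in> G"
    then obtain F where F: "F \<in> V" "\<not> vanC F" "B = cut_out F - D" using V(5) S by auto
    then show "B \<in> {pl.plus_div A f | f. f \<in> \<theta> H ` V \<and> f \<noteq> 0}"
      using pd[OF F(1,2)] \<theta>_eq_0[OF forms[OF F(1)] fH H(2)] by force
  next
    fix B assume "B \<in> {pl.plus_div A f | f. f \<in> \<theta> H ` V \<and> f \<noteq> 0}"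
    then obtain F where F: "F \<in> V" "\<theta> H F \<noteq> 0" "B = pl.plus_div A (\<theta> H F)" by blast
    then have nv: "\<not> vanC F" using \<theta>_eq_0[OF forms[OF F(1)] fH H(2)] by simp
    then have "cut_out F \<in> Series V" using F(1) S by blast
    then show "B \<in> G" using V(5) pd[OF F(1) nv] F(3) by simp
  qed
  moreover have "fls_space.dim (\<theta> H ` V) = r + 1" using Series_dim[OF V(1) H fH H(2)] V(3) by simp
  moreover have "\<theta> H ` V \<subseteq> pl.L A" using UL by blast
  ultimately show ?thesis unfolding pl.lin_g_def using A U by blast
qed

text \<open>A basis of \<open>U\<close> is written over a common denominator, and \<open>V\<close>
  consists of the numerators of elements of \<open>U\<close>. It may contain forms vanishing on
  \<open>C\<close>, which \<open>Series_dim\<close> does not count.\<close>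

lemma lin_g_imp_is_g:
  assumes "pl.lin_g n r G"
  shows "is_g n r G"
proof -
  obtain A U where A: "set_mset A \<subseteq> X" "size A = n" and U: "fls_space.subspace U" "U \<subseteq> pl.L A"
    "fls_space.dim U = r + 1" "G = {pl.plus_div A f | f. f \<in> U \<and> f \<noteq> 0}"
    using assms unfolding pl.lin_g_def by blast
  obtain B where B: "B \<subseteq> U" "U \<subseteq> fls_space.span B" "finite B" by (rule pl.finite_basis[OF U(2)]) (rule that)
  have BK: "B \<subseteq> ns.K" using B(1) U(2) pl.L_K by blast
  obtain d H0 where H0: "form w d H0" "\<not> vanC H0" "\<And>b. b \<in> B \<Longrightarrow> \<exists>F. form w d F \<and> b = \<theta> H0 F"
    using common_denominator[OF B(3) BK] by blast
  \<comment> \<open>Enlarging the denominator by \<open>T\<close> brings \<open>A\<close> inside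
    \<open>cut_out H\<close>, so that \<open>cut_out H - A\<close> is the effective fixed part to be
    removed.\<close>
  obtain e T where T: "form w e T" "\<not> vanC T" "A \<subseteq># cut_out T" using cut_out_covers[OF A(1)] by blast
  define H where "H = H0 * T"
  have H: "form w (d + e) H" "\<not> vanC H" unfolding H_def using H0 T vanC_mult form_mult by blast+
  define V where "V = {F. form w (d + e) F \<and> \<theta> H F \<in> U}"
  have forms: "\<And>F. F \<in> V \<Longrightarrow> form w (d + e) F" by (simp add: V_def)
  have Vsub: "mpol_space.subspace V"
    unfolding mpol_space.subspace_def
  proof (intro conjI ballI allI)
    have "\<theta> H 0 = 0" using \<theta>_scale[of H 0 0] by (simp add: fls_scale_def)
    then show "0 \<in> V" using fls_space.subspace_0[OF U(1)] by (simp add: V_def)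
    show "x + y \<in> V" if "x \<in> V" "y \<in> V" for x y
      using that fls_space.subspace_add[OF U(1)] by (simp add: V_def \<theta>_add form_add)
    show "scale_mpol c x \<in> V" if "x \<in> V" for c x
      using that fls_space.subspace_scale[OF U(1)] by (simp add: V_def \<theta>_scale form_scale)
  qed
  have imsub: "fls_space.subspace (\<theta> H ` V)" by (rule vector_space_pair.linear_subspace_image[OF mpol_fls_pair linear_\<theta> Vsub])
  have "b \<in> \<theta> H ` V" if b: "b \<in> B" for b
  proof -
    obtain F where F: "form w d F" "b = \<theta> H0 F" using H0(3)[OF b] by blast
    have "b = \<theta> H (F * T)" using F(2) by (simp add: H_def \<theta>_mult \<theta>_self[OF T(1,2)])
    moreover from this have "F * T \<in> V" using b B(1) form_mult[OF F(1) T(1)] by (auto simp: V_def)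
    ultimately show ?thesis by blast
  qed
  then have "fls_space.span B \<subseteq> \<theta> H ` V" by (intro fls_space.span_minimal imsub subsetI)
  then have im: "\<theta> H ` V = U" using B(2) by (auto simp: V_def)
  have "\<not> U \<subseteq> {0}"
  proof
    assume "U \<subseteq> {0}"
    then have "fls_space.dim U \<le> card ({} :: 'a fls set)" by (intro fls_space.dim_le_card) auto
    with U(3) show False by simp
  qed
  then obtain F0 where F0: "F0 \<in> V" "\<theta> H F0 \<noteq> 0" unfolding im[symmetric] by blast
  have nv: "\<not> vanC F \<longleftrightarrow> \<theta> H F \<noteq> 0" if "F \<in> V" for F using \<theta>_eq_0[OF forms[OF that] H] by simp
  have "F0 \<noteq> 0" using F0(2) \<theta>_scale[of H 0 0] by (auto simp: fls_scale_def)
  then have lsV: "linear_system w (d + e) V" using Vsub forms F0(1) by (auto simp: linear_system_def)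
  have S: "Series V = {cut_out F | F. F \<in> V \<and> \<not> vanC F}" by (rule Series_alt[OF forms])
  have "Series_dim V = r" using Series_dim[OF lsV F0(1) _ H] nv[OF F0(1)] F0(2) im U(3) by simp
  define D where "D = cut_out H - A"
  have AH: "A \<subseteq># cut_out H"
    unfolding H_def cut_out_mult[OF H0(1,2) T(1,2)] using T(3) by (simp add: subset_mset.add_increasing)
  have cD: "int (count D \<gamma>) = int (count (cut_out H) \<gamma>) - int (count A \<gamma>)" for \<gamma>
    using mset_subset_eq_count[OF AH, of \<gamma>] by (simp add: D_def)
  have key: "cut_out F = pl.plus_div A (\<theta> H F) + D" if F: "F \<in> V" "\<not> vanC F" for F
  proof (rule multiset_eqI)
    fix \<gamma>
    have L: "\<theta> H F \<in> pl.L A" "\<theta> H F \<noteq> 0" using F nv[OF F(1)] U(2) by (auto simp: V_def)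
    have "int (count (cut_out F) \<gamma>) = int (count (pl.plus_div A (\<theta> H F) + D) \<gamma>)"
    proof (cases "\<gamma> \<in> X")
      case True
      then show ?thesis
        using pl.count_plus_div[OF L, of \<gamma>] cD[of \<gamma>] v_\<theta>_cut_out[OF forms[OF F(1)] F(2) H True] by simp
    next
      case False
      then have "count D \<gamma> = 0" unfolding D_def using count_cut_out[OF H, of \<gamma>] by simp
      then show ?thesis using False pl.count_plus_div[OF L, of \<gamma>] count_cut_out[OF forms[OF F(1)] F(2), of \<gamma>] by simp
    qed
    then show "count (cut_out F) \<gamma> = count (pl.plus_div A (\<theta> H F) + D) \<gamma>" by linarith
  qed
  have "G = (\<lambda>A. A - D) ` Series V"
  proof (intro set_eqI iffI)
    fix B' assume "B' \<in> G"
    then obtain f where f: "f \<in> U" "f \<noteq> 0" "B' = pl.plus_div A f" using U(4) by blast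
    then obtain F where F: "F \<in> V" "f = \<theta> H F" using im by blast
    then have nvF: "\<not> vanC F" using nv f(2) by simp
    have "B' = cut_out F - D" using key[OF F(1) nvF] f(3) F(2) by simp
    then show "B' \<in> (\<lambda>A. A - D) ` Series V" unfolding S using F(1) nvF by blast
  next
    fix B' assume "B' \<in> (\<lambda>A. A - D) ` Series V"
    then obtain F where F: "F \<in> V" "\<not> vanC F" "B' = cut_out F - D" unfolding S by blast
    then have "B' = pl.plus_div A (\<theta> H F)" using key by simp
    then show "B' \<in> G" using F(1,2) nv im U(4) by blast
  qed
  moreover have "\<forall>A\<in>Series V. D \<subseteq># A" unfolding S using key by auto
  moreover have "Series V \<noteq> {}" unfolding S using F0 nv by blast
  moreover have "\<forall>A\<in>G. size A = n" using pl.lin_g_size[OF assms] by blast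
  ultimately show ?thesis unfolding is_g_def using lsV \<open>Series_dim V = r\<close> by blast
qed

lemma is_g_iff: "is_g n r G \<longleftrightarrow> pl.lin_g n r G"
  using is_g_imp_lin_g lin_g_imp_is_g by blast

section \<open>Complete series and their differences\<close>

lemma complete_g_iff: "complete_g n t G \<longleftrightarrow> pl.complete_lin n t G"
  unfolding complete_g_def pl.complete_lin_def is_g_iff ..

lemma complete_series: "set_mset A \<subseteq> X \<Longrightarrow> complete_series A = pl.cls A"
  unfolding complete_series_def complete_g_iff
  by (rule the_equality) (use pl.complete_lin_iff pl.cls_self in blast)+

lemma complete_dim: "set_mset A \<subseteq> X \<Longrightarrow> complete_dim A = pl.cdim A"
  unfolding complete_dim_def complete_g_iff complete_series
  using pl.complete_lin_iff[OF pl.cls_self, of A] by (intro the_equality) auto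

lemma lin_equiv_iff: "lin_equiv A B \<longleftrightarrow> set_mset A \<subseteq> X \<and> set_mset B \<subseteq> X \<and> pl.dequiv A B"
proof
  assume "lin_equiv A B"
  then obtain n r G where G: "pl.lin_g n r G" "A \<in> G" "B \<in> G" unfolding lin_equiv_def is_g_iff by blast
  have "A \<in> pl.cls B" using pl.lin_g_subset_cls(1)[OF G(1,3)] G(2) by blast
  then show "set_mset A \<subseteq> X \<and> set_mset B \<subseteq> X \<and> pl.dequiv A B"
    using pl.lin_g_set[OF G(1,3)] by (simp add: pl.cls_def)
next
  assume AB: "set_mset A \<subseteq> X \<and> set_mset B \<subseteq> X \<and> pl.dequiv A B"
  then have "A \<in> pl.cls B" "B \<in> pl.cls B" by (auto simp: pl.cls_def pl.dequiv_refl)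
  then show "lin_equiv A B" unfolding lin_equiv_def is_g_iff using pl.lin_g_cls[of B] AB by blast
qed

lemma lookup_gen_of: "Poly_Mapping.lookup (gen_of A) \<gamma> = int (count A \<gamma>)"
  unfolding gen_of_def by (induction A) (simp_all add: lookup_add)

lemma gen_of_decomposition:
  fixes D :: "'p \<Rightarrow>\<^sub>0 int"
  obtains A B where "D = gen_of A - gen_of B" "A \<inter># B = {#}"
    "\<And>\<gamma>. int (count A \<gamma>) = max 0 (Poly_Mapping.lookup D \<gamma>)" "\<And>\<gamma>. int (count B \<gamma>) = max 0 (- Poly_Mapping.lookup D \<gamma>)"
proof -
  define A where "A = fun_mset UNIV (\<lambda>\<gamma>. nat (Poly_Mapping.lookup D \<gamma>))"
  define B where "B = fun_mset UNIV (\<lambda>\<gamma>. nat (- Poly_Mapping.lookup D \<gamma>))"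
  have fin: "finite {\<gamma>. Poly_Mapping.lookup D \<gamma> \<noteq> 0}" by (rule finite_lookup)
  have "finite {\<gamma> \<in> UNIV. nat (Poly_Mapping.lookup D \<gamma>) \<noteq> 0}" "finite {\<gamma> \<in> UNIV. nat (- Poly_Mapping.lookup D \<gamma>) \<noteq> 0}"
    by (rule finite_subset[OF _ fin], force)+
  from count_fun_mset[OF this(1)] count_fun_mset[OF this(2)]
  have c: "int (count A \<gamma>) = max 0 (Poly_Mapping.lookup D \<gamma>)" "int (count B \<gamma>) = max 0 (- Poly_Mapping.lookup D \<gamma>)" for \<gamma>
    by (simp_all add: A_def B_def)
  have "D = gen_of A - gen_of B"
    by (rule poly_mapping_eqI) (simp add: lookup_minus lookup_gen_of c)
  moreover have "A \<inter># B = {#}"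
  proof (rule multiset_eqI)
    fix \<gamma>
    have "count A \<gamma> = 0 \<or> count B \<gamma> = 0" using c[of \<gamma>] by linarith
    then show "count (A \<inter># B) \<gamma> = count {#} \<gamma>" by auto
  qed
  ultimately show ?thesis using that c by blast
qed

text \<open>Moving the subtracted parts across turns equivalence of effective sums into
  \<open>D - D' = div f\<close>. Conversely, positive and negative multiplicities provide the
  disjoint parts that the definition asks for.\<close>

lemma gen_equiv_iff:
  "gen_equiv D D' \<longleftrightarrow> Poly_Mapping.keys D \<subseteq> X \<and> Poly_Mapping.keys D' \<subseteq> X \<and>
    (\<exists>f\<in>ns.K. f \<noteq> 0 \<and> (\<forall>\<gamma>\<in>X. Poly_Mapping.lookup D \<gamma> = Poly_Mapping.lookup D' \<gamma> + pl.v \<gamma> f))"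
proof
  assume "gen_equiv D D'"
  then obtain A1 A2 B1 B2 where *: "D = gen_of A1 - gen_of A2" "D' = gen_of B1 - gen_of B2"
    "lin_equiv (A1 + B2) (B1 + A2)" unfolding gen_equiv_def by blast
  have sets: "set_mset A1 \<subseteq> X" "set_mset A2 \<subseteq> X" "set_mset B1 \<subseteq> X" "set_mset B2 \<subseteq> X"
    using *(3) by (simp_all add: lin_equiv_iff)
  have "Poly_Mapping.keys D \<subseteq> X" "Poly_Mapping.keys D' \<subseteq> X"
    using sets unfolding * by (auto simp: in_keys_iff lookup_minus lookup_gen_of not_in_iff subset_iff)
      (metis count_eq_zero_iff)+
  moreover obtain f where f: "f \<in> ns.K" "f \<noteq> 0"
    "\<And>\<gamma>. \<gamma> \<in> X \<Longrightarrow> int (count (A1 + B2) \<gamma>) = int (count (B1 + A2) \<gamma>) + pl.v \<gamma> f"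
    using *(3) by (auto simp: lin_equiv_iff pl.dequiv_def)
  have "Poly_Mapping.lookup D \<gamma> = Poly_Mapping.lookup D' \<gamma> + pl.v \<gamma> f" if "\<gamma> \<in> X" for \<gamma>
    using f(3)[OF that] by (simp add: * lookup_minus lookup_gen_of)
  ultimately show "Poly_Mapping.keys D \<subseteq> X \<and> Poly_Mapping.keys D' \<subseteq> X \<and>
    (\<exists>f\<in>ns.K. f \<noteq> 0 \<and> (\<forall>\<gamma>\<in>X. Poly_Mapping.lookup D \<gamma> = Poly_Mapping.lookup D' \<gamma> + pl.v \<gamma> f))" using f(1,2) by blast
next
  assume a: "Poly_Mapping.keys D \<subseteq> X \<and> Poly_Mapping.keys D' \<subseteq> X \<and>
    (\<exists>f\<in>ns.K. f \<noteq> 0 \<and> (\<forall>\<gamma>\<in>X. Poly_Mapping.lookup D \<gamma> = Poly_Mapping.lookup D' \<gamma> + pl.v \<gamma> f))"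
  then obtain f where f: "f \<in> ns.K" "f \<noteq> 0"
    "\<And>\<gamma>. \<gamma> \<in> X \<Longrightarrow> Poly_Mapping.lookup D \<gamma> = Poly_Mapping.lookup D' \<gamma> + pl.v \<gamma> f" by blast
  obtain A1 A2 where A: "D = gen_of A1 - gen_of A2" "A1 \<inter># A2 = {#}"
    "\<And>\<gamma>. int (count A1 \<gamma>) = max 0 (Poly_Mapping.lookup D \<gamma>)" "\<And>\<gamma>. int (count A2 \<gamma>) = max 0 (- Poly_Mapping.lookup D \<gamma>)"
    by (rule gen_of_decomposition[of D]) (rule that)
  obtain B1 B2 where B: "D' = gen_of B1 - gen_of B2" "B1 \<inter># B2 = {#}"
    "\<And>\<gamma>. int (count B1 \<gamma>) = max 0 (Poly_Mapping.lookup D' \<gamma>)" "\<And>\<gamma>. int (count B2 \<gamma>) = max 0 (- Poly_Mapping.lookup D' \<gamma>)"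
    by (rule gen_of_decomposition[of D']) (rule that)
  have z: "Poly_Mapping.lookup D \<gamma> = 0" "Poly_Mapping.lookup D' \<gamma> = 0" if "\<gamma> \<notin> X" for \<gamma>
    using a that by (metis in_keys_iff subsetD)+
  have "count A1 \<gamma> = 0 \<and> count A2 \<gamma> = 0 \<and> count B1 \<gamma> = 0 \<and> count B2 \<gamma> = 0" if "\<gamma> \<notin> X" for \<gamma>
    using A(3,4)[of \<gamma>] B(3,4)[of \<gamma>] z[OF that] by simp
  then have "set_mset (A1 + B2) \<subseteq> X" "set_mset (B1 + A2) \<subseteq> X" by (force simp flip: count_greater_zero_iff)+
  moreover have "int (count (A1 + B2) \<gamma>) = int (count (B1 + A2) \<gamma>) + pl.v \<gamma> f" if "\<gamma> \<in> X" for \<gamma>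
    using f(3)[OF that] A(3,4)[of \<gamma>] B(3,4)[of \<gamma>] unfolding count_union of_nat_add by linarith
  ultimately have "lin_equiv (A1 + B2) (B1 + A2)"
    unfolding lin_equiv_iff pl.dequiv_def using f(1,2) by blast
  then show "gen_equiv D D'" unfolding gen_equiv_def using A(1,2) B(1,2) by blast
qed

lemma gen_equiv_sym: "gen_equiv D D' \<Longrightarrow> gen_equiv D' D"
  unfolding gen_equiv_iff
  by (elim conjE bexE, intro conjI; (rule_tac x = "inverse f" in bexI)?) (auto simp: pl.v_inverse ns.K_inverse)

lemma gen_equiv_trans: "gen_equiv D D' \<Longrightarrow> gen_equiv D' D'' \<Longrightarrow> gen_equiv D D''"
  unfolding gen_equiv_iff
  by (elim conjE bexE, intro conjI; (rule_tac x = "f * fa" in bexI)?) (auto simp: pl.v_mult ns.K_mult)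

lemma gen_series_eq: "gen_equiv D D' \<Longrightarrow> gen_series D = gen_series D'"
  unfolding gen_series_def using gen_equiv_trans gen_equiv_sym by blast

lemma keys_gen_of_diff:
  assumes "set_mset A \<subseteq> X" "set_mset B \<subseteq> X"
  shows "Poly_Mapping.keys (gen_of A - gen_of B) \<subseteq> X"
proof
  fix \<gamma> assume "\<gamma> \<in> Poly_Mapping.keys (gen_of A - gen_of B)"
  then have "\<gamma> \<in># A \<or> \<gamma> \<in># B" by (auto simp: in_keys_iff lookup_minus lookup_gen_of not_in_iff)
  then show "\<gamma> \<in> X" using assms by blast
qed

text \<open>Other representatives change the difference by the divisor of a quotient of functions,
  and a class containing \<open>gen_of A - gen_of B\<close> is determined by that element.\<close>

lemma series_diff:
  assumes A: "set_mset A \<subseteq> X" and B: "set_mset B \<subseteq> X"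
  shows "series_diff (pl.cls A) (pl.cls B) = gen_series (gen_of A - gen_of B)"
  unfolding series_diff_def
proof (rule the_equality, intro conjI ballI)
  show "\<exists>D. gen_series (gen_of A - gen_of B) = gen_series D" by blast
  fix A' B' assume A'B': "A' \<in> pl.cls A" "B' \<in> pl.cls B"
  then have sets: "set_mset A' \<subseteq> X" "set_mset B' \<subseteq> X" by (simp_all add: pl.cls_def)
  obtain f where f: "f \<in> ns.K" "f \<noteq> 0" "\<And>\<gamma>. \<gamma> \<in> X \<Longrightarrow> int (count A' \<gamma>) = int (count A \<gamma>) + pl.v \<gamma> f"
    using A'B'(1) by (auto simp: pl.cls_def pl.dequiv_def)
  obtain g where g: "g \<in> ns.K" "g \<noteq> 0" "\<And>\<gamma>. \<gamma> \<in> X \<Longrightarrow> int (count B' \<gamma>) = int (count B \<gamma>) + pl.v \<gamma> g"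
    using A'B'(2) by (auto simp: pl.cls_def pl.dequiv_def)
  have "f / g \<in> ns.K" "f / g \<noteq> 0" using f g pl.K_divide by auto
  moreover have "Poly_Mapping.lookup (gen_of A' - gen_of B') \<gamma> = Poly_Mapping.lookup (gen_of A - gen_of B) \<gamma> + pl.v \<gamma> (f / g)"
    if "\<gamma> \<in> X" for \<gamma>
    using f(3)[OF that] g(3)[OF that] pl.v_divide[OF f(1) g(1) f(2) g(2) that] by (simp add: lookup_minus lookup_gen_of)
  ultimately have "gen_equiv (gen_of A' - gen_of B') (gen_of A - gen_of B)"
    unfolding gen_equiv_iff using keys_gen_of_diff A B sets by blast
  then show "gen_of A' - gen_of B' \<in> gen_series (gen_of A - gen_of B)" by (simp add: gen_series_def)
next
  fix R assume R: "(\<exists>D. R = gen_series D) \<and> (\<forall>A'\<in>pl.cls A. \<forall>B'\<in>pl.cls B. gen_of A' - gen_of B' \<in> R)"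
  then obtain D where D: "R = gen_series D" by blast
  have "gen_of A - gen_of B \<in> R" using R pl.cls_self[OF A] pl.cls_self[OF B] by blast
  then have "gen_equiv (gen_of A - gen_of B) D" unfolding D gen_series_def by simp
  then show "R = gen_series (gen_of A - gen_of B)" unfolding D using gen_series_eq by blast
qed

section \<open>The Jacobian series\<close>

lemma pencil_exists:
  assumes A: "set_mset A \<subseteq> X" "pl.cdim A \<ge> 1"
  shows "\<exists>G. pl.lin_g (size A) 1 G \<and> G \<subseteq> pl.cls A"
proof -
  obtain B where B: "B \<subseteq> pl.L A" "\<not> fls_space.dependent B" "card B = fls_space.dim (pl.L A)" "finite B"
    by (rule pl.finite_basis[OF order_refl[of "pl.L A"]]) (rule that)
  have "2 \<le> card B" using B(3) pl.cdim[of A] A(2) by simp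
  then obtain S where S: "S \<subseteq> B" "card S = 2" using obtain_subset_with_card_n by metis
  have "\<not> fls_space.dependent S" using B(2) S(1) fls_space.dependent_mono by blast
  then have dim: "fls_space.dim (fls_space.span S) = 1 + 1"
    using fls_space.dim_span_eq_card_independent[of S] S(2) by simp
  have sub: "fls_space.span S \<subseteq> pl.L A" using S(1) B(1) by (intro fls_space.span_minimal pl.subspace_L) auto
  define G where "G = {pl.plus_div A f | f. f \<in> fls_space.span S \<and> f \<noteq> 0}"
  have "pl.lin_g (size A) 1 G"
    unfolding pl.lin_g_def using A(1) sub dim G_def fls_space.subspace_span[of S] by blast
  moreover have "G \<subseteq> pl.cls A" unfolding pl.cls_alt[OF A(1)] G_def using sub by blast
  ultimately show ?thesis by blast
qed

text \<open>The pencil has its own reference member and its own function \<open>z'\<close>; both are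
  compared with \<open>A\<close> and with a fixed \<open>z\<close>, so that different pencils, and
  later different \<open>A\<close>, refer to the same differential.\<close>

lemma Jac_divisor:
  assumes A: "set_mset A \<subseteq> X" and G: "pl.lin_g n 1 G" "G \<subseteq> pl.cls A"
    and z: "z \<in> ns.K" "z \<notin> range fls_const"
  shows "set_mset (Jac G) \<subseteq> X \<and> (\<exists>h\<in>ns.K. h \<noteq> 0 \<and>
    (\<forall>\<gamma>\<in>X. int (count (Jac G) \<gamma>) = 2 * int (count A \<gamma>) + pl.v \<gamma> h + pl.dv \<gamma> z))"
proof -
  obtain A' where A': "A' \<in> G" using pl.lin_g_nonempty[OF G(1)] by blast
  obtain f where f: "f \<in> ns.K" "f \<noteq> 0" "\<And>\<gamma>. \<gamma> \<in> X \<Longrightarrow> int (count A' \<gamma>) = int (count A \<gamma>) + pl.v \<gamma> f"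
    using A' G(2) by (auto simp: pl.cls_def pl.dequiv_def)
  obtain z' where z': "z' \<in> ns.K" "z' \<notin> range fls_const" "set_mset (Jac G) \<subseteq> X"
    "\<And>\<gamma>. \<gamma> \<in> X \<Longrightarrow> int (count (Jac G) \<gamma>) = 2 * int (count A' \<gamma>) + pl.dv \<gamma> z'"
    using Jac_pencil[OF curve_with_model_axioms pl.places_axioms G(1) A'] by blast
  have "X \<noteq> {}" using infinite_X by auto
  then obtain g where g: "g \<in> ns.K" "g \<noteq> 0" "\<And>\<gamma>. \<gamma> \<in> X \<Longrightarrow> pl.dv \<gamma> z' = pl.v \<gamma> g + pl.dv \<gamma> z"
    using pl.dv_ratio[OF z'(1,2) z] by blast
  \<comment> \<open>Twice \<open>A'\<close> contributes \<open>f\<close> twice, and \<open>g\<close>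
    is the quotient of the differentials of \<open>z'\<close> and \<open>z\<close>.\<close>
  let ?h = "f * f * g"
  have "?h \<in> ns.K" "?h \<noteq> 0" using f g by (simp_all add: ns.K_mult)
  moreover have "int (count (Jac G) \<gamma>) = 2 * int (count A \<gamma>) + pl.v \<gamma> ?h + pl.dv \<gamma> z" if "\<gamma> \<in> X" for \<gamma>
    using z'(4)[OF that] f(3)[OF that] g(3)[OF that] f(1,2) g(1,2) that by (simp add: pl.v_mult ns.K_mult)
  ultimately show ?thesis using z'(3) by blast
qed

text \<open>By \<open>Jac_divisor\<close> the Jacobians of any two pencils in the class differ by
  the divisor of a function, so one complete series contains them all; it is unique because a
  complete series is the class of any member.\<close>

lemma Jac_series:
  assumes A: "set_mset A \<subseteq> X" and G: "pl.lin_g n 1 G" "G \<subseteq> pl.cls A"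
    and z: "z \<in> ns.K" "z \<notin> range fls_const"
  shows "Jac_series A = pl.cls (Jac G)"
  unfolding Jac_series_def complete_series[OF A] complete_g_iff is_g_iff
proof (rule the_equality, intro conjI allI impI)
  note J = Jac_divisor[OF A _ _ z]
  show "\<exists>n t. pl.complete_lin n t (pl.cls (Jac G))"
    using pl.complete_lin_iff[OF pl.cls_self, of "Jac G"] J[OF G] by blast
  show "Jac G' \<in> pl.cls (Jac G)" if G': "pl.lin_g n' 1 G' \<and> G' \<subseteq> pl.cls A" for G' n'
  proof -
    obtain h where h: "h \<in> ns.K" "h \<noteq> 0" "\<And>\<gamma>. \<gamma> \<in> X \<Longrightarrow> int (count (Jac G) \<gamma>) = 2 * int (count A \<gamma>) + pl.v \<gamma> h + pl.dv \<gamma> z"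
      using J[OF G] by blast
    obtain h' where h': "h' \<in> ns.K" "h' \<noteq> 0" "\<And>\<gamma>. \<gamma> \<in> X \<Longrightarrow> int (count (Jac G') \<gamma>) = 2 * int (count A \<gamma>) + pl.v \<gamma> h' + pl.dv \<gamma> z"
      using J[of n' G'] G' by blast
    have "h' / h \<in> ns.K" "h' / h \<noteq> 0" using h h' pl.K_divide by auto
    moreover have "int (count (Jac G') \<gamma>) = int (count (Jac G) \<gamma>) + pl.v \<gamma> (h' / h)" if "\<gamma> \<in> X" for \<gamma>
      using h(3)[OF that] h'(3)[OF that] pl.v_divide[OF h'(1) h(1) h'(2) h(2) that] by simp
    ultimately have "pl.dequiv (Jac G') (Jac G)" unfolding pl.dequiv_def by blast
    then show ?thesis using J[of n' G'] G' by (simp add: pl.cls_def)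
  qed
next
  fix S assume S: "(\<exists>n t. pl.complete_lin n t S) \<and> (\<forall>G n. pl.lin_g n 1 G \<and> G \<subseteq> pl.cls A \<longrightarrow> Jac G \<in> S)"
  then have "Jac G \<in> S" using G by blast
  then show "S = pl.cls (Jac G)" using S pl.complete_lin_iff by blast
qed

lemma Jac_series_diff:
  assumes A: "set_mset A \<subseteq> X" "complete_dim A \<ge> 1" and z: "z \<in> ns.K" "z \<notin> range fls_const"
  shows "\<exists>D h. series_diff (Jac_series A) (complete_series (A + A)) = gen_series D \<and>
    Poly_Mapping.keys D \<subseteq> X \<and> h \<in> ns.K \<and> h \<noteq> 0 \<and> (\<forall>\<gamma>\<in>X. Poly_Mapping.lookup D \<gamma> = pl.v \<gamma> h + pl.dv \<gamma> z)"
proof -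
  obtain G where G: "pl.lin_g (size A) 1 G" "G \<subseteq> pl.cls A"
    using pencil_exists[OF A(1)] A(2) complete_dim[OF A(1)] by auto
  obtain h where h: "set_mset (Jac G) \<subseteq> X" "h \<in> ns.K" "h \<noteq> 0"
    "\<And>\<gamma>. \<gamma> \<in> X \<Longrightarrow> int (count (Jac G) \<gamma>) = 2 * int (count A \<gamma>) + pl.v \<gamma> h + pl.dv \<gamma> z"
    using Jac_divisor[OF A(1) G z] by blast
  have AA: "set_mset (A + A) \<subseteq> X" using A(1) by simp
  have "series_diff (Jac_series A) (complete_series (A + A)) = gen_series (gen_of (Jac G) - gen_of (A + A))"
    unfolding Jac_series[OF A(1) G z] complete_series[OF AA] by (rule series_diff[OF h(1) AA])
  moreover have "Poly_Mapping.lookup (gen_of (Jac G) - gen_of (A + A)) \<gamma> = pl.v \<gamma> h + pl.dv \<gamma> z" if "\<gamma> \<in> X" for \<gamma>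
    using h(4)[OF that] by (simp add: lookup_minus lookup_gen_of)
  ultimately show ?thesis using keys_gen_of_diff[OF h(1) AA] h(2,3) by blast
qed

lemma nonconstant_exists: "\<exists>z\<in>ns.K. z \<notin> range fls_const"
proof -
  obtain z where "z \<in> ns.K" "fls_subdegree (ns.\<sigma> ns.\<gamma>0 z) = int 1"
    using ns.approximation[of "{ns.\<gamma>0}" ns.\<gamma>0 1 0] ns.\<gamma>0 by auto
  then show ?thesis using ns.\<sigma>_const[OF ns.\<gamma>0] by (intro bexI[of _ z]) auto
qed

text \<open>Both differences are represented by the divisor of \<open>dz\<close> for one common
  \<open>z\<close>, up to functions \<open>h\<close> and \<open>h'\<close>; their quotient gives the
  equivalence.\<close>

lemma Jac_series_diff_unique:
  assumes "set_mset A \<subseteq> X" "complete_dim A \<ge> 1" "set_mset B \<subseteq> X" "complete_dim B \<ge> 1"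
  shows "series_diff (Jac_series A) (complete_series (A + A)) = series_diff (Jac_series B) (complete_series (B + B))"
proof -
  obtain z where z: "z \<in> ns.K" "z \<notin> range fls_const" using nonconstant_exists by blast
  obtain D h where D: "series_diff (Jac_series A) (complete_series (A + A)) = gen_series D"
    "Poly_Mapping.keys D \<subseteq> X" "h \<in> ns.K" "h \<noteq> 0" "\<And>\<gamma>. \<gamma> \<in> X \<Longrightarrow> Poly_Mapping.lookup D \<gamma> = pl.v \<gamma> h + pl.dv \<gamma> z"
    using Jac_series_diff[OF assms(1,2) z] by blast
  obtain D' h' where D': "series_diff (Jac_series B) (complete_series (B + B)) = gen_series D'"
    "Poly_Mapping.keys D' \<subseteq> X" "h' \<in> ns.K" "h' \<noteq> 0" "\<And>\<gamma>. \<gamma> \<in> X \<Longrightarrow> Poly_Mapping.lookup D' \<gamma> = pl.v \<gamma> h' + pl.dv \<gamma> z"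
    using Jac_series_diff[OF assms(3,4) z] by blast
  have "h / h' \<in> ns.K" "h / h' \<noteq> 0" using D D' pl.K_divide by auto
  moreover have "Poly_Mapping.lookup D \<gamma> = Poly_Mapping.lookup D' \<gamma> + pl.v \<gamma> (h / h')" if "\<gamma> \<in> X" for \<gamma>
    using D(5)[OF that] D'(5)[OF that] pl.v_divide[OF D(3) D'(3) D(4) D'(4) that] by simp
  ultimately have "gen_equiv D D'" unfolding gen_equiv_iff using D(2) D'(2) by blast
  then show ?thesis unfolding D(1) D'(1) by (rule gen_series_eq)
qed

end

theorem theorem3p32:
  fixes w m :: nat
    and C X :: "'a::{alg_closed_field, field_char_0} point set"
    and \<phi> :: "'a point \<Rightarrow> 'a point"
    and A B :: "'a point multiset"
  assumes "proj_curve w C" and "nonsingular_model w C m X \<phi>"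
    and "set_mset A \<subseteq> X" and "curve_with_model.complete_dim w C m X \<phi> A \<ge> 1"
    and "set_mset B \<subseteq> X" and "curve_with_model.complete_dim w C m X \<phi> B \<ge> 1"
  shows "curve_with_model.series_diff w C m X \<phi>
           (curve_with_model.Jac_series w C m X \<phi> A)
           (curve_with_model.complete_series w C m X \<phi> (A + A))
       = curve_with_model.series_diff w C m X \<phi>
           (curve_with_model.Jac_series w C m X \<phi> B)
           (curve_with_model.complete_series w C m X \<phi> (B + B))"
proof -
  interpret curve_model w C m X \<phi>
    using assms(1,2) by unfold_locales
  show ?thesis by (rule Jac_series_diff_unique[OF assms(3-6)])
qed

end
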